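(* Let the model data and the gradient discretization be as described in the context; in particular the flow gradient discretization is coercive, the Korn inequality holds on $\mathbf U_0$, and the discrete inf-sup condition holds. Assume moreover that the discrete initial porosity satisfies $\Pi^m_{\mathcal D_p}\phi^0_m\ge\phi_{\min}\ge0$ for a constant $\phi_{\min}$. Then there exists at least one solution $\big((p^\alpha)_{\alpha\in\{\mathrm{nw},\mathrm w\}},\mathbf u,(\boldsymbol\lambda^k)_{k=0,\dots,N}\big)$ of the modified gradient scheme (the gradient scheme for the two-phase flow model with partial linearization of the matrix accumulation term) described in the context.
   Context: **Geometry.** $\Omega\subset\mathbb R^d$, $d\in\{2,3\}$, is a bounded polytopal domain and $T>0$. The fracture network $\Gamma$ satisfies $\overline\Gamma=\bigcup_{i\in I}\overline\Gamma_i$, where the fractures $\Gamma_i\subset\Omega$ are planar, polygonal, simply connected, open, and pairwise disjoint (they may only meet at their boundaries). The two sides of a fracture are denoted $\pm$, with unit normals $\mathbf n^\pm$ oriented outward from the sides $\pm$ (so $\mathbf n^-=-\mathbf n^+$); $\gamma_{\mathfrak a}$ is the trace on side $\mathfrak a\in\{+,-\}$ of $\Gamma$ of functions in $H^1(\Omega\setminus\overline\Gamma)$, and $\gamma_{\partial\Omega}$ the trace on $\partial\Omega$. For $\mathbf v\in H^1(\Omega\setminus\overline\Gamma)^d$: $[\![\mathbf v]\!]=\gamma_+\mathbf v-\gamma_-\mathbf v$, $[\![\mathbf v]\!]_n=[\![\mathbf v]\!]\cdot\mathbf n^+$, $[\![\mathbf v]\!]_\tau=[\![\mathbf v]\!]-[\![\mathbf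 v]\!]_n\mathbf n^+$, and $\boldsymbol\varepsilon(\mathbf v)=\frac12(\nabla\mathbf v+(\nabla\mathbf v)^T)$. $\mathcal S_d(\mathbb R)$ is the space of symmetric $d\times d$ real matrices. $\mathbf U_0=\{\mathbf v\in H^1(\Omega\setminus\overline\Gamma)^d:\gamma_{\partial\Omega}\mathbf v=0\}$. The network is such that the Korn inequality holds on $\mathbf U_0$, so $\|\mathbf v\|_{\mathbf U_0}=\|\boldsymbol\varepsilon(\mathbf v)\|_{L^2(\Omega,\mathcal S_d(\mathbb R))}$ is a norm on $\mathbf U_0$ equivalent to the $H^1$-norm. $H^{-1/2}(\Gamma)$ is the dual of $H^{1/2}(\Gamma)$. For $x\in\mathbb R$, $x^+=\max\{0,x\}$, $x^-=(-x)^+$. **Model data (standing assumptions).** Phases are $\alpha\in\{\mathrm{nw},\mathrm w\}$ (non-wetting, wetting); rock types are $\mathrm{rt}\in\{m,f,\mathfrak a\}$ (matrix, fracture, damaged rock on side $\mathfrak a\in\{+,-\}$). - The mobilities $\eta^\alpha_{\mathrm{rt}}$ are continuous, non-decreasing, with $0<\eta^\alpha_{\mathrm{rt},\min}\le\eta^\alpha_{\mathrm{rt}}(s)\le\eta^\alpha_{\mathrm{rt},\max}<+\infty$ for $s\in[0,1]$; moreover $\eta^{\mathrm w}_{\mathfrak a}(1)=\eta^{\mathrm w}_f(1)$ and $\eta^{\mathrm{nw}}_{\mathfrak a}(0)=\eta^{\mathrm{nw}}_f(0)$. - $S^{\mathrm{nw}}_{\mathrm{rt}}:\mathbb R\to[0,1]$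 is non-decreasing and Lipschitz continuous, and $S^{\mathrm w}_{\mathrm{rt}}=1-S^{\mathrm{nw}}_{\mathrm{rt}}$. The capillary energy density is $U_{\mathrm{rt}}(p_c)=\int_0^{p_c}q\,(S^{\mathrm{nw}}_{\mathrm{rt}})'(q)\,dq$. - The damaged rock width $\bar d_{\mathfrak a}$ and porosity $\bar\phi_{\mathfrak a}$ are positive constants. - The fracture aperture at contact state $d_0>0$ is continuous on $\Gamma$ with zero limits at $\partial\Gamma\setminus(\partial\Gamma\cap\partial\Omega)$ and strictly positive limits at $\partial\Gamma\cap\partial\Omega$. - $b\in[0,1]$ (Biot coefficient), $M\in(0,+\infty]$ (Biot modulus, $1/M=0$ if $M=+\infty$), $E>0$ (Young modulus), $-1<\nu<1/2$ (Poisson ratio), $F\ge0$ (friction coefficient) are constants. - The initial porosity $\bar\phi^0_m\in L^\infty(\Omega)$ satisfies $\bar\phi_m^0\ge0$; the initial pressures satisfy $\bar p^\alpha_{0,m}\in L^\infty(\Omega)$, $\bar p^\alpha_{0,f}\in L^\infty(\Gamma)$. - $\mathbf f\in L^2(\Omega)^d$, $h^\alpha_m\in L^2((0,T)\times\Omega)$, $h^\alpha_f\in L^2((0,T)\times\Gamma)$. - $\Lambda_f\in L^\infty(\Gamma)$ is bounded below by a strictly positive constant; $\mathbb K_m\in L^\infty(\Omega)^{d\times d}$ is symmetric and uniformly elliptic. The elastic stress is $\boldsymbol\sigma(\mathbf u)=\frac{E}{1+\nu}\big(\boldsymbol\varepsilon(\mathbf u)+\frac{\nu}{1-2\nu}(\mathrm{div}\,\mathbf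 u)\mathbb I\big)$. **Gradient discretization for the flow.** $X^0_{\mathcal D_p}=X^0_{\mathcal D_p^m}\times X^0_{\mathcal D_p^f}$ is a finite-dimensional space of discrete unknowns, with linear operators: gradients $\nabla^m_{\mathcal D_p}:X^0_{\mathcal D_p^m}\to L^\infty(\Omega)^d$, $\nabla^f_{\mathcal D_p}:X^0_{\mathcal D_p^f}\to L^\infty(\Gamma)^{d-1}$; function reconstructions $\Pi^m_{\mathcal D_p}:X^0_{\mathcal D_p^m}\to L^\infty(\Omega)$, $\Pi^f_{\mathcal D_p}:X^0_{\mathcal D_p^f}\to L^\infty(\Gamma)$; jump reconstructions $[\![\cdot]\!]^{\mathfrak a}_{\mathcal D_p}:X^0_{\mathcal D_p}\to L^\infty(\Gamma)$ and trace reconstructions $\mathbb T^{\mathfrak a}_{\mathcal D_p}:X^0_{\mathcal D_p^m}\to L^\infty(\Gamma)$, $\mathfrak a\in\{+,-\}$. For $v=(v_m,v_f)$, $\nabla^m_{\mathcal D_p}v$ means $\nabla^m_{\mathcal D_p}v_m$, and similarly for $f$. The operators $\Pi^m_{\mathcal D_p},\Pi^f_{\mathcal D_p},\mathbb T^{\mathfrak a}_{\mathcal D_p}$ are piecewise constant: with unknowns $v=(v_i)_i$, each has the form $v\mapsto\sum_i v_i\mathbf 1_{A_i}$ with disjoint measurable sets $A_i$ covering the domain; nonlinear functions act on discrete unknowns componentwise, so they commute with these operators. The quantity $$\|\nabla^m_{\mathcal D_p}v\|_{L^2(\Omega)^d}+\|d_0^{3/2}\nabla^f_{\mathcal D_p}v\|_{L^2(\Gamma)^{d-1}}+\sum_{\mathfrak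 a\in\{+,-\}}\|[\![v]\!]^{\mathfrak a}_{\mathcal D_p}\|_{L^2(\Gamma)}$$ is assumed to be a norm on $X^0_{\mathcal D_p}$. Coercivity: there is $c^\star>0$, independent of $\mathcal D_p$, such that for all $v=(v_m,v_f)\in X^0_{\mathcal D_p}$ the quantity $\|\Pi^m_{\mathcal D_p}v_m\|_{L^2(\Omega)}+\|\Pi^f_{\mathcal D_p}v_f\|_{L^2(\Gamma)}+\sum_{\mathfrak a}\|\mathbb T^{\mathfrak a}_{\mathcal D_p}v_m\|_{L^2(\Gamma)}$ is at most $c^\star$ times the norm above. **Discretization of the mechanics.** $X^0_{\mathcal D_{\mathbf u}^m}\subset\mathbf U_0$ is a finite-dimensional space. $\mathcal F_{\mathcal D_{\mathbf u}}$ is a partition of $\Gamma$ into faces, conforming with $\{\Gamma_i\}_{i\in I}$, and $X_{\mathcal D_{\mathbf u}^f}=\{\boldsymbol\mu=(\boldsymbol\mu_\sigma)_{\sigma\in\mathcal F_{\mathcal D_{\mathbf u}}}:\boldsymbol\mu_\sigma\in\mathbb R^d\}$, identified with piecewise constant functions on $\Gamma$. For such $\boldsymbol\mu$: $\mu_{n,\sigma}=\boldsymbol\mu_\sigma\cdot\mathbf n_\sigma$, $\boldsymbol\mu_{\tau,\sigma}=\boldsymbol\mu_\sigma-\mu_{n,\sigma}\mathbf n_\sigma$ with $\mathbf n_\sigma=\mathbf n^+$ on $\sigma$; $\mu_n,\boldsymbol\mu_\tau$ are the corresponding piecewise constant functions. The discrete dual cone is $$\boldsymbol C_{\mathcal D_{\mathbf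 u}^f}(\lambda_n)=\{\boldsymbol\mu\in X_{\mathcal D_{\mathbf u}^f}:\ \mu_{n,\sigma}\ge0,\ |\boldsymbol\mu_{\tau,\sigma}|\le F\lambda_{n,\sigma}\ \ \forall\sigma\in\mathcal F_{\mathcal D_{\mathbf u}}\}.$$ Face averages: $\mathbf u^{\mathfrak a}_\sigma=\frac1{|\sigma|}\int_\sigma\gamma_{\mathfrak a}\mathbf u$, $[\![\mathbf u]\!]_\sigma=\mathbf u^+_\sigma-\mathbf u^-_\sigma$, $[\![\mathbf u]\!]_{n,\sigma}=[\![\mathbf u]\!]_\sigma\cdot\mathbf n^+$, and $[\![\mathbf u]\!]_{n,\mathcal F}$ is the function on $\Gamma$ equal to $[\![\mathbf u]\!]_{n,\sigma}$ on each $\sigma$. Inf-sup condition, with $c_\star$ independent of the mesh: $$\inf_{0\ne\boldsymbol\mu\in X_{\mathcal D_{\mathbf u}^f}}\ \sup_{0\ne\mathbf v\in X^0_{\mathcal D_{\mathbf u}^m}}\frac{\int_\Gamma\boldsymbol\mu\cdot[\![\mathbf v]\!]}{\|\mathbf v\|_{\mathbf U_0}\|\boldsymbol\mu\|_{H^{-1/2}(\Gamma)^d}}\ge c_\star>0.$$ **Time discretization.** $0=t_0<t_1<\dots<t_N=T$, $\delta t^{k+\frac12}=t_{k+1}-t_k$. A family $w=(w_k)_{k=0}^N$ is identified with the function of time $w(0)=w_0$, $w(t)=w_{k+1}$ for $t\in(t_k,t_{k+1}]$, and spatial operators are applied at each time. For $f$ piecewise constant in time with values $f_k$ on $(t_{k-1},t_k]$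 and $f_0=f(0)$, $\delta_tf(t)=(f_{k+1}-f_k)/\delta t^{k+\frac12}$ for $t\in(t_k,t_{k+1}]$. There are interpolators of initial conditions $I^m_{\mathcal D_p}:L^\infty(\Omega)\to X^0_{\mathcal D_p^m}$, $I^f_{\mathcal D_p}:L^\infty(\Gamma)\to X^0_{\mathcal D_p^f}$, $J^m_{\mathcal D_p}:L^2(\Omega)\to X^0_{\mathcal D_p^m}$. **Modified gradient scheme.** Find $p^\alpha=(p^\alpha_m,p^\alpha_f)\in(X^0_{\mathcal D_p})^{N+1}$ for $\alpha\in\{\mathrm{nw},\mathrm w\}$, $\mathbf u\in(X^0_{\mathcal D_{\mathbf u}^m})^{N+1}$ and $(\boldsymbol\lambda^k)_{k=0,\dots,N}$ with $\boldsymbol\lambda^k\in\boldsymbol C_{\mathcal D_{\mathbf u}^f}(\lambda^k_n)$ for all $k$, such that for all $\varphi^\alpha=(\varphi^\alpha_m,\varphi^\alpha_f)\in(X^0_{\mathcal D_p})^{N+1}$, $\mathbf v\in(X^0_{\mathcal D_{\mathbf u}^m})^{N+1}$ and $\boldsymbol\mu=(\boldsymbol\mu^k)_{k=1}^N$ with $\boldsymbol\mu^k\in\boldsymbol C_{\mathcal D_{\mathbf u}^f}(\lambda_n^k)$: (flow, for each $\alpha$) $$\begin{aligned}&\int_0^T\!\!\int_\Omega\Big(\big[(\Pi^m_{\mathcal D_p}\phi^0_m)\,\delta_t\Pi^m_{\mathcal D_p}s^\alpha_m+(\Pi^m_{\mathcal D_p}s^\alpha_m)\,\delta_t\phi_{\mathcal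 D}\big]\Pi^m_{\mathcal D_p}\varphi^\alpha_m+\eta^\alpha_m(\Pi^m_{\mathcal D_p}s^\alpha_m)\mathbb K_m\nabla^m_{\mathcal D_p}p^\alpha_m\cdot\nabla^m_{\mathcal D_p}\varphi^\alpha_m\Big)d\mathbf x\,dt\\&+\int_0^T\!\!\int_\Gamma\delta_t(d_{f,\mathcal D_{\mathbf u}}\Pi^f_{\mathcal D_p}s^\alpha_f)\,\Pi^f_{\mathcal D_p}\varphi^\alpha_f\,d\sigma dt+\int_0^T\!\!\int_\Gamma\eta^\alpha_f(\Pi^f_{\mathcal D_p}s^\alpha_f)\frac{d_{f,\mathcal D_{\mathbf u}}^3}{12}\nabla^f_{\mathcal D_p}p^\alpha_f\cdot\nabla^f_{\mathcal D_p}\varphi^\alpha_f\,d\sigma dt\\&+\sum_{\mathfrak a\in\{+,-\}}\int_0^T\!\!\int_\Gamma\Big(Q^\alpha_{f,\mathfrak a}[\![\varphi^\alpha]\!]^{\mathfrak a}_{\mathcal D_p}+\bar d_{\mathfrak a}\bar\phi_{\mathfrak a}\,\delta_t(\mathbb T^{\mathfrak a}_{\mathcal D_p}s^\alpha_{\mathfrak a})\,\mathbb T^{\mathfrak a}_{\mathcal D_p}\varphi^\alpha_m\Big)d\sigma dt\\&=\int_0^T\!\!\int_\Omega h^\alpha_m\Pi^m_{\mathcal D_p}\varphi^\alpha_m\,d\mathbf x\,dt+\int_0^T\!\!\int_\Gamma h^\alpha_f\Pi^f_{\mathcal D_p}\varphi^\alpha_f\,d\sigma dt,\end{aligned}$$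 (mechanics) $$\int_0^T\!\!\int_\Omega\big(\boldsymbol\sigma(\mathbf u):\boldsymbol\varepsilon(\mathbf v)-b\,\Pi^m_{\mathcal D_p}p^E_m\,\mathrm{div}\,\mathbf v\big)d\mathbf x\,dt+\int_0^T\!\!\int_\Gamma\boldsymbol\lambda\cdot[\![\mathbf v]\!]\,d\sigma dt+\int_0^T\!\!\int_\Gamma\Pi^f_{\mathcal D_p}p^E_f\,[\![\mathbf v]\!]_{n,\mathcal F}\,d\sigma dt=\int_0^T\!\!\int_\Omega\mathbf f\cdot\mathbf v\,d\mathbf x\,dt,$$ (contact) $$\int_0^T\!\!\int_\Gamma(\mu_n-\lambda_n)[\![\mathbf u]\!]_n\,d\sigma dt+\int_0^T\!\!\int_\Gamma(\boldsymbol\mu_\tau-\boldsymbol\lambda_\tau)\cdot\delta_t[\![\mathbf u]\!]_\tau\,d\sigma dt\le0,$$ with the closure equations, for $\omega\in\{m,f\}$ and $\mathfrak a\in\{+,-\}$: $$Q^\alpha_{f,\mathfrak a}=\Lambda_f\big[\eta^\alpha_{\mathfrak a}(\mathbb T^{\mathfrak a}_{\mathcal D_p}s^\alpha_{\mathfrak a})([\![p^\alpha]\!]^{\mathfrak a}_{\mathcal D_p})^+-\eta^\alpha_f(\Pi^f_{\mathcal D_p}s^\alpha_f)([\![p^\alpha]\!]^{\mathfrak a}_{\mathcal D_p})^-\big],$$ $$p_{c,\omega}=p^{\mathrm{nw}}_\omega-p^{\mathrm w}_\omega,\quad s^\alpha_\omega=S^\alpha_\omega(p_{c,\omega}),\quad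 s^\alpha_{\mathfrak a}=S^\alpha_{\mathfrak a}(p_{c,m}),$$ $$p^E_m=\sum_{\alpha}p^\alpha_m s^\alpha_m\ \text{(no capillary energy term)},\qquad p^E_f=\sum_\alpha p^\alpha_f s^\alpha_f-U_f(p_{c,f}),$$ $$\phi_{\mathcal D}-\Pi^m_{\mathcal D_p}\phi^0_m=b\,\mathrm{div}(\mathbf u-\mathbf u^0)+\frac1M\Pi^m_{\mathcal D_p}(p^E_m-p^{E,0}_m),\qquad d_{f,\mathcal D_{\mathbf u}}=d_0-[\![\mathbf u]\!]_{n,\mathcal F}.$$ Initial conditions (values at $k=0$): $p^\alpha_{0,\omega}=I^\omega_{\mathcal D_p}\bar p^\alpha_{0,\omega}$, $\phi^0_m=J^m_{\mathcal D_p}\bar\phi^0_m$, $p^{E,0}_m$ is the matrix equivalent pressure computed from the initial pressures, and $(\mathbf u^0,\boldsymbol\lambda^0)\in X^0_{\mathcal D_{\mathbf u}^m}\times\boldsymbol C_{\mathcal D_{\mathbf u}^f}(\lambda^0_n)$ solves the mechanical problem without the time variable, with equivalent pressures computed from the initial pressures: the mechanics equation without time integral for all $\mathbf v\in X^0_{\mathcal D_{\mathbf u}^m}$, together with $\int_\Gamma(\mu_n-\lambda^0_n)[\![\mathbf u^0]\!]_n\,d\sigma+\int_\Gamma(\boldsymbol\mu_\tau-\boldsymbol\lambda^0_\tau)\cdot[\![\mathbf u^0]\!]_\tau\,d\sigma\le0$ for all $\boldsymbol\mu\in\boldsymbol C_{\mathcal D_{\mathbf u}^f}(\lambda^0_n)$.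 *)

theory Defs
  imports "HOL-Analysis.Analysis"
begin

section \<open>Lebesgue and Sobolev spaces\<close>

text \<open>
  Elements of $L^2$, $L^\infty$ and $H^1$ are handled through representatives: all
  identities between such functions are required almost everywhere only.
\<close>

definition L2 :: "'a measure \<Rightarrow> ('a \<Rightarrow> 'b::euclidean_space) \<Rightarrow> bool" where
  "L2 M f \<longleftrightarrow> f \<in> borel_measurable M \<and> integrable M (\<lambda>x. (norm (f x))\<^sup>2)"

definition L2norm :: "'a measure \<Rightarrow> ('a \<Rightarrow> 'b::euclidean_space) \<Rightarrow> real" where
  "L2norm M f = sqrt (LINT x|M. (norm (f x))\<^sup>2)"

definition Linf :: "'a measure \<Rightarrow> ('a \<Rightarrow> 'b::euclidean_space) \<Rightarrow> bool" where
  "Linf M f \<longleftrightarrow> f \<in> borel_measurable M \<and> (\<exists>C. AE x in M. norm (f x) \<le> C)"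

definition ae_linear :: "'a measure \<Rightarrow> ('v::real_vector \<Rightarrow> 'a \<Rightarrow> 'b::euclidean_space) \<Rightarrow> bool" where
  "ae_linear M L \<longleftrightarrow>
     (\<forall>a b v w. AE x in M. L (a *\<^sub>R v + b *\<^sub>R w) x = a *\<^sub>R L v x + b *\<^sub>R L w x)"

definition is_norm :: "('v::real_vector \<Rightarrow> real) \<Rightarrow> bool" where
  "is_norm N \<longleftrightarrow>
     (\<forall>v. 0 \<le> N v) \<and> (\<forall>v. N v = 0 \<longleftrightarrow> v = 0) \<and>
     (\<forall>a v. N (a *\<^sub>R v) = \<bar>a\<bar> * N v) \<and> (\<forall>v w. N (v + w) \<le> N v + N w)"

text \<open>Compactly supported $C^1$ test functions on an open set, together with their gradient.\<close>

definition test_fun ::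
    "(real^'d::finite) set \<Rightarrow> (real^'d \<Rightarrow> real) \<Rightarrow> (real^'d \<Rightarrow> real^'d) \<Rightarrow> bool" where
  "test_fun U \<phi> D \<longleftrightarrow>
     (\<forall>x. (\<phi> has_derivative (\<lambda>h. D x \<bullet> h)) (at x)) \<and> continuous_on UNIV D \<and>
     compact (closure {x. \<phi> x \<noteq> 0}) \<and> closure {x. \<phi> x \<noteq> 0} \<subseteq> U"

definition is_wgrad ::
    "(real^'d::finite) set \<Rightarrow> (real^'d \<Rightarrow> real) \<Rightarrow> (real^'d \<Rightarrow> real^'d) \<Rightarrow> bool" where
  "is_wgrad U v g \<longleftrightarrow>
     (\<forall>\<phi> D. test_fun U \<phi> D \<longrightarrow>
        (LINT x|lebesgue_on U. v x *\<^sub>R D x) = - (LINT x|lebesgue_on U. \<phi> x *\<^sub>R g x))"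

definition H1 :: "(real^'d::finite) set \<Rightarrow> (real^'d \<Rightarrow> real) \<Rightarrow> bool" where
  "H1 U v \<longleftrightarrow>
     L2 (lebesgue_on U) v \<and> (\<exists>g. L2 (lebesgue_on U) g \<and> is_wgrad U v g)"

definition wgrad :: "(real^'d::finite) set \<Rightarrow> (real^'d \<Rightarrow> real) \<Rightarrow> real^'d \<Rightarrow> real^'d" where
  "wgrad U v = (SOME g. L2 (lebesgue_on U) g \<and> is_wgrad U v g)"

definition H1norm :: "(real^'d::finite) set \<Rightarrow> (real^'d \<Rightarrow> real) \<Rightarrow> real" where
  "H1norm U v = sqrt ((L2norm (lebesgue_on U) v)\<^sup>2 + (L2norm (lebesgue_on U) (wgrad U v))\<^sup>2)"

text \<open>
  Trace operators.  \<^term>\<open>R x\<close> is the region from which the point \<^term>\<open>x\<close> is approached.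
  A trace operator is a bounded linear map from $H^1(U)$ to $L^2(M)$ which extends
  the pointwise restriction of the functions that are continuous up to \<^term>\<open>space M\<close>.
\<close>

definition trace_operator ::
    "(real^'d::finite) set \<Rightarrow> (real^'d) measure \<Rightarrow> (real^'d \<Rightarrow> (real^'d) set) \<Rightarrow>
     ((real^'d \<Rightarrow> real) \<Rightarrow> real^'d \<Rightarrow> real) \<Rightarrow> bool" where
  "trace_operator U M R \<gamma> \<longleftrightarrow>
     (\<forall>v. H1 U v \<longrightarrow> L2 M (\<gamma> v)) \<and>
     (\<forall>a b v w. H1 U v \<longrightarrow> H1 U w \<longrightarrow>
        (AE x in M. \<gamma> (\<lambda>y. a * v y + b * w y) x = a * \<gamma> v x + b * \<gamma> w x)) \<and>
     (\<exists>C. \<forall>v. H1 U v \<longrightarrow> L2norm M (\<gamma> v) \<le> C * H1norm U v) \<and>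
     (\<forall>v g. H1 U v \<longrightarrow> continuous_on U v \<longrightarrow>
        (\<forall>x\<in>space M. (v \<longlongrightarrow> g x) (at x within R x)) \<longrightarrow> (AE x in M. \<gamma> v x = g x))"


section \<open>Polytopal sets and surface measure\<close>

text \<open>
  Bounded polytopal set of dimension \<^term>\<open>k\<close>, relatively open in its affine hull
  and without slits.
\<close>

definition polytopal :: "int \<Rightarrow> (real^'d::finite) set \<Rightarrow> bool" where
  "polytopal k S \<longleftrightarrow>
     S \<noteq> {} \<and> aff_dim S = k \<and> rel_interior (closure S) = S \<and>
     (\<exists>\<P>. finite \<P> \<and> (\<forall>P\<in>\<P>. polytope P) \<and> closure S = \<Union>\<P>)"

definition normal_to :: "real^'d::finite \<Rightarrow> (real^'d) set \<Rightarrow> bool" where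
  "normal_to n P \<longleftrightarrow> norm n = 1 \<and> (\<forall>x\<in>P. \<forall>y\<in>P. (x - y) \<bullet> n = 0)"

definition unit_normal :: "(real^'d::finite) set \<Rightarrow> real^'d" where
  "unit_normal P = (SOME n. normal_to n P)"

definition prism :: "(real^'d::finite) set \<Rightarrow> real^'d \<Rightarrow> (real^'d) set" where
  "prism A n = (\<lambda>(x, s). x + s *\<^sub>R n) ` (A \<times> {0..1})"

text \<open>
  Surface measure on a finite union of disjoint planar pieces of codimension one: the
  $(d-1)$-dimensional measure of a planar set is the volume of the prism of height 1 over it.
\<close>

definition surface_measure :: "(real^'d::finite) set set \<Rightarrow> (real^'d) measure" where
  "surface_measure \<P> = completion (measure_of (\<Union>\<P>) (sets (restrict_space borel (\<Union>\<P>)))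
     (\<lambda>A. \<Sum>P\<in>\<P>. emeasure lborel (prism (A \<inter> P) (unit_normal P))))"

text \<open>
  Slobodeckij norm of $H^{1/2}$ on a set of dimension $d-1$, so that the exponent is
  $(d-1) + 2\cdot\frac12 = d$, and the dual norm of a square integrable function.
\<close>

definition Hhalf_seminorm2 :: "(real^'d::finite) measure \<Rightarrow> (real^'d \<Rightarrow> real^'d) \<Rightarrow> ennreal" where
  "Hhalf_seminorm2 M v =
     (\<integral>\<^sup>+ x. (\<integral>\<^sup>+ y. ennreal ((norm (v x - v y))\<^sup>2 / norm (x - y) ^ CARD('d)) \<partial>M) \<partial>M)"

definition Hhalf :: "(real^'d::finite) measure \<Rightarrow> (real^'d \<Rightarrow> real^'d) \<Rightarrow> bool" where
  "Hhalf M v \<longleftrightarrow> L2 M v \<and> Hhalf_seminorm2 M v < \<infinity>"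

definition Hhalf_norm :: "(real^'d::finite) measure \<Rightarrow> (real^'d \<Rightarrow> real^'d) \<Rightarrow> real" where
  "Hhalf_norm M v = sqrt ((L2norm M v)\<^sup>2 + enn2real (Hhalf_seminorm2 M v))"

definition Hminus_half_norm :: "(real^'d::finite) measure \<Rightarrow> (real^'d \<Rightarrow> real^'d) \<Rightarrow> real" where
  "Hminus_half_norm M \<mu> = (SUP v\<in>{v. Hhalf M v \<and> Hhalf_norm M v \<le> 1}. LINT x|M. \<mu> x \<bullet> v x)"


section \<open>Fractured domain\<close>

datatype side = Plus | Minus
datatype phase = NW | W
datatype rock = Mat | Frac | Dam side

text \<open>
  \<^term>\<open>bfaces\<close> decomposes the boundary of the domain into planar pieces (needed only for its
  surface measure); \<^term>\<open>nplus\<close> gives the normal, outward from the side \<^term>\<open>Plus\<close>,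
  of each fracture.
\<close>

record ('d::finite) geometry =
  dom :: "(real^'d) set"
  bfaces :: "(real^'d) set set"
  fracs :: "(real^'d) set set"
  nplus :: "(real^'d) set \<Rightarrow> real^'d"
  tr :: "side \<Rightarrow> (real^'d \<Rightarrow> real) \<Rightarrow> real^'d \<Rightarrow> real"
  trb :: "(real^'d \<Rightarrow> real) \<Rightarrow> real^'d \<Rightarrow> real"

definition Gam :: "('d::finite) geometry \<Rightarrow> (real^'d) set" where
  "Gam G = \<Union>(fracs G)"

definition surf :: "('d::finite) geometry \<Rightarrow> (real^'d) measure" where
  "surf G = surface_measure (fracs G)"

definition vol :: "('d::finite) geometry \<Rightarrow> (real^'d) measure" where
  "vol G = lebesgue_on (dom G)"

definition cut_dom :: "('d::finite) geometry \<Rightarrow> (real^'d) set" where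
  "cut_dom G = dom G - closure (Gam G)"

definition nfield :: "('d::finite) geometry \<Rightarrow> real^'d \<Rightarrow> real^'d" where
  "nfield G x = (\<Sum>P\<in>fracs G. indicator P x *\<^sub>R nplus G P)"

fun side_sign :: "side \<Rightarrow> real" where
  "side_sign Plus = 1"
| "side_sign Minus = -1"

definition side_region :: "('d::finite) geometry \<Rightarrow> side \<Rightarrow> real^'d \<Rightarrow> (real^'d) set" where
  "side_region G a x = {y \<in> cut_dom G. (y - x) \<bullet> (side_sign a *\<^sub>R nfield G x) < 0}"

text \<open>
  The boundary of the network (fracture tips and fracture edges on the boundary of the domain):
  the closure of the boundary points that belong to the closure of a single fracture.
  Edges shared by several fractures are intersections, not boundary.
\<close>

definition bd_Gam :: "('d::finite) geometry \<Rightarrow> (real^'d) set" where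
  "bd_Gam G = closure {x. \<exists>P\<in>fracs G. x \<in> closure P - P \<and> (\<forall>Q\<in>fracs G. x \<in> closure Q \<longrightarrow> Q = P)}"

definition fractured_domain :: "('d::finite) geometry \<Rightarrow> bool" where
  "fractured_domain G \<longleftrightarrow>
     polytopal (int CARD('d)) (dom G) \<and> connected (dom G) \<and>
     finite (bfaces G) \<and> disjoint (bfaces G) \<and>
     (\<forall>P\<in>bfaces G. polytopal (int CARD('d) - 1) P) \<and>
     frontier (dom G) = (\<Union>P\<in>bfaces G. closure P) \<and>
     finite (fracs G) \<and>
     (\<forall>P\<in>fracs G. polytopal (int CARD('d) - 1) P \<and> simply_connected P \<and> P \<subseteq> dom G \<and>
        normal_to (nplus G P) P) \<and>
     (\<forall>P\<in>fracs G. \<forall>Q\<in>fracs G. P \<noteq> Q \<longrightarrow>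
        P \<inter> Q = {} \<and> closure P \<inter> closure Q \<subseteq> (closure P - P) \<inter> (closure Q - Q)) \<and>
     (\<forall>a. trace_operator (cut_dom G) (surf G) (side_region G a) (tr G a)) \<and>
     trace_operator (cut_dom G) (surface_measure (bfaces G)) (\<lambda>x. cut_dom G) (trb G)"


subsection \<open>Displacement fields\<close>

definition jac :: "('d::finite) geometry \<Rightarrow> (real^'d \<Rightarrow> real^'d) \<Rightarrow> real^'d \<Rightarrow> real^'d^'d" where
  "jac G v x = (\<chi> i. wgrad (cut_dom G) (\<lambda>y. v y $ i) x)"

definition eps :: "('d::finite) geometry \<Rightarrow> (real^'d \<Rightarrow> real^'d) \<Rightarrow> real^'d \<Rightarrow> real^'d^'d" where
  "eps G v x = (1/2) *\<^sub>R (jac G v x + transpose (jac G v x))"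

definition dvg :: "('d::finite) geometry \<Rightarrow> (real^'d \<Rightarrow> real^'d) \<Rightarrow> real^'d \<Rightarrow> real" where
  "dvg G v x = trace (jac G v x)"

definition vtr :: "('d::finite) geometry \<Rightarrow> side \<Rightarrow> (real^'d \<Rightarrow> real^'d) \<Rightarrow> real^'d \<Rightarrow> real^'d" where
  "vtr G a v x = (\<chi> i. tr G a (\<lambda>y. v y $ i) x)"

definition jmp :: "('d::finite) geometry \<Rightarrow> (real^'d \<Rightarrow> real^'d) \<Rightarrow> real^'d \<Rightarrow> real^'d" where
  "jmp G v x = vtr G Plus v x - vtr G Minus v x"

definition jmp_n :: "('d::finite) geometry \<Rightarrow> (real^'d \<Rightarrow> real^'d) \<Rightarrow> real^'d \<Rightarrow> real" where
  "jmp_n G v x = jmp G v x \<bullet> nfield G x"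

definition jmp_t :: "('d::finite) geometry \<Rightarrow> (real^'d \<Rightarrow> real^'d) \<Rightarrow> real^'d \<Rightarrow> real^'d" where
  "jmp_t G v x = jmp G v x - jmp_n G v x *\<^sub>R nfield G x"

definition U0 :: "('d::finite) geometry \<Rightarrow> (real^'d \<Rightarrow> real^'d) set" where
  "U0 G = {v. \<forall>i. H1 (cut_dom G) (\<lambda>y. v y $ i) \<and>
                  (AE x in surface_measure (bfaces G). trb G (\<lambda>y. v y $ i) x = 0)}"

definition U0norm :: "('d::finite) geometry \<Rightarrow> (real^'d \<Rightarrow> real^'d) \<Rightarrow> real" where
  "U0norm G v = L2norm (vol G) (eps G v)"

definition korn_inequality :: "('d::finite) geometry \<Rightarrow> bool" where
  "korn_inequality G \<longleftrightarrow>
     (\<exists>C. \<forall>v\<in>U0 G. sqrt (\<Sum>i\<in>UNIV. (H1norm (cut_dom G) (\<lambda>y. v y $ i))\<^sup>2) \<le> C * U0norm G v)"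


section \<open>Model data\<close>

record ('d::finite) model =
  eta :: "phase \<Rightarrow> rock \<Rightarrow> real \<Rightarrow> real"
  Snw :: "rock \<Rightarrow> real \<Rightarrow> real"
  width :: "side \<Rightarrow> real"
  dporo :: "side \<Rightarrow> real"
  d0 :: "real^'d \<Rightarrow> real"
  biot :: real
  Mbiot :: ereal
  young :: real
  poisson :: real
  fric :: real
  phibar :: "real^'d \<Rightarrow> real"
  pbarm :: "phase \<Rightarrow> real^'d \<Rightarrow> real"
  pbarf :: "phase \<Rightarrow> real^'d \<Rightarrow> real"
  bodyf :: "real^'d \<Rightarrow> real^'d"
  hm :: "phase \<Rightarrow> real \<Rightarrow> real^'d \<Rightarrow> real"
  hf :: "phase \<Rightarrow> real \<Rightarrow> real^'d \<Rightarrow> real"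
  Lamf :: "real^'d \<Rightarrow> real"
  Km :: "real^'d \<Rightarrow> real^'d^'d"

fun Sat :: "('d::finite) model \<Rightarrow> phase \<Rightarrow> rock \<Rightarrow> real \<Rightarrow> real" where
  "Sat D NW rt q = Snw D rt q"
| "Sat D W rt q = 1 - Snw D rt q"

text \<open>
  The saturation curve is Lipschitz, hence differentiable almost everywhere; the value
  of \<^term>\<open>deriv\<close> at the other points is irrelevant.  The interval integral is signed.
\<close>

definition capU :: "('d::finite) model \<Rightarrow> rock \<Rightarrow> real \<Rightarrow> real" where
  "capU D rt pc = (LBINT q=ereal 0..ereal pc. q * deriv (Snw D rt) q)"

definition invM :: "('d::finite) model \<Rightarrow> real" where
  "invM D = real_of_ereal (1 / Mbiot D)"

text \<open>
  For $d=3$, tips of the network may reach the boundary of the domain, where a zero and a positive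
  limit would be incompatible; such corner points are exempted from the positive limit, and
  the boundedness that follows from the limits is required explicitly.
\<close>

definition aperture_data :: "('d::finite) geometry \<Rightarrow> (real^'d \<Rightarrow> real) \<Rightarrow> bool" where
  "aperture_data G d \<longleftrightarrow>
     continuous_on (Gam G) d \<and> (\<forall>x\<in>Gam G. 0 < d x) \<and> bounded (d ` Gam G) \<and>
     (\<forall>x\<in>bd_Gam G - frontier (dom G). (d \<longlongrightarrow> 0) (at x within Gam G)) \<and>
     (\<forall>x\<in>(bd_Gam G \<inter> frontier (dom G)) - closure (bd_Gam G - frontier (dom G)).
        \<exists>l>0. (d \<longlongrightarrow> l) (at x within Gam G))"

definition model_data :: "('d::finite) geometry \<Rightarrow> real \<Rightarrow> 'd model \<Rightarrow> bool" where
  "model_data G T D \<longleftrightarrow>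
     (\<forall>\<alpha> rt. continuous_on {0..1} (eta D \<alpha> rt) \<and> mono_on {0..1} (eta D \<alpha> rt) \<and>
        (\<exists>lo hi. 0 < lo \<and> (\<forall>s\<in>{0..1}. lo \<le> eta D \<alpha> rt s \<and> eta D \<alpha> rt s \<le> hi))) \<and>
     (\<forall>a. eta D W (Dam a) 1 = eta D W Frac 1 \<and> eta D NW (Dam a) 0 = eta D NW Frac 0) \<and>
     (\<forall>rt. range (Snw D rt) \<subseteq> {0..1} \<and> mono (Snw D rt) \<and> (\<exists>L. L-lipschitz_on UNIV (Snw D rt))) \<and>
     (\<forall>a. 0 < width D a \<and> 0 < dporo D a) \<and>
     aperture_data G (d0 D) \<and>
     0 \<le> biot D \<and> biot D \<le> 1 \<and> 0 < Mbiot D \<and> 0 < young D \<and>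
     -1 < poisson D \<and> poisson D < 1/2 \<and> 0 \<le> fric D \<and>
     Linf (vol G) (phibar D) \<and> (AE x in vol G. 0 \<le> phibar D x) \<and>
     (\<forall>\<alpha>. Linf (vol G) (pbarm D \<alpha>) \<and> Linf (surf G) (pbarf D \<alpha>)) \<and>
     L2 (vol G) (bodyf D) \<and>
     (\<forall>\<alpha>. L2 (lebesgue_on {0<..<T} \<Otimes>\<^sub>M vol G) (\<lambda>(s, x). hm D \<alpha> s x) \<and>
          L2 (lebesgue_on {0<..<T} \<Otimes>\<^sub>M surf G) (\<lambda>(s, x). hf D \<alpha> s x)) \<and>
     Linf (surf G) (Lamf D) \<and> (\<exists>c>0. AE x in surf G. c \<le> Lamf D x) \<and>
     Linf (vol G) (Km D) \<and> (AE x in vol G. transpose (Km D x) = Km D x) \<and>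
     (\<exists>\<kappa>>0. AE x in vol G. \<forall>\<xi>. \<kappa> * (norm \<xi>)\<^sup>2 \<le> \<xi> \<bullet> (Km D x *v \<xi>))"

definition stress ::
    "('d::finite) geometry \<Rightarrow> 'd model \<Rightarrow> (real^'d \<Rightarrow> real^'d) \<Rightarrow> real^'d \<Rightarrow> real^'d^'d" where
  "stress G D u x = (young D / (1 + poisson D)) *\<^sub>R
     (eps G u x + (poisson D / (1 - 2 * poisson D) * dvg G u x) *\<^sub>R mat 1)"


section \<open>Gradient discretization of the flow\<close>

text \<open>
  The discrete unknowns are the coordinates of vectors indexed by \<^typ>\<open>'m\<close> (matrix) and
  \<^typ>\<open>'f\<close> (fractures); \<^typ>\<open>'e\<close> is the index type of tangential gradients,
  of cardinality $d-1$.  The families \<^term>\<open>cellm\<close>, \<^term>\<open>cellf\<close>, \<^term>\<open>cellt\<close>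
  are the sets $A_i$ defining the piecewise constant reconstructions.
\<close>

record ('d::finite, 'e::finite, 'm::finite, 'f::finite) flow_disc =
  gradm :: "real^'m \<Rightarrow> real^'d \<Rightarrow> real^'d"
  gradf :: "real^'f \<Rightarrow> real^'d \<Rightarrow> real^'e"
  cellm :: "'m \<Rightarrow> (real^'d) set"
  cellf :: "'f \<Rightarrow> (real^'d) set"
  cellt :: "side \<Rightarrow> 'm \<Rightarrow> (real^'d) set"
  djump :: "side \<Rightarrow> (real^'m) \<times> (real^'f) \<Rightarrow> real^'d \<Rightarrow> real"
  intm :: "(real^'d \<Rightarrow> real) \<Rightarrow> real^'m"
  intf :: "(real^'d \<Rightarrow> real) \<Rightarrow> real^'f"
  intphi :: "(real^'d \<Rightarrow> real) \<Rightarrow> real^'m"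

definition pwc :: "('i::finite \<Rightarrow> 'a set) \<Rightarrow> 'b::real_vector^'i \<Rightarrow> 'a \<Rightarrow> 'b" where
  "pwc A v x = (\<Sum>i\<in>UNIV. indicator (A i) x *\<^sub>R v $ i)"

definition ae_partition :: "'a measure \<Rightarrow> ('i::finite \<Rightarrow> 'a set) \<Rightarrow> bool" where
  "ae_partition M A \<longleftrightarrow>
     (\<forall>i. A i \<in> sets M) \<and> disjoint_family A \<and> (AE x in M. x \<in> (\<Union>i. A i))"

definition Pim where "Pim P = pwc (cellm P)"
definition Pif where "Pif P = pwc (cellf P)"
definition Tr where "Tr P a = pwc (cellt P a)"

definition flow_norm ::
    "('d::finite) geometry \<Rightarrow> 'd model \<Rightarrow> ('d, 'e::finite, 'm::finite, 'f::finite) flow_disc \<Rightarrow>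
     (real^'m) \<times> (real^'f) \<Rightarrow> real" where
  "flow_norm G D P v =
     L2norm (vol G) (gradm P (fst v))
     + L2norm (surf G) (\<lambda>x. (d0 D x powr (3/2)) *\<^sub>R gradf P (snd v) x)
     + (\<Sum>a\<in>{Plus, Minus}. L2norm (surf G) (djump P a v))"

definition flow_discretization ::
    "('d::finite) geometry \<Rightarrow> 'd model \<Rightarrow> ('d, 'e::finite, 'm::finite, 'f::finite) flow_disc \<Rightarrow> bool" where
  "flow_discretization G D P \<longleftrightarrow>
     ae_linear (vol G) (gradm P) \<and> (\<forall>v. Linf (vol G) (gradm P v)) \<and>
     ae_linear (surf G) (gradf P) \<and> (\<forall>v. Linf (surf G) (gradf P v)) \<and>
     (\<forall>a. ae_linear (surf G) (djump P a) \<and> (\<forall>v. Linf (surf G) (djump P a v))) \<and>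
     ae_partition (vol G) (cellm P) \<and> ae_partition (surf G) (cellf P) \<and>
     (\<forall>a. ae_partition (surf G) (cellt P a)) \<and>
     is_norm (flow_norm G D P)"

definition coercive ::
    "('d::finite) geometry \<Rightarrow> 'd model \<Rightarrow> ('d, 'e::finite, 'm::finite, 'f::finite) flow_disc \<Rightarrow>
     real \<Rightarrow> bool" where
  "coercive G D P c \<longleftrightarrow>
     (\<forall>v. L2norm (vol G) (Pim P (fst v)) + L2norm (surf G) (Pif P (snd v))
          + (\<Sum>a\<in>{Plus, Minus}. L2norm (surf G) (Tr P a (fst v)))
        \<le> c * flow_norm G D P v)"


section \<open>Discretization of the mechanics\<close>

text \<open>
  \<^term>\<open>dispV\<close> is the space of discrete displacements, \<^term>\<open>face \<sigma>\<close> is the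
  face with index \<^term>\<open>\<sigma>\<close> and \<^term>\<open>own \<sigma>\<close> the fracture containing it.
\<close>

record ('d::finite, 's::finite) mech_disc =
  dispV :: "(real^'d \<Rightarrow> real^'d) set"
  face :: "'s \<Rightarrow> (real^'d) set"
  own :: "'s \<Rightarrow> (real^'d) set"

definition mech_discretization ::
    "('d::finite) geometry \<Rightarrow> ('d, 's::finite) mech_disc \<Rightarrow> bool" where
  "mech_discretization G Q \<longleftrightarrow>
     (\<exists>B. finite B \<and> B \<subseteq> U0 G \<and> dispV Q = {(\<lambda>x. \<Sum>w\<in>B. c w *\<^sub>R w x) | c. True}) \<and>
     dispV Q \<subseteq> U0 G \<and>
     ae_partition (surf G) (face Q) \<and>
     (\<forall>\<sigma>. 0 < measure (surf G) (face Q \<sigma>) \<and> own Q \<sigma> \<in> fracs G \<and> face Q \<sigma> \<subseteq> own Q \<sigma>)"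

definition nface :: "('d::finite) geometry \<Rightarrow> ('d, 's::finite) mech_disc \<Rightarrow> 's \<Rightarrow> real^'d" where
  "nface G Q \<sigma> = nplus G (own Q \<sigma>)"

definition mul_n ::
    "('d::finite) geometry \<Rightarrow> ('d, 's::finite) mech_disc \<Rightarrow> (real^'d)^'s \<Rightarrow> real^'s" where
  "mul_n G Q \<mu> = (\<chi> \<sigma>. \<mu> $ \<sigma> \<bullet> nface G Q \<sigma>)"

definition mul_t ::
    "('d::finite) geometry \<Rightarrow> ('d, 's::finite) mech_disc \<Rightarrow> (real^'d)^'s \<Rightarrow> (real^'d)^'s" where
  "mul_t G Q \<mu> = (\<chi> \<sigma>. \<mu> $ \<sigma> - (mul_n G Q \<mu> $ \<sigma>) *\<^sub>R nface G Q \<sigma>)"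

definition dual_cone ::
    "('d::finite) geometry \<Rightarrow> 'd model \<Rightarrow> ('d, 's::finite) mech_disc \<Rightarrow> real^'s \<Rightarrow> ((real^'d)^'s) set" where
  "dual_cone G D Q lamn =
     {\<mu>. \<forall>\<sigma>. 0 \<le> mul_n G Q \<mu> $ \<sigma> \<and> norm (mul_t G Q \<mu> $ \<sigma>) \<le> fric D * lamn $ \<sigma>}"

definition avg_face ::
    "('d::finite) geometry \<Rightarrow> ('d, 's::finite) mech_disc \<Rightarrow> side \<Rightarrow> (real^'d \<Rightarrow> real^'d) \<Rightarrow> 's \<Rightarrow> real^'d" where
  "avg_face G Q a u \<sigma> =
     (1 / measure (surf G) (face Q \<sigma>)) *\<^sub>R (LINT x:face Q \<sigma>|surf G. vtr G a u x)"

definition jmpF ::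
    "('d::finite) geometry \<Rightarrow> ('d, 's::finite) mech_disc \<Rightarrow> (real^'d \<Rightarrow> real^'d) \<Rightarrow> real^'d \<Rightarrow> real" where
  "jmpF G Q u =
     pwc (face Q) (\<chi> \<sigma>. (avg_face G Q Plus u \<sigma> - avg_face G Q Minus u \<sigma>) \<bullet> nface G Q \<sigma>)"

text \<open>
  The infimum and supremum are taken in the extended reals; non-zero displacements are
  meant as elements of the Lebesgue space.
\<close>

definition inf_sup_condition ::
    "('d::finite) geometry \<Rightarrow> ('d, 's::finite) mech_disc \<Rightarrow> real \<Rightarrow> bool" where
  "inf_sup_condition G Q c \<longleftrightarrow>
     ereal c \<le> (INF \<mu>\<in>{\<mu>. \<mu> \<noteq> 0}. SUP v\<in>{v \<in> dispV Q. \<not> (AE x in vol G. v x = 0)}.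
        ereal ((LINT x|surf G. pwc (face Q) \<mu> x \<bullet> jmp G v x)
               / (U0norm G v * Hminus_half_norm (surf G) (pwc (face Q) \<mu>))))"


section \<open>Time discretization\<close>

definition time_grid :: "real \<Rightarrow> nat \<Rightarrow> (nat \<Rightarrow> real) \<Rightarrow> bool" where
  "time_grid T N t \<longleftrightarrow> t 0 = 0 \<and> (\<forall>k<N. t k < t (Suc k)) \<and> t N = T"

text \<open>For a time in $(t_k, t_{k+1}]$ the index is $k+1$, and for time 0 it is 0.\<close>

definition tidx :: "(nat \<Rightarrow> real) \<Rightarrow> real \<Rightarrow> nat" where
  "tidx t s = (LEAST k. s \<le> t k)"

definition at_time :: "(nat \<Rightarrow> real) \<Rightarrow> (nat \<Rightarrow> 'b) \<Rightarrow> real \<Rightarrow> 'b" where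
  "at_time t w s = w (tidx t s)"

definition dtime :: "(nat \<Rightarrow> real) \<Rightarrow> (nat \<Rightarrow> 'b::real_vector) \<Rightarrow> real \<Rightarrow> 'b" where
  "dtime t w s = (let k = tidx t s in (1 / (t k - t (k - 1))) *\<^sub>R (w k - w (k - 1)))"


section \<open>The modified gradient scheme\<close>

definition cmap :: "(real \<Rightarrow> real) \<Rightarrow> real^'i::finite \<Rightarrow> real^'i" where
  "cmap f v = (\<chi> i. f (v $ i))"

definition pos :: "real \<Rightarrow> real" where "pos x = max 0 x"
definition neg :: "real \<Rightarrow> real" where "neg x = pos (- x)"

text \<open>
  In what follows \<^term>\<open>p \<alpha>\<close> is the pair of matrix and fracture unknowns of the pressure
  of phase \<^term>\<open>\<alpha>\<close> at a fixed time.
\<close>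

definition pcm :: "(phase \<Rightarrow> (real^'m::finite) \<times> (real^'f::finite)) \<Rightarrow> real^'m" where
  "pcm p = fst (p NW) - fst (p W)"

definition pcf :: "(phase \<Rightarrow> (real^'m::finite) \<times> (real^'f::finite)) \<Rightarrow> real^'f" where
  "pcf p = snd (p NW) - snd (p W)"

definition satm ::
    "('d::finite) model \<Rightarrow> (phase \<Rightarrow> (real^'m::finite) \<times> (real^'f::finite)) \<Rightarrow> phase \<Rightarrow> real^'m" where
  "satm D p \<alpha> = cmap (Sat D \<alpha> Mat) (pcm p)"

definition satf ::
    "('d::finite) model \<Rightarrow> (phase \<Rightarrow> (real^'m::finite) \<times> (real^'f::finite)) \<Rightarrow> phase \<Rightarrow> real^'f" where
  "satf D p \<alpha> = cmap (Sat D \<alpha> Frac) (pcf p)"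

definition sata ::
    "('d::finite) model \<Rightarrow> side \<Rightarrow> (phase \<Rightarrow> (real^'m::finite) \<times> (real^'f::finite)) \<Rightarrow> phase \<Rightarrow> real^'m" where
  "sata D a p \<alpha> = cmap (Sat D \<alpha> (Dam a)) (pcm p)"

text \<open>The matrix equivalent pressure has no capillary energy term, the fracture one has.\<close>

definition pEm ::
    "('d::finite) model \<Rightarrow> (phase \<Rightarrow> (real^'m::finite) \<times> (real^'f::finite)) \<Rightarrow> real^'m" where
  "pEm D p = (\<chi> i. \<Sum>\<alpha>\<in>{NW, W}. fst (p \<alpha>) $ i * satm D p \<alpha> $ i)"

definition pEf ::
    "('d::finite) model \<Rightarrow> (phase \<Rightarrow> (real^'m::finite) \<times> (real^'f::finite)) \<Rightarrow> real^'f" where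
  "pEf D p = (\<chi> i. (\<Sum>\<alpha>\<in>{NW, W}. snd (p \<alpha>) $ i * satf D p \<alpha> $ i) - capU D Frac (pcf p $ i))"

definition apert ::
    "('d::finite) geometry \<Rightarrow> 'd model \<Rightarrow> ('d, 's::finite) mech_disc \<Rightarrow>
     (real^'d \<Rightarrow> real^'d) \<Rightarrow> real^'d \<Rightarrow> real" where
  "apert G D Q u x = d0 D x - jmpF G Q u x"

definition phiD ::
    "('d::finite) geometry \<Rightarrow> 'd model \<Rightarrow> ('d, 'e::finite, 'm::finite, 'f::finite) flow_disc \<Rightarrow>
     (phase \<Rightarrow> nat \<Rightarrow> (real^'m) \<times> (real^'f)) \<Rightarrow> (nat \<Rightarrow> real^'d \<Rightarrow> real^'d) \<Rightarrow> nat \<Rightarrow> real^'d \<Rightarrow> real" where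
  "phiD G D P p u k x =
     Pim P (intphi P (phibar D)) x + biot D * dvg G (\<lambda>y. u k y - u 0 y) x
     + invM D * Pim P (pEm D (\<lambda>\<alpha>. p \<alpha> k) - pEm D (\<lambda>\<alpha>. p \<alpha> 0)) x"

definition Qflux ::
    "('d::finite) model \<Rightarrow> ('d, 'e::finite, 'm::finite, 'f::finite) flow_disc \<Rightarrow>
     (phase \<Rightarrow> (real^'m) \<times> (real^'f)) \<Rightarrow> phase \<Rightarrow> side \<Rightarrow> real^'d \<Rightarrow> real" where
  "Qflux D P p \<alpha> a x = Lamf D x *
     (eta D \<alpha> (Dam a) (Tr P a (sata D a p \<alpha>) x) * pos (djump P a (p \<alpha>) x)
      - eta D \<alpha> Frac (Pif P (satf D p \<alpha>) x) * neg (djump P a (p \<alpha>) x))"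

definition flow_eq ::
    "('d::finite) geometry \<Rightarrow> 'd model \<Rightarrow> ('d, 'e::finite, 'm::finite, 'f::finite) flow_disc \<Rightarrow>
     ('d, 's::finite) mech_disc \<Rightarrow> real \<Rightarrow> (nat \<Rightarrow> real) \<Rightarrow>
     (phase \<Rightarrow> nat \<Rightarrow> (real^'m) \<times> (real^'f)) \<Rightarrow> (nat \<Rightarrow> real^'d \<Rightarrow> real^'d) \<Rightarrow>
     phase \<Rightarrow> (nat \<Rightarrow> (real^'m) \<times> (real^'f)) \<Rightarrow> bool" where
  "flow_eq G D P Q T t p u \<alpha> \<phi> \<longleftrightarrow>
     (let pk = (\<lambda>k \<beta>. p \<beta> k) in
     (LINT s|lebesgue_on {0<..<T}. LINT x|vol G.
        (Pim P (intphi P (phibar D)) x * dtime t (\<lambda>k. Pim P (satm D (pk k) \<alpha>) x) s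
         + at_time t (\<lambda>k. Pim P (satm D (pk k) \<alpha>) x) s * dtime t (\<lambda>k. phiD G D P p u k x) s)
          * at_time t (\<lambda>k. Pim P (fst (\<phi> k)) x) s
        + at_time t (\<lambda>k. eta D \<alpha> Mat (Pim P (satm D (pk k) \<alpha>) x) *
            ((Km D x *v gradm P (fst (p \<alpha> k)) x) \<bullet> gradm P (fst (\<phi> k)) x)) s)
     + (LINT s|lebesgue_on {0<..<T}. LINT x|surf G.
          dtime t (\<lambda>k. apert G D Q (u k) x * Pif P (satf D (pk k) \<alpha>) x) s
            * at_time t (\<lambda>k. Pif P (snd (\<phi> k)) x) s)
     + (LINT s|lebesgue_on {0<..<T}. LINT x|surf G.
          at_time t (\<lambda>k. eta D \<alpha> Frac (Pif P (satf D (pk k) \<alpha>) x) * (apert G D Q (u k) x ^ 3 / 12)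
            * (gradf P (snd (p \<alpha> k)) x \<bullet> gradf P (snd (\<phi> k)) x)) s)
     + (\<Sum>a\<in>{Plus, Minus}. LINT s|lebesgue_on {0<..<T}. LINT x|surf G.
          at_time t (\<lambda>k. Qflux D P (pk k) \<alpha> a x * djump P a (\<phi> k) x) s
          + width D a * dporo D a * dtime t (\<lambda>k. Tr P a (sata D a (pk k) \<alpha>) x) s
              * at_time t (\<lambda>k. Tr P a (fst (\<phi> k)) x) s)
     = (LINT s|lebesgue_on {0<..<T}. LINT x|vol G.
          hm D \<alpha> s x * at_time t (\<lambda>k. Pim P (fst (\<phi> k)) x) s)
     + (LINT s|lebesgue_on {0<..<T}. LINT x|surf G.
          hf D \<alpha> s x * at_time t (\<lambda>k. Pif P (snd (\<phi> k)) x) s))"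

text \<open>Both sides of the mechanical equation at a fixed time.\<close>

definition mech_lhs ::
    "('d::finite) geometry \<Rightarrow> 'd model \<Rightarrow> ('d, 'e::finite, 'm::finite, 'f::finite) flow_disc \<Rightarrow>
     ('d, 's::finite) mech_disc \<Rightarrow> (phase \<Rightarrow> (real^'m) \<times> (real^'f)) \<Rightarrow>
     (real^'d \<Rightarrow> real^'d) \<Rightarrow> (real^'d)^'s \<Rightarrow> (real^'d \<Rightarrow> real^'d) \<Rightarrow> real" where
  "mech_lhs G D P Q p u lam v =
     (LINT x|vol G. stress G D u x \<bullet> eps G v x - biot D * Pim P (pEm D p) x * dvg G v x)
     + (LINT x|surf G. pwc (face Q) lam x \<bullet> jmp G v x)
     + (LINT x|surf G. Pif P (pEf D p) x * jmpF G Q v x)"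

definition mech_rhs ::
    "('d::finite) geometry \<Rightarrow> 'd model \<Rightarrow> (real^'d \<Rightarrow> real^'d) \<Rightarrow> real" where
  "mech_rhs G D v = (LINT x|vol G. bodyf D x \<bullet> v x)"

definition initial_state ::
    "('d::finite) geometry \<Rightarrow> 'd model \<Rightarrow> ('d, 'e::finite, 'm::finite, 'f::finite) flow_disc \<Rightarrow>
     ('d, 's::finite) mech_disc \<Rightarrow> (phase \<Rightarrow> (real^'m) \<times> (real^'f)) \<Rightarrow>
     (real^'d \<Rightarrow> real^'d) \<Rightarrow> (real^'d)^'s \<Rightarrow> bool" where
  "initial_state G D P Q p u lam \<longleftrightarrow>
     (\<forall>\<alpha>. p \<alpha> = (intm P (pbarm D \<alpha>), intf P (pbarf D \<alpha>))) \<and>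
     u \<in> dispV Q \<and> lam \<in> dual_cone G D Q (mul_n G Q lam) \<and>
     (\<forall>v\<in>dispV Q. mech_lhs G D P Q p u lam v = mech_rhs G D v) \<and>
     (\<forall>\<mu>\<in>dual_cone G D Q (mul_n G Q lam).
        (LINT x|surf G. (pwc (face Q) (mul_n G Q \<mu>) x - pwc (face Q) (mul_n G Q lam) x) * jmp_n G u x)
        + (LINT x|surf G. (pwc (face Q) (mul_t G Q \<mu>) x - pwc (face Q) (mul_t G Q lam) x) \<bullet> jmp_t G u x)
        \<le> 0)"

definition scheme_solution ::
    "('d::finite) geometry \<Rightarrow> 'd model \<Rightarrow> ('d, 'e::finite, 'm::finite, 'f::finite) flow_disc \<Rightarrow>
     ('d, 's::finite) mech_disc \<Rightarrow> real \<Rightarrow> nat \<Rightarrow> (nat \<Rightarrow> real) \<Rightarrow>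
     (phase \<Rightarrow> nat \<Rightarrow> (real^'m) \<times> (real^'f)) \<Rightarrow> (nat \<Rightarrow> real^'d \<Rightarrow> real^'d) \<Rightarrow>
     (nat \<Rightarrow> (real^'d)^'s) \<Rightarrow> bool" where
  "scheme_solution G D P Q T N t p u lam \<longleftrightarrow>
     (\<forall>k\<le>N. u k \<in> dispV Q \<and> lam k \<in> dual_cone G D Q (mul_n G Q (lam k))) \<and>
     initial_state G D P Q (\<lambda>\<alpha>. p \<alpha> 0) (u 0) (lam 0) \<and>
     (\<forall>\<alpha> \<phi>. flow_eq G D P Q T t p u \<alpha> \<phi>) \<and>
     (\<forall>v. (\<forall>k\<le>N. v k \<in> dispV Q) \<longrightarrow>
        (LINT s|lebesgue_on {0<..<T}.
           at_time t (\<lambda>k. mech_lhs G D P Q (\<lambda>\<alpha>. p \<alpha> k) (u k) (lam k) (v k)) s)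
        = (LINT s|lebesgue_on {0<..<T}. at_time t (\<lambda>k. mech_rhs G D (v k)) s)) \<and>
     (\<forall>\<mu>. (\<forall>k\<in>{1..N}. \<mu> k \<in> dual_cone G D Q (mul_n G Q (lam k))) \<longrightarrow>
        (LINT s|lebesgue_on {0<..<T}. LINT x|surf G.
           at_time t (\<lambda>k. (pwc (face Q) (mul_n G Q (\<mu> k)) x - pwc (face Q) (mul_n G Q (lam k)) x)
             * jmp_n G (u k) x) s)
        + (LINT s|lebesgue_on {0<..<T}. LINT x|surf G.
           at_time t (\<lambda>k. pwc (face Q) (mul_t G Q (\<mu> k)) x - pwc (face Q) (mul_t G Q (lam k)) x) s
             \<bullet> dtime t (\<lambda>k. jmp_t G (u k) x) s)
        \<le> 0)"

end

theory Submission
  imports Defs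
begin

text \<open>
  A solution of one time step is a zero of a continuous map between Euclidean spaces, so
  Brouwer's fixed point theorem produces it as soon as a priori bounds are available; the time
  steps are then chained.

  The displacement is eliminated first. The elastic form controls the symmetric gradient because
  $-1 < \nu < 1/2$ and $d \le 3$ (\<open>stress_coercive\<close>), and by Korn's inequality the fields of zero
  elastic energy are invisible to the loads, the divergence and the jumps
  (\<open>null_functionals\<close>). Hence the mechanical equation determines, up to such fields, a displacement
  that depends continuously on the pressures and on the multipliers (\<open>parametric_riesz\<close>). What
  is left is a fixed point problem for the pressures and the multipliers
  (\<open>flow_contact_fixed_point\<close>): the contact conditions say that the normal multiplier is the
  projection onto $[0,\infty)$ of itself plus the normal jump, and the tangential multiplier the
  projection, onto the ball whose radius is the friction bound, of itself plus the slip
  increment; the flow equations say that the pressures are not moved by the residual. Truncating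
  the pressures at a radius $R_1$ and the normal multipliers at $R_2$ makes Brouwer's theorem
  applicable, and two estimates show that the truncations have no effect.

  The first estimate bounds the multipliers (\<open>flow_contact_existence\<close>). Contact and friction only
  dissipate energy, which bounds the elastic effect of the multipliers in terms of $R_1$, and the
  inf-sup condition turns this into a bound of the multipliers themselves. So
  $R_2$ can be chosen out of reach, the discrete contact conditions hold exactly, the sides of the
  fractures do not interpenetrate, and the aperture is at least its contact value \<open>d0\<close>.

  The second estimate bounds the pressures independently of $R_1$ (\<open>step_energy\<close>). The flow
  equations are tested with the pressures and the mechanical equation with the increment of the
  displacement, so that the work of the equivalent pressures cancels. In the matrix this uses
  the partial linearization: testing the accumulation term yields the equivalent pressure without
  capillary energy times the porosity increment, plus $\phi^0_m\, p_c\, (S(p_c) - S(p_c^k))$, which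
  is bounded below since \<open>S\<close> is monotone and $\phi^0_m \ge 0$; the damaged rock behaves likewise. In
  the fracture, where the aperture varies, the capillary energy \<open>U\<close> enters the equivalent
  pressure, and $U(p) - U(q) \le p\,(S(p) - S(q))$ and $U \ge 0$ give the same conclusion
  (\<open>capillary_energy_properties\<close>). The Darcy and interface dissipation then controls the square
  of the flow norm, against source terms that are linear in the pressures (\<open>step_exists\<close>).

  The initial state is an instance of the same contact problem in which the flow residual is
  replaced by the deviation from the initial pressures (\<open>initial_state_exists\<close>).
\<close>

section \<open>The capillary energy of a monotone Lipschitz saturation\<close>

text \<open>
  For a continuous function, differentiability at a point is a Cauchy condition on the difference
  quotients with small rational increments. The set of points of differentiability is therefore a
  countable combination of closed sets, and on it the derivative is a limit of continuous functions.
\<close>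

lemma borel_measurable_deriv_continuous:
  fixes f :: "real \<Rightarrow> real"
  assumes f: "continuous_on UNIV f"
  shows "deriv f \<in> borel_measurable borel"
proof -
  define q where "q x h = (f (x + h) - f x) / h" for x h
  define A where "A n m h k = {x. \<bar>q x h - q x k\<bar> \<le> 1 / real (Suc n)}" for n m :: nat and h k
  define I where "I m = {h::real. h \<in> \<rat> \<and> h \<noteq> 0 \<and> \<bar>h\<bar> < 1 / real (Suc m)}" for m :: nat
  define E where "E = (\<Inter>n. \<Union>m. \<Inter>h\<in>I m. \<Inter>k\<in>I m. A n m h k)"
  have fm [measurable]: "f \<in> borel_measurable borel"
    using f by (rule borel_measurable_continuous_onI)
  have A: "A n m h k \<in> sets borel" for n m h k
    unfolding A_def q_def by measurable
  have cI: "countable (I m)" for m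
    unfolding I_def by (rule countable_subset[of _ "\<rat>"]) (auto simp: countable_rat)
  have iI: "(\<Inter>h\<in>I m. B h) \<in> sets borel" if "\<And>h. B h \<in> sets borel" for B :: "real \<Rightarrow> real set" and m
    by (rule sets.countable_INT'') (use cI that in auto)
  have E [measurable]: "E \<in> sets borel"
    unfolding E_def by (intro sets.countable_INT'' sets.countable_UN'' iI A) auto
  have qc: "continuous_on (- {0}) (q x)" for x
    unfolding q_def by (intro continuous_intros continuous_on_compose2[OF f]) auto
  have diffE: "x \<in> E \<longleftrightarrow> (\<exists>d. DERIV f x :> d)" for x
  proof
    assume "\<exists>d. DERIV f x :> d"
    then obtain d where d: "(q x \<longlongrightarrow> d) (at 0)"
      unfolding DERIV_def q_def by auto
    show "x \<in> E"
      unfolding E_def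
    proof safe
      fix n :: nat
      have "0 < 1 / real (Suc n) / 2" by simp
      then obtain s where s: "s > 0" "\<And>h. h \<noteq> 0 \<Longrightarrow> \<bar>h\<bar> < s \<Longrightarrow> dist (q x h) d < 1 / real (Suc n) / 2"
        using d unfolding Lim_at by (metis dist_0_norm dist_commute real_norm_def zero_less_abs_iff)
      obtain m where m: "1 / real (Suc m) < s"
        using s(1) nat_approx_posE by blast
      have "x \<in> A n m h k" if "h \<in> I m" "k \<in> I m" for h k
      proof -
        have "dist (q x h) d < 1 / real (Suc n) / 2" "dist (q x k) d < 1 / real (Suc n) / 2"
          using s(2)[of h] s(2)[of k] that m unfolding I_def by auto
        then have "dist (q x h) (q x k) < 1 / real (Suc n)"
          by (rule dist_triangle_half_l)
        then show ?thesis unfolding A_def dist_real_def by simp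
      qed
      then show "x \<in> (\<Union>m. \<Inter>h\<in>I m. \<Inter>k\<in>I m. A n m h k)" by blast
    qed
  next
    assume x: "x \<in> E"
    have cau: "\<exists>s>0. \<forall>h k. h \<noteq> 0 \<longrightarrow> \<bar>h\<bar> < s \<longrightarrow> k \<noteq> 0 \<longrightarrow> \<bar>k\<bar> < s \<longrightarrow> \<bar>q x h - q x k\<bar> \<le> 1 / real (Suc n)" for n
    proof -
      obtain m where m: "\<And>h k. h \<in> I m \<Longrightarrow> k \<in> I m \<Longrightarrow> \<bar>q x h - q x k\<bar> \<le> 1 / real (Suc n)"
      proof -
        have "x \<in> (\<Union>m. \<Inter>h\<in>I m. \<Inter>k\<in>I m. A n m h k)" using x unfolding E_def by blast
        then obtain m where "x \<in> (\<Inter>h\<in>I m. \<Inter>k\<in>I m. A n m h k)" by blast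
        then have "x \<in> A n m h k" if "h \<in> I m" "k \<in> I m" for h k using that by blast
        then show thesis by (rule_tac that[of m]) (simp add: A_def)
      qed
      \<comment> \<open>The condition passes from rational increments to real ones by continuity.\<close>
      have *: "\<exists>r. (\<forall>i. r i \<in> I m) \<and> r \<longlonglongrightarrow> h" if h: "h \<noteq> 0" "\<bar>h\<bar> < 1 / real (Suc m)" for h
      proof -
        define lo where "lo = (if h > 0 then 0 else - (1 / real (Suc m)))"
        define hi where "hi = (if h > 0 then 1 / real (Suc m) else 0)"
        have "\<exists>r\<in>\<rat>. h < r \<and> r < min hi (h + 1 / real (Suc i))" for i :: nat
          using Rats_dense_in_real[of h "min hi (h + 1 / real (Suc i))"] h unfolding hi_def
          by (auto simp: abs_if split: if_splits)
        then obtain r where r: "\<And>i::nat. r i \<in> \<rat> \<and> h < r i \<and> r i < min hi (h + 1 / real (Suc i))" by metis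
        have "r i \<in> I m" for i
          using r[of i] h unfolding I_def hi_def by (auto simp: abs_if split: if_splits)
        moreover have "r \<longlonglongrightarrow> h"
        proof (rule tendsto_sandwich[of "\<lambda>i. h" r sequentially "\<lambda>i. h + 1 / real (Suc i)"])
          show "(\<lambda>i. h + 1 / real (Suc i)) \<longlonglongrightarrow> h"
            using tendsto_add[OF tendsto_const[of h] LIMSEQ_Suc[OF lim_1_over_n]] by simp
        qed (use r in \<open>auto intro!: always_eventually less_imp_le\<close>)
        ultimately show ?thesis by blast
      qed
      have "\<bar>q x h - q x k\<bar> \<le> 1 / real (Suc n)"
        if hk: "h \<noteq> 0" "\<bar>h\<bar> < 1 / real (Suc m)" "k \<noteq> 0" "\<bar>k\<bar> < 1 / real (Suc m)" for h k
      proof -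
        obtain r where r: "\<And>i::nat. r i \<in> I m" "r \<longlonglongrightarrow> h" using *[OF hk(1,2)] by blast
        obtain t where t: "\<And>i::nat. t i \<in> I m" "t \<longlonglongrightarrow> k" using *[OF hk(3,4)] by blast
        have "(\<lambda>i. q x (r i)) \<longlonglongrightarrow> q x h"
          by (rule continuous_on_tendsto_compose[OF qc r(2)]) (use hk r(1) in \<open>auto simp: I_def\<close>)
        moreover have "(\<lambda>i. q x (t i)) \<longlonglongrightarrow> q x k"
          by (rule continuous_on_tendsto_compose[OF qc t(2)]) (use hk t(1) in \<open>auto simp: I_def\<close>)
        ultimately have "(\<lambda>i. \<bar>q x (r i) - q x (t i)\<bar>) \<longlonglongrightarrow> \<bar>q x h - q x k\<bar>"
          by (intro tendsto_intros)
        then show ?thesis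
          by (rule LIMSEQ_le_const2) (use m r t in blast)
      qed
      then show ?thesis by (intro exI[of _ "1 / real (Suc m)"]) auto
    qed
    have r0: "(\<lambda>i. 1 / real (Suc i)) \<longlonglongrightarrow> 0" by (rule LIMSEQ_Suc[OF lim_1_over_n])
    have small: "\<forall>\<^sub>F i in sequentially. 1 / real (Suc i) \<noteq> 0 \<and> \<bar>1 / real (Suc i)\<bar> < s" if "s > 0" for s
      using order_tendstoD(2)[OF r0 that] by eventually_elim simp
    have "Cauchy (\<lambda>i. q x (1 / real (Suc i)))"
    proof (rule metric_CauchyI)
      fix e :: real assume "e > 0"
      then obtain n where n: "1 / real (Suc n) < e" using nat_approx_posE by blast
      obtain s where s: "s > 0" "\<And>h k. h \<noteq> 0 \<Longrightarrow> \<bar>h\<bar> < s \<Longrightarrow> k \<noteq> 0 \<Longrightarrow> \<bar>k\<bar> < s \<Longrightarrow> \<bar>q x h - q x k\<bar> \<le> 1 / real (Suc n)"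
        using cau[of n] by blast
      obtain M where M: "\<And>i. i \<ge> M \<Longrightarrow> 1 / real (Suc i) \<noteq> 0 \<and> \<bar>1 / real (Suc i)\<bar> < s"
        using small[OF s(1)] unfolding eventually_sequentially by blast
      have "dist (q x (1 / real (Suc i))) (q x (1 / real (Suc j))) < e" if "i \<ge> M" "j \<ge> M" for i j
        using s(2)[of "1 / real (Suc i)" "1 / real (Suc j)"] M[OF that(1)] M[OF that(2)] n
        unfolding dist_real_def by linarith
      then show "\<exists>M. \<forall>m\<ge>M. \<forall>n\<ge>M. dist (q x (1 / real (Suc m))) (q x (1 / real (Suc n))) < e" by blast
    qed
    then obtain d where d: "(\<lambda>i. q x (1 / real (Suc i))) \<longlonglongrightarrow> d"
      using real_Cauchy_convergent convergent_def by blast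
    have "(q x \<longlongrightarrow> d) (at 0)"
      unfolding LIM_def
    proof (intro allI impI)
      fix e :: real assume "e > 0"
      then obtain n where n: "1 / real (Suc n) < e" using nat_approx_posE by blast
      obtain s where s: "s > 0" "\<And>h k. h \<noteq> 0 \<Longrightarrow> \<bar>h\<bar> < s \<Longrightarrow> k \<noteq> 0 \<Longrightarrow> \<bar>k\<bar> < s \<Longrightarrow> \<bar>q x h - q x k\<bar> \<le> 1 / real (Suc n)"
        using cau[of n] by blast
      have "dist (q x h) d < e" if h: "h \<noteq> 0 \<and> dist h 0 < s" for h
      proof -
        have "\<bar>q x h - d\<bar> \<le> 1 / real (Suc n)"
        proof (rule tendsto_upperbound)
          show "((\<lambda>i. \<bar>q x h - q x (1 / real (Suc i))\<bar>) \<longlongrightarrow> \<bar>q x h - d\<bar>) sequentially"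
            by (intro tendsto_intros d)
          show "\<forall>\<^sub>F i in sequentially. \<bar>q x h - q x (1 / real (Suc i))\<bar> \<le> 1 / real (Suc n)"
            using small[OF s(1)] by eventually_elim (use s(2) h in \<open>simp add: dist_real_def\<close>)
        qed simp
        then show ?thesis using n unfolding dist_real_def by linarith
      qed
      then show "\<exists>s>0. \<forall>h. h \<noteq> 0 \<and> dist h 0 < s \<longrightarrow> dist (q x h) d < e" using s(1) by blast
    qed
    then have "\<exists>d. (q x \<longlongrightarrow> d) (at 0)" by blast
    then show "\<exists>d. DERIV f x :> d"
      unfolding DERIV_def q_def .
  qed
  define g where "g x = lim (\<lambda>n. q x (1 / real (Suc n)))" for x
  have [measurable]: "g \<in> borel_measurable borel"
    unfolding g_def q_def by measurable
  \<comment> \<open>Where no derivative exists, \<open>deriv\<close> is a choice from the empty predicate, which is one fixed value.\<close>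
  have "deriv f = (\<lambda>x. if x \<in> E then g x else (SOME d. False))"
  proof
    fix x show "deriv f x = (if x \<in> E then g x else (SOME d. False))"
    proof (cases "x \<in> E")
      case True
      then obtain d where d: "DERIV f x :> d" using diffE by blast
      then have "(q x \<longlongrightarrow> d) (at 0)" unfolding DERIV_def q_def .
      moreover have "(\<lambda>n. 1 / real (Suc n)) \<longlonglongrightarrow> 0" by (rule LIMSEQ_Suc[OF lim_1_over_n])
      then have "filterlim (\<lambda>n. 1 / real (Suc n)) (at 0) sequentially"
        by (simp add: filterlim_at del: of_nat_Suc)
      ultimately have "(\<lambda>n. q x (1 / real (Suc n))) \<longlonglongrightarrow> d"
        by (rule filterlim_compose)
      then have "g x = d" unfolding g_def by (rule limI)
      then show ?thesis using True d DERIV_imp_deriv by auto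
    next
      case False
      then show ?thesis using diffE unfolding deriv_def by auto
    qed
  qed
  then show ?thesis by simp
qed

text \<open>
  With a Lipschitz constant \<open>l\<close> of \<open>S\<close>, both $S(x)/l$ and $x - S(x)/l$ are non-decreasing, and they add
  up to the identity. Their Stieltjes measures thus add up to Lebesgue measure, so that the first
  one is absolutely continuous, and the Radon--Nikodym theorem gives the density.
\<close>

lemma lipschitz_mono_density:
  fixes S :: "real \<Rightarrow> real"
  assumes mono: "mono S" and lip: "L-lipschitz_on UNIV S"
  obtains h where "h \<in> borel_measurable borel" "\<And>x. 0 \<le> h x"
    "\<And>a b. a \<le> b \<Longrightarrow> has_bochner_integral lborel (\<lambda>x. indicator {a..b} x * h x) (S b - S a)"
proof -
  define l where "l = max L 1"
  have l: "l > 0" "l \<ge> L" unfolding l_def by auto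
  define F where "F x = x - S x / l" for x
  define H where "H x = S x / l" for x
  have Sle: "S y - S x \<le> l * (y - x)" if "x \<le> y" for x y
  proof -
    have "\<bar>S y - S x\<bar> \<le> L * \<bar>y - x\<bar>"
      using lipschitz_onD[OF lip, of y x] by (simp add: dist_real_def)
    also have "\<dots> \<le> l * (y - x)" using that l by (auto intro: mult_right_mono)
    finally show ?thesis by linarith
  qed
  have monoH: "H x \<le> H y" if "x \<le> y" for x y
    using monoD[OF mono that] l unfolding H_def by (simp add: divide_right_mono)
  have monoF: "F x \<le> F y" if "x \<le> y" for x y
    proof -
    have "(S y - S x) / l \<le> y - x" using Sle[OF that] l by (simp add: divide_le_eq mult.commute)
    then show ?thesis unfolding F_def by (simp add: diff_divide_distrib)
  qed
  have cS: "continuous_on UNIV S" using lip by (rule lipschitz_on_continuous_on)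
  have cH: "continuous_on UNIV H" unfolding H_def using l by (intro continuous_intros cS) auto
  have cF: "continuous_on UNIV F" unfolding F_def using l by (intro continuous_intros cS) auto
  define m1 where "m1 = interval_measure H"
  define m2 where "m2 = interval_measure F"
  have sets12 [simp]: "sets m1 = sets borel" "sets m2 = sets borel" by (simp_all add: m1_def m2_def)
  have Icc1: "emeasure m1 {a..b} = ennreal (H b - H a)" if "a \<le> b" for a b
    unfolding m1_def by (rule emeasure_interval_measure_Icc[OF that monoH cH])
  have Icc2: "emeasure m2 {a..b} = ennreal (F b - F a)" if "a \<le> b" for a b
    unfolding m2_def by (rule emeasure_interval_measure_Icc[OF that monoF cF])
  have Ioo: "emeasure m {a<..<b} = ennreal (K b - K a)"
    if ab: "a \<le> b" and m: "sets m = sets borel" and K: "\<And>x y. x \<le> y \<Longrightarrow> emeasure m {x..y} = ennreal (K y - K x)"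
    for m :: "real measure" and K :: "real \<Rightarrow> real" and a b
  proof (cases "a = b")
    case False
    have "emeasure m ({a..b} - {a, b}) = emeasure m {a..b} - emeasure m {a, b}"
    proof (rule emeasure_Diff)
      have "emeasure m {a, b} \<le> emeasure m {a..b}"
        using ab m by (intro emeasure_mono) auto
      then show "emeasure m {a, b} \<noteq> \<infinity>" using K[OF ab] by (metis ennreal_neq_top infinity_ennreal_def neq_top_trans)
    qed (use m ab in auto)
    moreover have "emeasure m {a, b} = 0"
    proof -
      have "emeasure m {a, b} \<le> emeasure m {a} + emeasure m {b}"
        using emeasure_subadditive[of "{a}" m "{b}"] m by (simp add: insert_commute)
      also have "\<dots> = 0" using K[of a a] K[of b b] by simp
      finally show ?thesis by simp
    qed
    moreover have "{a..b} - {a, b} = {a<..<b}" using ab by auto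
    ultimately show ?thesis using K[OF ab] by simp
  qed simp
  define M where "M = measure_of UNIV (sets borel) (\<lambda>A. emeasure m1 A + emeasure m2 A)"
  have setsM: "sets M = sets borel"
    unfolding M_def by (metis sets.sigma_sets_eq sets_measure_of space_borel subset_UNIV Pow_UNIV)
  have emM: "emeasure M A = emeasure m1 A + emeasure m2 A" if "A \<in> sets borel" for A
  proof (rule emeasure_measure_of[OF M_def])
    show "positive (sets M) (\<lambda>A. emeasure m1 A + emeasure m2 A)" by (simp add: positive_def)
    show "countably_additive (sets M) (\<lambda>A. emeasure m1 A + emeasure m2 A)"
    proof (rule countably_additiveI)
      fix A :: "nat \<Rightarrow> real set"
      assume A: "range A \<subseteq> sets M" "disjoint_family A"
      have "(\<Sum>i. emeasure m1 (A i) + emeasure m2 (A i)) = (\<Sum>i. emeasure m1 (A i)) + (\<Sum>i. emeasure m2 (A i))"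
        by (rule suminf_add[symmetric]) auto
      also have "\<dots> = emeasure m1 (\<Union>i. A i) + emeasure m2 (\<Union>i. A i)"
        using A by (simp add: suminf_emeasure setsM)
      finally show "(\<Sum>i. emeasure m1 (A i) + emeasure m2 (A i)) = emeasure m1 (\<Union> (range A)) + emeasure m2 (\<Union> (range A))" .
    qed
  qed (use that setsM in auto)
  have "lborel = M"
  proof (rule lborel_eqI)
    fix a b :: real assume "\<And>i. i \<in> Basis \<Longrightarrow> a \<bullet> i \<le> b \<bullet> i"
    then have ab: "a \<le> b" by simp
    have "emeasure M (box a b) = ennreal (H b - H a) + ennreal (F b - F a)"
      using emM[of "{a<..<b}"] Ioo[OF ab sets12(1) Icc1] Ioo[OF ab sets12(2) Icc2] by simp
    also have "\<dots> = ennreal ((H b - H a) + (F b - F a))"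
      by (rule ennreal_plus[symmetric]) (use monoH[OF ab] monoF[OF ab] in auto)
    also have "(H b - H a) + (F b - F a) = b - a" unfolding H_def F_def by simp
    finally show "emeasure M (box a b) = ennreal (\<Prod>i\<in>Basis. (b - a) \<bullet> i)" by simp
  qed (simp add: setsM)
  then have "absolutely_continuous lborel m1"
    unfolding absolutely_continuous_def null_sets_def using emM setsM by auto
  then obtain d where d [measurable]: "d \<in> borel_measurable lborel" and dm: "density lborel d = m1"
    using sigma_finite_measure.Radon_Nikodym[OF sigma_finite_lborel, of m1] by auto
  have nd: "(\<integral>\<^sup>+x. d x * indicator {a..b} x \<partial>lborel) = ennreal (H b - H a)" if "a \<le> b" for a b
    using Icc1[OF that] unfolding dm[symmetric] by (simp add: emeasure_density)
  have "AE x in lborel. \<forall>n::nat. d x * indicator {- real n..real n} x \<noteq> \<infinity>"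
    unfolding AE_all_countable
    by (intro allI nn_integral_PInf_AE) (auto simp: nd)
  then have fin: "AE x in lborel. d x \<noteq> \<infinity>"
  proof eventually_elim
    case (elim x)
    obtain n :: nat where "\<bar>x\<bar> \<le> real n" using real_arch_simple by blast
    with elim[rule_format, of n] show ?case by (auto simp: indicator_def abs_le_iff)
  qed
  define h where "h x = l * enn2real (d x)" for x
  show ?thesis
  proof
    show "h \<in> borel_measurable borel" using d unfolding h_def by measurable
    show "0 \<le> h x" for x using l unfolding h_def by simp
    fix a b :: real assume ab: "a \<le> b"
    show "has_bochner_integral lborel (\<lambda>x. indicator {a..b} x * h x) (S b - S a)"
    proof (rule has_bochner_integral_nn_integral)
      show "(\<lambda>x. indicator {a..b} x * h x) \<in> borel_measurable lborel" unfolding h_def by measurable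
      have "(\<integral>\<^sup>+x. ennreal (indicator {a..b} x * h x) \<partial>lborel) = (\<integral>\<^sup>+x. ennreal l * (d x * indicator {a..b} x) \<partial>lborel)"
        by (rule nn_integral_cong_AE, use fin in eventually_elim)
           (use l in \<open>auto simp: h_def ennreal_mult'' indicator_def ennreal_enn2real less_top ennreal_mult\<close>)
      also have "\<dots> = ennreal l * ennreal (H b - H a)" by (simp add: nn_integral_cmult nd[OF ab])
      also have "\<dots> = ennreal (S b - S a)"
        using l monoH[OF ab] by (subst ennreal_mult[symmetric]) (auto simp: H_def field_simps)
      finally show "(\<integral>\<^sup>+x. ennreal (indicator {a..b} x * h x) \<partial>lborel) = ennreal (S b - S a)" .
    qed (use monoD[OF mono ab] l in \<open>auto simp: h_def\<close>)
  qed
qed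

lemma AE_lborel_not_negligible:
  assumes "negligible N"
  shows "AE x in lborel. x \<notin> N"
proof -
  have "AE x in lebesgue. x \<notin> N"
    using assms unfolding negligible_iff_null_sets by (rule AE_not_in)
  then show ?thesis by (simp add: AE_completion_iff)
qed

text \<open>
  At a Lebesgue point of the density the difference quotients, being averages of the density,
  converge to its value. The averages over intervals to the left of a point are those
  of the reflected density to the right of the reflected point.
\<close>

lemma lipschitz_mono_AE_deriv:
  fixes S :: "real \<Rightarrow> real"
  assumes h: "\<And>a b. a \<le> b \<Longrightarrow> has_bochner_integral lborel (\<lambda>x. indicator {a..b} x * h x) (S b - S a)"
  shows "AE x in lborel. (S has_real_derivative h x) (at x)"
proof -
  have hi: "(h has_integral (S b - S a)) {a..b}" if "a \<le> b" for a b
  proof -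
    have s: "set_integrable lborel {a..b} h"
      using h[OF that] unfolding set_integrable_def by (auto simp: has_bochner_integral_iff)
    have "(LINT x:{a..b}|lborel. h x) = S b - S a"
      using h[OF that] unfolding set_lebesgue_integral_def by (auto simp: has_bochner_integral_iff)
    then show ?thesis
      using set_borel_integral_eq_integral[OF s] by (metis integrable_integral)
  qed
  have hi': "((\<lambda>x. h (- x)) has_integral (S (- a) - S (- b))) {a..b}" if "a \<le> b" for a b
    using hi[of "- b" "- a"] that has_integral_reflect_real[of h "S (- a) - S (- b)" "- a" "- b"] by simp
  have int1: "h integrable_on cbox a b" for a b
    using hi[of a b] by (cases "a \<le> b") (auto simp: integrable_on_def)
  have int2: "(\<lambda>x. h (- x)) integrable_on cbox a b" for a b
    using hi'[of a b] by (cases "a \<le> b") (auto simp: integrable_on_def)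
  obtain N1 where N1: "negligible N1" and L1: "\<And>x e. \<lbrakk>x \<notin> N1; 0 < e\<rbrakk> \<Longrightarrow>
      \<exists>d>0. \<forall>k. 0 < k \<and> k < d \<longrightarrow> norm (integral (cbox x (x + k *\<^sub>R One)) h /\<^sub>R k ^ DIM(real) - h x) < e"
    using integrable_ccontinuous_explicit[of h, OF int1] by metis
  obtain N2 where N2: "negligible N2" and L2: "\<And>x e. \<lbrakk>x \<notin> N2; 0 < e\<rbrakk> \<Longrightarrow>
      \<exists>d>0. \<forall>k. 0 < k \<and> k < d \<longrightarrow> norm (integral (cbox x (x + k *\<^sub>R One)) (\<lambda>x. h (- x)) /\<^sub>R k ^ DIM(real) - h (- x)) < e"
    using integrable_ccontinuous_explicit[of "\<lambda>x. h (- x)", OF int2] by metis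
  have "negligible (uminus ` N2)"
    by (rule negligible_differentiable_image_negligible[OF _ N2]) (auto intro: derivative_intros simp: differentiable_on_def)
  from AE_lborel_not_negligible[OF this] AE_lborel_not_negligible[OF N1]
  show ?thesis
  proof eventually_elim
    case (elim x)
    then have x1: "x \<notin> N1" and x2: "- x \<notin> N2" by (auto simp: image_iff)
    show ?case
      unfolding DERIV_def LIM_def
    proof (intro allI impI)
      fix e :: real assume e: "e > 0"
      obtain d1 where d1: "d1 > 0" "\<And>k. 0 < k \<Longrightarrow> k < d1 \<Longrightarrow> norm (integral (cbox x (x + k *\<^sub>R One)) h /\<^sub>R k ^ DIM(real) - h x) < e"
        using L1[OF x1 e] by blast
      obtain d2 where d2: "d2 > 0" "\<And>k. 0 < k \<Longrightarrow> k < d2 \<Longrightarrow> norm (integral (cbox (- x) (- x + k *\<^sub>R One)) (\<lambda>x. h (- x)) /\<^sub>R k ^ DIM(real) - h (- (- x))) < e"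
        using L2[OF x2 e] by blast
      have "dist ((S (x + k) - S x) / k) (h x) < e" if k: "k \<noteq> 0" "abs k < min d1 d2" for k
      proof (cases "k > 0")
        case True
        then have "integral (cbox x (x + k)) h = S (x + k) - S x"
          using hi[of x "x + k"] by (simp add: integral_unique)
        then show ?thesis using d1(2)[of k] True k by (simp add: dist_real_def divide_inverse_commute)
      next
        case False
        then have k': "k < 0" using k by simp
        then have "integral (cbox (- x) (- x - k)) (\<lambda>x. h (- x)) = S x - S (x + k)"
          using hi'[of "- x" "- x - k"] by (simp add: integral_unique add.commute)
        moreover have "(S x - S (x + k)) / (- k) = (S (x + k) - S x) / k"
          by (metis minus_diff_eq minus_divide_divide)
        ultimately show ?thesis using d2(2)[of "- k"] k' k by (simp add: dist_real_def divide_inverse_commute)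
      qed
      then show "\<exists>d>0. \<forall>xa. xa \<noteq> 0 \<and> dist xa 0 < d \<longrightarrow> dist ((S (x + xa) - S x) / xa) (h x) < e"
        using d1(1) d2(1) by (intro exI[of _ "min d1 d2"]) auto
    qed
  qed
qed

text \<open>
  The increment $U(p) - U(q)$ is the integral of $x\,h(x)$ from \<open>q\<close> to \<open>p\<close>, where \<open>h\<close> is the density
  of \<open>S\<close>. Replacing the factor \<open>x\<close> by its extreme values shows that the increment lies between
  $q\,(S(p) - S(q))$ and $p\,(S(p) - S(q))$, which gives all three claims.
\<close>

lemma capillary_energy_properties:
  fixes S :: "real \<Rightarrow> real" and U :: "real \<Rightarrow> real"
  assumes mono: "mono S" and lip: "L-lipschitz_on UNIV S"
  defines "U \<equiv> \<lambda>p. (LBINT q=ereal 0..ereal p. q * deriv S q)"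
  shows "U p - U q \<le> p * (S p - S q)" and "0 \<le> U p" and "continuous_on UNIV U"
proof -
  obtain h where hm [measurable]: "h \<in> borel_measurable borel" and h0: "\<And>x. 0 \<le> h x"
    and h: "\<And>a b. a \<le> b \<Longrightarrow> has_bochner_integral lborel (\<lambda>x. indicator {a..b} x * h x) (S b - S a)"
    using lipschitz_mono_density[OF mono lip] by metis
  have cS: "continuous_on UNIV S" using lip by (rule lipschitz_on_continuous_on)
  have [measurable]: "deriv S \<in> borel_measurable borel" by (rule borel_measurable_deriv_continuous[OF cS])
  have ae: "AE x in lborel. deriv S x = h x"
  proof -
    have "AE x in lborel. (S has_real_derivative h x) (at x)"
      by (rule lipschitz_mono_AE_deriv) (rule h)
    then show ?thesis by eventually_elim (rule DERIV_imp_deriv)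
  qed
  have U: "U p = (LBINT q=ereal 0..ereal p. q * h q)" for p
    unfolding U_def by (rule interval_integral_cong_AE) (use ae in auto)
  have int: "set_integrable lborel {a..b} (\<lambda>x. x * h x)" for a b
  proof (cases "a \<le> b")
    case True
    define c where "c = max \<bar>a\<bar> \<bar>b\<bar>"
    have "integrable lborel (\<lambda>x. c * (indicator {a..b} x * h x))"
      using h[OF True] by (auto simp: has_bochner_integral_iff)
    then show ?thesis unfolding set_integrable_def
    proof (rule Bochner_Integration.integrable_bound)
      show "AE x in lborel. norm (indicator {a..b} x *\<^sub>R (x * h x)) \<le> norm (c * (indicator {a..b} x * h x))"
        by (intro AE_I2) (use h0 in \<open>auto simp: indicator_def abs_mult c_def intro!: mult_right_mono\<close>)
    qed measurable
  qed (simp add: set_integrable_def)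
  have inti: "interval_lebesgue_integrable lborel (ereal a) (ereal b) (\<lambda>x. x * h x)" for a b
    unfolding interval_lebesgue_integrable_def einterval_eq
    using set_integrable_subset[OF int[of a b], of "{a<..<b}"] set_integrable_subset[OF int[of b a], of "{b<..<a}"]
    by (auto simp: less_imp_le subset_iff)
  have add: "U q + (LBINT x=ereal q..ereal p. x * h x) = U p" for p q
    unfolding U by (rule interval_integral_sum) (auto simp: min_def max_def inti)
  have bnd: "a * (S b - S a) \<le> U b - U a \<and> U b - U a \<le> b * (S b - S a)" if ab: "a \<le> b" for a b
  proof -
    have "U b - U a = (LBINT x:{a..b}. x * h x)"
      using add[of a b] ab by (simp add: interval_integral_Icc)
    moreover have "(LBINT x:{a..b}. c * h x) = c * (S b - S a)" "set_integrable lborel {a..b} (\<lambda>x. c * h x)" for c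
      using has_bochner_integral_mult_right[OF h[OF ab], of c]
      unfolding set_lebesgue_integral_def set_integrable_def
      by (auto simp: has_bochner_integral_iff mult.left_commute)
    moreover have "(LBINT x:{a..b}. a * h x) \<le> (LBINT x:{a..b}. x * h x)"
      using calculation(3) int by (rule set_integral_mono) (auto intro!: mult_right_mono h0)
    moreover have "(LBINT x:{a..b}. x * h x) \<le> (LBINT x:{a..b}. b * h x)"
      using int calculation(3) by (rule set_integral_mono) (auto intro!: mult_right_mono h0)
    ultimately show ?thesis by metis
  qed
  have 1: "U p - U q \<le> p * (S p - S q)" for p q
  proof (cases "q \<le> p")
    case True then show ?thesis using bnd by blast
  next
    case False
    then have "p * (S q - S p) \<le> U q - U p" using bnd[of p q] by simp
    then show ?thesis by (simp add: algebra_simps)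
  qed
  then show "U p - U q \<le> p * (S p - S q)" .
  have "U 0 = 0" unfolding U by simp
  then show "0 \<le> U p"
    using 1[of 0 p] by simp
  show "continuous_on UNIV U"
    unfolding continuous_on_def
  proof
    fix a :: real
    have Sa: "(S \<longlongrightarrow> S a) (at a)" using cS by (simp add: continuous_on_def)
    have "((\<lambda>p. U p - U a) \<longlongrightarrow> 0) (at a)"
    proof (rule tendsto_sandwich)
      show "\<forall>\<^sub>F p in at a. a * (S p - S a) \<le> U p - U a"
        using 1[of a] by (intro always_eventually allI) (simp add: algebra_simps)
      show "\<forall>\<^sub>F p in at a. U p - U a \<le> p * (S p - S a)" using 1 by simp
      show "((\<lambda>p. a * (S p - S a)) \<longlongrightarrow> 0) (at a)"
        using tendsto_mult[OF tendsto_const[of a] tendsto_diff[OF Sa tendsto_const[of "S a"]]] by simp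
      show "((\<lambda>p. p * (S p - S a)) \<longlongrightarrow> 0) (at a)"
        using tendsto_mult[OF tendsto_ident_at tendsto_diff[OF Sa tendsto_const[of "S a"]]] by simp
    qed
    then show "(U \<longlongrightarrow> U a) (at a)" by (simp add: LIM_zero_iff)
  qed
qed

section \<open>Square integrable functions\<close>

lemma L2_lincomb:
  assumes "L2 M f" "L2 M g"
  shows "L2 M (\<lambda>x. a *\<^sub>R f x + b *\<^sub>R g x)"
proof -
  have [measurable]: "f \<in> borel_measurable M" "g \<in> borel_measurable M"
    using assms by (auto simp: L2_def)
  have "integrable M (\<lambda>x. 2 * a\<^sup>2 * (norm (f x))\<^sup>2 + 2 * b\<^sup>2 * (norm (g x))\<^sup>2)"
    using assms by (auto simp: L2_def)
  then have "integrable M (\<lambda>x. (norm (a *\<^sub>R f x + b *\<^sub>R g x))\<^sup>2)"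
  proof (rule Bochner_Integration.integrable_bound)
    show "AE x in M. norm ((norm (a *\<^sub>R f x + b *\<^sub>R g x))\<^sup>2) \<le> norm (2 * a\<^sup>2 * (norm (f x))\<^sup>2 + 2 * b\<^sup>2 * (norm (g x))\<^sup>2)"
    proof (rule AE_I2)
      fix x
      have "norm (a *\<^sub>R f x + b *\<^sub>R g x) \<le> \<bar>a\<bar> * norm (f x) + \<bar>b\<bar> * norm (g x)"
        by (metis norm_scaleR norm_triangle_ineq)
      then have "(norm (a *\<^sub>R f x + b *\<^sub>R g x))\<^sup>2 \<le> (\<bar>a\<bar> * norm (f x) + \<bar>b\<bar> * norm (g x))\<^sup>2"
        by (rule power_mono) simp
      also have "\<dots> \<le> 2 * (\<bar>a\<bar> * norm (f x))\<^sup>2 + 2 * (\<bar>b\<bar> * norm (g x))\<^sup>2"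
        using sum_squares_ge_zero[of "\<bar>a\<bar> * norm (f x) - \<bar>b\<bar> * norm (g x)" 0]
        by (simp add: power2_eq_square algebra_simps)
      finally show "norm ((norm (a *\<^sub>R f x + b *\<^sub>R g x))\<^sup>2) \<le> norm (2 * a\<^sup>2 * (norm (f x))\<^sup>2 + 2 * b\<^sup>2 * (norm (g x))\<^sup>2)"
        by (simp add: power_mult_distrib)
    qed
  qed measurable
  then show ?thesis by (simp add: L2_def)
qed

lemma L2_inner_integrable:
  assumes "L2 M f" "L2 M g"
  shows "integrable M (\<lambda>x. f x \<bullet> g x)"
proof -
  have [measurable]: "f \<in> borel_measurable M" "g \<in> borel_measurable M"
    using assms by (auto simp: L2_def)
  have "integrable M (\<lambda>x. (norm (f x))\<^sup>2 + (norm (g x))\<^sup>2)"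
    using assms by (auto simp: L2_def)
  then show ?thesis
  proof (rule Bochner_Integration.integrable_bound)
    show "AE x in M. norm (f x \<bullet> g x) \<le> norm ((norm (f x))\<^sup>2 + (norm (g x))\<^sup>2)"
    proof (rule AE_I2)
      fix x
      have "\<bar>f x \<bullet> g x\<bar> \<le> norm (f x) * norm (g x)" by (rule Cauchy_Schwarz_ineq2)
      also have "\<dots> \<le> (norm (f x))\<^sup>2 + (norm (g x))\<^sup>2"
        using sum_squares_bound[of "norm (f x)" "norm (g x)"]
          mult_nonneg_nonneg[OF norm_ge_zero[of "f x"] norm_ge_zero[of "g x"]] by linarith
      finally show "norm (f x \<bullet> g x) \<le> norm ((norm (f x))\<^sup>2 + (norm (g x))\<^sup>2)" by simp
    qed
  qed measurable
qed

lemma (in finite_measure) L2_integrable: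
  assumes "L2 M f" shows "integrable M f"
proof -
  have [measurable]: "f \<in> borel_measurable M"
    using assms by (auto simp: L2_def)
  have "integrable M (\<lambda>x. 1 + (norm (f x))\<^sup>2)"
    using assms by (auto simp: L2_def)
  then show ?thesis
  proof (rule Bochner_Integration.integrable_bound)
    show "AE x in M. norm (f x) \<le> norm (1 + (norm (f x))\<^sup>2)"
    proof (rule AE_I2)
      fix x
      have "2 * norm (f x) \<le> 1 + (norm (f x))\<^sup>2"
        using sum_squares_bound[of 1 "norm (f x)"] by simp
      then show "norm (f x) \<le> norm (1 + (norm (f x))\<^sup>2)" using norm_ge_zero[of "f x"] zero_le_power2[of "norm (f x)"] unfolding real_norm_def by linarith
    qed
  qed measurable
qed

lemma L2_bounded_scaleR:
  assumes f: "L2 M f" and g: "Linf M (g :: 'a \<Rightarrow> real)"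
  shows "L2 M (\<lambda>x. g x *\<^sub>R f x)"
proof -
  have [measurable]: "f \<in> borel_measurable M" "g \<in> borel_measurable M"
    using assms by (auto simp: L2_def Linf_def)
  obtain C where C: "AE x in M. norm (g x) \<le> C" using g by (auto simp: Linf_def)
  have "integrable M (\<lambda>x. C\<^sup>2 * (norm (f x))\<^sup>2)" using f by (auto simp: L2_def)
  then have "integrable M (\<lambda>x. (norm (g x *\<^sub>R f x))\<^sup>2)"
  proof (rule Bochner_Integration.integrable_bound)
    show "AE x in M. norm ((norm (g x *\<^sub>R f x))\<^sup>2) \<le> norm (C\<^sup>2 * (norm (f x))\<^sup>2)"
      using C
    proof eventually_elim
      case (elim x)
      then have "(norm (g x))\<^sup>2 \<le> C\<^sup>2" by (intro power_mono) auto
      then show ?case by (simp add: power_mult_distrib mult_right_mono)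
    qed
  qed measurable
  then show ?thesis by (simp add: L2_def)
qed

lemma (in finite_measure) Linf_L2:
  assumes g: "Linf M g" shows "L2 M g"
proof -
  have [measurable]: "g \<in> borel_measurable M"
    using assms by (auto simp: Linf_def)
  obtain C where C: "AE x in M. norm (g x) \<le> C" using g by (auto simp: Linf_def)
  have "integrable M (\<lambda>x. (norm (g x))\<^sup>2)"
    by (rule integrable_const_bound[where B = "C\<^sup>2"])
      (use C in eventually_elim, auto intro!: power_mono)
  then show ?thesis by (simp add: L2_def)
qed

lemma L2norm_eq_0_AE:
  assumes "L2 M f" "L2norm M f \<le> 0"
  shows "AE x in M. f x = 0"
proof -
  have "(LINT x|M. (norm (f x))\<^sup>2) = 0"
    using assms(2) unfolding L2norm_def
    by (metis Bochner_Integration.integral_nonneg antisym real_sqrt_ge_zero real_sqrt_eq_zero_cancel_iff zero_le_power2)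
  then have "AE x in M. (norm (f x))\<^sup>2 = 0"
    using integral_nonneg_eq_0_iff_AE[of M "\<lambda>x. (norm (f x))\<^sup>2"] assms(1) by (simp add: L2_def)
  then show ?thesis by simp
qed

section \<open>Test functions determine integrable fields\<close>

lemma has_real_derivative_pos_part_square:
  "((\<lambda>s::real. (max 0 s)\<^sup>2) has_real_derivative 2 * max 0 s) (at s)"
proof -
  consider "s < 0" | "s > 0" | "s = 0" by linarith
  then show ?thesis
  proof cases
    case 1
    have "((\<lambda>s::real. 0) has_real_derivative 2 * max 0 s) (at s)" using 1 by simp
    moreover have "\<forall>\<^sub>F x in nhds s. 0 = (max 0 x)\<^sup>2"
      by (rule eventually_mono[OF eventually_nhds_in_open[of "{..<0}" s]]) (use 1 in auto)
    ultimately show ?thesis using DERIV_cong_ev[OF refl _ refl, THEN iffD1] by fast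
  next
    case 2
    have "((\<lambda>s::real. s\<^sup>2) has_real_derivative 2 * max 0 s) (at s)" using 2 by (auto intro!: derivative_eq_intros)
    moreover have "\<forall>\<^sub>F x in nhds s. x\<^sup>2 = (max 0 x)\<^sup>2"
      by (rule eventually_mono[OF eventually_nhds_in_open[of "{0<..}" s]]) (use 2 in auto)
    ultimately show ?thesis using DERIV_cong_ev[OF refl _ refl, THEN iffD1] by fast
  next
    case 3
    have "((\<lambda>h. ((max 0 (0 + h))\<^sup>2 - (max 0 0)\<^sup>2) / h) \<longlongrightarrow> 0) (at (0::real))"
    proof (rule tendsto_0_le[where f = "\<lambda>h. h" and K = 1])
      show "\<forall>\<^sub>F x in at (0::real). norm (((max 0 (0 + x))\<^sup>2 - (max 0 0)\<^sup>2) / x) \<le> norm x * 1"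
        by (intro always_eventually allI) (auto simp: max_def power2_eq_square)
    qed (rule tendsto_ident_at)
    then show ?thesis using 3 by (simp add: DERIV_def)
  qed
qed

text \<open>
  Products of one-dimensional bumps, composed with \<open>y \<mapsto> n y / (1 + n y)\<close>, are $C^1$ and
  increase to the indicator function of an open box.
\<close>

lemma box_bump_functions:
  fixes a b :: "real^'d::finite"
  assumes ab: "\<And>i. a $ i \<le> b $ i" and sub: "cbox a b \<subseteq> U"
  obtains \<phi> D where "\<And>n::nat. test_fun U (\<phi> n) (D n)" "\<And>n x. 0 \<le> \<phi> n x \<and> \<phi> n x \<le> 1"
    "\<And>x. (\<lambda>n. \<phi> n x) \<longlonglongrightarrow> indicator (box a b) x"
proof -
  define q where "q i s = (s - a $ i) * (b $ i - s)" for i and s :: real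
  define c where "c i s = (max 0 (q i s))\<^sup>2" for i and s :: real
  define c' where "c' i s = 2 * max 0 (q i s) * ((b $ i - s) - (s - a $ i))" for i and s :: real
  have c: "(c i has_real_derivative c' i s) (at s)" for i s
    unfolding c_def c'_def
    by (rule DERIV_chain2[OF has_real_derivative_pos_part_square])
      (auto simp: q_def intro!: derivative_eq_intros)
  have cc: "continuous_on UNIV (c i)" "continuous_on UNIV (c' i)" for i
    unfolding c_def c'_def q_def by (intro continuous_intros)+
  define Y where "Y x = (\<Prod>i\<in>UNIV. c i (x $ i))" for x :: "real^'d"
  define Y' where "Y' x = (\<chi> i. c' i (x $ i) * (\<Prod>j\<in>UNIV - {i}. c j (x $ j)))" for x :: "real^'d"
  have Y0: "0 \<le> Y x" for x unfolding Y_def c_def by (intro prod_nonneg) auto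
  have qpos: "q i s > 0 \<longleftrightarrow> a $ i < s \<and> s < b $ i" for i s
    unfolding q_def zero_less_mult_iff using ab[of i] by auto
  have Ypos: "Y x > 0 \<longleftrightarrow> x \<in> box a b" for x
  proof
    assume "Y x > 0"
    then have "c i (x $ i) \<noteq> 0" for i unfolding Y_def by (auto simp: less_le prod_zero_iff)
    then have "max 0 (q i (x $ i)) \<noteq> 0" for i unfolding c_def by (metis zero_power2)
    then have "q i (x $ i) > 0" for i by (metis max.absorb1 not_less)
    then show "x \<in> box a b" using qpos by (simp add: mem_box_cart)
  next
    assume "x \<in> box a b"
    then have "q i (x $ i) > 0" for i using qpos by (simp add: mem_box_cart)
    then show "Y x > 0" unfolding Y_def c_def by (intro prod_pos ballI zero_less_power) (simp add: less_max_iff_disj)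
  qed
  have dY: "(Y has_derivative (\<lambda>h. Y' x \<bullet> h)) (at x)" for x
  proof -
    have "((\<lambda>x. c i (x $ i)) has_derivative (\<lambda>h. c' i (x $ i) * (h $ i))) (at x)" for i
      using has_derivative_compose[OF bounded_linear_imp_has_derivative[OF bounded_linear_vec_nth[of i], of "at x"] c[of i "x $ i", unfolded has_field_derivative_def]]
      by simp
    then have "(Y has_derivative (\<lambda>h. \<Sum>i\<in>UNIV. c' i (x $ i) * (h $ i) * (\<Prod>j\<in>UNIV - {i}. c j (x $ j)))) (at x)"
      unfolding Y_def by (rule has_derivative_prod)
    then show ?thesis
      by (simp add: inner_vec_def Y'_def mult_ac)
  qed
  have cY: "continuous_on UNIV Y" "continuous_on UNIV Y'"
    unfolding Y_def Y'_def
    by (intro continuous_on_prod continuous_on_vec_lambda continuous_intros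
        continuous_on_compose2[OF cc(1)] continuous_on_compose2[OF cc(2)] subset_UNIV)+
  define \<phi> where "\<phi> n x = 1 - inverse (1 + real n * Y x)" for n x
  define D where "D n x = (real n / (1 + real n * Y x)\<^sup>2) *\<^sub>R Y' x" for n x
  have den: "1 + real n * Y x > 0" for n x using Y0[of x] by (simp add: add_pos_nonneg)
  show ?thesis
  proof
    fix n :: nat
    show "test_fun U (\<phi> n) (D n)"
      unfolding test_fun_def
    proof (intro conjI allI)
      fix x
      have "((\<lambda>y. 1 + real n * y) has_real_derivative real n) (at (Y x))"
        by (auto intro!: derivative_eq_intros)
      then have "((\<lambda>y. inverse (1 + real n * y)) has_real_derivative - (inverse (1 + real n * Y x) * real n * inverse (1 + real n * Y x))) (at (Y x))"
        by (rule DERIV_inverse') (use den[of n x] in simp)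
      then have "((\<lambda>y. 1 - inverse (1 + real n * y)) has_real_derivative 0 - - (inverse (1 + real n * Y x) * real n * inverse (1 + real n * Y x))) (at (Y x))"
        by (intro DERIV_diff DERIV_const)
      then have F: "((\<lambda>y. 1 - inverse (1 + real n * y)) has_real_derivative (real n / (1 + real n * Y x)\<^sup>2)) (at (Y x))"
        by (simp add: power2_eq_square divide_inverse mult_ac)
      show "(\<phi> n has_derivative (\<lambda>h. D n x \<bullet> h)) (at x)"
        unfolding \<phi>_def D_def
        using has_derivative_compose[OF dY F[unfolded has_field_derivative_def]] by simp
    next
      show "continuous_on UNIV (D n)"
        unfolding D_def using den
        by (intro continuous_intros cY) (auto simp: less_imp_neq[symmetric])
      have "{x. \<phi> n x \<noteq> 0} \<subseteq> {x. Y x > 0}"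
      proof safe
        fix x assume "\<phi> n x \<noteq> 0"
        then have "Y x \<noteq> 0" unfolding \<phi>_def by (metis add.right_neutral diff_self inverse_1 mult_zero_right)
        then show "Y x > 0" using Y0[of x] by linarith
      qed
      also have "\<dots> \<subseteq> cbox a b" using Ypos box_subset_cbox by blast
      finally have *: "closure {x. \<phi> n x \<noteq> 0} \<subseteq> cbox a b" by (rule closure_minimal) (rule closed_cbox)
      then show "closure {x. \<phi> n x \<noteq> 0} \<subseteq> U" using sub by blast
      show "compact (closure {x. \<phi> n x \<noteq> 0})"
        using bounded_subset[OF bounded_cbox *] by (simp add: compact_eq_bounded_closed)
    qed
    fix x
    show "0 \<le> \<phi> n x \<and> \<phi> n x \<le> 1"
    proof -
      have "0 \<le> real n * Y x" using Y0[of x] by simp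
      then show ?thesis unfolding \<phi>_def by (simp add: inverse_le_1_iff)
    qed
  next
    fix x
    show "(\<lambda>n. \<phi> n x) \<longlonglongrightarrow> indicator (box a b) x"
    proof (cases "x \<in> box a b")
      case False
      then have "Y x = 0" using Ypos[of x] Y0[of x] by simp
      then show ?thesis using False by (simp add: \<phi>_def)
    next
      case True
      then have "Y x > 0" using Ypos by blast
      then have "filterlim (\<lambda>n. 1 + real n * Y x) at_top sequentially"
        by (intro filterlim_tendsto_add_at_top[OF tendsto_const] filterlim_at_top_mult_tendsto_pos[OF tendsto_const _ filterlim_real_sequentially])
      then have "(\<lambda>n. 1 - inverse (1 + real n * Y x)) \<longlonglongrightarrow> 1 - 0"
        by (intro tendsto_intros tendsto_inverse_0_at_top)
      then show ?thesis using True unfolding \<phi>_def by simp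
    qed
  qed
qed

text \<open>
  Test functions increase to the indicator of any box in \<open>U\<close>, so \<open>g\<close> has mean zero over every
  such box, and its value at a Lebesgue point is a limit of means over boxes.
\<close>

lemma test_fun_annihilator_AE_zero:
  fixes U :: "(real^'d::finite) set" and g :: "real^'d \<Rightarrow> real^'d"
  assumes U: "open U" and g: "integrable (lebesgue_on U) g"
    and z: "\<And>\<phi> D. test_fun U \<phi> D \<Longrightarrow> (LINT x|lebesgue_on U. \<phi> x *\<^sub>R g x) = 0"
  shows "AE x in lebesgue_on U. g x = 0"
proof -
  have Um [measurable]: "U \<in> sets lebesgue" using borel_open[OF U] by simp
  define f where "f x = indicator U x *\<^sub>R g x" for x
  have fi: "integrable lebesgue f"
    using g Um unfolding f_def by (simp add: integrable_restrict_space)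
  have gm [measurable]: "g \<in> borel_measurable (lebesgue_on U)" using g by auto
  have box0: "integral (cbox a b) f = 0" if ab: "\<And>i. a $ i \<le> b $ i" and sub: "cbox a b \<subseteq> U" for a b
  proof -
    obtain \<phi> D where tf: "\<And>n::nat. test_fun U (\<phi> n) (D n)" and b01: "\<And>n x. 0 \<le> \<phi> n x \<and> \<phi> n x \<le> 1"
      and lim: "\<And>x. (\<lambda>n. \<phi> n x) \<longlonglongrightarrow> indicator (box a b) x"
      using box_bump_functions[OF ab sub] by metis
    have cphi: "continuous_on UNIV (\<phi> n)" for n
      using tf[of n] unfolding test_fun_def
      by (metis continuous_at_imp_continuous_on has_derivative_continuous)
    have [measurable]: "\<phi> n \<in> borel_measurable (lebesgue_on U)" for n
      by (rule continuous_imp_measurable_on_sets_lebesgue[OF continuous_on_subset[OF cphi] Um]) simp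
    have [measurable]: "(indicator (box a b) :: _ \<Rightarrow> real) \<in> borel_measurable (lebesgue_on U)"
      by (intro measurable_restrict_space1 borel_measurable_indicator) (simp add: sets_completionI_sets)
    have "(\<lambda>n. LINT x|lebesgue_on U. \<phi> n x *\<^sub>R g x) \<longlonglongrightarrow> (LINT x|lebesgue_on U. indicator (box a b) x *\<^sub>R g x)"
    proof (rule integral_dominated_convergence[where w = "\<lambda>x. norm (g x)"])
      show "AE x in lebesgue_on U. norm (\<phi> n x *\<^sub>R g x) \<le> norm (g x)" for n
        using b01 by (intro AE_I2) (simp add: mult_left_le_one_le)
      show "AE x in lebesgue_on U. (\<lambda>n. \<phi> n x *\<^sub>R g x) \<longlonglongrightarrow> indicator (box a b) x *\<^sub>R g x"
        by (intro AE_I2 tendsto_scaleR lim tendsto_const)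
      show "(\<lambda>x. indicator (box a b) x *\<^sub>R g x) \<in> borel_measurable (lebesgue_on U)" by measurable
      show "(\<lambda>x. \<phi> n x *\<^sub>R g x) \<in> borel_measurable (lebesgue_on U)" for n by measurable
      show "integrable (lebesgue_on U) (\<lambda>x. norm (g x))" using g by (rule integrable_norm)
    qed
    then have "(LINT x|lebesgue_on U. indicator (box a b) x *\<^sub>R g x) = 0"
      using z[OF tf] by (simp add: LIMSEQ_const_iff)
    then have *: "(LINT x|lebesgue. indicator U x *\<^sub>R (indicator (box a b) x *\<^sub>R g x)) = 0"
      using Um by (simp add: integral_restrict_space)
    have si: "set_integrable lebesgue (cbox a b) f"
      using fi by (simp add: set_integrable_def integrable_mult_indicator)
    have "integral (cbox a b) f = (LINT x:cbox a b|lebesgue. f x)"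
      using set_lebesgue_integral_eq_integral(2)[OF si] by simp
    also have "\<dots> = (LINT x|lebesgue. indicator U x *\<^sub>R (indicator (box a b) x *\<^sub>R g x))"
      unfolding set_lebesgue_integral_def
    proof (rule integral_cong_AE)
      have "cbox a b - box a b \<in> null_sets lebesgue"
        using negligible_frontier_interval negligible_iff_null_sets by blast
      from AE_not_in[OF this] show "AE x in lebesgue. indicator (cbox a b) x *\<^sub>R f x = indicator U x *\<^sub>R (indicator (box a b) x *\<^sub>R g x)"
      proof eventually_elim
        case (elim x)
        moreover have "x \<in> box a b \<Longrightarrow> x \<in> cbox a b" using box_subset_cbox by blast
        ultimately have "x \<in> cbox a b \<longleftrightarrow> x \<in> box a b" by blast
        then show ?case unfolding f_def indicator_def by simp
      qed
      have m: "(\<lambda>x. indicator A x *\<^sub>R f x) \<in> borel_measurable lebesgue" if "A \<in> sets lebesgue" for A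
        using borel_measurable_integrable[OF fi] that by (intro borel_measurable_scaleR borel_measurable_indicator)
      show "(\<lambda>x. indicator (cbox a b) x *\<^sub>R f x) \<in> borel_measurable lebesgue"
        by (rule m) (simp add: sets_completionI_sets)
      have "(\<lambda>x. indicator U x *\<^sub>R (indicator (box a b) x *\<^sub>R g x)) = (\<lambda>x. indicator (box a b) x *\<^sub>R f x)"
        unfolding f_def by (simp add: mult.commute)
      then show "(\<lambda>x. indicator U x *\<^sub>R (indicator (box a b) x *\<^sub>R g x)) \<in> borel_measurable lebesgue"
        using m[of "box a b"] by (simp add: sets_completionI_sets)
    qed
    finally show ?thesis using * by simp
  qed
  have "f integrable_on cbox a b" for a b
  proof -
    have "set_integrable lebesgue (cbox a b) f"
      using fi by (simp add: set_integrable_def integrable_mult_indicator)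
    then show ?thesis by (rule set_lebesgue_integral_eq_integral(1))
  qed
  then obtain N where N: "negligible N" and L: "\<And>x e. \<lbrakk>x \<notin> N; 0 < e\<rbrakk> \<Longrightarrow>
     \<exists>d>0. \<forall>h. 0 < h \<and> h < d \<longrightarrow> norm (integral (cbox x (x + h *\<^sub>R One)) f /\<^sub>R h ^ DIM(real^'d) - f x) < e"
    using integrable_ccontinuous_explicit[of f] by metis
  have "g x = 0" if x: "x \<in> U" "x \<notin> N" for x
  proof (rule ccontr)
    assume "g x \<noteq> 0"
    then have e: "norm (f x) > 0" using x by (simp add: f_def)
    obtain d where d: "d > 0" "\<And>h. 0 < h \<Longrightarrow> h < d \<Longrightarrow> norm (integral (cbox x (x + h *\<^sub>R One)) f /\<^sub>R h ^ DIM(real^'d) - f x) < norm (f x)"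
      using L[OF x(2) e] by blast
    obtain r where r: "r > 0" "ball x r \<subseteq> U" using U x(1) openE by blast
    define k where "k = norm (One :: real^'d)"
    define h where "h = min (d / 2) (r / (2 * (k + 1)))"
    have k: "k \<ge> 0" unfolding k_def by simp
    have h: "h > 0" "h < d" using d(1) r(1) k unfolding h_def by auto
    have One: "(One :: real^'d) $ i = 1" for i
      by (simp add: cart_eq_inner_axis axis_in_Basis_iff inner_sum_left_Basis)
    have shift: "(z + l *\<^sub>R (One :: real^'d)) $ i = z $ i + l" for z l i
      by (simp only: vector_add_component vector_scaleR_component One) simp
    have "cbox x (x + h *\<^sub>R One) \<subseteq> U"
    proof
      fix y assume y: "y \<in> cbox x (x + h *\<^sub>R One)"
      have "norm (y - x) \<le> norm (h *\<^sub>R (One :: real^'d))"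
      proof (rule norm_le_componentwise_cart)
        fix i
        have "x $ i \<le> y $ i \<and> y $ i \<le> x $ i + h" using y shift by (simp only: mem_box_cart)
        moreover have "(h *\<^sub>R (One :: real^'d)) $ i = h" using shift[of 0 h i] by (simp only: add_0 zero_index)
        ultimately show "norm ((y - x) $ i) \<le> norm ((h *\<^sub>R (One :: real^'d)) $ i)"
          using h by (simp only: vector_minus_component) simp
      qed
      also have "\<dots> = h * k" using h by (simp add: k_def)
      also have "\<dots> \<le> r / (2 * (k + 1)) * k" using k unfolding h_def by (intro mult_right_mono) auto
      also have "\<dots> < r" using r(1) k by (simp add: field_simps add_nonneg_pos)
      finally show "y \<in> U" using r(2) by (auto simp: dist_norm norm_minus_commute)
    qed
    moreover have "x $ i \<le> (x + h *\<^sub>R One) $ i" for i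
      using h shift[of x h i] by linarith
    ultimately have "integral (cbox x (x + h *\<^sub>R One)) f = 0" by (intro box0) auto
    then show False using d(2)[OF h] by simp
  qed
  moreover have "AE x in lebesgue. x \<notin> N"
    using N unfolding negligible_iff_null_sets by (rule AE_not_in)
  ultimately have "AE x in lebesgue. x \<in> U \<longrightarrow> g x = 0"
    by (rule_tac eventually_mono[of "\<lambda>x. x \<notin> N"]) auto
  then show ?thesis by (simp add: AE_restrict_space_iff)
qed

section \<open>Weak gradients\<close>

lemma open_in_sets_lebesgue: "open U \<Longrightarrow> U \<in> sets lebesgue" for U :: "'a::euclidean_space set"
  by (simp add: borel_open sets_completionI_sets)

lemma finite_measure_lebesgue_on_bounded:
  fixes U :: "'a::euclidean_space set"
  assumes "open U" "bounded U"
  shows "finite_measure (lebesgue_on U)"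
proof -
  have "U \<in> lmeasurable" using assms by (simp add: lmeasurable_open)
  then show ?thesis
    by (intro finite_measure_lebesgue_on)
qed

lemma test_fun_bounded:
  assumes t: "test_fun U \<phi> D"
  obtains C where "\<And>x. \<bar>\<phi> x\<bar> \<le> C" "\<And>x. norm (D x) \<le> C"
proof -
  define K where "K = closure {x. \<phi> x \<noteq> 0}"
  have d: "(\<phi> has_derivative (\<lambda>h. D x \<bullet> h)) (at x)" for x using t by (auto simp: test_fun_def)
  have cD: "continuous_on UNIV D" and K: "compact K" using t by (auto simp: test_fun_def K_def)
  have c\<phi>: "continuous_on UNIV \<phi>"
    by (intro continuous_at_imp_continuous_on ballI has_derivative_continuous[OF d])
  have z: "\<phi> x = 0" if "x \<notin> K" for x using that closure_subset[of "{x. \<phi> x \<noteq> 0}"] unfolding K_def by auto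
  have zD: "D x = 0" if "x \<notin> K" for x
  proof -
    have "open (- K)" using K by (simp add: compact_imp_closed open_Compl)
    then have "(\<phi> has_derivative (\<lambda>h. 0)) (at x)"
      using z that by (intro has_derivative_transform_within_open[OF has_derivative_const[of 0]]) auto
    then have "(\<lambda>h. D x \<bullet> h) = (\<lambda>h. 0)" by (rule has_derivative_unique[OF d])
    then show ?thesis by (metis inner_eq_zero_iff)
  qed
  have "bounded (\<phi> ` K)" "bounded (D ` K)"
    using K c\<phi> cD continuous_on_subset by (blast intro: compact_imp_bounded compact_continuous_image)+
  then obtain C1 C2 where "\<And>x. x \<in> K \<Longrightarrow> \<bar>\<phi> x\<bar> \<le> C1" "\<And>x. x \<in> K \<Longrightarrow> norm (D x) \<le> C2"
    unfolding bounded_iff by (auto simp: real_norm_def)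
  then have "\<bar>\<phi> x\<bar> \<le> max (max C1 C2) 0 \<and> norm (D x) \<le> max (max C1 C2) 0" for x
    using z[of x] zD[of x] by (cases "x \<in> K") fastforce+
  then show ?thesis using that by blast
qed

lemma test_fun_continuous:
  assumes "test_fun U \<phi> D"
  shows "continuous_on UNIV \<phi>" "continuous_on UNIV D"
  using assms unfolding test_fun_def
  by (blast intro: continuous_at_imp_continuous_on has_derivative_continuous)+

lemma test_fun_measurable:
  assumes "test_fun U \<phi> D"
  shows "\<phi> \<in> borel_measurable (lebesgue_on V)" "D \<in> borel_measurable (lebesgue_on V)"
  using test_fun_continuous[OF assms]
  by (auto intro!: measurable_restrict_space1 measurable_completion borel_measurable_continuous_onI)

lemma test_fun_integrable:
  assumes t: "test_fun U \<phi> D"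
  shows "integrable M (g :: real^'d \<Rightarrow> real^'d) \<Longrightarrow> M = lebesgue_on V \<Longrightarrow> integrable M (\<lambda>x. \<phi> x *\<^sub>R g x)"
    and "integrable M (f :: real^'d::finite \<Rightarrow> real) \<Longrightarrow> M = lebesgue_on V \<Longrightarrow> integrable M (\<lambda>x. f x *\<^sub>R D x)"
proof -
  obtain C where C: "\<And>x. \<bar>\<phi> x\<bar> \<le> C" "\<And>x. norm (D x) \<le> C" using test_fun_bounded[OF t] by blast
  have C0: "C \<ge> 0" using C(1)[of undefined] abs_ge_zero order_trans by blast
  have [measurable]: "\<phi> \<in> borel_measurable (lebesgue_on V)" "D \<in> borel_measurable (lebesgue_on V)"
    using test_fun_measurable[OF t] by auto
  show "integrable M (\<lambda>x. \<phi> x *\<^sub>R g x)" if g: "integrable M g" and M: "M = lebesgue_on V"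
  proof (rule Bochner_Integration.integrable_bound[where f = "\<lambda>x. C *\<^sub>R g x"])
    have [measurable]: "g \<in> borel_measurable (lebesgue_on V)" using g M by auto
    show "(\<lambda>x. \<phi> x *\<^sub>R g x) \<in> borel_measurable M" unfolding M by measurable
    show "AE x in M. norm (\<phi> x *\<^sub>R g x) \<le> norm (C *\<^sub>R g x)"
      using C C0 by (intro AE_I2) (auto intro: mult_right_mono)
  qed (use g in auto)
  show "integrable M (\<lambda>x. f x *\<^sub>R D x)" if f: "integrable M f" and M: "M = lebesgue_on V"
  proof (rule Bochner_Integration.integrable_bound[where f = "\<lambda>x. C *\<^sub>R f x"])
    have [measurable]: "f \<in> borel_measurable (lebesgue_on V)" using f M by auto
    show "(\<lambda>x. f x *\<^sub>R D x) \<in> borel_measurable M" unfolding M by measurable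
    show "AE x in M. norm (f x *\<^sub>R D x) \<le> norm (C *\<^sub>R f x)"
    proof (rule AE_I2)
      fix x
      have "norm (D x) * \<bar>f x\<bar> \<le> C * \<bar>f x\<bar>" by (intro mult_right_mono C) simp
      then show "norm (f x *\<^sub>R D x) \<le> norm (C *\<^sub>R f x)" using C0 by (simp add: abs_mult mult.commute)
    qed
  qed (use f in auto)
qed

lemma integral_lincomb:
  fixes f g :: "'a \<Rightarrow> 'b::euclidean_space"
  assumes "integrable M f" "integrable M g"
  shows "(LINT x|M. a *\<^sub>R f x + b *\<^sub>R g x) = a *\<^sub>R (LINT x|M. f x) + b *\<^sub>R (LINT x|M. g x)"
  using assms by (subst Bochner_Integration.integral_add) auto

context
  fixes U :: "(real^'d::finite) set"
  assumes U: "open U" "bounded U"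
begin

interpretation fU: finite_measure "lebesgue_on U"
  by (rule finite_measure_lebesgue_on_bounded[OF U])

lemma is_wgrad_lincomb:
  assumes L2: "L2 (lebesgue_on U) v" "L2 (lebesgue_on U) w" "L2 (lebesgue_on U) g" "L2 (lebesgue_on U) h"
    and wg: "is_wgrad U v g" "is_wgrad U w h"
  shows "is_wgrad U (\<lambda>x. a * v x + b * w x) (\<lambda>x. a *\<^sub>R g x + b *\<^sub>R h x)"
  unfolding is_wgrad_def
proof (intro allI impI)
  fix \<phi> D assume t: "test_fun U \<phi> D"
  note i = L2[THEN fU.L2_integrable]
  note j = test_fun_integrable(2)[OF t i(1) refl] test_fun_integrable(2)[OF t i(2) refl]
    test_fun_integrable(1)[OF t i(3) refl] test_fun_integrable(1)[OF t i(4) refl]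
  have "(LINT x|lebesgue_on U. (a * v x + b * w x) *\<^sub>R D x)
      = (LINT x|lebesgue_on U. a *\<^sub>R (v x *\<^sub>R D x) + b *\<^sub>R (w x *\<^sub>R D x))"
    by (simp add: scaleR_add_left)
  also have "\<dots> = a *\<^sub>R (LINT x|lebesgue_on U. v x *\<^sub>R D x) + b *\<^sub>R (LINT x|lebesgue_on U. w x *\<^sub>R D x)"
    by (rule integral_lincomb) (rule j)+
  also have "\<dots> = - (a *\<^sub>R (LINT x|lebesgue_on U. \<phi> x *\<^sub>R g x) + b *\<^sub>R (LINT x|lebesgue_on U. \<phi> x *\<^sub>R h x))"
    using wg t by (simp add: is_wgrad_def)
  also have "\<dots> = - (LINT x|lebesgue_on U. a *\<^sub>R (\<phi> x *\<^sub>R g x) + b *\<^sub>R (\<phi> x *\<^sub>R h x))"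
    by (subst integral_lincomb) (rule j refl)+
  also have "\<dots> = - (LINT x|lebesgue_on U. \<phi> x *\<^sub>R (a *\<^sub>R g x + b *\<^sub>R h x))"
    by (simp add: scaleR_add_right mult.commute)
  finally show "(LINT x|lebesgue_on U. (a * v x + b * w x) *\<^sub>R D x) = - (LINT x|lebesgue_on U. \<phi> x *\<^sub>R (a *\<^sub>R g x + b *\<^sub>R h x))" .
qed

lemma is_wgrad_unique:
  assumes L2: "L2 (lebesgue_on U) g" "L2 (lebesgue_on U) h"
    and wg: "is_wgrad U v g" "is_wgrad U v h"
  shows "AE x in lebesgue_on U. g x = h x"
proof -
  note i = L2[THEN fU.L2_integrable]
  have "AE x in lebesgue_on U. g x - h x = 0"
  proof (rule test_fun_annihilator_AE_zero[OF U(1)])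
    fix \<phi> D assume t: "test_fun U \<phi> D"
    have "(LINT x|lebesgue_on U. \<phi> x *\<^sub>R g x) = (LINT x|lebesgue_on U. \<phi> x *\<^sub>R h x)"
      using wg(1)[unfolded is_wgrad_def, rule_format, OF t] wg(2)[unfolded is_wgrad_def, rule_format, OF t]
      by (rule neg_equal_iff_equal[THEN iffD1, OF trans[OF sym]])
    then show "(LINT x|lebesgue_on U. \<phi> x *\<^sub>R (g x - h x)) = 0"
      using test_fun_integrable(1)[OF t i(1) refl] test_fun_integrable(1)[OF t i(2) refl]
      by (simp add: scaleR_diff_right)
  qed (use i in auto)
  then show ?thesis by simp
qed

lemma wgrad_H1:
  assumes "H1 U v"
  shows "L2 (lebesgue_on U) (wgrad U v)" "is_wgrad U v (wgrad U v)"
proof -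
  have "\<exists>g. L2 (lebesgue_on U) g \<and> is_wgrad U v g" using assms by (auto simp: H1_def)
  then have "L2 (lebesgue_on U) (wgrad U v) \<and> is_wgrad U v (wgrad U v)"
    unfolding wgrad_def by (rule someI_ex)
  then show "L2 (lebesgue_on U) (wgrad U v)" "is_wgrad U v (wgrad U v)" by auto
qed

text \<open>
  As \<open>wgrad\<close> is a choice among all weak gradients, its linearity rests on their uniqueness and
  holds almost everywhere only.
\<close>

lemma H1_lincomb:
  assumes "H1 U v" "H1 U w"
  shows "H1 U (\<lambda>x. a * v x + b * w x)"
    and "AE x in lebesgue_on U. wgrad U (\<lambda>x. a * v x + b * w x) x = a *\<^sub>R wgrad U v x + b *\<^sub>R wgrad U w x"
proof -
  have L: "L2 (lebesgue_on U) v" "L2 (lebesgue_on U) w" using assms by (auto simp: H1_def)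
  note g = wgrad_H1[OF assms(1)] wgrad_H1[OF assms(2)]
  have 1: "L2 (lebesgue_on U) (\<lambda>x. a * v x + b * w x)" using L2_lincomb[OF L, of a b] by simp
  have 2: "L2 (lebesgue_on U) (\<lambda>x. a *\<^sub>R wgrad U v x + b *\<^sub>R wgrad U w x)" by (rule L2_lincomb) (rule g)+
  have 3: "is_wgrad U (\<lambda>x. a * v x + b * w x) (\<lambda>x. a *\<^sub>R wgrad U v x + b *\<^sub>R wgrad U w x)"
    by (rule is_wgrad_lincomb) (use L g in auto)
  show H: "H1 U (\<lambda>x. a * v x + b * w x)" using 1 2 3 unfolding H1_def by blast
  show "AE x in lebesgue_on U. wgrad U (\<lambda>x. a * v x + b * w x) x = a *\<^sub>R wgrad U v x + b *\<^sub>R wgrad U w x"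
    by (rule is_wgrad_unique[OF wgrad_H1(1)[OF H] 2 wgrad_H1(2)[OF H] 3])
qed

end

lemma L2_vec:
  fixes f :: "'a \<Rightarrow> ('b::euclidean_space)^'n::finite"
  assumes "\<And>i. L2 M (\<lambda>x. f x $ i)"
  shows "L2 M f"
proof -
  have [measurable]: "(\<lambda>x. f x $ i) \<in> borel_measurable M" for i using assms by (auto simp: L2_def)
  have m: "f \<in> borel_measurable M"
  proof (subst borel_measurable_euclidean_space, intro ballI)
    fix b :: "'b^'n" assume "b \<in> Basis"
    then obtain i c where "b = axis i c" by (auto simp: Basis_vec_def)
    then show "(\<lambda>x. f x \<bullet> b) \<in> borel_measurable M" by (simp add: inner_axis)
  qed
  have "(norm (f x))\<^sup>2 = (\<Sum>i\<in>UNIV. (norm (f x $ i))\<^sup>2)" for x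
    by (simp add: norm_vec_def L2_set_def sum_nonneg)
  moreover have "integrable M (\<lambda>x. \<Sum>i\<in>UNIV. (norm (f x $ i))\<^sup>2)" using assms by (auto simp: L2_def)
  ultimately show ?thesis using m by (simp add: L2_def)
qed

section \<open>Polytopal sets and surface measure\<close>

lemma polytopal_bounded:
  assumes "polytopal k P" shows "bounded P"
proof -
  obtain \<P> where \<P>: "finite \<P>" "\<forall>Q\<in>\<P>. polytope Q" "closure P = \<Union>\<P>"
    using assms unfolding polytopal_def by blast
  have "bounded (\<Union>\<P>)" using \<P> by (intro bounded_Union) (auto intro: polytope_imp_bounded)
  then show ?thesis using \<P>(3) closure_subset bounded_subset by metis
qed

lemma polytopal_full_open:
  fixes P :: "(real^'d::finite) set"
  assumes "polytopal (int CARD('d)) P" shows "open P"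
proof -
  have "aff_dim (closure P) = int DIM(real^'d)" using assms by (simp add: polytopal_def)
  then have "rel_interior (closure P) = interior (closure P)"
    using interior_rel_interior_gen[of "closure P"] by simp
  then show ?thesis using assms by (metis open_interior polytopal_def)
qed

lemma polytopal_borel:
  fixes P :: "(real^'d::finite) set"
  assumes "polytopal k P" shows "P \<in> sets borel"
proof -
  have "openin (top_of_set (affine hull (closure P))) (rel_interior (closure P))"
    by (rule openin_rel_interior)
  then obtain T where "open T" "rel_interior (closure P) = affine hull (closure P) \<inter> T"
    unfolding openin_open by blast
  moreover have "rel_interior (closure P) = P" using assms by (simp add: polytopal_def)
  ultimately show ?thesis by (metis borel_closed borel_open closed_affine_hull sets.Int)
qed

lemma finite_surface_measure:
  fixes \<P> :: "(real^'d::finite) set set"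
  assumes bdd: "\<And>P. P \<in> \<P> \<Longrightarrow> bounded P"
  shows "finite_measure (surface_measure \<P>)"
proof -
  define \<Omega> where "\<Omega> = \<Union>\<P>"
  define \<mu> where "\<mu> = (\<lambda>A. \<Sum>P\<in>\<P>. emeasure lborel (prism (A \<inter> P) (unit_normal P)))"
  define M where "M = measure_of \<Omega> (sets (restrict_space borel \<Omega>)) \<mu>"
  have sub: "sets (restrict_space borel \<Omega>) \<subseteq> Pow \<Omega>" by (auto simp: sets_restrict_space)
  have spM: "space M = \<Omega>" unfolding M_def using sub by (simp add: space_measure_of)
  have fin: "emeasure lborel (prism (A \<inter> P) n) < \<infinity>" if P: "P \<in> \<P>" for A P n
  proof -
    have "bounded (prism (A \<inter> P) n)"
    proof -
      obtain c where c: "\<And>x. x \<in> P \<Longrightarrow> norm x \<le> c" using bdd[OF P] by (auto simp: bounded_iff)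
      have "norm y \<le> c + norm n" if y: "y \<in> prism (A \<inter> P) n" for y
      proof -
        obtain x s where xs: "x \<in> P" "0 \<le> s" "s \<le> 1" "y = x + s *\<^sub>R n" using y by (auto simp: prism_def)
        have "norm y \<le> norm x + \<bar>s\<bar> * norm n" using xs(4) norm_triangle_ineq[of x "s *\<^sub>R n"] by simp
        also have "\<bar>s\<bar> * norm n \<le> 1 * norm n" using xs by (intro mult_right_mono) auto
        finally show ?thesis using c[OF xs(1)] by simp
      qed
      then show ?thesis by (auto simp: bounded_iff)
    qed
    then obtain a b where "prism (A \<inter> P) n \<subseteq> cbox a b" using bounded_subset_cbox_symmetric by blast
    then have "emeasure lborel (prism (A \<inter> P) n) \<le> emeasure lborel (cbox a b)"
      by (intro emeasure_mono) auto
    also have "\<dots> < \<infinity>" by (simp add: emeasure_lborel_cbox_eq)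
    finally show ?thesis .
  qed
  have "emeasure M \<Omega> < \<infinity>"
  proof -
    have "\<mu> \<Omega> < \<infinity>" unfolding \<mu>_def using fin by (cases "finite \<P>") (auto simp: ennreal_sum_less_top)
    \<comment> \<open>A set function that is not a measure is replaced by zero, which is finite as well.\<close>
    then show ?thesis unfolding M_def emeasure_measure_of_conv by auto
  qed
  moreover have "surface_measure \<P> = completion M"
    unfolding surface_measure_def M_def \<Omega>_def \<mu>_def ..
  moreover have "\<Omega> \<in> sets M" using sets.top[of M] spM by simp
  ultimately show ?thesis
    by (intro finite_measureI) (auto simp: spM)
qed

lemma surface_measure_simps:
  shows "space (surface_measure \<P>) = \<Union>\<P>"
    and "A \<in> sets borel \<Longrightarrow> A \<subseteq> \<Union>\<P> \<Longrightarrow> A \<in> sets (surface_measure \<P>)"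
    and "f \<in> borel_measurable (restrict_space borel (\<Union>\<P>)) \<Longrightarrow> f \<in> borel_measurable (surface_measure \<P>)"
proof -
  define M where "M = measure_of (\<Union>\<P>) (sets (restrict_space borel (\<Union>\<P>)))
     (\<lambda>A. \<Sum>P\<in>\<P>. emeasure lborel (prism (A \<inter> P) (unit_normal P)))"
  have sub: "sets (restrict_space borel (\<Union>\<P>)) \<subseteq> Pow (\<Union>\<P>)" by (auto simp: sets_restrict_space)
  have sp: "space M = \<Union>\<P>" unfolding M_def using sub by (simp add: space_measure_of)
  have st: "sets M = sets (restrict_space borel (\<Union>\<P>))"
    unfolding M_def using sub sets.sigma_sets_eq[of "restrict_space borel (\<Union>\<P>)"] by (simp add: space_restrict_space)
  have eq: "surface_measure \<P> = completion M" unfolding surface_measure_def M_def ..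
  show "space (surface_measure \<P>) = \<Union>\<P>" using eq sp by simp
  show "A \<in> sets (surface_measure \<P>)" if "A \<in> sets borel" "A \<subseteq> \<Union>\<P>"
  proof -
    have "A \<in> sets M" unfolding st using that by (auto simp: sets_restrict_space image_iff intro!: bexI[of _ A])
    then show ?thesis unfolding eq by (rule sets_completionI_sets)
  qed
  show "f \<in> borel_measurable (surface_measure \<P>)" if "f \<in> borel_measurable (restrict_space borel (\<Union>\<P>))"
    unfolding eq using that measurable_cong_sets[OF st refl] by (intro measurable_completion) blast
qed

section \<open>Displacements of a fractured domain\<close>

locale fractured =
  fixes G :: "('d::finite) geometry"
  assumes fd: "fractured_domain G"
begin

lemma dom_polytopal: "polytopal (int CARD('d)) (dom G)"
  using fd unfolding fractured_domain_def by (elim conjE)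

lemma dom_open: "open (dom G)" and dom_bounded: "bounded (dom G)"
  using polytopal_full_open[OF dom_polytopal] polytopal_bounded[OF dom_polytopal] .

lemma fracs_finite: "finite (fracs G)"
  using fd unfolding fractured_domain_def by (elim conjE)

lemma fracD:
  assumes "P \<in> fracs G"
  shows "polytopal (int CARD('d) - 1) P" "normal_to (nplus G P) P" "bounded P" "P \<in> sets borel" "norm (nplus G P) = 1"
proof -
  have "\<forall>P\<in>fracs G. polytopal (int CARD('d) - 1) P \<and> simply_connected P \<and> P \<subseteq> dom G \<and> normal_to (nplus G P) P"
    using fd unfolding fractured_domain_def by (elim conjE)
  with assms show p: "polytopal (int CARD('d) - 1) P" and n: "normal_to (nplus G P) P" by simp_all
  show "bounded P" "P \<in> sets borel" using polytopal_bounded[OF p] polytopal_borel[OF p] .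
  show "norm (nplus G P) = 1" using n by (simp add: normal_to_def)
qed

lemma fracs_disjoint: "P \<in> fracs G \<Longrightarrow> Q \<in> fracs G \<Longrightarrow> P \<noteq> Q \<Longrightarrow> P \<inter> Q = {}"
proof -
  have "\<forall>P\<in>fracs G. \<forall>Q\<in>fracs G. P \<noteq> Q \<longrightarrow>
        P \<inter> Q = {} \<and> closure P \<inter> closure Q \<subseteq> (closure P - P) \<inter> (closure Q - Q)"
    using fd unfolding fractured_domain_def by (elim conjE)
  then show "P \<in> fracs G \<Longrightarrow> Q \<in> fracs G \<Longrightarrow> P \<noteq> Q \<Longrightarrow> P \<inter> Q = {}" by simp
qed

lemma trace_side: "trace_operator (cut_dom G) (surf G) (side_region G a) (tr G a)"
  using fd unfolding fractured_domain_def by (elim conjE) (rule spec)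

lemma trb_trace: "trace_operator (cut_dom G) (surface_measure (bfaces G)) (\<lambda>x. cut_dom G) (trb G)"
  using fd unfolding fractured_domain_def by (elim conjE)

lemma cut_open: "open (cut_dom G)" and cut_bounded: "bounded (cut_dom G)" and cut_sub: "cut_dom G \<subseteq> dom G"
  unfolding cut_dom_def using dom_open dom_bounded by (auto intro: bounded_subset)

lemma closure_Gam_negligible: "negligible (closure (Gam G))"
proof -
  have "negligible (closure P)" if P: "P \<in> fracs G" for P
  proof -
    define n where "n = nplus G P"
    have n: "norm n = 1" "\<And>x y. x \<in> P \<Longrightarrow> y \<in> P \<Longrightarrow> (x - y) \<bullet> n = 0"
      using fracD(2)[OF P] by (auto simp: normal_to_def n_def)
    have "P \<noteq> {}" using fracD(1)[OF P] by (simp add: polytopal_def)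
    then obtain y where y: "y \<in> P" by blast
    have "P \<subseteq> {x. n \<bullet> x = n \<bullet> y}"
    proof
      fix x assume "x \<in> P"
      then have "(x - y) \<bullet> n = 0" using n(2) y by blast
      then show "x \<in> {x. n \<bullet> x = n \<bullet> y}" by (simp add: inner_diff_left inner_commute[of n])
    qed
    then have "closure P \<subseteq> {x. n \<bullet> x = n \<bullet> y}" by (rule closure_minimal) (rule closed_hyperplane)
    moreover have "negligible {x. n \<bullet> x = n \<bullet> y}" by (rule negligible_hyperplane) (use n(1) in auto)
    ultimately show ?thesis using negligible_subset by blast
  qed
  then have "negligible (\<Union>P\<in>fracs G. closure P)"
    using fracs_finite by (intro negligible_Union) auto
  moreover have "closure (Gam G) \<subseteq> (\<Union>P\<in>fracs G. closure P)"
    unfolding Gam_def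
  proof (rule closure_minimal)
    show "\<Union> (fracs G) \<subseteq> (\<Union>P\<in>fracs G. closure P)" using closure_subset by (intro UN_mono Union_least) blast
    show "closed (\<Union>P\<in>fracs G. closure P)" using fracs_finite by (intro closed_UN) auto
  qed
  ultimately show ?thesis by (rule negligible_subset)
qed

sublocale vol: finite_measure "vol G"
  unfolding vol_def by (rule finite_measure_lebesgue_on_bounded[OF dom_open dom_bounded])

sublocale surf: finite_measure "surf G"
  unfolding surf_def by (rule finite_surface_measure) (rule fracD)

lemma space_surf: "space (surf G) = Gam G"
  by (simp add: surf_def Gam_def surface_measure_simps)

lemma continuous_on_Gam_measurable:
  fixes f :: "real^'d \<Rightarrow> 'b::{second_countable_topology, t2_space}"
  assumes "continuous_on (Gam G) f" shows "f \<in> borel_measurable (surf G)"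
proof -
  have "f \<in> borel_measurable (restrict_space borel (\<Union>(fracs G)))"
    using assms unfolding Gam_def by (rule borel_measurable_continuous_on_restrict)
  then show ?thesis unfolding surf_def surface_measure_simps using measurable_completion
    by (metis surface_measure_simps(3))
qed

lemma frac_in_surf: "P \<in> fracs G \<Longrightarrow> P \<in> sets (surf G)"
  unfolding surf_def by (intro surface_measure_simps fracD) auto

lemma nfield_eq: "x \<in> P \<Longrightarrow> P \<in> fracs G \<Longrightarrow> nfield G x = nplus G P"
proof -
  assume x: "x \<in> P" and P: "P \<in> fracs G"
  have "nfield G x = (\<Sum>Q\<in>fracs G. if Q = P then nplus G P else 0)"
    unfolding nfield_def
    by (rule sum.cong[OF refl]) (use x P fracs_disjoint in \<open>auto simp: indicator_def\<close>)
  then show ?thesis using fracs_finite P by simp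
qed

text \<open>
  Weak gradients live on the domain without the closed network, whereas the equations are integrated
  over the whole domain. The two measures differ by a null set, as each fracture lies
  in a hyperplane.
\<close>

lemma AE_cut_vol:
  assumes "AE x in lebesgue_on (cut_dom G). P x" shows "AE x in vol G. P x"
proof -
  have "AE x in lebesgue. x \<in> cut_dom G \<longrightarrow> P x"
    using assms open_in_sets_lebesgue[OF cut_open] by (simp add: AE_restrict_space_iff)
  moreover have "AE x in lebesgue. x \<notin> closure (Gam G)"
    using closure_Gam_negligible unfolding negligible_iff_null_sets by (rule AE_not_in)
  ultimately have "AE x in lebesgue. x \<in> dom G \<longrightarrow> P x"
    by eventually_elim (auto simp: cut_dom_def)
  then show ?thesis using open_in_sets_lebesgue[OF dom_open] unfolding vol_def by (subst AE_restrict_space_iff) auto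
qed

lemma cut_vol_transfer:
  fixes f :: "real^'d \<Rightarrow> 'b::euclidean_space"
  shows "f \<in> borel_measurable (lebesgue_on (cut_dom G)) \<Longrightarrow> f \<in> borel_measurable (vol G)"
    and "integrable (lebesgue_on (cut_dom G)) f \<Longrightarrow> integrable (vol G) f"
proof -
  have cs: "cut_dom G \<in> sets lebesgue" "dom G \<in> sets lebesgue"
    using open_in_sets_lebesgue cut_open dom_open by auto
  have n: "AE x in lebesgue. x \<notin> closure (Gam G)"
    using closure_Gam_negligible unfolding negligible_iff_null_sets by (rule AE_not_in)
  have eq: "AE x in lebesgue. indicator (cut_dom G) x *\<^sub>R f x = indicator (dom G) x *\<^sub>R f x"
    using n by eventually_elim (auto simp: cut_dom_def indicator_def)
  have m: "(\<lambda>x. indicator (dom G) x *\<^sub>R f x) \<in> borel_measurable lebesgue"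
    if "f \<in> borel_measurable (lebesgue_on (cut_dom G))"
  proof -
    have "(\<lambda>x. indicator (cut_dom G) x *\<^sub>R f x) \<in> borel_measurable lebesgue"
      using that cs borel_measurable_restrict_space_iff[of "cut_dom G" lebesgue f] by simp
    then have vi: "(\<lambda>x. indicator (cut_dom G) x *\<^sub>R f x) -` A \<in> sets lebesgue" if "A \<in> sets borel" for A
      using measurable_sets[OF _ that, of "\<lambda>x. indicator (cut_dom G) x *\<^sub>R f x" lebesgue] by simp
    have "(\<lambda>x. indicator (dom G) x *\<^sub>R f x) -` A \<in> sets lebesgue" if "A \<in> sets borel" for A
    proof (rule completion.in_sets_AE[rotated])
      show "(\<lambda>x. indicator (cut_dom G) x *\<^sub>R f x) -` A \<in> sets lebesgue"
        by (rule vi[OF that])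
      show "AE x in lebesgue. x \<in> (\<lambda>x. indicator (cut_dom G) x *\<^sub>R f x) -` A \<longleftrightarrow> x \<in> (\<lambda>x. indicator (dom G) x *\<^sub>R f x) -` A"
        using eq
      proof eventually_elim
        case (elim x)
        show ?case unfolding vimage_eq elim ..
      qed
    qed simp
    then show ?thesis by (intro measurableI) auto
  qed
  show fm: "f \<in> borel_measurable (vol G)" if "f \<in> borel_measurable (lebesgue_on (cut_dom G))"
    using m[OF that] cs borel_measurable_restrict_space_iff[of "dom G" lebesgue f] by (simp add: vol_def)
  show "integrable (vol G) f" if i: "integrable (lebesgue_on (cut_dom G)) f"
  proof -
    have "integrable lebesgue (\<lambda>x. indicator (cut_dom G) x *\<^sub>R f x)"
      using i cs by (simp add: integrable_restrict_space)
    then have "integrable lebesgue (\<lambda>x. indicator (dom G) x *\<^sub>R f x)"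
      using m[OF borel_measurable_integrable[OF i]] eq by (subst integrable_cong_AE[symmetric]) auto
    then show ?thesis using cs by (simp add: vol_def integrable_restrict_space)
  qed
qed

lemma L2_cut_vol: "L2 (lebesgue_on (cut_dom G)) f \<Longrightarrow> L2 (vol G) f"
  unfolding L2_def using cut_vol_transfer(1)[of f] cut_vol_transfer(2)[of "\<lambda>x. (norm (f x))\<^sup>2"] by blast

lemma U0_H1: "u \<in> U0 G \<Longrightarrow> H1 (cut_dom G) (\<lambda>y. u y $ i)"
  by (simp add: U0_def)

lemma jac_lincomb:
  assumes "u \<in> U0 G" "v \<in> U0 G"
  shows "AE x in vol G. jac G (\<lambda>y. a *\<^sub>R u y + b *\<^sub>R v y) x = a *\<^sub>R jac G u x + b *\<^sub>R jac G v x"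
proof -
  have "AE x in vol G. wgrad (cut_dom G) (\<lambda>y. (a *\<^sub>R u y + b *\<^sub>R v y) $ i) x
     = a *\<^sub>R wgrad (cut_dom G) (\<lambda>y. u y $ i) x + b *\<^sub>R wgrad (cut_dom G) (\<lambda>y. v y $ i) x" for i
    using AE_cut_vol[OF H1_lincomb(2)[OF cut_open cut_bounded U0_H1[OF assms(1), of i] U0_H1[OF assms(2), of i], of a b]]
    by simp
  then have "AE x in vol G. \<forall>i. wgrad (cut_dom G) (\<lambda>y. (a *\<^sub>R u y + b *\<^sub>R v y) $ i) x
     = a *\<^sub>R wgrad (cut_dom G) (\<lambda>y. u y $ i) x + b *\<^sub>R wgrad (cut_dom G) (\<lambda>y. v y $ i) x"
    by (intro AE_all_countable[THEN iffD2] allI)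
  then show ?thesis
    by eventually_elim (simp add: jac_def vec_eq_iff)
qed

lemma L2_jac: "u \<in> U0 G \<Longrightarrow> L2 (vol G) (jac G u)"
  unfolding jac_def
  by (rule L2_vec) (simp add: L2_cut_vol wgrad_H1(1)[OF cut_open cut_bounded] U0_H1)

lemma L2_bounded_linear:
  fixes f :: "'a \<Rightarrow> 'b::euclidean_space" and h :: "'b \<Rightarrow> 'c::euclidean_space"
  assumes f: "L2 M f" and h: "bounded_linear h" shows "L2 M (\<lambda>x. h (f x))"
proof -
  obtain K where K: "\<And>x. norm (h x) \<le> norm x * K" "K \<ge> 0"
    using bounded_linear.nonneg_bounded[OF h] by metis
  have [measurable]: "f \<in> borel_measurable M" "h \<in> borel_measurable borel"
    using f linear_continuous_on[OF h, of UNIV] by (auto simp: L2_def intro: borel_measurable_continuous_onI)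
  have "integrable M (\<lambda>x. K\<^sup>2 * (norm (f x))\<^sup>2)" using f by (simp add: L2_def)
  then have "integrable M (\<lambda>x. (norm (h (f x)))\<^sup>2)"
  proof (rule Bochner_Integration.integrable_bound)
    show "AE x in M. norm ((norm (h (f x)))\<^sup>2) \<le> norm (K\<^sup>2 * (norm (f x))\<^sup>2)"
    proof (rule AE_I2)
      fix x
      have "(norm (h (f x)))\<^sup>2 \<le> (norm (f x) * K)\<^sup>2" by (intro power_mono K) simp
      then show "norm ((norm (h (f x)))\<^sup>2) \<le> norm (K\<^sup>2 * (norm (f x))\<^sup>2)"
        by (simp add: power_mult_distrib mult.commute)
    qed
  qed measurable
  then show ?thesis by (simp add: L2_def)
qed

lemma bounded_linear_sym: "bounded_linear (\<lambda>A::real^'n::finite^'n. (1/2) *\<^sub>R (A + transpose A))"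
  by (intro linear_conv_bounded_linear[THEN iffD1] linearI) (simp_all add: vec_eq_iff transpose_def algebra_simps)

lemma bounded_linear_trace: "bounded_linear (trace :: real^'n::finite^'n \<Rightarrow> real)"
  by (intro linear_conv_bounded_linear[THEN iffD1] linearI) (simp_all add: trace_def sum.distrib sum_distrib_left)

lemma L2_eps: "u \<in> U0 G \<Longrightarrow> L2 (vol G) (eps G u)"
  unfolding eps_def using L2_bounded_linear[OF L2_jac bounded_linear_sym] .

lemma L2_dvg: "u \<in> U0 G \<Longrightarrow> L2 (vol G) (dvg G u)"
  unfolding dvg_def using L2_bounded_linear[OF L2_jac bounded_linear_trace] .

lemma eps_lincomb:
  assumes "u \<in> U0 G" "v \<in> U0 G"
  shows "AE x in vol G. eps G (\<lambda>y. a *\<^sub>R u y + b *\<^sub>R v y) x = a *\<^sub>R eps G u x + b *\<^sub>R eps G v x"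
  using jac_lincomb[OF assms, of a b]
  by eventually_elim
    (simp add: eps_def linear_add[OF bounded_linear.linear[OF bounded_linear_sym]] linear_cmul[OF bounded_linear.linear[OF bounded_linear_sym]])

lemma dvg_lincomb:
  assumes "u \<in> U0 G" "v \<in> U0 G"
  shows "AE x in vol G. dvg G (\<lambda>y. a *\<^sub>R u y + b *\<^sub>R v y) x = a * dvg G u x + b * dvg G v x"
  using jac_lincomb[OF assms, of a b]
  by eventually_elim
    (simp add: dvg_def linear_add[OF bounded_linear.linear[OF bounded_linear_trace]] linear_cmul[OF bounded_linear.linear[OF bounded_linear_trace]])

lemma L2_U0: "u \<in> U0 G \<Longrightarrow> L2 (vol G) u"
  by (intro L2_vec L2_cut_vol) (use U0_H1 in \<open>auto simp: H1_def\<close>)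

lemma L2_vtr: "u \<in> U0 G \<Longrightarrow> L2 (surf G) (vtr G a u)"
  using trace_side[of a] U0_H1 unfolding vtr_def trace_operator_def by (intro L2_vec) auto

lemma vtr_lincomb:
  assumes "u \<in> U0 G" "v \<in> U0 G"
  shows "AE x in surf G. vtr G s (\<lambda>y. a *\<^sub>R u y + b *\<^sub>R v y) x = a *\<^sub>R vtr G s u x + b *\<^sub>R vtr G s v x"
proof -
  have "AE x in surf G. tr G s (\<lambda>y. a * u y $ i + b * v y $ i) x = a * tr G s (\<lambda>y. u y $ i) x + b * tr G s (\<lambda>y. v y $ i) x" for i
    using trace_side[of s] U0_H1[OF assms(1)] U0_H1[OF assms(2)] unfolding trace_operator_def by blast
  then have "AE x in surf G. \<forall>i. tr G s (\<lambda>y. a * u y $ i + b * v y $ i) x = a * tr G s (\<lambda>y. u y $ i) x + b * tr G s (\<lambda>y. v y $ i) x"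
    by (intro AE_all_countable[THEN iffD2] allI)
  then show ?thesis
    by eventually_elim (simp add: vtr_def vec_eq_iff)
qed

lemma L2_jmp: "u \<in> U0 G \<Longrightarrow> L2 (surf G) (jmp G u)"
  using L2_lincomb[OF L2_vtr[of u Plus] L2_vtr[of u Minus], of 1 "-1"] by (simp add: jmp_def[abs_def])

lemma jmp_lincomb:
  assumes "u \<in> U0 G" "v \<in> U0 G"
  shows "AE x in surf G. jmp G (\<lambda>y. a *\<^sub>R u y + b *\<^sub>R v y) x = a *\<^sub>R jmp G u x + b *\<^sub>R jmp G v x"
  using vtr_lincomb[OF assms, of Plus a b] vtr_lincomb[OF assms, of Minus a b]
  by eventually_elim (simp add: jmp_def algebra_simps)

lemma U0_lincomb:
  assumes "u \<in> U0 G" "v \<in> U0 G"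
  shows "(\<lambda>y. a *\<^sub>R u y + b *\<^sub>R v y) \<in> U0 G"
  unfolding U0_def
proof (intro CollectI allI conjI)
  fix i
  show "H1 (cut_dom G) (\<lambda>y. (a *\<^sub>R u y + b *\<^sub>R v y) $ i)"
    using H1_lincomb(1)[OF cut_open cut_bounded U0_H1[OF assms(1), of i] U0_H1[OF assms(2), of i], of a b] by simp
  have "AE x in surface_measure (bfaces G). trb G (\<lambda>y. a * u y $ i + b * v y $ i) x = a * trb G (\<lambda>y. u y $ i) x + b * trb G (\<lambda>y. v y $ i) x"
    using trb_trace U0_H1[OF assms(1)] U0_H1[OF assms(2)] unfolding trace_operator_def by blast
  moreover have "AE x in surface_measure (bfaces G). trb G (\<lambda>y. u y $ i) x = 0" "AE x in surface_measure (bfaces G). trb G (\<lambda>y. v y $ i) x = 0"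
    using assms by (auto simp: U0_def)
  ultimately show "AE x in surface_measure (bfaces G). trb G (\<lambda>y. (a *\<^sub>R u y + b *\<^sub>R v y) $ i) x = 0"
    by eventually_elim simp
qed

text \<open>
  By Korn's inequality the whole $H^1$ norm vanishes with the symmetric gradient, and the traces are
  bounded by it.
\<close>

lemma korn_null:
  assumes korn: "korn_inequality G" and z: "z \<in> U0 G" and n: "U0norm G z \<le> 0"
  shows "AE x in vol G. eps G z x = 0" "AE x in vol G. dvg G z x = 0" "AE x in vol G. z x = 0"
    "AE x in surf G. jmp G z x = 0"
proof -
  obtain C where C: "sqrt (\<Sum>i\<in>UNIV. (H1norm (cut_dom G) (\<lambda>y. z y $ i))\<^sup>2) \<le> C * U0norm G z"
    using korn z unfolding korn_inequality_def by blast
  have u0: "U0norm G z = 0"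
    using n unfolding U0norm_def L2norm_def by (intro antisym) auto
  have "(\<Sum>i\<in>UNIV. (H1norm (cut_dom G) (\<lambda>y. z y $ i))\<^sup>2) \<le> 0"
    using C u0 by (simp add: real_sqrt_le_0_iff)
  then have "(\<Sum>i\<in>UNIV. (H1norm (cut_dom G) (\<lambda>y. z y $ i))\<^sup>2) = 0"
    by (intro antisym sum_nonneg) auto
  then have h: "H1norm (cut_dom G) (\<lambda>y. z y $ i) = 0" for i
    by (subst (asm) sum_nonneg_eq_0_iff) auto
  have "(L2norm (lebesgue_on (cut_dom G)) (\<lambda>y. z y $ i))\<^sup>2 + (L2norm (lebesgue_on (cut_dom G)) (wgrad (cut_dom G) (\<lambda>y. z y $ i)))\<^sup>2 = 0" for i
    using h[of i] unfolding H1norm_def by simp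
  then have l: "L2norm (lebesgue_on (cut_dom G)) (\<lambda>y. z y $ i) = 0" "L2norm (lebesgue_on (cut_dom G)) (wgrad (cut_dom G) (\<lambda>y. z y $ i)) = 0" for i
    by (simp_all add: sum_power2_eq_zero_iff)
  have "AE x in vol G. wgrad (cut_dom G) (\<lambda>y. z y $ i) x = 0" for i
    by (intro AE_cut_vol L2norm_eq_0_AE) (auto simp: l wgrad_H1[OF cut_open cut_bounded] U0_H1[OF z])
  then have "AE x in vol G. \<forall>i. wgrad (cut_dom G) (\<lambda>y. z y $ i) x = 0" by (intro AE_all_countable[THEN iffD2] allI)
  then have j: "AE x in vol G. jac G z x = 0" by eventually_elim (simp add: jac_def vec_eq_iff)
  then show "AE x in vol G. eps G z x = 0" "AE x in vol G. dvg G z x = 0"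
    by (eventually_elim, simp add: eps_def dvg_def trace_def transpose_def vec_eq_iff)+
  have "AE x in vol G. z x $ i = 0" for i
    by (intro AE_cut_vol L2norm_eq_0_AE) (use U0_H1[OF z] in \<open>auto simp: l H1_def\<close>)
  then have "AE x in vol G. \<forall>i. z x $ i = 0" by (intro AE_all_countable[THEN iffD2] allI)
  then show "AE x in vol G. z x = 0" by eventually_elim (simp add: vec_eq_iff)
  have v: "AE x in surf G. vtr G s z x = 0" for s
  proof -
    have "AE x in surf G. tr G s (\<lambda>y. z y $ i) x = 0" for i
    proof (rule L2norm_eq_0_AE)
      show "L2 (surf G) (tr G s (\<lambda>y. z y $ i))"
        using trace_side[of s] U0_H1[OF z] unfolding trace_operator_def by blast
      obtain C where "L2norm (surf G) (tr G s (\<lambda>y. z y $ i)) \<le> C * H1norm (cut_dom G) (\<lambda>y. z y $ i)"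
        using trace_side[of s] U0_H1[OF z, of i] unfolding trace_operator_def by blast
      then show "L2norm (surf G) (tr G s (\<lambda>y. z y $ i)) \<le> 0" using h by simp
    qed
    then have "AE x in surf G. \<forall>i. tr G s (\<lambda>y. z y $ i) x = 0" by (intro AE_all_countable[THEN iffD2] allI)
    then show ?thesis by eventually_elim (simp add: vtr_def vec_eq_iff)
  qed
  show "AE x in surf G. jmp G z x = 0" using v[of Plus] v[of Minus] by eventually_elim (simp add: jmp_def)
qed

end

section \<open>Parametric Riesz representation\<close>

text \<open>
  Displacements are plain functions, so spaces of displacements and linear maps on them are expressed
  through pointwise linear combinations.
\<close>

definition fun_space :: "('x \<Rightarrow> 'v::real_vector) set \<Rightarrow> bool" where
  "fun_space U \<longleftrightarrow> (\<lambda>x. 0) \<in> U \<and> (\<forall>u\<in>U. \<forall>v\<in>U. \<forall>p q. (\<lambda>x. p *\<^sub>R u x + q *\<^sub>R v x) \<in> U)"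

definition fun_linear :: "('x \<Rightarrow> 'v::real_vector) set \<Rightarrow> (('x \<Rightarrow> 'v) \<Rightarrow> 'w::real_vector) \<Rightarrow> bool" where
  "fun_linear U f \<longleftrightarrow> (\<forall>u\<in>U. \<forall>v\<in>U. \<forall>p q. f (\<lambda>x. p *\<^sub>R u x + q *\<^sub>R v x) = p *\<^sub>R f u + q *\<^sub>R f v)"

lemma fun_spaceD:
  "fun_space U \<Longrightarrow> (\<lambda>x. 0) \<in> U"
  "fun_space U \<Longrightarrow> u \<in> U \<Longrightarrow> v \<in> U \<Longrightarrow> (\<lambda>x. p *\<^sub>R u x + q *\<^sub>R v x) \<in> U"
  by (auto simp: fun_space_def)

lemma fun_linearD:
  "fun_linear U f \<Longrightarrow> u \<in> U \<Longrightarrow> v \<in> U \<Longrightarrow> f (\<lambda>x. p *\<^sub>R u x + q *\<^sub>R v x) = p *\<^sub>R f u + q *\<^sub>R f v"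
  by (auto simp: fun_linear_def)

lemma fun_linear_0: "fun_linear U f \<Longrightarrow> fun_space U \<Longrightarrow> f (\<lambda>x. 0) = 0"
  using fun_linearD[of U f "\<lambda>x. 0" "\<lambda>x. 0" 0 0] fun_spaceD(1)[of U] by simp

lemma fun_space_lincomb:
  assumes U: "fun_space U" and B: "finite B" "B \<subseteq> U"
  shows "(\<lambda>x. \<Sum>w\<in>B. c w *\<^sub>R w x) \<in> U"
  using B
proof (induction B rule: finite_induct)
  case (insert w B)
  then have "(\<lambda>x. c w *\<^sub>R w x + 1 *\<^sub>R (\<Sum>w\<in>B. c w *\<^sub>R w x)) \<in> U" by (intro fun_spaceD(2)[OF U]) auto
  then show ?case using insert by simp
qed (simp add: fun_spaceD[OF U])

lemma fun_linear_lincomb: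
  assumes U: "fun_space U" and f: "fun_linear U f" and B: "finite B" "B \<subseteq> U"
  shows "f (\<lambda>x. \<Sum>w\<in>B. c w *\<^sub>R w x) = (\<Sum>w\<in>B. c w *\<^sub>R f w)"
  using B
proof (induction B rule: finite_induct)
  case (insert w B)
  have "f (\<lambda>x. c w *\<^sub>R w x + 1 *\<^sub>R (\<Sum>w\<in>B. c w *\<^sub>R w x)) = c w *\<^sub>R f w + 1 *\<^sub>R f (\<lambda>x. \<Sum>w\<in>B. c w *\<^sub>R w x)"
    by (rule fun_linearD[OF f]) (use insert fun_space_lincomb[OF U] in auto)
  then show ?case using insert by simp
qed (simp add: fun_linear_0[OF f U])

text \<open>
  The form may vanish on non-zero functions, because the energy sees its arguments only up to null
  sets.
\<close>

locale energy_form =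
  fixes U :: "('x \<Rightarrow> 'v::real_vector) set" and a :: "('x \<Rightarrow> 'v) \<Rightarrow> ('x \<Rightarrow> 'v) \<Rightarrow> real"
  assumes U: "fun_space U"
    and a_lin: "v \<in> U \<Longrightarrow> fun_linear U (\<lambda>u. a u v)"
    and a_sym: "u \<in> U \<Longrightarrow> v \<in> U \<Longrightarrow> a u v = a v u"
    and a_pos: "u \<in> U \<Longrightarrow> 0 \<le> a u u"
begin

lemma a_comb_left:
  "u \<in> U \<Longrightarrow> v \<in> U \<Longrightarrow> w \<in> U \<Longrightarrow> a (\<lambda>x. p *\<^sub>R u x + q *\<^sub>R v x) w = p * a u w + q * a v w"
  using fun_linearD[OF a_lin] by simp

lemma a_comb_right:
  "u \<in> U \<Longrightarrow> v \<in> U \<Longrightarrow> w \<in> U \<Longrightarrow> a w (\<lambda>x. p *\<^sub>R u x + q *\<^sub>R v x) = p * a w u + q * a w v"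
  using a_comb_left[of u v w p q] a_sym fun_spaceD(2)[OF U, of u v p q] by simp

lemma a_lin_right: "u \<in> U \<Longrightarrow> fun_linear U (a u)"
  unfolding fun_linear_def using a_comb_right by simp

text \<open>
  The coefficients are built by Gram--Schmidt. When a generator \<open>b\<close> is added, its part \<open>b2\<close>
  orthogonal to the previous ones is obtained from the induction hypothesis for the functional
  \<open>a b\<close>. If \<open>b2\<close> has positive energy, the value \<open>l z b\<close> fixes its coefficient as a continuous
  function of \<open>z\<close>; if not, \<open>l z\<close> does not see \<open>b2\<close> and the coefficient 0 is right. Linearly dependent
  generators are thereby covered.
\<close>

lemma parametric_riesz:
  fixes l :: "'z::topological_space \<Rightarrow> ('x \<Rightarrow> 'v) \<Rightarrow> real"
  assumes B: "finite B" "B \<subseteq> U"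
    and l: "\<And>z. fun_linear U (l z)" and null: "\<And>z u. u \<in> U \<Longrightarrow> a u u = 0 \<Longrightarrow> l z u = 0"
    and cont: "\<And>u. u \<in> U \<Longrightarrow> continuous_on UNIV (\<lambda>z. l z u)"
  shows "\<exists>C. (\<forall>w. continuous_on UNIV (\<lambda>z. C z w)) \<and>
    (\<forall>z. \<forall>v\<in>B. a (\<lambda>x. \<Sum>w\<in>B. C z w *\<^sub>R w x) v = l z v)"
  using B l null cont
proof (induction B arbitrary: l rule: finite_induct)
  case empty
  show ?case by (intro exI[of _ "\<lambda>z w. 0"]) auto
next
  case (insert b B)
  have b: "b \<in> U" and BU: "B \<subseteq> U" using insert.prems by auto
  have span: "(\<lambda>x. \<Sum>w\<in>B. c w *\<^sub>R w x) \<in> U" for c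
    using fun_space_lincomb[OF U insert.hyps(1) BU] .
  obtain C where C: "\<And>w. continuous_on UNIV (\<lambda>z. C z w)"
    and Cl: "\<And>z v. v \<in> B \<Longrightarrow> a (\<lambda>x. \<Sum>w\<in>B. C z w *\<^sub>R w x) v = l z v"
  proof -
    have "\<exists>C. (\<forall>w. continuous_on UNIV (\<lambda>z. C z w)) \<and> (\<forall>z. \<forall>v\<in>B. a (\<lambda>x. \<Sum>w\<in>B. C z w *\<^sub>R w x) v = l z v)"
      by (rule insert.IH[OF BU insert.prems(2,3,4)])
    then show ?thesis using that by blast
  qed
  \<comment> \<open>The functional \<open>a b\<close>, with a dummy parameter so that the induction hypothesis applies.\<close>
  define lb where "lb = (\<lambda>z::'z. a b)"
  \<comment> \<open>Cauchy--Schwarz: otherwise the energy would be negative somewhere on the line \<open>b + t u\<close>.\<close>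
  have null_b: "a b u = 0" if "u \<in> U" "a u u = 0" for u
  proof (rule ccontr)
    assume nz: "a b u \<noteq> 0"
    define t where "t = - (a b b + 1) / (2 * a b u)"
    have "0 \<le> a (\<lambda>x. 1 *\<^sub>R b x + t *\<^sub>R u x) (\<lambda>x. 1 *\<^sub>R b x + t *\<^sub>R u x)"
      by (intro a_pos fun_spaceD(2)[OF U] b that)
    also have "\<dots> = a b b + 2 * t * a b u + t * t * a u u"
      using b that fun_spaceD(2)[OF U b that(1), of 1 t] a_sym[OF that(1) b]
      by (simp only: a_comb_left a_comb_right) (simp add: algebra_simps)
    also have "\<dots> = -1" using nz that(2) unfolding t_def by (simp add: field_simps)
    finally show False by simp
  qed
  have "\<exists>E. (\<forall>w. continuous_on UNIV (\<lambda>z. E z w)) \<and> (\<forall>z. \<forall>v\<in>B. a (\<lambda>x. \<Sum>w\<in>B. E z w *\<^sub>R w x) v = lb z v)"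
    unfolding lb_def by (rule insert.IH[OF BU]) (auto intro: a_lin_right b null_b)
  then obtain E0 where E0: "\<And>z v. v \<in> B \<Longrightarrow> a (\<lambda>x. \<Sum>w\<in>B. E0 z w *\<^sub>R w x) v = a b v"
    unfolding lb_def by blast
  define e where "e = E0 undefined"
  define b1 where "b1 = (\<lambda>x. \<Sum>w\<in>B. e w *\<^sub>R w x)"
  have b1: "b1 \<in> U" "\<And>v. v \<in> B \<Longrightarrow> a b1 v = a b v" unfolding b1_def e_def using span E0 by auto
  define b2 where "b2 = (\<lambda>x. 1 *\<^sub>R b x + (-1) *\<^sub>R b1 x)"
  have b2: "b2 \<in> U" unfolding b2_def by (intro fun_spaceD(2)[OF U] b b1)
  have b2v: "a b2 v = 0" if "v \<in> B" for v
    using that b b1 BU unfolding b2_def by (subst a_comb_left) auto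
  have b2b1: "a b2 b1 = 0"
    using fun_linear_lincomb[OF U a_lin_right[OF b2] insert.hyps(1) BU, of e] b2v
    by (simp add: b1_def)
  have b2b: "a b2 b = a b2 b2"
  proof -
    have "a b2 b2 = 1 * a b2 b + (-1) * a b2 b1"
      by (subst (2) b2_def) (intro a_comb_right b b1 b2)
    then show ?thesis using b2b1 by simp
  qed
  define u1 where "u1 z = (\<lambda>x. \<Sum>w\<in>B. C z w *\<^sub>R w x)" for z
  have u1: "u1 z \<in> U" for z unfolding u1_def by (rule span)
  define t where "t z = (if a b2 b2 = 0 then 0 else (l z b - a (u1 z) b) / a b2 b2)" for z
  define C' where "C' z w = (if w = b then t z else C z w - t z * e w)" for z w
  have u1b: "a (u1 z) b = (\<Sum>w\<in>B. C z w * a w b)" for z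
    unfolding u1_def using fun_linear_lincomb[OF U a_lin[OF b] insert.hyps(1) BU] by simp
  have ct: "continuous_on UNIV t"
  proof (cases "a b2 b2 = 0")
    case False
    then have "t = (\<lambda>z. (l z b - (\<Sum>w\<in>B. C z w * a w b)) / a b2 b2)"
      unfolding t_def u1b by auto
    then show ?thesis using False by (auto intro!: continuous_intros C insert.prems(4) b)
  next
    case True
    then show ?thesis by (simp add: t_def[abs_def])
  qed
  have C'eq: "(\<lambda>x. \<Sum>w\<in>insert b B. C' z w *\<^sub>R w x) = (\<lambda>x. 1 *\<^sub>R u1 z x + t z *\<^sub>R b2 x)" for z
  proof
    fix x
    have "(\<Sum>w\<in>B. C' z w *\<^sub>R w x) = (\<Sum>w\<in>B. C z w *\<^sub>R w x - t z *\<^sub>R (e w *\<^sub>R w x))"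
      by (rule sum.cong[OF refl]) (use insert.hyps(2) in \<open>auto simp: C'_def algebra_simps\<close>)
    also have "\<dots> = u1 z x - t z *\<^sub>R b1 x"
      unfolding u1_def b1_def by (simp add: sum_subtractf scaleR_sum_right)
    finally show "(\<Sum>w\<in>insert b B. C' z w *\<^sub>R w x) = 1 *\<^sub>R u1 z x + t z *\<^sub>R b2 x"
      using insert.hyps unfolding b2_def by (simp add: C'_def algebra_simps)
  qed
  have main: "a (\<lambda>x. 1 *\<^sub>R u1 z x + t z *\<^sub>R b2 x) v = l z v" if v: "v \<in> insert b B" for z v
  proof (cases "v = b")
    case False
    then have "v \<in> B" "v \<in> U" using v BU by auto
    moreover have "a (u1 z) v = l z v" unfolding u1_def by (rule Cl) fact
    ultimately show ?thesis using b2v[of v] by (subst a_comb_left[OF u1 b2]) auto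
  next
    case True
    have "l z b = a (u1 z) b" if z: "a b2 b2 = 0"
    proof -
      have "l z b2 = 0" using insert.prems(3)[OF b2 z] .
      moreover have "l z b2 = 1 *\<^sub>R l z b + (-1) *\<^sub>R l z b1"
        unfolding b2_def by (rule fun_linearD[OF insert.prems(2) b b1(1)])
      ultimately have "l z b = l z b1" by simp
      also have "\<dots> = (\<Sum>w\<in>B. e w * l z w)"
        unfolding b1_def using fun_linear_lincomb[OF U insert.prems(2) insert.hyps(1) BU] by simp
      also have "\<dots> = (\<Sum>w\<in>B. e w * a (u1 z) w)" using Cl by (simp add: u1_def)
      also have "\<dots> = a (u1 z) b1"
        unfolding b1_def using fun_linear_lincomb[OF U a_lin_right[OF u1] insert.hyps(1) BU] by simp
      also have "\<dots> = a b1 (u1 z)" by (rule a_sym[OF u1 b1(1)])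
      also have "\<dots> = (\<Sum>w\<in>B. C z w * a b1 w)"
        unfolding u1_def using fun_linear_lincomb[OF U a_lin_right[OF b1(1)] insert.hyps(1) BU] by simp
      also have "\<dots> = (\<Sum>w\<in>B. C z w * a b w)" using b1(2) by simp
      also have "\<dots> = a b (u1 z)"
        unfolding u1_def using fun_linear_lincomb[OF U a_lin_right[OF b] insert.hyps(1) BU] by simp
      also have "\<dots> = a (u1 z) b" by (rule a_sym[OF b u1])
      finally show ?thesis .
    qed
    then show ?thesis unfolding True by (subst a_comb_left[OF u1 b2 b]) (simp add: b2b t_def)
  qed
  show ?case
  proof (intro exI[of _ C'] conjI allI ballI)
    fix w show "continuous_on UNIV (\<lambda>z. C' z w)"
      unfolding C'_def using ct C by (cases "w = b") (auto intro!: continuous_intros)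
  next
    fix z v assume "v \<in> insert b B"
    then show "a (\<lambda>x. \<Sum>w\<in>insert b B. C' z w *\<^sub>R w x) v = l z v"
      unfolding C'eq by (rule main)
  qed
qed

end

section \<open>Fixed point\<close>

text \<open>
  For $r \ge 0$ this is the metric projection onto the closed ball of radius \<open>r\<close> around 0. At $r = 0$
  it is 0, also at $y = 0$, where the quotient has the default value 0.
\<close>

definition ball_proj :: "real \<Rightarrow> 'a::real_inner \<Rightarrow> 'a" where
  "ball_proj r y = (r / max r (norm y)) *\<^sub>R y"

lemma norm_ball_proj_le: "0 \<le> r \<Longrightarrow> norm (ball_proj r y) \<le> r"
proof (cases "max r (norm y) = 0")
  case False
  assume r: "0 \<le> r"
  have "norm (ball_proj r y) = r * norm y / max r (norm y)" using r unfolding ball_proj_def by simp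
  also have "\<dots> \<le> r * max r (norm y) / max r (norm y)" using r
    by (intro divide_right_mono mult_left_mono) auto
  also have "\<dots> = r" using False by simp
  finally show ?thesis .
qed (auto simp: ball_proj_def)

text \<open>
  Where both the radius and the argument vanish the quotient is singular, but the value is bounded
  by the radius.
\<close>

lemma continuous_on_ball_proj:
  fixes y :: "'z::topological_space \<Rightarrow> 'a::real_inner"
  assumes r: "continuous_on S r" and y: "continuous_on S y" and r0: "\<And>z. z \<in> S \<Longrightarrow> 0 \<le> r z"
  shows "continuous_on S (\<lambda>z. ball_proj (r z) (y z))"
  unfolding continuous_on_def
proof
  fix z assume z: "z \<in> S"
  have rl: "(r \<longlongrightarrow> r z) (at z within S)" and yl: "(y \<longlongrightarrow> y z) (at z within S)"
    using r y z by (auto simp: continuous_on_def)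
  show "((\<lambda>z. ball_proj (r z) (y z)) \<longlongrightarrow> ball_proj (r z) (y z)) (at z within S)"
  proof (cases "max (r z) (norm (y z)) = 0")
    case False
    then show ?thesis unfolding ball_proj_def by (intro tendsto_intros rl yl)
  next
    case True
    then have "r z = 0" using r0[OF z] by (metis max.cobounded1 antisym)
    then have "(r \<longlongrightarrow> 0) (at z within S)" using rl by simp
    moreover have "\<forall>\<^sub>F w in at z within S. norm (ball_proj (r w) (y w)) \<le> r w"
      unfolding eventually_at_filter by (intro always_eventually) (auto intro: norm_ball_proj_le r0)
    ultimately have "((\<lambda>z. ball_proj (r z) (y z)) \<longlongrightarrow> 0) (at z within S)"
      by (rule Lim_null_comparison[rotated])
    then show ?thesis using \<open>r z = 0\<close> by (simp add: ball_proj_def)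
  qed
qed

text \<open>
  That \<open>x\<close> is the projection of $x + J$ means that \<open>J\<close> belongs to the normal cone of the ball at \<open>x\<close>: it
  is zero in the interior and a non-negative multiple of \<open>x\<close> on the sphere.
\<close>

lemma ball_proj_fixed_point:
  assumes r: "0 \<le> r" and x: "x = ball_proj r (x + J)"
  shows "norm x \<le> r" and "norm m \<le> r \<Longrightarrow> (m - x) \<bullet> J \<le> 0" and "norm x < r \<Longrightarrow> J = 0"
proof -
  show xr: "norm x \<le> r" using norm_ball_proj_le[OF r] x by metis
  have cases: "J = 0 \<or> (norm x = r \<and> (\<exists>c\<ge>0. J = c *\<^sub>R x)) \<or> r = 0"
  proof (cases "r = 0 \<or> norm (x + J) \<le> r")
    case True
    then show ?thesis
    proof
      assume "norm (x + J) \<le> r"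
      then have "ball_proj r (x + J) = x + J \<or> r = 0" by (auto simp: ball_proj_def max_def)
      then show ?thesis using x by (metis add_cancel_right_right)
    qed simp
  next
    case False
    define k where "k = norm (x + J)"
    have k: "k > r" "r > 0" using False r by (auto simp: k_def)
    have e: "x = (r / k) *\<^sub>R (x + J)" using x k by (simp add: ball_proj_def k_def[symmetric] max_def)
    have "norm x = norm ((r / k) *\<^sub>R (x + J))" by (rule arg_cong[OF e])
    also have "\<dots> = r" using k by (simp add: k_def[symmetric])
    finally have nx: "norm x = r" .
    have "(k / r) *\<^sub>R x = (k / r) *\<^sub>R ((r / k) *\<^sub>R (x + J))" by (rule arg_cong[OF e])
    also have "\<dots> = x + J" using k by simp
    finally have "J = (k / r - 1) *\<^sub>R x" by (simp add: algebra_simps)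
    moreover have "k / r - 1 \<ge> 0" using k by simp
    ultimately show ?thesis using nx by blast
  qed
  show "(m - x) \<bullet> J \<le> 0" if m: "norm m \<le> r"
    using cases
  proof (elim disjE conjE exE)
    fix c :: real assume c: "c \<ge> 0" "J = c *\<^sub>R x" and nx: "norm x = r"
    have "m \<bullet> x \<le> norm m * norm x" by (rule norm_cauchy_schwarz)
    also have "\<dots> \<le> r * r" using m nx r by (intro mult_mono) auto
    also have "\<dots> = x \<bullet> x" using nx by (metis power2_eq_square power2_norm_eq_inner)
    finally have "(m - x) \<bullet> x \<le> 0" by (simp add: inner_diff_left)
    then show ?thesis using c by (simp add: mult_nonneg_nonpos)
  next
    assume "r = 0"
    then have "m = 0" "x = 0" using m xr by auto
    then show ?thesis by simp
  qed simp
  show "J = 0" if "norm x < r"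
    using cases that norm_ge_zero[of x] by (elim disjE conjE) auto
qed

text \<open>
  The one-dimensional analogue: \<open>j\<close> belongs to the normal cone of the interval $[0,R]$ at \<open>l\<close>.
\<close>

lemma clamp_fixed_point:
  fixes l j R :: real
  assumes R: "0 \<le> R" and l: "l = max 0 (min R (l + j))"
  shows "0 \<le> l" "l \<le> R" "0 \<le> l * j" "l < R \<Longrightarrow> j \<le> 0" "l < R \<Longrightarrow> l * j = 0"
proof -
  show 0: "0 \<le> l" and 1: "l \<le> R" using R l by linarith+
  have d: "l = 0 \<and> j \<le> 0 \<or> l = R \<and> 0 \<le> j \<or> j = 0" using l R by (auto simp: max_def min_def split: if_splits)
  then show "0 \<le> l * j" using R by auto
  show "l < R \<Longrightarrow> j \<le> 0" "l < R \<Longrightarrow> l * j = 0" using d by auto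
qed

text \<open>
  Brouwer's theorem for the map that shifts the pressures by $-\rho$ and projects them onto the ball
  of radius \<open>R1\<close>, clamps the normal multiplier shifted by the normal jump to $[0,R_2]$, and
  projects the tangential multiplier shifted by \<open>Jt\<close> onto the ball with radius \<open>F\<close> times the updated
  normal multiplier. The values are bounded, so a product of two balls is mapped into itself. A fixed
  point solves a variational inequality for $\rho$ on the pressure ball, truncated non-penetration
  conditions, and the Coulomb friction law.
\<close>

lemma flow_contact_fixed_point:
  fixes \<rho> :: "'x::euclidean_space \<times> ((real^'d::finite)^'s::finite) \<Rightarrow> 'x"
    and Jn :: "'x \<times> ((real^'d)^'s) \<Rightarrow> 's \<Rightarrow> real" and Jt :: "'x \<times> ((real^'d)^'s) \<Rightarrow> 's \<Rightarrow> real^'d"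
    and n :: "'s \<Rightarrow> real^'d"
  assumes c\<rho>: "continuous_on UNIV \<rho>" and cJn: "\<And>s. continuous_on UNIV (\<lambda>z. Jn z s)"
    and cJt: "\<And>s. continuous_on UNIV (\<lambda>z. Jt z s)"
    and n: "\<And>s. norm (n s) = 1" and orth: "\<And>z s. Jt z s \<bullet> n s = 0"
    and R1: "0 \<le> R1" and R2: "0 \<le> R2" and F: "0 \<le> F"
  obtains p lam where "norm p \<le> R1" "\<And>q. norm q \<le> R1 \<Longrightarrow> 0 \<le> \<rho> (p, lam) \<bullet> (q - p)"
    "norm p < R1 \<Longrightarrow> \<rho> (p, lam) = 0"
    "\<And>s. lam $ s \<bullet> n s = max 0 (min R2 (lam $ s \<bullet> n s + Jn (p, lam) s))"
    "\<And>s. norm (lam $ s - (lam $ s \<bullet> n s) *\<^sub>R n s) \<le> F * (lam $ s \<bullet> n s)"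
    "\<And>s m. norm m \<le> F * (lam $ s \<bullet> n s) \<Longrightarrow> (m - (lam $ s - (lam $ s \<bullet> n s) *\<^sub>R n s)) \<bullet> Jt (p, lam) s \<le> 0"
proof -
  define c where "c z s = max 0 (min R2 (snd z $ s \<bullet> n s + Jn z s))" for z :: "'x \<times> ((real^'d)^'s)" and s
  define t where "t z s = ball_proj (F * c z s) (snd z $ s - (snd z $ s \<bullet> n s) *\<^sub>R n s + Jt z s)" for z :: "'x \<times> ((real^'d)^'s)" and s
  define \<Phi> where "\<Phi> z = (ball_proj R1 (fst z - \<rho> z), (\<chi> s. c z s *\<^sub>R n s + t z s))" for z
  define R3 where "R3 = real CARD('s) * (R2 + F * R2)"
  define K where "K = (cball 0 R1 :: 'x set) \<times> (cball 0 R3 :: ((real^'d)^'s) set)"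
  have c0: "0 \<le> c z s" "c z s \<le> R2" for z s using R2 by (auto simp: c_def)
  have cn: "\<And>s. continuous_on UNIV (\<lambda>z. c z s)"
    unfolding c_def by (intro continuous_intros cJn)
  have ct: "\<And>s. continuous_on UNIV (\<lambda>z. t z s)"
    unfolding t_def by (intro continuous_on_ball_proj continuous_intros cn cJt) (simp add: F c0)
  have c\<Phi>: "continuous_on K \<Phi>"
    unfolding \<Phi>_def
    by (rule continuous_on_subset[OF _ subset_UNIV])
      (intro continuous_on_Pair continuous_on_vec_lambda continuous_on_ball_proj continuous_intros c\<rho> cn ct R1)
  have tn: "t z s \<bullet> n s = 0" for z s
  proof -
    have "n s \<bullet> n s = 1" using n[of s] by (metis norm_eq_1)
    then show ?thesis unfolding t_def ball_proj_def by (simp add: inner_add_left inner_diff_left orth)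
  qed
  have "\<Phi> \<in> K \<rightarrow> K"
  proof
    fix z assume "z \<in> K"
    have "norm (snd (\<Phi> z)) \<le> (\<Sum>s\<in>UNIV. norm (snd (\<Phi> z) $ s))"
      unfolding norm_vec_def by (rule L2_set_le_sum) simp
    also have "\<dots> \<le> (\<Sum>s\<in>(UNIV::'s set). R2 + F * R2)"
    proof (rule sum_mono)
      fix s
      have "norm (snd (\<Phi> z) $ s) \<le> norm (c z s *\<^sub>R n s) + norm (t z s)"
        using norm_triangle_ineq[of "c z s *\<^sub>R n s" "t z s"] unfolding \<Phi>_def by simp
      also have "\<dots> \<le> c z s + F * c z s"
        using n c0 F norm_ball_proj_le[of "F * c z s"] unfolding t_def by (intro add_mono) auto
      also have "\<dots> \<le> R2 + F * R2" using c0 F by (intro add_mono mult_left_mono)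
      finally show "norm (snd (\<Phi> z) $ s) \<le> R2 + F * R2" .
    qed
    also have "\<dots> = R3" by (simp add: R3_def)
    finally show "\<Phi> z \<in> K" unfolding K_def mem_Times_iff
      using norm_ball_proj_le[OF R1] by (simp add: \<Phi>_def)
  qed
  moreover have "0 \<le> R3" using R2 F by (simp add: R3_def)
  moreover have "compact K" "convex K" unfolding K_def by (intro compact_Times convex_Times compact_cball convex_cball)+
  moreover have "K \<noteq> {}" using R1 calculation(2) by (auto simp: K_def)
  ultimately have "\<exists>z\<in>K. \<Phi> z = z"
    using c\<Phi> by (metis brouwer)
  then obtain z where z: "z \<in> K" "\<Phi> z = z" by blast
  obtain p lam where pl: "z = (p, lam)" by (cases z)
  have p: "p = ball_proj R1 (p + (- \<rho> (p, lam)))" using z(2) by (simp add: \<Phi>_def pl)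
  have lam: "lam $ s = c z s *\<^sub>R n s + t z s" for s
    using z(2) pl unfolding \<Phi>_def by (metis snd_conv vec_lambda_beta)
  have nn: "n s \<bullet> n s = 1" for s using n[of s] by (metis norm_eq_1)
  have ln: "lam $ s \<bullet> n s = c z s" for s unfolding lam using tn nn by (simp add: inner_add_left)
  have lt: "lam $ s - (lam $ s \<bullet> n s) *\<^sub>R n s = t z s" for s unfolding ln unfolding lam by simp
  have fix_t: "t z s = ball_proj (F * c z s) (t z s + Jt (p, lam) s)" for s
    using lt[of s] by (subst t_def) (simp add: pl)
  have Fc: "0 \<le> F * c z s" for s using F c0 by simp
  show ?thesis
  proof (rule that[of p lam])
    show "norm p \<le> R1" by (rule ball_proj_fixed_point(1)[OF R1 p])
    show "0 \<le> \<rho> (p, lam) \<bullet> (q - p)" if "norm q \<le> R1" for q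
      using ball_proj_fixed_point(2)[OF R1 p that] by (simp add: inner_commute)
    show "\<rho> (p, lam) = 0" if "norm p < R1"
      using ball_proj_fixed_point(3)[OF R1 p that] by simp
    show "lam $ s \<bullet> n s = max 0 (min R2 (lam $ s \<bullet> n s + Jn (p, lam) s))" for s
      using ln[of s] unfolding c_def pl by simp
    show "norm (lam $ s - (lam $ s \<bullet> n s) *\<^sub>R n s) \<le> F * (lam $ s \<bullet> n s)" for s
      unfolding lt unfolding ln by (rule ball_proj_fixed_point(1)[OF Fc fix_t])
    show "(m - (lam $ s - (lam $ s \<bullet> n s) *\<^sub>R n s)) \<bullet> Jt (p, lam) s \<le> 0" if "norm m \<le> F * (lam $ s \<bullet> n s)" for s m
      unfolding lt by (rule ball_proj_fixed_point(2)[OF Fc fix_t]) (use that ln in simp)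
  qed
qed

section \<open>Continuity of integrals with respect to parameters\<close>

text \<open>
  Up to null sets \<open>F\<close> is a Caratheodory function that is dominated, for the parameters of each ball, by
  an element of \<open>Bs\<close>. The representative \<open>F'\<close> is there because operators that are linear almost
  everywhere have exceptional sets depending on the argument. With integrable bounds the
  integral depends continuously on the parameter, by dominated convergence; with constant bounds the class is
  stable under continuous nonlinear operations.
\<close>

definition pdom :: "('a \<Rightarrow> real) set \<Rightarrow> 'a measure \<Rightarrow> ('z::euclidean_space \<Rightarrow> 'a \<Rightarrow> 'b::euclidean_space) \<Rightarrow> bool" where
  "pdom Bs M F \<longleftrightarrow> (\<forall>z. F z \<in> borel_measurable M) \<and>
     (\<exists>F'. (\<forall>z. AE x in M. F z x = F' z x) \<and> (\<forall>z. F' z \<in> borel_measurable M) \<and>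
        (\<forall>x. continuous_on UNIV (\<lambda>z. F' z x)) \<and>
        (\<forall>r. \<exists>w\<in>Bs. AE x in M. \<forall>z\<in>cball 0 r. norm (F' z x) \<le> w x))"

abbreviation pint :: "'a measure \<Rightarrow> ('z::euclidean_space \<Rightarrow> 'a \<Rightarrow> 'b::euclidean_space) \<Rightarrow> bool" where
  "pint M \<equiv> pdom {w. integrable M w} M"

abbreviation pbdd :: "'a measure \<Rightarrow> ('z::euclidean_space \<Rightarrow> 'a \<Rightarrow> 'b::euclidean_space) \<Rightarrow> bool" where
  "pbdd M \<equiv> pdom (range (\<lambda>C x. C)) M"

lemma pdomE:
  assumes "pdom Bs M F"
  obtains F' where "\<And>z. F z \<in> borel_measurable M" "\<And>z. AE x in M. F z x = F' z x" "\<And>z. F' z \<in> borel_measurable M"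
    "\<And>x. continuous_on UNIV (\<lambda>z. F' z x)" "\<And>r. \<exists>w\<in>Bs. AE x in M. \<forall>z\<in>cball 0 r. norm (F' z x) \<le> w x"
  using assms unfolding pdom_def by blast

lemma pint_integrable:
  assumes "pint M F" shows "integrable M (F z)"
proof -
  obtain F' where F: "F z \<in> borel_measurable M" "AE x in M. F z x = F' z x"
    and d: "\<exists>w\<in>{w. integrable M w}. AE x in M. \<forall>z'\<in>cball 0 (norm z). norm (F' z' x) \<le> w x"
    using assms by (rule pdomE) blast
  obtain w where w: "integrable M w" "AE x in M. \<forall>z'\<in>cball 0 (norm z). norm (F' z' x) \<le> w x" using d by blast
  show ?thesis
  proof (rule Bochner_Integration.integrable_bound[OF w(1) F(1)])
    show "AE x in M. norm (F z x) \<le> norm (w x)"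
      using w(2) F(2)
    proof eventually_elim
      case (elim x)
      then have "norm (F' z x) \<le> w x" by simp
      then show ?case using elim(2) by simp
    qed
  qed
qed

lemma pint_continuous:
  fixes F :: "'z::euclidean_space \<Rightarrow> 'a \<Rightarrow> 'b::euclidean_space"
  assumes "pint M F" shows "continuous_on UNIV (\<lambda>z. LINT x|M. F z x)"
proof (rule continuous_on_sequentiallyI)
  obtain F' where Fm: "\<And>z. F z \<in> borel_measurable M" and F': "\<And>z. AE x in M. F z x = F' z x" "\<And>z. F' z \<in> borel_measurable M"
    "\<And>x. continuous_on UNIV (\<lambda>z. F' z x)"
    "\<And>r. \<exists>w\<in>{w. integrable M w}. AE x in M. \<forall>z\<in>cball 0 r. norm (F' z x) \<le> w x"
    using assms by (rule pdomE) blast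
  have eq: "(LINT x|M. F z x) = (LINT x|M. F' z x)" for z
    by (rule integral_cong_AE) (use Fm F' in auto)
  fix u :: "nat \<Rightarrow> 'z" and a assume u: "u \<longlonglongrightarrow> a"
  obtain r where r: "\<And>n. norm (u n) \<le> r"
    using convergent_imp_Bseq[OF convergentI[OF u]] unfolding Bseq_def by blast
  obtain w where w: "integrable M w" "AE x in M. \<forall>z\<in>cball 0 r. norm (F' z x) \<le> w x"
    using F'(4) by blast
  show "(\<lambda>n. LINT x|M. F (u n) x) \<longlonglongrightarrow> (LINT x|M. F a x)"
    unfolding eq
  proof (rule integral_dominated_convergence[OF F'(2) F'(2) w(1)])
    show "AE x in M. (\<lambda>n. F' (u n) x) \<longlonglongrightarrow> F' a x"
      by (intro AE_I2 continuous_on_tendsto_compose[OF F'(3) u]) auto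
    show "AE x in M. norm (F' (u n) x) \<le> w x" for n
      using w(2) by eventually_elim (use r in simp)
  qed
qed

lemma pdom_comp2:
  fixes F :: "'z::euclidean_space \<Rightarrow> 'a \<Rightarrow> 'b::euclidean_space" and H :: "'z \<Rightarrow> 'a \<Rightarrow> 'c::euclidean_space"
    and h :: "'b \<Rightarrow> 'c \<Rightarrow> 'd::euclidean_space"
  assumes F: "pdom V M F" and H: "pdom Bs M H" and h: "continuous_on UNIV (\<lambda>p. h (fst p) (snd p))"
    and dom: "\<And>v w. v \<in> V \<Longrightarrow> w \<in> Bs \<Longrightarrow> \<exists>y\<in>Y. \<forall>x b c. norm b \<le> v x \<longrightarrow> norm c \<le> w x \<longrightarrow> norm (h b c) \<le> y x"
  shows "pdom Y M (\<lambda>z x. h (F z x) (H z x))"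
proof -
  obtain F' where Fm: "\<And>z. F z \<in> borel_measurable M" and F': "\<And>z. AE x in M. F z x = F' z x" "\<And>z. F' z \<in> borel_measurable M"
    "\<And>x. continuous_on UNIV (\<lambda>z. F' z x)" "\<And>r. \<exists>w\<in>V. AE x in M. \<forall>z\<in>cball 0 r. norm (F' z x) \<le> w x"
    using F by (rule pdomE) blast
  obtain H' where Hm: "\<And>z. H z \<in> borel_measurable M" and H': "\<And>z. AE x in M. H z x = H' z x" "\<And>z. H' z \<in> borel_measurable M"
    "\<And>x. continuous_on UNIV (\<lambda>z. H' z x)" "\<And>r. \<exists>w\<in>Bs. AE x in M. \<forall>z\<in>cball 0 r. norm (H' z x) \<le> w x"
    using H by (rule pdomE) blast
  have hm: "(\<lambda>x. h (k x) (l x)) \<in> borel_measurable M" if "k \<in> borel_measurable M" "l \<in> borel_measurable M" for k l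
    using measurable_compose[OF borel_measurable_Pair[OF that] borel_measurable_continuous_onI[OF h]] by simp
  show ?thesis
    unfolding pdom_def
  proof (intro conjI allI exI[of _ "\<lambda>z x. h (F' z x) (H' z x)"])
    show "AE x in M. h (F z x) (H z x) = h (F' z x) (H' z x)" for z
      using F'(1)[of z] H'(1)[of z] by eventually_elim simp
    show "continuous_on UNIV (\<lambda>z. h (F' z x) (H' z x))" for x
      using continuous_on_compose2[OF h continuous_on_Pair[OF F'(3) H'(3)]] by simp
    fix r
    obtain v where v: "v \<in> V" "AE x in M. \<forall>z\<in>cball 0 r. norm (F' z x) \<le> v x" using F'(4) by blast
    obtain w where w: "w \<in> Bs" "AE x in M. \<forall>z\<in>cball 0 r. norm (H' z x) \<le> w x" using H'(4) by blast
    obtain y where y: "y \<in> Y" "\<And>x b c. norm b \<le> v x \<Longrightarrow> norm c \<le> w x \<Longrightarrow> norm (h b c) \<le> y x"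
      using dom[OF v(1) w(1)] by blast
    show "\<exists>w\<in>Y. AE x in M. \<forall>z\<in>cball 0 r. norm (h (F' z x) (H' z x)) \<le> w x"
      by (rule bexI[OF _ y(1)], use v(2) w(2) in eventually_elim) (use y(2) in blast)
  qed (rule hm[OF Fm Hm], rule hm[OF F'(2) H'(2)])
qed

lemma pbdd_comp2:
  fixes h :: "'b::euclidean_space \<Rightarrow> 'c::euclidean_space \<Rightarrow> 'd::euclidean_space"
  assumes "pbdd M F" "pbdd M H" and h: "continuous_on UNIV (\<lambda>p. h (fst p) (snd p))"
  shows "pbdd M (\<lambda>z x. h (F z x) (H z x))"
proof (rule pdom_comp2[OF assms])
  fix v w :: "'a \<Rightarrow> real" assume "v \<in> range (\<lambda>C x. C)" "w \<in> range (\<lambda>C x. C)"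
  then obtain C E where CE: "v = (\<lambda>x. C)" "w = (\<lambda>x. E)" by blast
  have "compact ((\<lambda>p. h (fst p) (snd p)) ` (cball 0 C \<times> cball 0 E))"
    by (intro compact_continuous_image continuous_on_subset[OF h] compact_Times) auto
  then obtain B where "\<forall>y\<in>(\<lambda>p. h (fst p) (snd p)) ` (cball 0 C \<times> cball 0 E). norm y \<le> B"
    using compact_imp_bounded[of "(\<lambda>p. h (fst p) (snd p)) ` (cball 0 C \<times> cball 0 E)"] unfolding bounded_iff by blast
  then show "\<exists>y\<in>range (\<lambda>C x. C). \<forall>x b c. norm b \<le> v x \<longrightarrow> norm c \<le> w x \<longrightarrow> norm (h b c) \<le> y x"
    unfolding CE by (intro bexI[of _ "\<lambda>x. B"]) auto
qed

lemma pbdd_comp: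
  fixes h :: "'b::euclidean_space \<Rightarrow> 'c::euclidean_space"
  assumes F: "pbdd M F" and h: "continuous_on UNIV h"
  shows "pbdd M (\<lambda>z x. h (F z x))"
  by (rule pbdd_comp2[OF F F, of "\<lambda>b c. h b"]) (auto intro!: continuous_on_compose2[OF h] continuous_intros)

lemma pbdd_add: "pbdd M F \<Longrightarrow> pbdd M H \<Longrightarrow> pbdd M (\<lambda>z x. F z x + H z x)"
  by (erule pbdd_comp2) (auto intro!: continuous_intros)

lemma pbdd_diff: "pbdd M F \<Longrightarrow> pbdd M H \<Longrightarrow> pbdd M (\<lambda>z x. F z x - H z x)"
  by (erule pbdd_comp2) (auto intro!: continuous_intros)

lemma pbdd_mult:
  fixes F H :: "'z::euclidean_space \<Rightarrow> 'a \<Rightarrow> real"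
  shows "pbdd M F \<Longrightarrow> pbdd M H \<Longrightarrow> pbdd M (\<lambda>z x. F z x * H z x)"
  by (erule pbdd_comp2) (auto intro!: continuous_intros)

lemma pbdd_inner: "pbdd M F \<Longrightarrow> pbdd M H \<Longrightarrow> pbdd M (\<lambda>z x. F z x \<bullet> H z x)"
  by (erule pbdd_comp2) (auto intro!: continuous_intros)

lemma pbdd_power:
  fixes F :: "'z::euclidean_space \<Rightarrow> 'a \<Rightarrow> real"
  shows "pbdd M F \<Longrightarrow> pbdd M (\<lambda>z x. F z x ^ k)"
  by (erule pbdd_comp) (auto intro!: continuous_intros)

lemma pbdd_max:
  fixes F H :: "'z::euclidean_space \<Rightarrow> 'a \<Rightarrow> real"
  shows "pbdd M F \<Longrightarrow> pbdd M H \<Longrightarrow> pbdd M (\<lambda>z x. max (F z x) (H z x))"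
  by (erule pbdd_comp2) (auto intro!: continuous_intros)

lemma pbdd_matrix_vector:
  fixes F :: "'z::euclidean_space \<Rightarrow> 'a \<Rightarrow> real^'n::finite^'m::finite"
  shows "pbdd M F \<Longrightarrow> pbdd M H \<Longrightarrow> pbdd M (\<lambda>z x. F z x *v H z x)"
  by (erule pbdd_comp2)
    (auto simp: matrix_vector_mult_def intro!: continuous_intros continuous_on_vec_lambda)

lemma pbdd_param:
  assumes c: "continuous_on UNIV c" shows "pbdd M (\<lambda>z x. c z)"
  unfolding pdom_def
proof (intro conjI allI exI[of _ "\<lambda>z x. c z"])
  fix r
  have "compact (c ` cball 0 r)" by (intro compact_continuous_image continuous_on_subset[OF c]) auto
  then obtain D where "\<forall>y\<in>c ` cball 0 r. norm y \<le> D"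
    using compact_imp_bounded[of "c ` cball 0 r"] unfolding bounded_iff by blast
  then show "\<exists>w\<in>range (\<lambda>C x. C). AE x in M. \<forall>z\<in>cball 0 r. norm (c z) \<le> w x"
    by (intro bexI[of _ "\<lambda>x. D"] AE_I2) auto
qed (use c in auto)

lemma pdom_const: "g \<in> borel_measurable M \<Longrightarrow> w \<in> Bs \<Longrightarrow> AE x in M. norm (g x) \<le> w x \<Longrightarrow> pdom Bs M (\<lambda>z x. g x)"
  unfolding pdom_def by (intro conjI allI exI[of _ "\<lambda>z x. g x"] bexI[of _ w]) auto

lemma pbdd_const: "Linf M g \<Longrightarrow> pbdd M (\<lambda>z x. g x)"
  unfolding Linf_def by (elim conjE exE) (rule pdom_const, auto)

lemma pint_const: "integrable M g \<Longrightarrow> pint M (\<lambda>z x. g x)"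
  by (rule pdom_const[of _ _ "\<lambda>x. norm (g x)"]) auto

lemma pdom_cong_AE:
  assumes F: "pdom Bs M F" and e: "\<And>z. AE x in M. F z x = H z x" and m: "\<And>z. H z \<in> borel_measurable M"
  shows "pdom Bs M H"
proof -
  obtain F' where F': "\<And>z. AE x in M. F z x = F' z x" "\<And>z. F' z \<in> borel_measurable M"
    "\<And>x. continuous_on UNIV (\<lambda>z. F' z x)" "\<And>r. \<exists>w\<in>Bs. AE x in M. \<forall>z\<in>cball 0 r. norm (F' z x) \<le> w x"
    using F by (rule pdomE) blast
  have "AE x in M. H z x = F' z x" for z
    using F'(1)[of z] e[of z] by eventually_elim simp
  then show ?thesis unfolding pdom_def using F'(2-4) m by blast
qed

lemma pbdd_sum: "finite I \<Longrightarrow> (\<And>i. i \<in> I \<Longrightarrow> pbdd M (F i)) \<Longrightarrow> pbdd M (\<lambda>z x. \<Sum>i\<in>I. F i z x)"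
  by (induction I rule: finite_induct) (simp_all add: pbdd_param pbdd_add)

lemma pint_mult:
  fixes F H :: "'z::euclidean_space \<Rightarrow> 'a \<Rightarrow> real"
  assumes "pbdd M F" "pint M H"
  shows "pint M (\<lambda>z x. F z x * H z x)"
proof (rule pdom_comp2[OF assms])
  fix v w :: "'a \<Rightarrow> real" assume "v \<in> range (\<lambda>C x. C)" "w \<in> {w. integrable M w}"
  then obtain C where C: "v = (\<lambda>x. C)" and w: "integrable M w" by blast
  have "norm (b * c) \<le> \<bar>C\<bar> * \<bar>w x\<bar>" if "norm b \<le> C" "norm c \<le> w x" for b c :: real and x
    using that by (auto simp: abs_mult intro!: mult_mono)
  then show "\<exists>y\<in>{w. integrable M w}. \<forall>x b c. norm (b::real) \<le> v x \<longrightarrow> norm (c::real) \<le> w x \<longrightarrow> norm (b * c) \<le> y x"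
    unfolding C using w by (intro bexI[of _ "\<lambda>x. \<bar>C\<bar> * \<bar>w x\<bar>"]) auto
qed (intro continuous_intros)

lemma pint_add:
  assumes "pint M F" "pint M H"
  shows "pint M (\<lambda>z x. F z x + H z x)"
proof (rule pdom_comp2[OF assms])
  fix v w :: "'a \<Rightarrow> real" assume "v \<in> {w. integrable M w}" "w \<in> {w. integrable M w}"
  then show "\<exists>y\<in>{w. integrable M w}. \<forall>x b c. norm (b::'c) \<le> v x \<longrightarrow> norm c \<le> w x \<longrightarrow> norm (b + c) \<le> y x"
    by (intro bexI[of _ "\<lambda>x. v x + w x"]) (auto intro: order_trans[OF norm_triangle_ineq] add_mono)
qed (intro continuous_intros)

lemma (in finite_measure) pint_bdd:
  assumes "pbdd M F" shows "pint M F"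
proof -
  obtain F' where F': "\<And>z. F z \<in> borel_measurable M" "\<And>z. AE x in M. F z x = F' z x" "\<And>z. F' z \<in> borel_measurable M"
    "\<And>x. continuous_on UNIV (\<lambda>z. F' z x)" "\<And>r. \<exists>w\<in>range (\<lambda>C x. C). AE x in M. \<forall>z\<in>cball 0 r. norm (F' z x) \<le> w x"
    using assms by (rule pdomE) blast
  have "\<exists>w\<in>{w. integrable M w}. AE x in M. \<forall>z\<in>cball 0 r. norm (F' z x) \<le> w x" for r
  proof -
    obtain C where "AE x in M. \<forall>z\<in>cball 0 r. norm (F' z x) \<le> C" using F'(5)[of r] by blast
    then show ?thesis by (intro bexI[of _ "\<lambda>x. C"]) auto
  qed
  then show ?thesis unfolding pdom_def using F'(1-4) by blast
qed

lemma pint_diff: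
  fixes F H :: "'z::euclidean_space \<Rightarrow> 'a \<Rightarrow> real"
  assumes "pint M F" "pint M H" shows "pint M (\<lambda>z x. F z x - H z x)"
  using pint_add[OF assms(1) pint_mult[OF pbdd_param[OF continuous_on_const, of M "-1"] assms(2)]] by simp

lemma pint_sum:
  fixes F :: "'i \<Rightarrow> 'z::euclidean_space \<Rightarrow> 'a \<Rightarrow> 'b::euclidean_space"
  shows "finite I \<Longrightarrow> (\<And>i. i \<in> I \<Longrightarrow> pint M (F i)) \<Longrightarrow> pint M (\<lambda>z x. \<Sum>i\<in>I. F i z x)"
  by (induction I rule: finite_induct) (simp_all add: pint_add pint_const)

lemma ae_linear_expand:
  fixes L :: "'v::euclidean_space \<Rightarrow> 'a \<Rightarrow> 'b::euclidean_space"
  assumes L: "ae_linear M L"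
  shows "AE x in M. L v x = (\<Sum>b\<in>Basis. (v \<bullet> b) *\<^sub>R L b x)"
proof -
  have L2: "AE x in M. L (p *\<^sub>R v + q *\<^sub>R w) x = p *\<^sub>R L v x + q *\<^sub>R L w x" for p q v w
    using L unfolding ae_linear_def by blast
  have "AE x in M. L (\<Sum>b\<in>B. c b *\<^sub>R b) x = (\<Sum>b\<in>B. c b *\<^sub>R L b x)" if "finite B" for B :: "'v set" and c
    using that
  proof (induction B rule: finite_induct)
    case empty
    show ?case using L2[of 0 0 0 0] by eventually_elim simp
  next
    case (insert b B)
    from insert.IH L2[of "c b" b 1 "\<Sum>b\<in>B. c b *\<^sub>R b"] show ?case
      by eventually_elim (simp add: insert.hyps)
  qed
  from this[of Basis "\<lambda>b. v \<bullet> b"] show ?thesis by (simp add: euclidean_representation)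
qed

text \<open>
  For each parameter, \<open>L\<close> agrees almost everywhere with the combination of its values at the basis
  vectors, and this combination is continuous in the parameter at every point.
\<close>

lemma pbdd_linear:
  fixes L :: "'v::euclidean_space \<Rightarrow> 'a \<Rightarrow> 'b::euclidean_space"
  assumes L: "ae_linear M L" and Li: "\<And>v. Linf M (L v)" and c: "continuous_on UNIV c"
  shows "pbdd M (\<lambda>z x. L (c z) x)"
proof (rule pdom_cong_AE)
  show "pbdd M (\<lambda>z x. \<Sum>b\<in>Basis. (c z \<bullet> b) *\<^sub>R L b x)"
  proof (rule pbdd_sum)
    fix b :: 'v assume "b \<in> Basis"
    have "pbdd M (\<lambda>z x. c z \<bullet> b)" by (rule pbdd_param) (intro continuous_intros c)
    then show "pbdd M (\<lambda>z x. (c z \<bullet> b) *\<^sub>R L b x)"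
      by (rule pbdd_comp2[OF _ pbdd_const[OF Li]]) (auto intro!: continuous_intros)
  qed simp
  show "AE x in M. (\<Sum>b\<in>Basis. (c z \<bullet> b) *\<^sub>R L b x) = L (c z) x" for z
    using ae_linear_expand[OF L, of "c z"] by eventually_elim simp
  show "L (c z) \<in> borel_measurable M" for z using Li by (simp add: Linf_def)
qed

lemma ae_partition_cell:
  assumes "ae_partition M A"
  shows "AE x in M. \<exists>i. x \<in> A i \<and> (\<forall>v :: 'b::real_vector^'i::finite. pwc A v x = v $ i)"
proof -
  have dj: "disjoint_family A" and cov: "AE x in M. x \<in> (\<Union>i. A i)" using assms by (auto simp: ae_partition_def)
  from cov show ?thesis
  proof eventually_elim
    case (elim x)
    then obtain i where i: "x \<in> A i" by blast
    have "pwc A v x = v $ i" for v :: "'b^'i"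
    proof -
      have "pwc A v x = (\<Sum>j\<in>UNIV. if j = i then v $ i else 0)"
        unfolding pwc_def
        by (rule sum.cong[OF refl]) (use i dj in \<open>auto simp: indicator_def disjoint_family_on_def\<close>)
      then show ?thesis by simp
    qed
    then show ?case using i by blast
  qed
qed

lemma pwc_measurable:
  fixes v :: "'b::euclidean_space^'i::finite"
  assumes "ae_partition M A" shows "pwc A v \<in> borel_measurable M"
proof -
  have "(\<lambda>x. \<Sum>i\<in>UNIV. indicator (A i) x *\<^sub>R v $ i) \<in> borel_measurable M"
    using assms by (intro borel_measurable_sum borel_measurable_scaleR borel_measurable_indicator) (auto simp: ae_partition_def)
  then show ?thesis by (simp add: pwc_def[abs_def])
qed

lemma pwc_Linf:
  fixes v :: "'b::euclidean_space^'i::finite"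
  assumes "ae_partition M A" shows "Linf M (pwc A v)"
proof -
  have "AE x in M. norm (pwc A v x) \<le> norm v"
    using ae_partition_cell[OF assms, where 'b = 'b]
  proof eventually_elim
    case (elim x)
    then obtain i where "pwc A v x = v $ i" by blast
    then show ?case by (simp add: Finite_Cartesian_Product.norm_nth_le)
  qed
  then show ?thesis using pwc_measurable[OF assms] by (auto simp: Linf_def)
qed

lemma pwc_linear: "pwc A (a *\<^sub>R v + b *\<^sub>R w) x = a *\<^sub>R pwc A v x + b *\<^sub>R pwc A w x"
  unfolding pwc_def scaleR_sum_right sum.distrib[symmetric]
  by (rule sum.cong) (simp_all add: algebra_simps)

lemma pbdd_pwc:
  fixes c :: "'z::euclidean_space \<Rightarrow> 'b::euclidean_space^'i::finite"
  assumes A: "ae_partition M A" and c: "continuous_on UNIV c"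
  shows "pbdd M (\<lambda>z x. pwc A (c z) x)"
  by (rule pbdd_linear[OF _ pwc_Linf[OF A] c]) (simp add: ae_linear_def pwc_linear)

section \<open>The elastic problem\<close>

text \<open>
  The pressures of both phases are kept as one point of a Euclidean space, to which Brouwer's theorem
  applies; this is the phase-indexed family that the equations refer to.
\<close>

definition by_phase :: "'a \<times> 'a \<Rightarrow> phase \<Rightarrow> 'a" where
  "by_phase x \<alpha> = (case \<alpha> of NW \<Rightarrow> fst x | W \<Rightarrow> snd x)"

lemma by_phase_simps [simp]: "by_phase x NW = fst x" "by_phase x W = snd x"
  by (simp_all add: by_phase_def)

lemma continuous_on_by_phase: "continuous_on S f \<Longrightarrow> continuous_on S (\<lambda>z. by_phase (f z) \<alpha>)"
  by (cases \<alpha>) (auto intro: continuous_intros)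

lemma LINT_pwc_inner:
  fixes v :: "'b::euclidean_space^'i::finite" and f :: "'a \<Rightarrow> 'b"
  assumes A: "\<And>i. A i \<in> sets M" and f: "integrable M f"
  shows "integrable M (\<lambda>x. pwc A v x \<bullet> f x)"
    and "(LINT x|M. pwc A v x \<bullet> f x) = (\<Sum>i\<in>UNIV. v $ i \<bullet> (LINT x:A i|M. f x))"
proof -
  have i: "integrable M (\<lambda>x. indicator (A i) x *\<^sub>R f x)" for i
    using A f by (intro integrable_mult_indicator)
  have e: "pwc A v x \<bullet> f x = (\<Sum>i\<in>UNIV. v $ i \<bullet> (indicator (A i) x *\<^sub>R f x))" for x
    by (simp add: pwc_def inner_sum_left)
  show "integrable M (\<lambda>x. pwc A v x \<bullet> f x)" unfolding e
    by (intro Bochner_Integration.integrable_sum integrable_inner_right) (rule i)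
  show "(LINT x|M. pwc A v x \<bullet> f x) = (\<Sum>i\<in>UNIV. v $ i \<bullet> (LINT x:A i|M. f x))"
  proof -
    have "(LINT x|M. pwc A v x \<bullet> f x) = (\<Sum>i\<in>UNIV. LINT x|M. v $ i \<bullet> (indicator (A i) x *\<^sub>R f x))"
      unfolding e by (intro Bochner_Integration.integral_sum integrable_inner_right) (rule i)
    also have "\<dots> = (\<Sum>i\<in>UNIV. v $ i \<bullet> (LINT x:A i|M. f x))"
      unfolding set_lebesgue_integral_def by (intro sum.cong refl integral_inner_right) (rule i)
    finally show ?thesis .
  qed
qed

locale poromechanics = fractured G
  for G :: "('d::finite) geometry" +
  fixes D :: "'d model"
    and P :: "('d, 'e::finite, 'm::finite, 'f::finite) flow_disc"
    and Q :: "('d, 's::finite) mech_disc"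
    and T cinf :: real
  assumes card: "CARD('d) \<in> {2, 3}"
    and korn: "korn_inequality G"
    and model: "model_data G T D"
    and flow: "flow_discretization G D P"
    and mech: "mech_discretization G Q"
    and infsup: "0 < cinf" "inf_sup_condition G Q cinf"
    and phi0: "AE x in vol G. 0 \<le> Pim P (intphi P (phibar D)) x"
begin

lemma mechanical_constants:
  "0 < young D" "-1 < poisson D" "poisson D < 1/2" "0 \<le> fric D" "0 \<le> biot D" "0 < Mbiot D" "L2 (vol G) (bodyf D)"
  "aperture_data G (d0 D)"
  using model unfolding model_data_def by simp_all

lemma Snw_props: "range (Snw D rt) \<subseteq> {0..1}" "mono (Snw D rt)" "\<exists>L. L-lipschitz_on UNIV (Snw D rt)"
proof -
  have *: "\<forall>rt. range (Snw D rt) \<subseteq> {0..1} \<and> mono (Snw D rt) \<and> (\<exists>L. L-lipschitz_on UNIV (Snw D rt))"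
    using model unfolding model_data_def by (elim conjE)
  show "range (Snw D rt) \<subseteq> {0..1}" "mono (Snw D rt)" "\<exists>L. L-lipschitz_on UNIV (Snw D rt)"
    using spec[OF *, of rt] by simp_all
qed

lemma invM_nonneg: "0 \<le> invM D"
  using mechanical_constants(6) unfolding invM_def
  by (cases "Mbiot D") (auto simp: one_ereal_def)

lemma continuous_Sat: "continuous_on UNIV (Sat D \<alpha> rt)"
proof -
  have "continuous_on UNIV (Snw D rt)" using Snw_props(3) lipschitz_on_continuous_on by blast
  moreover have "Sat D \<alpha> rt = (\<lambda>q. if \<alpha> = NW then Snw D rt q else 1 - Snw D rt q)"
    by (rule ext) (cases \<alpha>; simp)
  ultimately show ?thesis by (cases \<alpha>) (auto intro!: continuous_intros)
qed

lemma Sat_range: "0 \<le> Sat D \<alpha> rt q" "Sat D \<alpha> rt q \<le> 1"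
  using Snw_props(1)[of rt] by (cases \<alpha>; force simp: image_subset_iff)+

lemma capU_props:
  "capU D rt p - capU D rt q \<le> p * (Snw D rt p - Snw D rt q)" "0 \<le> capU D rt p" "continuous_on UNIV (capU D rt)"
proof -
  obtain L where L: "L-lipschitz_on UNIV (Snw D rt)" using Snw_props(3) by blast
  have e: "capU D rt = (\<lambda>p. (LBINT q=ereal 0..ereal p. q * deriv (Snw D rt) q))"
    by (rule ext) (simp add: capU_def zero_ereal_def)
  show "capU D rt p - capU D rt q \<le> p * (Snw D rt p - Snw D rt q)" "0 \<le> capU D rt p" "continuous_on UNIV (capU D rt)"
    unfolding e using capillary_energy_properties[OF Snw_props(2) L] by blast+
qed

lemma disp_basis:
  "\<exists>B. finite B \<and> B \<subseteq> U0 G \<and> dispV Q = {(\<lambda>x. \<Sum>w\<in>B. c w *\<^sub>R w x) | c. True}"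
  using mech unfolding mech_discretization_def by (elim conjE)

text \<open>
  Displacements are parametrized by their coefficients with respect to one finite generating set,
  so that continuous dependence of a displacement means that of its coefficients.
\<close>

definition disp_gen where "disp_gen = (SOME B. finite B \<and> B \<subseteq> U0 G \<and> dispV Q = {(\<lambda>x. \<Sum>w\<in>B. c w *\<^sub>R w x) | c. True})"

definition disp_comb :: "((real^'d \<Rightarrow> real^'d) \<Rightarrow> real) \<Rightarrow> real^'d \<Rightarrow> real^'d" where
  "disp_comb c = (\<lambda>x. \<Sum>w\<in>disp_gen. c w *\<^sub>R w x)"

lemma disp_gen: "finite disp_gen" "disp_gen \<subseteq> U0 G" "dispV Q = range disp_comb"
proof -
  from disp_basis have "finite disp_gen \<and> disp_gen \<subseteq> U0 G \<and> dispV Q = {(\<lambda>x. \<Sum>w\<in>disp_gen. c w *\<^sub>R w x) | c. True}"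
    unfolding disp_gen_def by (rule someI_ex)
  then show "finite disp_gen" "disp_gen \<subseteq> U0 G" "dispV Q = range disp_comb" by (auto simp: disp_comb_def[abs_def])
qed

lemma U0_fun_space: "fun_space (U0 G)"
proof -
  have "dispV Q \<subseteq> U0 G" using mech unfolding mech_discretization_def by (elim conjE)
  moreover have "disp_comb (\<lambda>w. 0) \<in> dispV Q" using disp_gen(3) by simp
  ultimately have "(\<lambda>x. 0) \<in> U0 G" by (auto simp: disp_comb_def)
  then show ?thesis unfolding fun_space_def using U0_lincomb by simp
qed

lemma disp_comb_U0: "disp_comb c \<in> U0 G" and disp_comb_V: "disp_comb c \<in> dispV Q"
  using fun_space_lincomb[OF U0_fun_space disp_gen(1,2)] disp_gen(3) unfolding disp_comb_def by auto

lemma dispV_subset: "dispV Q \<subseteq> U0 G" using disp_comb_U0 disp_gen(3) by auto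

lemma disp_comb_lincomb: "(\<lambda>x. a *\<^sub>R disp_comb c x + b *\<^sub>R disp_comb e x) = disp_comb (\<lambda>w. a * c w + b * e w)"
  by (rule ext) (simp add: disp_comb_def scaleR_sum_right sum.distrib[symmetric] algebra_simps)

lemma dispV_fun_space: "fun_space (dispV Q)"
  unfolding fun_space_def disp_gen(3)
proof (intro conjI ballI allI)
  show "(\<lambda>x. 0) \<in> range disp_comb" by (rule range_eqI[of _ _ "\<lambda>w. 0"]) (simp add: disp_comb_def)
qed (auto simp: disp_comb_lincomb)

lemma disp_gen_V: "disp_gen \<subseteq> dispV Q"
proof
  fix w assume w: "w \<in> disp_gen"
  have "disp_comb (\<lambda>v. if v = w then 1 else 0) = w"
    unfolding disp_comb_def using w disp_gen(1) by (simp add: if_distrib[of "\<lambda>c. c *\<^sub>R _"] cong: if_cong)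
  then show "w \<in> dispV Q" unfolding disp_gen(3) by (metis rangeI)
qed

definition elastic :: "(real^'d \<Rightarrow> real^'d) \<Rightarrow> (real^'d \<Rightarrow> real^'d) \<Rightarrow> real" where
  "elastic u v = (LINT x|vol G. stress G D u x \<bullet> eps G v x)"

lemma trace_eps: "trace (eps G v x) = dvg G v x"
  by (simp add: eps_def dvg_def trace_def transpose_def sum.distrib[symmetric] sum_divide_distrib[symmetric])

lemma mat1_inner: "mat 1 \<bullet> (A :: real^'d^'d) = trace A"
proof -
  have "(mat 1 :: real^'d^'d) $ i \<bullet> A $ i = A $ i $ i" for i
    unfolding inner_vec_def mat_def by (simp add: if_distrib[of "\<lambda>c. c * _"] cong: if_cong)
  then show ?thesis by (simp add: inner_vec_def[of "mat 1" A] trace_def)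
qed

lemma stress_inner:
  "stress G D u x \<bullet> eps G v x = young D / (1 + poisson D) *
     (eps G u x \<bullet> eps G v x + poisson D / (1 - 2 * poisson D) * (dvg G u x * dvg G v x))"
  by (simp add: stress_def inner_add_left mat1_inner trace_eps algebra_simps)

lemma stress_integrable:
  assumes "u \<in> U0 G" "v \<in> U0 G"
  shows "integrable (vol G) (\<lambda>x. stress G D u x \<bullet> eps G v x)"
  unfolding stress_inner
  using L2_inner_integrable[OF L2_eps L2_eps, OF assms] L2_inner_integrable[OF L2_dvg L2_dvg, OF assms]
  by simp

text \<open>
  Only a negative Poisson ratio is dangerous. As $(\mathrm{tr}\,A)^2 \le 3 |A|^2$ in dimension at most
  three, the trace term takes away at most the factor $1 + 3\nu/(1-2\nu) = (1+\nu)/(1-2\nu)$, which is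
  positive.
\<close>

lemma stress_coercive:
  "\<exists>c>0. \<forall>u x. c * (norm (eps G u x))\<^sup>2 \<le> stress G D u x \<bullet> eps G u x"
proof -
  define y where "y = young D / (1 + poisson D)"
  define k where "k = poisson D / (1 - 2 * poisson D)"
  define c0 where "c0 = min 1 (1 + 3 * k)"
  note mc = mechanical_constants(1,2,3)
  have y: "y > 0" using mc by (simp add: y_def)
  have "1 + 3 * k = (1 + poisson D) / (1 - 2 * poisson D)" using mc by (simp add: k_def field_simps)
  also have "\<dots> > 0" using mc by simp
  finally have c0: "c0 > 0" by (simp add: c0_def)
  have "y * c0 * (norm (eps G u x))\<^sup>2 \<le> stress G D u x \<bullet> eps G u x" for u x
  proof -
    define A where "A = eps G u x"
    have "(trace A)\<^sup>2 \<le> (\<Sum>i\<in>UNIV. (A $ i $ i)\<^sup>2) * real CARD('d)"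
      unfolding trace_def by (rule sum_squared_le_sum_of_squares)
    also have "\<dots> \<le> (norm A)\<^sup>2 * 3"
    proof (rule mult_mono)
      have "(\<Sum>i\<in>UNIV. (A $ i $ i)\<^sup>2) \<le> (\<Sum>i\<in>UNIV. (norm (A $ i))\<^sup>2)"
        by (intro sum_mono) (metis abs_ge_zero component_le_norm_cart power2_abs power_mono)
      also have "\<dots> = (norm A)\<^sup>2" by (simp add: norm_vec_def[of A] L2_set_def sum_nonneg)
      finally show "(\<Sum>i\<in>UNIV. (A $ i $ i)\<^sup>2) \<le> (norm A)\<^sup>2" .
    qed (use card in auto)
    finally have t: "(trace A)\<^sup>2 \<le> 3 * (norm A)\<^sup>2" by simp
    have "c0 * (norm A)\<^sup>2 \<le> (norm A)\<^sup>2 + k * (trace A)\<^sup>2"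
    proof (cases "k \<ge> 0")
      case True
      have "c0 * (norm A)\<^sup>2 \<le> 1 * (norm A)\<^sup>2" by (rule mult_right_mono) (auto simp: c0_def)
      then show ?thesis using True mult_nonneg_nonneg[OF True zero_le_power2[of "trace A"]] by linarith
    next
      case False
      have "c0 * (norm A)\<^sup>2 \<le> (1 + 3 * k) * (norm A)\<^sup>2" by (rule mult_right_mono) (auto simp: c0_def)
      moreover have "k * (3 * (norm A)\<^sup>2) \<le> k * (trace A)\<^sup>2" using False t by (intro mult_left_mono_neg) auto
      ultimately show ?thesis by (simp add: algebra_simps)
    qed
    then have "y * (c0 * (norm A)\<^sup>2) \<le> y * ((norm A)\<^sup>2 + k * (trace A)\<^sup>2)" using y by (intro mult_left_mono) auto
    also have "\<dots> = stress G D u x \<bullet> eps G u x"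
      unfolding stress_inner y_def k_def A_def trace_eps power2_norm_eq_inner by (simp add: power2_eq_square)
    finally show ?thesis by (simp add: A_def mult.assoc)
  qed
  then show ?thesis using y c0 by (intro exI[of _ "y * c0"]) simp
qed

lemma elastic_energy: "energy_form (U0 G) elastic"
proof
  show "fun_space (U0 G)" by (rule U0_fun_space)
  show "fun_linear (U0 G) (\<lambda>u. elastic u v)" if v: "v \<in> U0 G" for v
    unfolding fun_linear_def
  proof (intro ballI allI)
    fix u w p q assume uw: "u \<in> U0 G" "w \<in> U0 G"
    have "elastic (\<lambda>x. p *\<^sub>R u x + q *\<^sub>R w x) v = (LINT x|vol G. p *\<^sub>R (stress G D u x \<bullet> eps G v x) + q *\<^sub>R (stress G D w x \<bullet> eps G v x))"
      unfolding elastic_def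
    proof (rule integral_cong_AE)
      show "AE x in vol G. stress G D (\<lambda>x. p *\<^sub>R u x + q *\<^sub>R w x) x \<bullet> eps G v x
          = p *\<^sub>R (stress G D u x \<bullet> eps G v x) + q *\<^sub>R (stress G D w x \<bullet> eps G v x)"
        using eps_lincomb[OF uw, of p q] dvg_lincomb[OF uw, of p q]
        by eventually_elim (simp add: stress_inner inner_add_left algebra_simps)
    qed (use stress_integrable[OF U0_lincomb[OF uw] v] stress_integrable[OF uw(1) v] stress_integrable[OF uw(2) v] in auto)
    then show "elastic (\<lambda>x. p *\<^sub>R u x + q *\<^sub>R w x) v = p *\<^sub>R elastic u v + q *\<^sub>R elastic w v"
      using integral_lincomb[OF stress_integrable[OF uw(1) v] stress_integrable[OF uw(2) v], of p q] by (simp add: elastic_def)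
  qed
  show "elastic u v = elastic v u" for u v
    unfolding elastic_def stress_inner by (simp add: inner_commute mult.commute)
  show "0 \<le> elastic u u" if "u \<in> U0 G" for u
    unfolding elastic_def
  proof (rule integral_nonneg_AE, rule AE_I2)
    fix x
    obtain c where c: "c > 0" "c * (norm (eps G u x))\<^sup>2 \<le> stress G D u x \<bullet> eps G u x"
      using stress_coercive by metis
    show "0 \<le> stress G D u x \<bullet> eps G u x"
      by (rule order_trans[OF _ c(2)]) (use c(1) in simp)
  qed
qed

sublocale elastic: energy_form "U0 G" elastic
  by (rule elastic_energy)

lemma elastic_null:
  assumes u: "u \<in> U0 G" and 0: "elastic u u = 0"
  shows "U0norm G u \<le> 0"
proof -
  obtain c where c: "c > 0" "\<And>x. c * (norm (eps G u x))\<^sup>2 \<le> stress G D u x \<bullet> eps G u x"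
    using stress_coercive by metis
  have i: "integrable (vol G) (\<lambda>x. (norm (eps G u x))\<^sup>2)" using L2_eps[OF u] by (simp add: L2_def)
  have "c * (LINT x|vol G. (norm (eps G u x))\<^sup>2) = (LINT x|vol G. c * (norm (eps G u x))\<^sup>2)" by simp
  also have "\<dots> \<le> elastic u u" unfolding elastic_def
    by (intro integral_mono stress_integrable u c) (use i in simp)
  finally have "(LINT x|vol G. (norm (eps G u x))\<^sup>2) \<le> 0" using 0 c(1) by (simp add: mult_le_0_iff)
  then show ?thesis by (simp add: U0norm_def L2norm_def)
qed


lemma face_props:
  "ae_partition (surf G) (face Q)" "face Q \<sigma> \<in> sets (surf G)" "0 < measure (surf G) (face Q \<sigma>)"
  "own Q \<sigma> \<in> fracs G" "face Q \<sigma> \<subseteq> own Q \<sigma>"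
proof -
  show p: "ae_partition (surf G) (face Q)" using mech unfolding mech_discretization_def by (elim conjE)
  then show "face Q \<sigma> \<in> sets (surf G)" by (simp add: ae_partition_def)
  have *: "\<forall>\<sigma>. 0 < measure (surf G) (face Q \<sigma>) \<and> own Q \<sigma> \<in> fracs G \<and> face Q \<sigma> \<subseteq> own Q \<sigma>"
    using mech unfolding mech_discretization_def by (elim conjE)
  show "0 < measure (surf G) (face Q \<sigma>)" "own Q \<sigma> \<in> fracs G" "face Q \<sigma> \<subseteq> own Q \<sigma>"
    using spec[OF *, of \<sigma>] by simp_all
qed

lemma nface_norm: "norm (nface G Q \<sigma>) = 1" "nface G Q \<sigma> \<bullet> nface G Q \<sigma> = 1"
  using fracD(5)[OF face_props(4)] by (simp_all add: nface_def norm_eq_1)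

lemma nfield_face: "x \<in> face Q \<sigma> \<Longrightarrow> nfield G x = nface G Q \<sigma>"
  using nfield_eq[of x "own Q \<sigma>"] face_props(4,5)[of \<sigma>] by (auto simp: nface_def)

abbreviation area :: "'s \<Rightarrow> real" where "area \<sigma> \<equiv> measure (surf G) (face Q \<sigma>)"

definition face_jump :: "(real^'d \<Rightarrow> real^'d) \<Rightarrow> 's \<Rightarrow> real^'d" where
  "face_jump u \<sigma> = avg_face G Q Plus u \<sigma> - avg_face G Q Minus u \<sigma>"

definition face_jump_n :: "(real^'d \<Rightarrow> real^'d) \<Rightarrow> 's \<Rightarrow> real" where
  "face_jump_n u \<sigma> = face_jump u \<sigma> \<bullet> nface G Q \<sigma>"

definition face_jump_t :: "(real^'d \<Rightarrow> real^'d) \<Rightarrow> 's \<Rightarrow> real^'d" where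
  "face_jump_t u \<sigma> = face_jump u \<sigma> - face_jump_n u \<sigma> *\<^sub>R nface G Q \<sigma>"

lemma jmpF_eq: "jmpF G Q u = pwc (face Q) (\<chi> \<sigma>. face_jump_n u \<sigma>)"
  by (simp add: jmpF_def face_jump_n_def face_jump_def)

lemma jmp_integrable: "u \<in> U0 G \<Longrightarrow> integrable (surf G) (jmp G u)"
  by (rule surf.L2_integrable[OF L2_jmp])

lemma face_jump_eq:
  assumes "u \<in> U0 G"
  shows "area \<sigma> *\<^sub>R face_jump u \<sigma> = (LINT x:face Q \<sigma>|surf G. jmp G u x)"
proof -
  have i: "set_integrable (surf G) (face Q \<sigma>) (vtr G a u)" for a
    unfolding set_integrable_def
    by (intro integrable_mult_indicator surf.L2_integrable[OF L2_vtr] face_props assms)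
  show ?thesis
    using face_props(3)[of \<sigma>] unfolding jmp_def
    by (subst set_integral_diff(2)[OF i i]) (simp add: face_jump_def avg_face_def scaleR_diff_right)
qed

lemma fun_linear_LINT:
  fixes F :: "('x \<Rightarrow> 'v::real_vector) \<Rightarrow> 'a \<Rightarrow> 'b::euclidean_space"
  assumes U: "fun_space U" and i: "\<And>v. v \<in> U \<Longrightarrow> integrable M (F v)"
    and l: "\<And>u v p q. u \<in> U \<Longrightarrow> v \<in> U \<Longrightarrow> AE x in M. F (\<lambda>x. p *\<^sub>R u x + q *\<^sub>R v x) x = p *\<^sub>R F u x + q *\<^sub>R F v x"
  shows "fun_linear U (\<lambda>v. LINT x|M. F v x)"
  unfolding fun_linear_def
proof (intro ballI allI)
  fix u v p q assume uv: "u \<in> U" "v \<in> U"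
  have "(LINT x|M. F (\<lambda>x. p *\<^sub>R u x + q *\<^sub>R v x) x) = (LINT x|M. p *\<^sub>R F u x + q *\<^sub>R F v x)"
    by (rule integral_cong_AE) (use i[OF uv(1)] i[OF uv(2)] i[OF fun_spaceD(2)[OF U uv]] l[OF uv] in auto)
  then show "(LINT x|M. F (\<lambda>x. p *\<^sub>R u x + q *\<^sub>R v x) x) = p *\<^sub>R (LINT x|M. F u x) + q *\<^sub>R (LINT x|M. F v x)"
    using integral_lincomb[OF i[OF uv(1)] i[OF uv(2)]] by simp
qed

lemma fun_linear_add: "fun_linear U f \<Longrightarrow> fun_linear U g \<Longrightarrow> fun_linear U (\<lambda>v. f v + g v)"
  by (simp add: fun_linear_def algebra_simps)

lemma fun_linear_diff: "fun_linear U f \<Longrightarrow> fun_linear U g \<Longrightarrow> fun_linear U (\<lambda>v. f v - g v)"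
  by (simp add: fun_linear_def algebra_simps)

lemma fun_linear_scale: "fun_linear U f \<Longrightarrow> fun_linear U (\<lambda>v. (c::real) *\<^sub>R f v)"
  by (simp add: fun_linear_def algebra_simps)

lemma fun_linear_blinear: "fun_linear U f \<Longrightarrow> linear h \<Longrightarrow> fun_linear U (\<lambda>v. h (f v))"
  by (simp add: fun_linear_def linear_add linear_cmul)

lemma fun_linear_sum: "finite I \<Longrightarrow> (\<And>i. i \<in> I \<Longrightarrow> fun_linear U (f i)) \<Longrightarrow> fun_linear U (\<lambda>v. \<Sum>i\<in>I. f i v)"
proof (induction I rule: finite_induct)
  case (insert i I)
  then show ?case by (simp add: fun_linear_add)
qed (simp add: fun_linear_def)

lemma face_jump_linear: "fun_linear (U0 G) (\<lambda>u. face_jump u \<sigma>)"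
proof -
  have i: "integrable (surf G) (\<lambda>x. indicator (face Q \<sigma>) x *\<^sub>R jmp G v x)" if "v \<in> U0 G" for v
    by (intro integrable_mult_indicator jmp_integrable that face_props)
  have l: "fun_linear (U0 G) (\<lambda>u. LINT x:face Q \<sigma>|surf G. jmp G u x)"
    unfolding set_lebesgue_integral_def
  proof (rule fun_linear_LINT[OF U0_fun_space i])
    fix u v p q assume "u \<in> U0 G" "v \<in> U0 G"
    from jmp_lincomb[OF this, of p q]
    show "AE x in surf G. indicator (face Q \<sigma>) x *\<^sub>R jmp G (\<lambda>x. p *\<^sub>R u x + q *\<^sub>R v x) x
       = p *\<^sub>R indicator (face Q \<sigma>) x *\<^sub>R jmp G u x + q *\<^sub>R indicator (face Q \<sigma>) x *\<^sub>R jmp G v x"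
      by eventually_elim (simp add: algebra_simps)
  qed
  have e: "face_jump u \<sigma> = (1 / area \<sigma>) *\<^sub>R (LINT x:face Q \<sigma>|surf G. jmp G u x)" if "u \<in> U0 G" for u
    using face_jump_eq[OF that, of \<sigma>, symmetric] face_props(3)[of \<sigma>] by simp
  show ?thesis
    using fun_linear_scale[OF l, of "1 / area \<sigma>"] e fun_spaceD(2)[OF U0_fun_space] by (simp add: fun_linear_def)
qed

lemma face_jump_n_linear: "fun_linear (U0 G) (\<lambda>u. face_jump_n u \<sigma>)"
  unfolding face_jump_n_def by (rule fun_linear_blinear[OF face_jump_linear]) (intro bounded_linear.linear bounded_linear_inner_left)

lemma face_jump_t_linear: "fun_linear (U0 G) (\<lambda>u. face_jump_t u \<sigma>)"
  using face_jump_linear[of \<sigma>] face_jump_n_linear[of \<sigma>] unfolding face_jump_t_def fun_linear_def by (simp add: algebra_simps)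

lemma face_jump_t_orth: "face_jump_t u \<sigma> \<bullet> nface G Q \<sigma> = 0"
  by (simp add: face_jump_t_def face_jump_n_def inner_diff_left nface_norm)

definition traction :: "(real^'d)^'s \<Rightarrow> (real^'d \<Rightarrow> real^'d) \<Rightarrow> real" where
  "traction lam v = (\<Sum>\<sigma>\<in>UNIV. area \<sigma> * (lam $ \<sigma> \<bullet> face_jump v \<sigma>))"

lemma traction_LINT: "v \<in> U0 G \<Longrightarrow> (LINT x|surf G. pwc (face Q) lam x \<bullet> jmp G v x) = traction lam v"
  by (subst LINT_pwc_inner(2)[OF face_props(2) jmp_integrable])
    (simp_all add: traction_def face_jump_eq[symmetric])

lemma jmp_n_LINT:
  assumes v: "v \<in> U0 G"
  shows "(LINT x|surf G. pwc (face Q) \<nu> x * jmp_n G v x) = (\<Sum>\<sigma>\<in>UNIV. area \<sigma> * (\<nu> $ \<sigma> * face_jump_n v \<sigma>))"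
proof -
  have "pwc (face Q) \<nu> x * jmp_n G v x = pwc (face Q) (\<chi> \<sigma>. \<nu> $ \<sigma> *\<^sub>R nface G Q \<sigma>) x \<bullet> jmp G v x" for x
    unfolding pwc_def inner_sum_left sum_distrib_right
  proof (rule sum.cong[OF refl])
    fix \<sigma>
    show "indicator (face Q \<sigma>) x *\<^sub>R \<nu> $ \<sigma> * jmp_n G v x = indicator (face Q \<sigma>) x *\<^sub>R (\<chi> \<sigma>. \<nu> $ \<sigma> *\<^sub>R nface G Q \<sigma>) $ \<sigma> \<bullet> jmp G v x"
      by (cases "x \<in> face Q \<sigma>") (simp_all add: jmp_n_def nfield_face inner_commute)
  qed
  then have "(LINT x|surf G. pwc (face Q) \<nu> x * jmp_n G v x) = traction (\<chi> \<sigma>. \<nu> $ \<sigma> *\<^sub>R nface G Q \<sigma>) v"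
    using traction_LINT[OF v] by simp
  then show ?thesis by (simp add: traction_def face_jump_n_def inner_commute)
qed

lemma jmp_t_LINT:
  assumes v: "v \<in> U0 G"
  shows "(LINT x|surf G. pwc (face Q) \<tau> x \<bullet> jmp_t G v x) = (\<Sum>\<sigma>\<in>UNIV. area \<sigma> * (\<tau> $ \<sigma> \<bullet> face_jump_t v \<sigma>))"
    and "integrable (surf G) (\<lambda>x. pwc (face Q) \<tau> x \<bullet> jmp_t G v x)"
proof -
  define \<tau>' where "\<tau>' = (\<chi> \<sigma>. \<tau> $ \<sigma> - (\<tau> $ \<sigma> \<bullet> nface G Q \<sigma>) *\<^sub>R nface G Q \<sigma>)"
  have e: "pwc (face Q) \<tau> x \<bullet> jmp_t G v x = pwc (face Q) \<tau>' x \<bullet> jmp G v x" for x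
    unfolding pwc_def inner_sum_left
  proof (rule sum.cong[OF refl])
    fix \<sigma>
    show "indicator (face Q \<sigma>) x *\<^sub>R \<tau> $ \<sigma> \<bullet> jmp_t G v x = indicator (face Q \<sigma>) x *\<^sub>R \<tau>' $ \<sigma> \<bullet> jmp G v x"
      by (cases "x \<in> face Q \<sigma>")
        (simp_all add: jmp_t_def jmp_n_def nfield_face \<tau>'_def inner_diff_left inner_diff_right inner_commute)
  qed
  show "integrable (surf G) (\<lambda>x. pwc (face Q) \<tau> x \<bullet> jmp_t G v x)"
    unfolding e by (rule LINT_pwc_inner(1)[OF face_props(2) jmp_integrable[OF v]])
  have "(LINT x|surf G. pwc (face Q) \<tau> x \<bullet> jmp_t G v x) = traction \<tau>' v"
    using traction_LINT[OF v] e by simp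
  then show "(LINT x|surf G. pwc (face Q) \<tau> x \<bullet> jmp_t G v x) = (\<Sum>\<sigma>\<in>UNIV. area \<sigma> * (\<tau> $ \<sigma> \<bullet> face_jump_t v \<sigma>))"
    by (simp add: traction_def \<tau>'_def face_jump_t_def face_jump_n_def inner_diff_left inner_diff_right inner_commute mult.commute)
qed

text \<open>
  Fields of zero elastic energy are not seen by the functionals of the mechanical problem; this is the
  hypothesis that \<open>parametric_riesz\<close> needs for the elastic form.
\<close>

lemma null_functionals:
  assumes z: "z \<in> U0 G" and 0: "elastic z z = 0"
  shows "AE x in vol G. z x = 0" "AE x in vol G. dvg G z x = 0" "face_jump z \<sigma> = 0"
proof -
  note k = korn_null[OF korn z elastic_null[OF z 0]]
  show "AE x in vol G. z x = 0" "AE x in vol G. dvg G z x = 0" using k by auto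
  have "(LINT x:face Q \<sigma>|surf G. jmp G z x) = (LINT x|surf G. 0)"
    unfolding set_lebesgue_integral_def
  proof (rule integral_cong_AE)
    show "(\<lambda>x. indicator (face Q \<sigma>) x *\<^sub>R jmp G z x) \<in> borel_measurable (surf G)"
      by (intro borel_measurable_integrable integrable_mult_indicator jmp_integrable z face_props)
    show "AE x in surf G. indicator (face Q \<sigma>) x *\<^sub>R jmp G z x = 0"
      using k(4) by eventually_elim simp
  qed simp
  then show "face_jump z \<sigma> = 0" using face_jump_eq[OF z, of \<sigma>] face_props(3)[of \<sigma>] by simp
qed

text \<open>
  The body force together with the pressure terms, so that the mechanical equation is
  \<open>elastic u v + traction lam v = mech_load p v\<close>.
\<close>

definition mech_load :: "(phase \<Rightarrow> (real^'m) \<times> (real^'f)) \<Rightarrow> (real^'d \<Rightarrow> real^'d) \<Rightarrow> real" where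
  "mech_load p v = (LINT x|vol G. bodyf D x \<bullet> v x) + biot D * (LINT x|vol G. Pim P (pEm D p) x * dvg G v x)
     - (LINT x|surf G. Pif P (pEf D p) x * jmpF G Q v x)"

lemma flow_cells:
  "ae_partition (vol G) (cellm P)" "ae_partition (surf G) (cellf P)" "ae_partition (surf G) (cellt P a)"
  using flow unfolding flow_discretization_def by simp_all

lemma Pim_Linf: "Linf (vol G) (Pim P v)" unfolding Pim_def by (rule pwc_Linf[OF flow_cells(1)])
lemma Pif_Linf: "Linf (surf G) (Pif P v)" unfolding Pif_def by (rule pwc_Linf[OF flow_cells(2)])
lemma Tr_Linf: "Linf (surf G) (Tr P a v)" unfolding Tr_def by (rule pwc_Linf[OF flow_cells(3)])
lemma jmpF_Linf: "Linf (surf G) (jmpF G Q u)" unfolding jmpF_eq by (rule pwc_Linf[OF face_props(1)])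

lemma Pim_dvg_integrable:
  assumes "v \<in> U0 G" shows "integrable (vol G) (\<lambda>x. Pim P w x * dvg G v x)"
  using vol.L2_integrable[OF L2_bounded_scaleR[OF L2_dvg[OF assms] Pim_Linf]] by simp

lemma Pif_jmpF_integrable: "integrable (surf G) (\<lambda>x. Pif P w x * jmpF G Q v x)"
  using surf.L2_integrable[OF L2_bounded_scaleR[OF surf.Linf_L2[OF jmpF_Linf] Pif_Linf]] by simp

lemma jmpF_lincomb:
  assumes "u \<in> U0 G" "v \<in> U0 G"
  shows "jmpF G Q (\<lambda>x. p *\<^sub>R u x + q *\<^sub>R v x) x = p * jmpF G Q u x + q * jmpF G Q v x"
proof -
  have "(\<chi> \<sigma>. face_jump_n (\<lambda>x. p *\<^sub>R u x + q *\<^sub>R v x) \<sigma>) = p *\<^sub>R (\<chi> \<sigma>. face_jump_n u \<sigma>) + q *\<^sub>R (\<chi> \<sigma>. face_jump_n v \<sigma>)"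
    using fun_linearD[OF face_jump_n_linear assms] by (simp add: vec_eq_iff)
  then show ?thesis unfolding jmpF_eq by (simp add: pwc_linear)
qed

lemma mech_rhs_integrable: "v \<in> U0 G \<Longrightarrow> integrable (vol G) (\<lambda>x. bodyf D x \<bullet> v x)"
  by (rule L2_inner_integrable[OF mechanical_constants(7) L2_U0])

lemma mech_rhs_linear: "fun_linear (U0 G) (\<lambda>v. LINT x|vol G. bodyf D x \<bullet> v x)"
  by (rule fun_linear_LINT[OF U0_fun_space mech_rhs_integrable]) (auto simp: inner_add_right)

lemma mech_load_linear: "fun_linear (U0 G) (mech_load p)"
  unfolding mech_load_def[abs_def]
proof (intro fun_linear_diff fun_linear_add mech_rhs_linear)
  have "fun_linear (U0 G) (\<lambda>v. LINT x|vol G. Pim P (pEm D p) x * dvg G v x)"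
  proof (rule fun_linear_LINT[OF U0_fun_space Pim_dvg_integrable])
    fix u v a b assume "u \<in> U0 G" "v \<in> U0 G"
    from dvg_lincomb[OF this, of a b]
    show "AE x in vol G. Pim P (pEm D p) x * dvg G (\<lambda>x. a *\<^sub>R u x + b *\<^sub>R v x) x
       = a *\<^sub>R (Pim P (pEm D p) x * dvg G u x) + b *\<^sub>R (Pim P (pEm D p) x * dvg G v x)"
      by eventually_elim (simp add: algebra_simps)
  qed
  from fun_linear_scale[OF this, of "biot D"]
  show "fun_linear (U0 G) (\<lambda>v. biot D * (LINT x|vol G. Pim P (pEm D p) x * dvg G v x))" by simp
  show "fun_linear (U0 G) (\<lambda>v. LINT x|surf G. Pif P (pEf D p) x * jmpF G Q v x)"
    by (rule fun_linear_LINT[OF U0_fun_space Pif_jmpF_integrable]) (auto simp: jmpF_lincomb algebra_simps)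
qed

lemma traction_linear: "fun_linear (U0 G) (traction lam)"
  unfolding traction_def[abs_def]
proof (rule fun_linear_sum)
  fix \<sigma>
  have "fun_linear (U0 G) (\<lambda>v. lam $ \<sigma> \<bullet> face_jump v \<sigma>)"
    by (rule fun_linear_blinear[OF face_jump_linear]) (intro bounded_linear.linear bounded_linear_inner_right)
  from fun_linear_scale[OF this, of "area \<sigma>"]
  show "fun_linear (U0 G) (\<lambda>v. area \<sigma> * (lam $ \<sigma> \<bullet> face_jump v \<sigma>))" by simp
qed simp

lemma mech_load_null:
  assumes z: "z \<in> U0 G" and 0: "elastic z z = 0" shows "mech_load p z = 0"
proof -
  note k = null_functionals[OF z 0]
  have "(LINT x|vol G. bodyf D x \<bullet> z x) = (LINT x|vol G. 0)"
    by (rule integral_cong_AE) (use k(1) mech_rhs_integrable[OF z] in auto)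
  moreover have "(LINT x|vol G. Pim P (pEm D p) x * dvg G z x) = (LINT x|vol G. 0)"
    by (rule integral_cong_AE) (use k(2) Pim_dvg_integrable[OF z] in auto)
  moreover have "jmpF G Q z x = 0" for x
    unfolding jmpF_eq by (simp add: face_jump_n_def k(3) pwc_def)
  ultimately show ?thesis by (simp add: mech_load_def)
qed

lemma traction_null: "z \<in> U0 G \<Longrightarrow> elastic z z = 0 \<Longrightarrow> traction lam z = 0"
  by (simp add: traction_def null_functionals)

lemma mech_lhs_eq:
  assumes u: "u \<in> U0 G" and v: "v \<in> U0 G" and e: "elastic u v + traction lam v = mech_load p v"
  shows "mech_lhs G D P Q p u lam v = mech_rhs G D v"
proof -
  have "(LINT x|vol G. stress G D u x \<bullet> eps G v x - biot D * Pim P (pEm D p) x * dvg G v x)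
     = elastic u v - biot D * (LINT x|vol G. Pim P (pEm D p) x * dvg G v x)"
    unfolding elastic_def mult.assoc
    using stress_integrable[OF u v] Pim_dvg_integrable[OF v, of "pEm D p"] by simp
  then show ?thesis
    using e traction_LINT[OF v, of lam] by (simp add: mech_lhs_def mech_rhs_def mech_load_def)
qed

lemma sat_continuous:
  fixes f :: "'z::topological_space \<Rightarrow> ((real^'m) \<times> (real^'f)) \<times> ((real^'m) \<times> (real^'f))"
  assumes f: "continuous_on UNIV f"
  shows "continuous_on UNIV (\<lambda>z. satm D (by_phase (f z)) \<alpha>)"
    "continuous_on UNIV (\<lambda>z. satf D (by_phase (f z)) \<alpha>)"
    "continuous_on UNIV (\<lambda>z. sata D a (by_phase (f z)) \<alpha>)"
    "continuous_on UNIV (\<lambda>z. pEm D (by_phase (f z)))"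
    "continuous_on UNIV (\<lambda>z. pEf D (by_phase (f z)))"
proof -
  have m: "continuous_on UNIV (\<lambda>z. pcm (by_phase (f z)))" and g: "continuous_on UNIV (\<lambda>z. pcf (by_phase (f z)))"
    unfolding pcm_def pcf_def by (intro continuous_intros continuous_on_by_phase f)+
  have cc: "continuous_on UNIV (\<lambda>z. cmap h (k z) :: real^'i)"
    if "continuous_on UNIV h" "continuous_on UNIV k" for h and k :: "'z \<Rightarrow> real^'i::finite"
    unfolding cmap_def
    by (intro continuous_on_vec_lambda continuous_on_compose2[OF that(1)] continuous_intros that(2)) auto
  show s: "continuous_on UNIV (\<lambda>z. satm D (by_phase (f z)) \<alpha>)"
    "continuous_on UNIV (\<lambda>z. satf D (by_phase (f z)) \<alpha>)"
    "continuous_on UNIV (\<lambda>z. sata D a (by_phase (f z)) \<alpha>)" for \<alpha>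
    unfolding satm_def satf_def sata_def by (intro cc continuous_Sat m g)+
  show "continuous_on UNIV (\<lambda>z. pEm D (by_phase (f z)))"
    unfolding pEm_def by (intro continuous_on_vec_lambda continuous_intros continuous_on_by_phase f s)
  show "continuous_on UNIV (\<lambda>z. pEf D (by_phase (f z)))"
    unfolding pEf_def
    by (intro continuous_on_vec_lambda continuous_intros continuous_on_by_phase f s g
        continuous_on_compose2[OF capU_props(3)]) auto
qed

lemma mech_load_continuous:
  fixes f :: "'z::euclidean_space \<Rightarrow> ((real^'m) \<times> (real^'f)) \<times> ((real^'m) \<times> (real^'f))"
  assumes f: "continuous_on UNIV f" and v: "v \<in> U0 G"
  shows "continuous_on UNIV (\<lambda>z. mech_load (by_phase (f z)) v)"
  unfolding mech_load_def
proof (intro continuous_intros pint_continuous)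
  show "pint (vol G) (\<lambda>z x. Pim P (pEm D (by_phase (f z))) x * dvg G v x)"
    unfolding Pim_def
    by (intro pint_mult pbdd_pwc[OF flow_cells(1)] pint_const sat_continuous f vol.L2_integrable[OF L2_dvg[OF v]])
  show "pint (surf G) (\<lambda>z x. Pif P (pEf D (by_phase (f z))) x * jmpF G Q v x)"
    unfolding Pif_def
    by (intro pint_mult pbdd_pwc[OF flow_cells(2)] pint_const sat_continuous f surf.L2_integrable surf.Linf_L2 jmpF_Linf)
qed

lemma traction_continuous: "continuous_on UNIV (\<lambda>lam. traction lam v)"
  unfolding traction_def by (intro continuous_intros)


section \<open>Contact coupled with an arbitrary flow residual\<close>

text \<open>
  The constant is the minimum over the unit sphere.
\<close>

lemma homogeneous_lower_bound:
  fixes f :: "'a::euclidean_space \<Rightarrow> real"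
  assumes c: "continuous_on UNIV f" and h: "\<And>r x. f (r *\<^sub>R x) = \<bar>r\<bar> * f x" and p: "\<And>x. x \<noteq> 0 \<Longrightarrow> 0 < f x"
  shows "\<exists>c>0. \<forall>x. c * norm x \<le> f x"
proof -
  obtain b :: 'a where "b \<in> Basis" using nonempty_Basis by blast
  then have "sphere 0 1 \<noteq> ({} :: 'a set)" by (auto intro!: exI[of _ b])
  then obtain x0 where x0: "x0 \<in> sphere 0 1" "\<And>x. x \<in> sphere 0 1 \<Longrightarrow> f x0 \<le> f x"
    using continuous_attains_inf[of "sphere 0 1" f] continuous_on_subset[OF c] by (metis compact_sphere subset_UNIV)
  have "f x0 * norm x \<le> f x" for x
  proof (cases "x = 0")
    case True
    then show ?thesis using h[of 0 0] by simp
  next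
    case False
    then have "f x0 \<le> f ((1 / norm x) *\<^sub>R x)" by (intro x0(2)) simp
    also have "\<dots> = f x / norm x" by (subst h) simp
    finally show ?thesis using False by (simp add: field_simps)
  qed
  moreover have "f x0 > 0" using x0(1) by (intro p) auto
  ultimately show ?thesis by blast
qed

text \<open>
  If $\mu$ did no work on any discrete displacement, all the quotients at $\mu$ in the inf-sup condition
  would vanish.
\<close>

lemma traction_injective:
  assumes "\<mu> \<noteq> 0" shows "\<exists>w\<in>disp_gen. traction \<mu> w \<noteq> 0"
proof (rule ccontr)
  assume "\<not> ?thesis"
  then have z: "traction \<mu> w = 0" if "w \<in> disp_gen" for w using that by blast
  have "traction \<mu> v = 0" if "v \<in> dispV Q" for v
  proof -
    obtain c where c: "v = disp_comb c" using \<open>v \<in> dispV Q\<close> unfolding disp_gen(3) by blast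
    have "traction \<mu> v = (\<Sum>w\<in>disp_gen. c w * traction \<mu> w)"
      unfolding c disp_comb_def using fun_linear_lincomb[OF U0_fun_space traction_linear disp_gen(1,2)] by simp
    then show ?thesis using z by simp
  qed
  then have "(LINT x|surf G. pwc (face Q) \<mu> x \<bullet> jmp G v x) = 0" if "v \<in> dispV Q" for v
    using traction_LINT[of v \<mu>] that dispV_subset by auto
  then have "(SUP v\<in>{v \<in> dispV Q. \<not> (AE x in vol G. v x = 0)}.
        ereal ((LINT x|surf G. pwc (face Q) \<mu> x \<bullet> jmp G v x)
               / (U0norm G v * Hminus_half_norm (surf G) (pwc (face Q) \<mu>)))) \<le> 0"
    by (intro SUP_least) simp
  moreover have "ereal cinf \<le> (SUP v\<in>{v \<in> dispV Q. \<not> (AE x in vol G. v x = 0)}.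
        ereal ((LINT x|surf G. pwc (face Q) \<mu> x \<bullet> jmp G v x)
               / (U0norm G v * Hminus_half_norm (surf G) (pwc (face Q) \<mu>))))"
    using infsup(2) unfolding inf_sup_condition_def by (rule order_trans) (use assms in \<open>auto intro: INF_lower\<close>)
  ultimately have "ereal cinf \<le> 0" by (rule order_trans[rotated])
  then show False using infsup(1) by simp
qed

lemma traction_lower_bound: "\<exists>c>0. \<forall>\<mu>. c * norm \<mu> \<le> (\<Sum>w\<in>disp_gen. \<bar>traction \<mu> w\<bar>)"
proof (rule homogeneous_lower_bound)
  show "continuous_on UNIV (\<lambda>\<mu>. \<Sum>w\<in>disp_gen. \<bar>traction \<mu> w\<bar>)" by (intro continuous_intros traction_continuous)
  show "(\<Sum>w\<in>disp_gen. \<bar>traction (r *\<^sub>R x) w\<bar>) = \<bar>r\<bar> * (\<Sum>w\<in>disp_gen. \<bar>traction x w\<bar>)" for r x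
  proof -
    have "traction (r *\<^sub>R x) w = r * traction x w" for w by (simp add: traction_def sum_distrib_left mult_ac)
    then show ?thesis by (simp add: sum_distrib_left abs_mult)
  qed
  show "0 < (\<Sum>w\<in>disp_gen. \<bar>traction x w\<bar>)" if x: "x \<noteq> 0" for x
  proof -
    obtain w where "w \<in> disp_gen" "traction x w \<noteq> 0" using traction_injective[OF x] by blast
    then show ?thesis by (intro sum_pos2[OF disp_gen(1)]) auto
  qed
qed

lemma riesz_V:
  fixes l :: "'z::euclidean_space \<Rightarrow> (real^'d \<Rightarrow> real^'d) \<Rightarrow> real"
  assumes l: "\<And>z. fun_linear (U0 G) (l z)" and null: "\<And>z u. u \<in> U0 G \<Longrightarrow> elastic u u = 0 \<Longrightarrow> l z u = 0"
    and cont: "\<And>u. u \<in> U0 G \<Longrightarrow> continuous_on UNIV (\<lambda>z. l z u)"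
  shows "\<exists>C. (\<forall>w. continuous_on UNIV (\<lambda>z. C z w)) \<and> (\<forall>z. \<forall>v\<in>dispV Q. elastic (disp_comb (C z)) v = l z v)"
proof -
  obtain C where C: "\<And>w. continuous_on UNIV (\<lambda>z. C z w)" "\<And>z v. v \<in> disp_gen \<Longrightarrow> elastic (disp_comb (C z)) v = l z v"
    using elastic.parametric_riesz[OF disp_gen(1,2) l null cont] unfolding disp_comb_def by blast
  have "elastic (disp_comb (C z)) v = l z v" if v: "v \<in> dispV Q" for z v
  proof -
    obtain c where c: "v = disp_comb c" using v unfolding disp_gen(3) by blast
    have "elastic (disp_comb (C z)) v = (\<Sum>w\<in>disp_gen. c w * elastic (disp_comb (C z)) w)"
      unfolding c disp_comb_def[of c] using fun_linear_lincomb[OF U0_fun_space elastic.a_lin_right[OF disp_comb_U0] disp_gen(1,2)] by simp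
    also have "\<dots> = (\<Sum>w\<in>disp_gen. c w * l z w)" using C(2) by simp
    also have "\<dots> = l z v"
      unfolding c disp_comb_def[of c] using fun_linear_lincomb[OF U0_fun_space l disp_gen(1,2)] by simp
    finally show ?thesis .
  qed
  then show ?thesis using C(1) by blast
qed

lemma elastic_diff:
  assumes "u \<in> U0 G" "v \<in> U0 G" "w \<in> U0 G"
  shows "elastic (\<lambda>x. u x - v x) w = elastic u w - elastic v w" "elastic w (\<lambda>x. u x - v x) = elastic w u - elastic w v"
  using elastic.a_comb_left[OF assms, of 1 "-1"] elastic.a_comb_right[OF assms, of 1 "-1"] by simp_all

lemma U0_diff: "u \<in> U0 G \<Longrightarrow> v \<in> U0 G \<Longrightarrow> (\<lambda>x. u x - v x) \<in> U0 G"
  using U0_lincomb[of u v 1 "-1"] by simp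

lemma V_diff: "u \<in> dispV Q \<Longrightarrow> v \<in> dispV Q \<Longrightarrow> (\<lambda>x. u x - v x) \<in> dispV Q"
  using fun_spaceD(2)[OF dispV_fun_space, of u v 1 "-1"] by simp

lemma elastic_young:
  assumes "u \<in> U0 G" "v \<in> U0 G" shows "2 * elastic u v \<le> elastic u u + elastic v v"
proof -
  have "0 \<le> elastic (\<lambda>x. u x - v x) (\<lambda>x. u x - v x)" by (rule elastic.a_pos[OF U0_diff[OF assms]])
  also have "\<dots> = elastic u u - elastic u v - (elastic v u - elastic v v)"
    using assms U0_diff[OF assms] by (simp add: elastic_diff)
  finally show ?thesis using elastic.a_sym[OF assms] by simp
qed

definition mult_n :: "(real^'d)^'s \<Rightarrow> 's \<Rightarrow> real" where "mult_n lam \<sigma> = lam $ \<sigma> \<bullet> nface G Q \<sigma>"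
definition mult_t :: "(real^'d)^'s \<Rightarrow> 's \<Rightarrow> real^'d" where "mult_t lam \<sigma> = lam $ \<sigma> - mult_n lam \<sigma> *\<^sub>R nface G Q \<sigma>"

lemma multiplier_split: "lam $ \<sigma> \<bullet> face_jump v \<sigma> = mult_n lam \<sigma> * face_jump_n v \<sigma> + mult_t lam \<sigma> \<bullet> face_jump_t v \<sigma>"
proof -
  have "mult_t lam \<sigma> \<bullet> face_jump_t v \<sigma> = mult_t lam \<sigma> \<bullet> face_jump v \<sigma>"
    by (simp add: face_jump_t_def mult_t_def mult_n_def inner_diff_left inner_diff_right nface_norm)
  moreover have "lam $ \<sigma> \<bullet> face_jump v \<sigma> = mult_n lam \<sigma> * (nface G Q \<sigma> \<bullet> face_jump v \<sigma>) + mult_t lam \<sigma> \<bullet> face_jump v \<sigma>"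
    by (simp add: mult_t_def inner_diff_left)
  ultimately show ?thesis by (simp add: face_jump_n_def inner_commute)
qed

text \<open>
  Non-penetration with complementarity, and Coulomb friction as a principle of maximal dissipation for
  the slip since the previous displacement \<open>uk\<close>. These are the variational inequalities of the
  scheme, face by face.
\<close>

definition contact :: "(real^'d \<Rightarrow> real^'d) \<Rightarrow> (real^'d \<Rightarrow> real^'d) \<Rightarrow> (real^'d)^'s \<Rightarrow> bool" where
  "contact uk u lam \<longleftrightarrow> (\<forall>\<sigma>. 0 \<le> mult_n lam \<sigma> \<and> face_jump_n u \<sigma> \<le> 0 \<and> mult_n lam \<sigma> * face_jump_n u \<sigma> = 0 \<and>
     norm (mult_t lam \<sigma>) \<le> fric D * mult_n lam \<sigma> \<and>
     (\<forall>m. norm m \<le> fric D * mult_n lam \<sigma> \<longrightarrow> (m - mult_t lam \<sigma>) \<bullet> (face_jump_t u \<sigma> - face_jump_t uk \<sigma>) \<le> 0))"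

text \<open>
  The normal multiplier does non-negative work on the jump of \<open>u\<close> and non-positive work on the
  non-penetrating jump of \<open>uk\<close>; for the slip, the friction inequality is tested with 0. Since the sign
  condition on \<open>mult_n lam * face_jump_n u\<close> also holds for clamped multipliers, the estimate is
  available before the clamping is known to have no effect.
\<close>

lemma contact_dissipation:
  assumes uk: "uk \<in> U0 G" "\<And>\<sigma>. face_jump_n uk \<sigma> \<le> 0" and u: "u \<in> U0 G"
    and n: "\<And>\<sigma>. 0 \<le> mult_n lam \<sigma>" "\<And>\<sigma>. 0 \<le> mult_n lam \<sigma> * face_jump_n u \<sigma>"
    and t: "\<And>\<sigma> m. norm m \<le> fric D * mult_n lam \<sigma> \<Longrightarrow> (m - mult_t lam \<sigma>) \<bullet> (face_jump_t u \<sigma> - face_jump_t uk \<sigma>) \<le> 0"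
  shows "0 \<le> traction lam (\<lambda>x. u x - uk x)"
  unfolding traction_def
proof (intro sum_nonneg mult_nonneg_nonneg)
  fix \<sigma>
  have "face_jump_n (\<lambda>x. u x - uk x) \<sigma> = face_jump_n u \<sigma> - face_jump_n uk \<sigma>" "face_jump_t (\<lambda>x. u x - uk x) \<sigma> = face_jump_t u \<sigma> - face_jump_t uk \<sigma>"
    using fun_linearD[OF face_jump_n_linear u uk(1), of 1 "-1" \<sigma>] fun_linearD[OF face_jump_t_linear u uk(1), of 1 "-1" \<sigma>] by simp_all
  moreover have "mult_n lam \<sigma> * face_jump_n uk \<sigma> \<le> 0" using n(1) uk(2) by (rule mult_nonneg_nonpos)
  moreover have "0 \<le> mult_t lam \<sigma> \<bullet> (face_jump_t u \<sigma> - face_jump_t uk \<sigma>)"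
    using t[of 0 \<sigma>] n(1)[of \<sigma>] mechanical_constants(4) by (simp add: inner_diff_left)
  ultimately show "0 \<le> lam $ \<sigma> \<bullet> face_jump (\<lambda>x. u x - uk x) \<sigma>"
    using n(2)[of \<sigma>] unfolding multiplier_split by (simp add: right_diff_distrib)
qed simp

lemma continuous_disp_comb:
  fixes J :: "(real^'d \<Rightarrow> real^'d) \<Rightarrow> 'w::real_normed_vector" and K :: "'z::topological_space \<Rightarrow> (real^'d \<Rightarrow> real^'d) \<Rightarrow> real"
  assumes J: "fun_linear (U0 G) J" and K: "\<And>w. continuous_on UNIV (\<lambda>z. K z w)"
  shows "continuous_on UNIV (\<lambda>z. J (disp_comb (K z)))"
proof -
  have "J (disp_comb (K z)) = (\<Sum>w\<in>disp_gen. K z w *\<^sub>R J w)" for z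
    unfolding disp_comb_def by (rule fun_linear_lincomb[OF U0_fun_space J disp_gen(1,2)])
  then show ?thesis by (simp add: continuous_intros K)
qed

text \<open>
  Let \<open>u\<close> be the displacement of a fixed point, \<open>y\<close> the displacement that the same pressures produce without
  multipliers, and $e = y - u$. The multipliers act on discrete displacements as \<open>elastic e\<close>, so that dissipativity
  gives $a(e,e) \le a(e, y - u_k)$ for the elastic form \<open>a\<close>. Hence $a(e,e)$ is at most the squared
  energy distance of \<open>y\<close> and \<open>uk\<close>, a continuous function of the pressures, bounded on their ball. By
  the inf-sup condition the multipliers are then bounded in terms of \<open>R1\<close> alone, and the bound
  \<open>R2\<close> for the normal multipliers is chosen larger than that.
  
  The residual $\rho$ is left arbitrary so that both a time step and the initial state are covered.
\<close>

lemma flow_contact_existence: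
  fixes \<rho> :: "((real^'m) \<times> (real^'f)) \<times> ((real^'m) \<times> (real^'f)) \<Rightarrow> (real^'d \<Rightarrow> real^'d)
      \<Rightarrow> ((real^'m) \<times> (real^'f)) \<times> ((real^'m) \<times> (real^'f))"
  assumes uk: "uk \<in> dispV Q" "\<And>\<sigma>. face_jump_n uk \<sigma> \<le> 0" and R1: "0 \<le> R1"
    and c\<rho>: "\<And>C :: (((real^'m) \<times> (real^'f)) \<times> ((real^'m) \<times> (real^'f))) \<times> ((real^'d)^'s) \<Rightarrow> (real^'d \<Rightarrow> real^'d) \<Rightarrow> real.
       (\<And>w. continuous_on UNIV (\<lambda>z. C z w)) \<Longrightarrow> continuous_on UNIV (\<lambda>z. \<rho> (fst z) (disp_comb (C z)))"
  obtains p u lam where "u \<in> dispV Q" "norm p \<le> R1" "\<And>q. norm q \<le> R1 \<Longrightarrow> 0 \<le> \<rho> p u \<bullet> (q - p)"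
    "norm p < R1 \<Longrightarrow> \<rho> p u = 0" "\<And>v. v \<in> dispV Q \<Longrightarrow> elastic u v + traction lam v = mech_load (by_phase p) v"
    "contact uk u lam"
proof -
  note VU = subsetD[OF dispV_subset]
  have ukU: "uk \<in> U0 G" using uk dispV_subset by blast
  have "\<exists>C. (\<forall>w. continuous_on UNIV (\<lambda>z. C z w)) \<and> (\<forall>z :: (((real^'m) \<times> (real^'f)) \<times> ((real^'m) \<times> (real^'f))) \<times> ((real^'d)^'s).
      \<forall>v\<in>dispV Q. elastic (disp_comb (C z)) v = mech_load (by_phase (fst z)) v - traction (snd z) v)"
    by (rule riesz_V)
      (auto intro!: fun_linear_diff mech_load_linear traction_linear continuous_intros mech_load_continuous continuous_on_compose2[OF traction_continuous]
        simp: mech_load_null traction_null)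
  then obtain C where C: "\<And>w. continuous_on UNIV (\<lambda>z. C z w)"
    and Cm: "\<And>z v. v \<in> dispV Q \<Longrightarrow> elastic (disp_comb (C z)) v = mech_load (by_phase (fst z)) v - traction (snd z) v" by blast
  have "\<exists>C. (\<forall>w. continuous_on UNIV (\<lambda>z. C z w)) \<and> (\<forall>z :: ((real^'m) \<times> (real^'f)) \<times> ((real^'m) \<times> (real^'f)).
      \<forall>v\<in>dispV Q. elastic (disp_comb (C z)) v = mech_load (by_phase z) v)"
    by (rule riesz_V) (auto intro!: mech_load_linear mech_load_continuous simp: mech_load_null)
  then obtain Y where Y: "\<And>w. continuous_on UNIV (\<lambda>z. Y z w)"
    and Ym: "\<And>z v. v \<in> dispV Q \<Longrightarrow> elastic (disp_comb (Y z)) v = mech_load (by_phase z) v" by blast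
  \<comment> \<open>The squared energy distance to \<open>uk\<close> of the displacement driven by the pressures alone.\<close>
  define g where "g z = elastic (\<lambda>x. disp_comb (Y z) x - uk x) (\<lambda>x. disp_comb (Y z) x - uk x)" for z
  have g_eq: "g z = mech_load (by_phase z) (disp_comb (Y z)) - 2 * elastic (disp_comb (Y z)) uk + elastic uk uk" for z
    unfolding g_def using disp_comb_U0 ukU U0_diff[OF disp_comb_U0 ukU] Ym[OF disp_comb_V] elastic.a_sym[OF ukU disp_comb_U0]
    by (simp add: elastic_diff)
  have "continuous_on UNIV (\<lambda>z. mech_load (by_phase z) (disp_comb (Y z)))"
  proof -
    have "mech_load (by_phase z) (disp_comb (Y z)) = (\<Sum>w\<in>disp_gen. Y z w *\<^sub>R mech_load (by_phase z) w)" for z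
      unfolding disp_comb_def by (rule fun_linear_lincomb[OF U0_fun_space mech_load_linear disp_gen(1,2)])
    moreover have "continuous_on UNIV (\<lambda>z. mech_load (by_phase z) w)" if "w \<in> disp_gen" for w
      using that disp_gen(2) by (intro mech_load_continuous continuous_intros) auto
    ultimately show ?thesis by (simp add: continuous_intros Y)
  qed
  then have "continuous_on UNIV g"
    unfolding g_eq[abs_def] by (intro continuous_intros continuous_disp_comb[OF elastic.a_lin[OF ukU] Y])
  then have "compact (g ` cball 0 R1)"
    by (intro compact_continuous_image) (auto intro: continuous_on_subset)
  then obtain M0 where M0: "\<forall>y\<in>g ` cball 0 R1. norm y \<le> M0"
    using compact_imp_bounded[of "g ` cball 0 R1"] unfolding bounded_iff by blast
  have M: "g z \<le> M0" if "norm z \<le> R1" for z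
    using M0[rule_format, of "g z"] that by auto
  obtain c where c: "c > 0" "\<And>\<mu>. c * norm \<mu> \<le> (\<Sum>w\<in>disp_gen. \<bar>traction \<mu> w\<bar>)" using traction_lower_bound by blast
  define S where "S = (\<Sum>w\<in>disp_gen. M0 + elastic w w)"
  define R2 where "R2 = S / c + 1"
  have "0 \<le> g 0" unfolding g_def by (intro elastic.a_pos U0_diff disp_comb_U0 ukU)
  then have M00: "0 \<le> M0" using M[of 0] R1 by simp
  then have S: "0 \<le> S" unfolding S_def using disp_gen(2) elastic.a_pos by (intro sum_nonneg add_nonneg_nonneg) auto
  have R2: "0 \<le> R2" using S c(1) by (simp add: R2_def)
  obtain p lam where
    p: "norm p \<le> R1" "\<And>q. norm q \<le> R1 \<Longrightarrow> 0 \<le> \<rho> p (disp_comb (C (p, lam))) \<bullet> (q - p)"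
      "norm p < R1 \<Longrightarrow> \<rho> p (disp_comb (C (p, lam))) = 0"
    and l: "\<And>\<sigma>. mult_n lam \<sigma> = max 0 (min R2 (mult_n lam \<sigma> + face_jump_n (disp_comb (C (p, lam))) \<sigma>))"
    "\<And>\<sigma>. norm (mult_t lam \<sigma>) \<le> fric D * mult_n lam \<sigma>"
    "\<And>\<sigma> m. norm m \<le> fric D * mult_n lam \<sigma> \<Longrightarrow> (m - mult_t lam \<sigma>) \<bullet> (face_jump_t (disp_comb (C (p, lam))) \<sigma> - face_jump_t uk \<sigma>) \<le> 0"
  proof (rule flow_contact_fixed_point[of "\<lambda>z. \<rho> (fst z) (disp_comb (C z))" "\<lambda>z. face_jump_n (disp_comb (C z))"
        "\<lambda>z \<sigma>. face_jump_t (disp_comb (C z)) \<sigma> - face_jump_t uk \<sigma>" "nface G Q" R1 R2 "fric D"])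
    show "continuous_on UNIV (\<lambda>z. \<rho> (fst z) (disp_comb (C z)))" by (rule c\<rho>[OF C])
    show "continuous_on UNIV (\<lambda>z. face_jump_n (disp_comb (C z)) \<sigma>)" for \<sigma> by (rule continuous_disp_comb[OF face_jump_n_linear C])
    show "continuous_on UNIV (\<lambda>z. face_jump_t (disp_comb (C z)) \<sigma> - face_jump_t uk \<sigma>)" for \<sigma>
      by (intro continuous_intros continuous_disp_comb[OF face_jump_t_linear C])
    show "(face_jump_t (disp_comb (C z)) \<sigma> - face_jump_t uk \<sigma>) \<bullet> nface G Q \<sigma> = 0" for z \<sigma>
      by (simp add: inner_diff_left face_jump_t_orth)
    show "norm (nface G Q \<sigma>) = 1" "0 \<le> R1" "0 \<le> R2" "0 \<le> fric D" for \<sigma>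
      using R1 R2 nface_norm mechanical_constants(4) by auto
    fix p lam
    assume h: "norm p \<le> R1" "\<And>q. norm q \<le> R1 \<Longrightarrow> 0 \<le> \<rho> (fst (p, lam)) (disp_comb (C (p, lam))) \<bullet> (q - p)"
      "norm p < R1 \<Longrightarrow> \<rho> (fst (p, lam)) (disp_comb (C (p, lam))) = 0"
      "\<And>s. lam $ s \<bullet> nface G Q s = max 0 (min R2 (lam $ s \<bullet> nface G Q s + face_jump_n (disp_comb (C (p, lam))) s))"
      "\<And>s. norm (lam $ s - (lam $ s \<bullet> nface G Q s) *\<^sub>R nface G Q s) \<le> fric D * (lam $ s \<bullet> nface G Q s)"
      "\<And>s m. norm m \<le> fric D * (lam $ s \<bullet> nface G Q s) \<Longrightarrow>
         (m - (lam $ s - (lam $ s \<bullet> nface G Q s) *\<^sub>R nface G Q s)) \<bullet> (face_jump_t (disp_comb (C (p, lam))) s - face_jump_t uk s) \<le> 0"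
    note h' = h(2,3)[unfolded fst_conv] h(4,5,6)[folded mult_n_def, folded mult_t_def]
    show thesis
      by (rule that[of p lam]) (fact h(1) h')+
  qed
  define u where "u = disp_comb (C (p, lam))"
  have uV: "u \<in> dispV Q" and uU: "u \<in> U0 G" unfolding u_def using disp_comb_V disp_comb_U0 by auto
  have mech: "elastic u v + traction lam v = mech_load (by_phase p) v" if "v \<in> dispV Q" for v
    using Cm[OF that, of "(p, lam)"] by (simp add: u_def)
  note cl = clamp_fixed_point[OF R2 l(1), folded u_def]
  have diss: "0 \<le> traction lam (\<lambda>x. u x - uk x)"
    by (rule contact_dissipation[OF ukU uk(2) uU cl(1) cl(3) l(3)[folded u_def]])
  \<comment> \<open>The inf-sup condition bounds the multiplier, so that its truncation is inactive.\<close>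
  define y where "y = disp_comb (Y p)"
  have yV: "y \<in> dispV Q" and yU: "y \<in> U0 G" unfolding y_def using disp_comb_V disp_comb_U0 by auto
  define e where "e = (\<lambda>x. y x - u x)"
  have eU: "e \<in> U0 G" unfolding e_def by (rule U0_diff[OF yU uU])
  have be: "traction lam v = elastic e v" if "v \<in> dispV Q" for v
    using mech[OF that] Ym[OF that, of p] elastic_diff(1)[OF yU uU VU[OF that]] by (simp add: e_def y_def)
  have "elastic e e \<le> M0"
  proof -
    have "elastic e (\<lambda>x. u x - uk x) = traction lam (\<lambda>x. u x - uk x)" by (rule be[OF V_diff[OF uV uk(1)], symmetric])
    then have 1: "0 \<le> elastic e (\<lambda>x. u x - uk x)" using diss by simp
    have ee: "e = (\<lambda>x. (y x - uk x) - (u x - uk x))" by (simp add: e_def)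
    have "elastic e e = elastic e (\<lambda>x. y x - uk x) - elastic e (\<lambda>x. u x - uk x)"
      by (subst (2) ee) (rule elastic_diff(2)[OF U0_diff[OF yU ukU] U0_diff[OF uU ukU] eU])
    moreover have "2 * elastic e (\<lambda>x. y x - uk x) \<le> elastic e e + elastic (\<lambda>x. y x - uk x) (\<lambda>x. y x - uk x)"
      by (rule elastic_young[OF eU U0_diff[OF yU ukU]])
    ultimately have "elastic e e \<le> g p" using 1 by (simp add: g_def y_def)
    then show ?thesis using M[OF p(1)] by simp
  qed
  have "\<bar>traction lam w\<bar> \<le> M0 + elastic w w" if w: "w \<in> disp_gen" for w
  proof -
    have wU: "w \<in> U0 G" and wV: "w \<in> dispV Q" using w disp_gen(2) disp_gen_V by auto
    define e' where "e' = (\<lambda>x. (-1) *\<^sub>R e x + 0 *\<^sub>R e x)"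
    have e': "e' \<in> U0 G" unfolding e'_def by (rule U0_lincomb[OF eU eU])
    have 1: "elastic e' w = - elastic e w" unfolding e'_def by (subst elastic.a_comb_left[OF eU eU wU]) simp
    have 2: "elastic e' e' = elastic e e"
      using elastic.a_comb_left[OF eU eU e'[unfolded e'_def], of "-1" 0] elastic.a_comb_right[OF eU eU eU, of "-1" 0]
      by (simp add: e'_def)
    have "2 * elastic e w \<le> elastic e e + elastic w w" "2 * elastic e' w \<le> elastic e' e' + elastic w w"
      by (rule elastic_young[OF eU wU], rule elastic_young[OF e' wU])
    then have "2 * \<bar>elastic e w\<bar> \<le> M0 + elastic w w" using 1 2 \<open>elastic e e \<le> M0\<close> by linarith
    moreover have "0 \<le> elastic w w" by (rule elastic.a_pos[OF wU])
    ultimately show ?thesis using be[OF wV] M00 by linarith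
  qed
  then have "(\<Sum>w\<in>disp_gen. \<bar>traction lam w\<bar>) \<le> S" unfolding S_def by (rule sum_mono)
  then have "c * norm lam \<le> S" using c(2)[of lam] by linarith
  then have nl: "norm lam \<le> S / c" using c(1) by (simp add: field_simps)
  have lt: "mult_n lam \<sigma> < R2" for \<sigma>
  proof -
    have "mult_n lam \<sigma> \<le> norm (lam $ \<sigma>) * norm (nface G Q \<sigma>)" unfolding mult_n_def by (rule norm_cauchy_schwarz)
    also have "\<dots> \<le> norm lam" using nface_norm Finite_Cartesian_Product.norm_nth_le by simp
    also have "\<dots> < R2" using nl by (simp add: R2_def)
    finally show ?thesis .
  qed
  have "contact uk u lam"
    unfolding contact_def using cl(1) cl(4)[OF lt] cl(5)[OF lt] l(2) l(3)[folded u_def] by blast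
  then show ?thesis
    using that[OF uV p(1) p(2)[folded u_def] p(3)[folded u_def] mech] by blast
qed

end

context poromechanics
begin

section \<open>The flow residual of one time step\<close>

lemma eta_continuous: "continuous_on {0..1} (eta D \<alpha> rt)"
proof -
  have *: "\<forall>\<alpha> rt. continuous_on {0..1} (eta D \<alpha> rt) \<and> mono_on {0..1} (eta D \<alpha> rt) \<and>
        (\<exists>lo hi. 0 < lo \<and> (\<forall>s\<in>{0..1}. lo \<le> eta D \<alpha> rt s \<and> eta D \<alpha> rt s \<le> hi))"
    using model unfolding model_data_def by (elim conjE)
  then show ?thesis by blast
qed

lemma eta_lower_bound: "\<exists>lo>0. \<forall>\<alpha> rt. \<forall>s\<in>{0..1}. lo \<le> eta D \<alpha> rt s"
proof -
  have "\<forall>\<alpha> rt. continuous_on {0..1} (eta D \<alpha> rt) \<and> mono_on {0..1} (eta D \<alpha> rt) \<and>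
        (\<exists>lo hi. 0 < lo \<and> (\<forall>s\<in>{0..1}. lo \<le> eta D \<alpha> rt s \<and> eta D \<alpha> rt s \<le> hi))"
    using model unfolding model_data_def by (elim conjE)
  then have "\<forall>\<alpha> rt. \<exists>lo. 0 < lo \<and> (\<forall>s\<in>{0..1}. lo \<le> eta D \<alpha> rt s)" by blast
  then obtain lo where lo: "\<And>\<alpha> rt. 0 < lo \<alpha> rt" "\<And>\<alpha> rt s. s \<in> {0..1} \<Longrightarrow> lo \<alpha> rt \<le> eta D \<alpha> rt s"
    by metis
  define S where "S = (\<lambda>(\<alpha>, rt). lo \<alpha> rt) ` ({NW, W} \<times> {Mat, Frac, Dam Plus, Dam Minus})"
  have S: "finite S" "S \<noteq> {}" by (auto simp: S_def)
  have "lo \<alpha> rt \<in> S" for \<alpha> rt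
  proof -
    have "\<alpha> \<in> {NW, W}" by (cases \<alpha>) auto
    moreover have "rt \<in> {Mat, Frac, Dam Plus, Dam Minus}"
    proof (cases rt)
      case (Dam a) then show ?thesis by (cases a) auto
    qed auto
    ultimately show ?thesis unfolding S_def by (intro image_eqI[of _ _ "(\<alpha>, rt)"]) auto
  qed
  then have "Min S \<le> lo \<alpha> rt" for \<alpha> rt by (rule Min_le[OF S(1)])
  then have "Min S \<le> eta D \<alpha> rt s" if "s \<in> {0..1}" for \<alpha> rt s using lo(2)[OF that] order_trans by blast
  moreover have "y > 0" if "y \<in> S" for y using that lo(1) by (auto simp: S_def)
  then have "Min S > 0" using Min_in[OF S] .
  ultimately show ?thesis by blast
qed

lemma Lamf_props: "Linf (surf G) (Lamf D)" "\<exists>c>0. AE x in surf G. c \<le> Lamf D x"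
  using model unfolding model_data_def by simp_all

lemma Km_props: "Linf (vol G) (Km D)" "\<exists>\<kappa>>0. AE x in vol G. \<forall>\<xi>. \<kappa> * (norm \<xi>)\<^sup>2 \<le> \<xi> \<bullet> (Km D x *v \<xi>)"
  using model unfolding model_data_def by simp_all

lemma damaged_props: "0 < width D a" "0 < dporo D a"
  using model unfolding model_data_def by simp_all

lemma d0_props: "Linf (surf G) (d0 D)" "\<And>x. x \<in> Gam G \<Longrightarrow> 0 < d0 D x"
proof -
  have c: "continuous_on (Gam G) (d0 D)" and p: "\<forall>x\<in>Gam G. 0 < d0 D x" and b: "bounded (d0 D ` Gam G)"
    using mechanical_constants(8) unfolding aperture_data_def by simp_all
  show "\<And>x. x \<in> Gam G \<Longrightarrow> 0 < d0 D x" using p by blast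
  obtain C where "\<forall>y\<in>d0 D ` Gam G. norm y \<le> C" using b unfolding bounded_iff by blast
  then have "AE x in surf G. norm (d0 D x) \<le> C" by (intro AE_I2) (simp add: space_surf)
  then show "Linf (surf G) (d0 D)" using continuous_on_Gam_measurable[OF c] by (auto simp: Linf_def)
qed

lemma flow_operators:
  "ae_linear (vol G) (gradm P)" "Linf (vol G) (gradm P v)"
  "ae_linear (surf G) (gradf P)" "Linf (surf G) (gradf P w)"
  "ae_linear (surf G) (djump P a)" "Linf (surf G) (djump P a y)"
  "is_norm (flow_norm G D P)"
proof -
  have *: "\<forall>a. ae_linear (surf G) (djump P a) \<and> (\<forall>v. Linf (surf G) (djump P a v))"
    using flow unfolding flow_discretization_def by (elim conjE)
  then show "ae_linear (surf G) (djump P a)" "Linf (surf G) (djump P a y)" by blast+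
qed (use flow in \<open>simp_all add: flow_discretization_def\<close>)

lemma pwc_value:
  fixes v :: "'b::real_vector^'i::finite"
  assumes "disjoint_family A" shows "pwc A v x = 0 \<or> (\<exists>i. pwc A v x = v $ i)"
proof (cases "x \<in> (\<Union>i. A i)")
  case True
  then obtain i where i: "x \<in> A i" by blast
  have "pwc A v x = (\<Sum>j\<in>UNIV. if j = i then v $ i else 0)"
    unfolding pwc_def
    by (rule sum.cong[OF refl]) (use i assms in \<open>auto simp: indicator_def disjoint_family_on_def\<close>)
  then show ?thesis by auto
next
  case False
  then have "pwc A v x = 0" unfolding pwc_def by (intro sum.neutral) (auto simp: indicator_def)
  then show ?thesis by simp
qed

lemma pwc_01:
  fixes v :: "real^'i::finite"
  assumes A: "ae_partition M A" and v: "\<And>i. v $ i \<in> {0..1}"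
  shows "pwc A v x \<in> {0..1}"
  using pwc_value[of A v x] A v by (fastforce simp: ae_partition_def)

lemma sat_01: "satm D p \<alpha> $ i \<in> {0..1}" "satf D p \<alpha> $ j \<in> {0..1}" "sata D a p \<alpha> $ i \<in> {0..1}"
  by (simp_all add: satm_def satf_def sata_def cmap_def Sat_range)

lemma Pim_sat_01: "Pim P (satm D p \<alpha>) x \<in> {0..1}" unfolding Pim_def by (rule pwc_01[OF flow_cells(1) sat_01(1)])
lemma Pif_sat_01: "Pif P (satf D p \<alpha>) x \<in> {0..1}" unfolding Pif_def by (rule pwc_01[OF flow_cells(2) sat_01(2)])
lemma Tr_sat_01: "Tr P a (sata D b p \<alpha>) x \<in> {0..1}" unfolding Tr_def by (rule pwc_01[OF flow_cells(3) sat_01(3)])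

lemma pbdd_eta_pwc:
  fixes c :: "'z::euclidean_space \<Rightarrow> real^'i::finite"
  assumes A: "ae_partition M A" and c: "continuous_on UNIV c" and r: "\<And>z i. c z $ i \<in> {0..1}"
  shows "pbdd M (\<lambda>z x. eta D \<alpha> rt (pwc A (c z) x))"
proof -
  \<comment> \<open>Clamping the saturation extends the mobility continuously to the real line.\<close>
  have "continuous_on UNIV (\<lambda>s. eta D \<alpha> rt (max 0 (min 1 s)))"
    by (rule continuous_on_compose2[OF eta_continuous]) (auto intro!: continuous_intros)
  from pbdd_comp[OF pbdd_pwc[OF A c] this]
  have "pbdd M (\<lambda>z x. eta D \<alpha> rt (max 0 (min 1 (pwc A (c z) x))))" .
  moreover have "max 0 (min 1 (pwc A (c z) x)) = pwc A (c z) x" for z x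
    using pwc_01[OF A r, of z x] by simp
  ultimately show ?thesis by simp
qed

lemma dvg_zero: "AE x in vol G. dvg G (\<lambda>y. 0) x = 0"
  using dvg_lincomb[OF fun_spaceD(1)[OF U0_fun_space] fun_spaceD(1)[OF U0_fun_space], of 0 0] by simp

lemma dvg_disp_comb: "AE x in vol G. dvg G (disp_comb c) x = (\<Sum>w\<in>disp_gen. c w * dvg G w x)"
proof -
  have "AE x in vol G. dvg G (\<lambda>y. \<Sum>w\<in>B. c w *\<^sub>R w y) x = (\<Sum>w\<in>B. c w * dvg G w x)" if "finite B" "B \<subseteq> U0 G" for B
    using that
  proof (induction B rule: finite_induct)
    case empty
    then show ?case using dvg_zero by simp
  next
    case (insert w B)
    have "AE x in vol G. dvg G (\<lambda>y. c w *\<^sub>R w y + 1 *\<^sub>R (\<Sum>w\<in>B. c w *\<^sub>R w y)) x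
        = c w * dvg G w x + 1 * dvg G (\<lambda>y. \<Sum>w\<in>B. c w *\<^sub>R w y) x"
      by (rule dvg_lincomb) (use insert fun_space_lincomb[OF U0_fun_space] in auto)
    moreover have "AE x in vol G. dvg G (\<lambda>y. \<Sum>w\<in>B. c w *\<^sub>R w y) x = (\<Sum>w\<in>B. c w * dvg G w x)"
      using insert by simp
    ultimately show ?case by eventually_elim (simp add: insert.hyps)
  qed
  from this[OF disp_gen(1,2)] show ?thesis by (simp add: disp_comb_def[abs_def])
qed

lemma dvg_diff:
  assumes "u \<in> U0 G" "v \<in> U0 G"
  shows "AE x in vol G. dvg G (\<lambda>y. u y - v y) x = dvg G u x - dvg G v x"
  using dvg_lincomb[OF assms, of 1 "-1"] by simp

lemma pint_dvg:
  fixes K :: "'z::euclidean_space \<Rightarrow> (real^'d \<Rightarrow> real^'d) \<Rightarrow> real"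
  assumes K: "\<And>w. continuous_on UNIV (\<lambda>z. K z w)" and uk: "uk \<in> U0 G"
  shows "pint (vol G) (\<lambda>z x. dvg G (\<lambda>y. disp_comb (K z) y - uk y) x)"
proof (rule pdom_cong_AE)
  have i: "integrable (vol G) (dvg G w)" if "w \<in> U0 G" for w by (rule vol.L2_integrable[OF L2_dvg[OF that]])
  show "pint (vol G) (\<lambda>z x. (\<Sum>w\<in>disp_gen. K z w * dvg G w x) - dvg G uk x)"
    using disp_gen(2) by (intro pint_diff pint_sum disp_gen(1) pint_mult pbdd_param K pint_const i uk) auto
  show "AE x in vol G. (\<Sum>w\<in>disp_gen. K z w * dvg G w x) - dvg G uk x = dvg G (\<lambda>y. disp_comb (K z) y - uk y) x" for z
    using dvg_disp_comb[of "K z"] dvg_diff[OF disp_comb_U0 uk, of "K z"] by eventually_elim simp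
  show "dvg G (\<lambda>y. disp_comb (K z) y - uk y) \<in> borel_measurable (vol G)" for z
    using L2_dvg[OF U0_diff[OF disp_comb_U0 uk]] by (simp add: L2_def)
qed

abbreviation phi0 :: "real^'m" where "phi0 \<equiv> intphi P (phibar D)"

text \<open>
  The integrands of the flow equation of one phase over one step, multiplied by its length \<open>dt\<close>: matrix
  accumulation and Darcy term, fracture accumulation, fracture Darcy term, and interface fluxes with
  accumulation in the damaged rock. The previous state is \<open>pk\<close>, \<open>uk\<close>.
\<close>

definition matrix_term where
  "matrix_term pk uk dt p u \<alpha> \<phi> x =
     (Pim P (intphi P (phibar D)) x * (Pim P (satm D p \<alpha>) x - Pim P (satm D pk \<alpha>) x)
       + Pim P (satm D p \<alpha>) x * (biot D * dvg G (\<lambda>y. u y - uk y) x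
            + invM D * (Pim P (pEm D p) x - Pim P (pEm D pk) x))) * Pim P (fst \<phi>) x
     + dt * (eta D \<alpha> Mat (Pim P (satm D p \<alpha>) x) * ((Km D x *v gradm P (fst (p \<alpha>)) x) \<bullet> gradm P (fst \<phi>) x))"

definition fracture_acc where
  "fracture_acc pk uk p u \<alpha> \<phi> x =
     (apert G D Q u x * Pif P (satf D p \<alpha>) x - apert G D Q uk x * Pif P (satf D pk \<alpha>) x) * Pif P (snd \<phi>) x"

text \<open>
  The truncation of the aperture at its contact value keeps the term coercive for every displacement, and
  it does not change non-penetrating ones.
\<close>

definition fracture_cond where
  "fracture_cond dt p u \<alpha> \<phi> x = dt * (eta D \<alpha> Frac (Pif P (satf D p \<alpha>) x) * (max (d0 D x) (apert G D Q u x) ^ 3 / 12)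
     * (gradf P (snd (p \<alpha>)) x \<bullet> gradf P (snd \<phi>) x))"

definition interface_term where
  "interface_term a pk dt p \<alpha> \<phi> x = dt * (Qflux D P p \<alpha> a x * djump P a \<phi> x)
     + width D a * dporo D a * (Tr P a (sata D a p \<alpha>) x - Tr P a (sata D a pk \<alpha>) x) * Tr P a (fst \<phi>) x"

definition flow_res where
  "flow_res pk uk dt src p u \<alpha> \<phi> = (LINT x|vol G. matrix_term pk uk dt p u \<alpha> \<phi> x) + (LINT x|surf G. fracture_acc pk uk p u \<alpha> \<phi> x)
     + (LINT x|surf G. fracture_cond dt p u \<alpha> \<phi> x) + (\<Sum>a\<in>{Plus, Minus}. LINT x|surf G. interface_term a pk dt p \<alpha> \<phi> x) - src \<alpha> \<phi>"

text \<open>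
  Continuity of the residual along continuous families of pressures, displacement coefficients and test
  functions.
\<close>

context
  fixes f :: "'z::euclidean_space \<Rightarrow> ((real^'m) \<times> (real^'f)) \<times> ((real^'m) \<times> (real^'f))"
    and K :: "'z \<Rightarrow> (real^'d \<Rightarrow> real^'d) \<Rightarrow> real"
    and h :: "'z \<Rightarrow> (real^'m) \<times> (real^'f)"
    and uk :: "real^'d \<Rightarrow> real^'d"
  assumes f: "continuous_on UNIV f" and K: "\<And>w. continuous_on UNIV (\<lambda>z. K z w)" and h: "continuous_on UNIV h"
    and uk: "uk \<in> U0 G"
begin

lemma pbdd_Pim: "continuous_on UNIV c \<Longrightarrow> pbdd (vol G) (\<lambda>z x. Pim P (c z :: real^'m) x)" for c :: "'z \<Rightarrow> real^'m"
  unfolding Pim_def by (rule pbdd_pwc[OF flow_cells(1)])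

lemma pbdd_Pif: "continuous_on UNIV c \<Longrightarrow> pbdd (surf G) (\<lambda>z x. Pif P (c z :: real^'f) x)" for c :: "'z \<Rightarrow> real^'f"
  unfolding Pif_def by (rule pbdd_pwc[OF flow_cells(2)])

lemma pbdd_Tr: "continuous_on UNIV c \<Longrightarrow> pbdd (surf G) (\<lambda>z x. Tr P a (c z :: real^'m) x)" for c :: "'z \<Rightarrow> real^'m"
  unfolding Tr_def by (rule pbdd_pwc[OF flow_cells(3)])

lemma pbdd_apert: "pbdd (surf G) (\<lambda>z x. apert G D Q (disp_comb (K z)) x)" "pbdd (surf G) (\<lambda>z x. apert G D Q uk x)" (is ?B)
proof -
  have "continuous_on UNIV (\<lambda>z. \<chi> \<sigma>. face_jump_n (disp_comb (K z)) \<sigma>)"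
    by (intro continuous_on_vec_lambda continuous_disp_comb face_jump_n_linear K)
  then show "pbdd (surf G) (\<lambda>z x. apert G D Q (disp_comb (K z)) x)"
    unfolding apert_def jmpF_eq
    by (intro pbdd_diff pbdd_const d0_props(1) pbdd_pwc[OF face_props(1)])
  show ?B unfolding apert_def by (intro pbdd_diff pbdd_const d0_props(1) jmpF_Linf)
qed

lemma pint_matrix_term: "pint (vol G) (\<lambda>z x. matrix_term pk uk dt (by_phase (f z)) (disp_comb (K z)) \<alpha> (h z) x)"
proof -
  define dv where "dv z x = dvg G (\<lambda>y. disp_comb (K z) y - uk y) x" for z x
  define s where "s z x = Pim P (satm D (by_phase (f z)) \<alpha>) x" for z x
  define w where "w z x = Pim P (fst (h z)) x" for z x
  define e where "e z x = Pim P (pEm D (by_phase (f z))) x" for z x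
  define A1 where "A1 z x = (Pim P phi0 x * (s z x - Pim P (satm D pk \<alpha>) x)
     + s z x * (invM D * (e z x - Pim P (pEm D pk) x))) * w z x" for z x
  define A2 where "A2 z x = s z x * biot D * w z x" for z x
  define A3 where "A3 z x = dt * (eta D \<alpha> Mat (s z x) * ((Km D x *v gradm P (fst (by_phase (f z) \<alpha>)) x) \<bullet> gradm P (fst (h z)) x))" for z x
  have s: "pbdd (vol G) s" and w: "pbdd (vol G) w" and e: "pbdd (vol G) e"
    unfolding s_def w_def e_def by (intro pbdd_Pim sat_continuous f continuous_intros h)+
  have c: "pbdd (vol G) (\<lambda>z x. Pim P v x)" for v by (intro pbdd_const Pim_Linf)
  have 1: "pbdd (vol G) A1" "pbdd (vol G) A2"
    unfolding A1_def A2_def by (intro pbdd_add pbdd_mult pbdd_diff s w e c pbdd_param continuous_intros)+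
  have ee: "pbdd (vol G) (\<lambda>z x. eta D \<alpha> Mat (s z x))"
    unfolding s_def Pim_def by (intro pbdd_eta_pwc flow_cells sat_continuous f sat_01)
  have 3: "pbdd (vol G) A3"
    unfolding A3_def
    by (intro pbdd_mult pbdd_inner pbdd_matrix_vector ee pbdd_param continuous_intros pbdd_const[OF Km_props(1)]
        pbdd_linear flow_operators continuous_on_by_phase f h)
  have "(\<lambda>z x. matrix_term pk uk dt (by_phase (f z)) (disp_comb (K z)) \<alpha> (h z) x) = (\<lambda>z x. (A1 z x + A2 z x * dv z x) + A3 z x)"
    by (intro ext) (simp add: matrix_term_def A1_def A2_def A3_def s_def w_def e_def dv_def algebra_simps)
  moreover have "pint (vol G) (\<lambda>z x. (A1 z x + A2 z x * dv z x) + A3 z x)"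
    unfolding dv_def by (intro pint_add vol.pint_bdd 1 3 pint_mult pint_dvg K uk)
  ultimately show ?thesis by simp
qed

lemma pint_fracture_acc: "pint (surf G) (\<lambda>z x. fracture_acc pk uk (by_phase (f z)) (disp_comb (K z)) \<alpha> (h z) x)"
  unfolding fracture_acc_def
  by (intro surf.pint_bdd pbdd_mult pbdd_diff pbdd_apert pbdd_Pif sat_continuous f continuous_intros h)

lemma pint_fracture_cond: "pint (surf G) (\<lambda>z x. fracture_cond dt (by_phase (f z)) (disp_comb (K z)) \<alpha> (h z) x)"
proof -
  have 1: "pbdd (surf G) (\<lambda>z x. eta D \<alpha> Frac (Pif P (satf D (by_phase (f z)) \<alpha>) x))"
    unfolding Pif_def by (intro pbdd_eta_pwc flow_cells sat_continuous f sat_01)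
  have 2: "pbdd (surf G) (\<lambda>z x. max (d0 D x) (apert G D Q (disp_comb (K z)) x) ^ 3 * (1 / 12))"
    by (intro pbdd_mult pbdd_power pbdd_max pbdd_apert pbdd_const d0_props pbdd_param continuous_intros)
  show ?thesis
    unfolding fracture_cond_def
    by (intro surf.pint_bdd pbdd_mult 1 2[simplified] pbdd_inner pbdd_linear flow_operators continuous_on_by_phase
        pbdd_param continuous_intros f h)
qed

lemma pint_interface_term: "pint (surf G) (\<lambda>z x. interface_term a pk dt (by_phase (f z)) \<alpha> (h z) x)"
proof -
  have 1: "pbdd (surf G) (\<lambda>z x. eta D \<alpha> Frac (Pif P (satf D (by_phase (f z)) \<alpha>) x))"
    unfolding Pif_def by (intro pbdd_eta_pwc flow_cells sat_continuous f sat_01)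
  have 2: "pbdd (surf G) (\<lambda>z x. eta D \<alpha> (Dam a) (Tr P a (sata D a (by_phase (f z)) \<alpha>) x))"
    unfolding Tr_def by (intro pbdd_eta_pwc flow_cells sat_continuous f sat_01)
  have j: "pbdd (surf G) (\<lambda>z x. djump P a (c z) x)" if "continuous_on UNIV c" for c :: "'z \<Rightarrow> (real^'m) \<times> (real^'f)"
    by (intro pbdd_linear flow_operators that)
  have q: "pbdd (surf G) (\<lambda>z x. pos (djump P a (by_phase (f z) \<alpha>) x))" "pbdd (surf G) (\<lambda>z x. neg (djump P a (by_phase (f z) \<alpha>) x))"
    unfolding pos_def neg_def
    by (rule pbdd_comp[OF j[OF continuous_on_by_phase[OF f]]], intro continuous_intros)+
  show ?thesis
    unfolding interface_term_def Qflux_def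
    by (intro surf.pint_bdd pbdd_add pbdd_mult pbdd_diff 1 2 q j h pbdd_Tr sat_continuous f pbdd_param continuous_intros
        pbdd_const[OF Lamf_props(1)])
qed

lemma flow_res_continuous:
  assumes src: "continuous_on UNIV (\<lambda>z. src \<alpha> (h z))"
  shows "continuous_on UNIV (\<lambda>z. flow_res pk uk dt src (by_phase (f z)) (disp_comb (K z)) \<alpha> (h z))"
  unfolding flow_res_def
  by (intro continuous_intros src pint_continuous pint_matrix_term pint_fracture_acc pint_fracture_cond pint_interface_term)

end

lemma by_phase_pair: "by_phase (p NW, p W) = p"
  by (rule ext) (simp add: by_phase_def split: phase.split)

lemma V_disp_comb: "u \<in> dispV Q \<Longrightarrow> \<exists>c. u = disp_comb c"
  using disp_gen(3) by auto

lemma flow_integrable: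
  assumes u: "u \<in> dispV Q" and uk: "uk \<in> U0 G"
  shows "integrable (vol G) (matrix_term pk uk dt p u \<alpha> \<phi>)" "integrable (surf G) (fracture_acc pk uk p u \<alpha> \<phi>)"
    "integrable (surf G) (fracture_cond dt p u \<alpha> \<phi>)" "integrable (surf G) (interface_term a pk dt p \<alpha> \<phi>)"
proof -
  obtain c where c: "u = disp_comb c" using V_disp_comb[OF u] by blast
  have k: "continuous_on UNIV (\<lambda>z::real. (p NW, p W))" "continuous_on UNIV (\<lambda>z::real. \<phi>)"
    "\<And>w. continuous_on UNIV (\<lambda>z::real. c w)" by simp_all
  show "integrable (vol G) (matrix_term pk uk dt p u \<alpha> \<phi>)" "integrable (surf G) (fracture_acc pk uk p u \<alpha> \<phi>)"
    "integrable (surf G) (fracture_cond dt p u \<alpha> \<phi>)" "integrable (surf G) (interface_term a pk dt p \<alpha> \<phi>)"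
    using pint_integrable[OF pint_matrix_term[OF k(1) k(3) k(2) uk, where pk = pk and dt = dt and \<alpha> = \<alpha>]]
      pint_integrable[OF pint_fracture_acc[OF k(1) k(3) k(2) uk, where pk = pk and \<alpha> = \<alpha>]]
      pint_integrable[OF pint_fracture_cond[OF k(1) k(3) k(2) uk, where dt = dt and \<alpha> = \<alpha>]]
      pint_integrable[OF pint_interface_term[OF k(1) k(3) k(2) uk, where pk = pk and dt = dt and \<alpha> = \<alpha> and a = a]]
    by (simp_all add: by_phase_pair c)
qed

lemma flow_res_linear:
  assumes u: "u \<in> dispV Q" and uk: "uk \<in> U0 G" and src: "linear (src \<alpha>)"
  shows "linear (flow_res pk uk dt src p u \<alpha>)"
proof -
  have comb: "flow_res pk uk dt src p u \<alpha> (a *\<^sub>R v + b *\<^sub>R w) = a * flow_res pk uk dt src p u \<alpha> v + b * flow_res pk uk dt src p u \<alpha> w" for a b v w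
  proof -
    note i = flow_integrable[OF u uk]
    have L: "(LINT x|M. F (a *\<^sub>R v + b *\<^sub>R w) x) = a * (LINT x|M. F v x) + b * (LINT x|M. F w x)"
      if "\<And>\<phi>. integrable M (F \<phi>)" "AE x in M. F (a *\<^sub>R v + b *\<^sub>R w) x = a * F v x + b * F w x"
      for M and F :: "_ \<Rightarrow> real^'d \<Rightarrow> real"
    proof -
      have "(LINT x|M. F (a *\<^sub>R v + b *\<^sub>R w) x) = (LINT x|M. a *\<^sub>R F v x + b *\<^sub>R F w x)"
        by (rule integral_cong_AE) (use that in auto)
      then show ?thesis using integral_lincomb[OF that(1)[of v] that(1)[of w], of a b] by simp
    qed
    have gm: "AE x in vol G. gradm P (a *\<^sub>R fst v + b *\<^sub>R fst w) x = a *\<^sub>R gradm P (fst v) x + b *\<^sub>R gradm P (fst w) x"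
      using flow_operators(1) unfolding ae_linear_def by blast
    have gf: "AE x in surf G. gradf P (a *\<^sub>R snd v + b *\<^sub>R snd w) x = a *\<^sub>R gradf P (snd v) x + b *\<^sub>R gradf P (snd w) x"
      using flow_operators(3) unfolding ae_linear_def by blast
    have dj: "AE x in surf G. djump P s (a *\<^sub>R v + b *\<^sub>R w) x = a *\<^sub>R djump P s v x + b *\<^sub>R djump P s w x" for s
      using flow_operators(5) unfolding ae_linear_def by blast
    have pl: "Pim P (a *\<^sub>R y + b *\<^sub>R z) x = a * Pim P y x + b * Pim P z x" for y z x
      by (simp add: Pim_def pwc_linear)
    have pf: "Pif P (a *\<^sub>R y + b *\<^sub>R z) x = a * Pif P y x + b * Pif P z x" for y z x
      by (simp add: Pif_def pwc_linear)
    have pt: "Tr P s (a *\<^sub>R y + b *\<^sub>R z) x = a * Tr P s y x + b * Tr P s z x" for s y z x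
      by (simp add: Tr_def pwc_linear)
    have 1: "(LINT x|vol G. matrix_term pk uk dt p u \<alpha> (a *\<^sub>R v + b *\<^sub>R w) x) = a * (LINT x|vol G. matrix_term pk uk dt p u \<alpha> v x) + b * (LINT x|vol G. matrix_term pk uk dt p u \<alpha> w x)"
      by (rule L[OF i(1)], use gm in eventually_elim) (simp add: matrix_term_def pl inner_add_right algebra_simps)
    have 2: "(LINT x|surf G. fracture_acc pk uk p u \<alpha> (a *\<^sub>R v + b *\<^sub>R w) x) = a * (LINT x|surf G. fracture_acc pk uk p u \<alpha> v x) + b * (LINT x|surf G. fracture_acc pk uk p u \<alpha> w x)"
      by (rule L[OF i(2)]) (simp add: fracture_acc_def pf algebra_simps)
    have 3: "(LINT x|surf G. fracture_cond dt p u \<alpha> (a *\<^sub>R v + b *\<^sub>R w) x) = a * (LINT x|surf G. fracture_cond dt p u \<alpha> v x) + b * (LINT x|surf G. fracture_cond dt p u \<alpha> w x)"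
      by (rule L[OF i(3)], use gf in eventually_elim) (simp add: fracture_cond_def inner_add_right algebra_simps)
    have 4: "(LINT x|surf G. interface_term s pk dt p \<alpha> (a *\<^sub>R v + b *\<^sub>R w) x) = a * (LINT x|surf G. interface_term s pk dt p \<alpha> v x) + b * (LINT x|surf G. interface_term s pk dt p \<alpha> w x)" for s
      by (rule L[OF i(4)], use dj[of s] in eventually_elim) (simp add: interface_term_def pt algebra_simps)
    have 5: "src \<alpha> (a *\<^sub>R v + b *\<^sub>R w) = a * src \<alpha> v + b * src \<alpha> w"
      using src by (simp add: linear_add linear_cmul)
    show ?thesis unfolding flow_res_def 1 2 3 4 5 by (simp add: algebra_simps)
  qed
  show ?thesis
  proof (rule linearI)
    show "flow_res pk uk dt src p u \<alpha> (v + w) = flow_res pk uk dt src p u \<alpha> v + flow_res pk uk dt src p u \<alpha> w" for v w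
      using comb[of 1 v 1 w] by simp
    show "flow_res pk uk dt src p u \<alpha> (r *\<^sub>R v) = r *\<^sub>R flow_res pk uk dt src p u \<alpha> v" for r v
      using comb[of r v 0 v] by simp
  qed
qed

text \<open>
  The Riesz representative of the residuals of the two phases.
\<close>

definition flow_resvec where
  "flow_resvec pk uk dt src p u = ((\<Sum>b\<in>Basis. flow_res pk uk dt src (by_phase p) u NW b *\<^sub>R b),
     (\<Sum>b\<in>Basis. flow_res pk uk dt src (by_phase p) u W b *\<^sub>R b))"

lemma flow_resvec_inner:
  assumes u: "u \<in> dispV Q" and uk: "uk \<in> U0 G" and src: "\<And>\<alpha>. linear (src \<alpha>)"
  shows "flow_resvec pk uk dt src p u \<bullet> q = flow_res pk uk dt src (by_phase p) u NW (fst q) + flow_res pk uk dt src (by_phase p) u W (snd q)"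
proof -
  have "(\<Sum>b\<in>Basis. flow_res pk uk dt src (by_phase p) u \<alpha> b *\<^sub>R b) \<bullet> v = flow_res pk uk dt src (by_phase p) u \<alpha> v" for \<alpha> v
  proof -
    note l = flow_res_linear[where src = src and \<alpha> = \<alpha>, OF u uk src]
    have "flow_res pk uk dt src (by_phase p) u \<alpha> v = flow_res pk uk dt src (by_phase p) u \<alpha> (\<Sum>b\<in>Basis. (v \<bullet> b) *\<^sub>R b)"
      by (simp add: euclidean_representation)
    also have "\<dots> = (\<Sum>b\<in>Basis. (v \<bullet> b) * flow_res pk uk dt src (by_phase p) u \<alpha> b)"
      by (simp add: linear_sum[OF l] linear_cmul[OF l])
    also have "\<dots> = (\<Sum>b\<in>Basis. flow_res pk uk dt src (by_phase p) u \<alpha> b *\<^sub>R b) \<bullet> v"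
      unfolding inner_sum_left inner_scaleR_left by (rule sum.cong[OF refl]) (metis inner_commute mult.commute)
    finally show ?thesis ..
  qed
  then show ?thesis by (simp add: flow_resvec_def inner_prod_def)
qed

lemma flow_resvec_continuous:
  fixes C :: "(((real^'m) \<times> (real^'f)) \<times> ((real^'m) \<times> (real^'f))) \<times> ((real^'d)^'s) \<Rightarrow> (real^'d \<Rightarrow> real^'d) \<Rightarrow> real"
  assumes C: "\<And>w. continuous_on UNIV (\<lambda>z. C z w)" and uk: "uk \<in> U0 G"
  shows "continuous_on UNIV (\<lambda>z. flow_resvec pk uk dt src (fst z) (disp_comb (C z)))"
proof -
  have "continuous_on UNIV (\<lambda>z. flow_res pk uk dt src (by_phase (fst z)) (disp_comb (C z)) \<alpha> b)" for \<alpha> b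
    by (rule flow_res_continuous[OF continuous_on_fst[OF continuous_on_id] C continuous_on_const uk continuous_on_const])
  then show ?thesis unfolding flow_resvec_def by (intro continuous_intros)
qed

end

context poromechanics
begin

section \<open>Energy estimate\<close>

text \<open>
  Tested with the pressures \<open>a\<close> and \<open>b\<close>, the linearized accumulation becomes
  $f_0\,(a-b)(s-s_k) + e\,(\beta\,dv + m\,(e - e_k))$, since $a s + b (1-s)$ is the equivalent pressure \<open>e\<close>. The
  first term is at least $f_0\,c_k\,(s-s_k)$ by monotonicity of the saturation, the coupling term
  $\beta\,e\,dv$ is kept, and the square in the last one absorbs $e\,e_k$.
\<close>

lemma matrix_cell_energy:
  fixes a b s sk e ek dv bt m f0 ck :: real
  assumes "0 \<le> f0" "0 \<le> m" "s \<in> {0..1}" "sk \<in> {0..1}" and mono: "0 \<le> ((a - b) - ck) * (s - sk)"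
    and e: "e = a * s + b * (1 - s)"
  shows "- f0 * \<bar>ck\<bar> - m * ek\<^sup>2 + bt * (e * dv)
    \<le> (f0 * (s - sk) + s * (bt * dv + m * (e - ek))) * a + (f0 * ((1 - s) - (1 - sk)) + (1 - s) * (bt * dv + m * (e - ek))) * b"
proof -
  have "\<bar>ck * (s - sk)\<bar> \<le> \<bar>ck\<bar> * 1" unfolding abs_mult using assms by (intro mult_left_mono) auto
  then have "- \<bar>ck\<bar> \<le> (a - b) * (s - sk)" using mono by (simp add: left_diff_distrib)
  then have 1: "f0 * - \<bar>ck\<bar> \<le> f0 * ((a - b) * (s - sk))" using assms(1) by (rule mult_left_mono)
  have "0 \<le> (e - ek / 2)\<^sup>2 + 3 / 4 * ek\<^sup>2" by (intro add_nonneg_nonneg) auto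
  then have "- ek\<^sup>2 \<le> e * (e - ek)" by (simp add: power2_eq_square algebra_simps)
  then have 2: "m * - ek\<^sup>2 \<le> m * (e * (e - ek))" using assms(2) by (rule mult_left_mono)
  have "(f0 * (s - sk) + s * (bt * dv + m * (e - ek))) * a + (f0 * ((1 - s) - (1 - sk)) + (1 - s) * (bt * dv + m * (e - ek))) * b
     = f0 * ((a - b) * (s - sk)) + bt * (e * dv) + m * (e * (e - ek))"
    unfolding e by (simp add: algebra_simps)
  then show ?thesis using 1 2 by simp
qed

text \<open>
  With the pressures \<open>a\<close>, \<open>b\<close> the accumulation is $d_k (a-b)(s-s_k) + (d-d_k)(a s + b(1-s))$. The capillary
  inequality bounds the first term below by $d_k (U - U_k)$, and subtracting $U$ in the equivalent pressure
  leaves $d\,U - d_k U_k \ge - d_k U_k$.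
\<close>

lemma fracture_cell_energy:
  fixes a b s sk d dk U Uk :: real
  assumes "0 \<le> d" "0 \<le> dk" "0 \<le> U" and U: "U - Uk \<le> (a - b) * (s - sk)"
  shows "- dk * Uk + (d - dk) * (a * s + b * (1 - s) - U)
    \<le> (d * s - dk * sk) * a + (d * (1 - s) - dk * (1 - sk)) * b"
proof -
  have "dk * (U - Uk) \<le> dk * ((a - b) * (s - sk))" using U assms(2) by (rule mult_left_mono)
  moreover have "0 \<le> d * U" using assms by simp
  ultimately show ?thesis by (simp add: algebra_simps)
qed

text \<open>
  Whatever the sign of the jump, only the mobility on the upwind side acts on it.
\<close>

lemma jump_energy:
  fixes j L e1 e2 lo c :: real
  assumes "0 < c" "c \<le> L" "0 < lo" "lo \<le> e1" "lo \<le> e2"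
  shows "c * lo * j\<^sup>2 \<le> L * (e1 * pos j - e2 * neg j) * j"
proof -
  have "c * lo * j\<^sup>2 \<le> L * lo * j\<^sup>2" using assms by (intro mult_right_mono) auto
  also have "\<dots> = L * (lo * j\<^sup>2)" by simp
  also have "\<dots> \<le> L * ((e1 * pos j - e2 * neg j) * j)"
  proof (rule mult_left_mono)
    show "lo * j\<^sup>2 \<le> (e1 * pos j - e2 * neg j) * j"
      using assms mult_right_mono[OF assms(4), of "j * j"] mult_right_mono[OF assms(5), of "j * j"]
      by (cases "j \<ge> 0") (auto simp: pos_def neg_def power2_eq_square max_def mult.assoc)
  qed (use assms in simp)
  finally show ?thesis by (simp add: mult.assoc)
qed

lemma L2norm_sq: "(L2norm M f)\<^sup>2 = (LINT x|M. (norm (f x))\<^sup>2)"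
  unfolding L2norm_def by (subst real_sqrt_pow2) auto

lemma cell_vol: "AE x in vol G. \<exists>i. \<forall>v::real^'m. Pim P v x = v $ i"
  using ae_partition_cell[OF flow_cells(1), where 'b = real] unfolding Pim_def by eventually_elim blast

lemma cell_surf: "AE x in surf G. \<exists>i. \<forall>v::real^'f. Pif P v x = v $ i"
  using ae_partition_cell[OF flow_cells(2), where 'b = real] unfolding Pif_def by eventually_elim blast

lemma cell_trace: "AE x in surf G. \<exists>i. \<forall>v::real^'m. Tr P a v x = v $ i"
  using ae_partition_cell[OF flow_cells(3), where 'b = real] unfolding Tr_def by eventually_elim blast

lemma Snw_mono_prod: "0 \<le> (p - q) * (Snw D rt p - Snw D rt q)"
  using monoD[OF Snw_props(2), of p q rt] monoD[OF Snw_props(2), of q p rt]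
  by (cases "p \<le> q") (auto intro: mult_nonneg_nonneg mult_nonpos_nonpos)

lemma Snw_01: "Snw D rt q \<in> {0..1}" using Sat_range[of NW rt q] by simp

lemma gradm_L2: "L2 (vol G) (gradm P v)" by (rule vol.Linf_L2[OF flow_operators(2)])
lemma djump_L2: "L2 (surf G) (djump P a v)" by (rule surf.Linf_L2[OF flow_operators(6)])

lemma gradf_L2: "L2 (surf G) (\<lambda>x. (d0 D x powr (3/2)) *\<^sub>R gradf P v x)"
proof (rule L2_bounded_scaleR[OF surf.Linf_L2[OF flow_operators(4)]])
  obtain C where m: "d0 D \<in> borel_measurable (surf G)" and C: "AE x in surf G. norm (d0 D x) \<le> C"
    using d0_props(1) by (auto simp: Linf_def)
  have "AE x in surf G. norm (d0 D x powr (3/2)) \<le> C powr (3/2)"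
    using C AE_space
  proof eventually_elim
    case (elim x)
    then have "0 < d0 D x" using d0_props(2) by (simp add: space_surf)
    then show ?case using elim(1) by (simp add: powr_mono2)
  qed
  then show "Linf (surf G) (\<lambda>x. d0 D x powr (3/2))" using m by (auto simp: Linf_def)
qed

lemma bounded_cells_integrable:
  fixes v w :: "real^'m" and y :: "real^'f"
  shows
  "integrable (vol G) (\<lambda>x. Pim P v x * \<bar>Pim P w x\<bar>)" "integrable (vol G) (\<lambda>x. (Pim P v x)\<^sup>2)"
  "integrable (surf G) (\<lambda>x. \<bar>Tr P a v x\<bar>)" "integrable (surf G) (\<lambda>x. apert G D Q u x * Pif P y x)"
proof -
  show "integrable (vol G) (\<lambda>x. (Pim P v x)\<^sup>2)"
    using vol.Linf_L2[OF Pim_Linf[of v]] by (simp add: L2_def)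
  show "integrable (surf G) (\<lambda>x. \<bar>Tr P a v x\<bar>)"
    using surf.L2_integrable[OF surf.Linf_L2[OF Tr_Linf[of a v]]] by simp
  have "L2 (vol G) (\<lambda>x. \<bar>Pim P w x\<bar>)"
    using vol.Linf_L2[OF Pim_Linf[of w]] by (auto simp: L2_def intro!: borel_measurable_abs)
  from vol.L2_integrable[OF L2_bounded_scaleR[OF this Pim_Linf[of v]]]
  show "integrable (vol G) (\<lambda>x. Pim P v x * \<bar>Pim P w x\<bar>)" by simp
  have "L2 (surf G) (apert G D Q u)"
    using L2_lincomb[OF surf.Linf_L2[OF d0_props(1)] surf.Linf_L2[OF jmpF_Linf[of u]], of 1 "-1"]
    by (simp add: apert_def[abs_def])
  from surf.L2_integrable[OF L2_bounded_scaleR[OF this Pif_Linf[of y]]]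
  show "integrable (surf G) (\<lambda>x. apert G D Q u x * Pif P y x)" by (simp add: mult.commute)
qed

lemma matrix_term_energy:
  fixes p pk :: "phase \<Rightarrow> (real^'m) \<times> (real^'f)"
  assumes u: "u \<in> dispV Q" and uk: "uk \<in> U0 G" and dt: "0 < dt" and lo: "0 < lo" "\<And>\<alpha> rt s. s \<in> {0..1} \<Longrightarrow> lo \<le> eta D \<alpha> rt s"
    and kap: "0 < \<kappa>" "AE x in vol G. \<forall>\<xi>. \<kappa> * (norm \<xi>)\<^sup>2 \<le> \<xi> \<bullet> (Km D x *v \<xi>)"
  shows "- (LINT x|vol G. Pim P phi0 x * \<bar>Pim P (pcm pk) x\<bar>) - invM D * (LINT x|vol G. (Pim P (pEm D pk) x)\<^sup>2)
      + biot D * (LINT x|vol G. Pim P (pEm D p) x * dvg G (\<lambda>y. u y - uk y) x)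
      + dt * lo * \<kappa> * ((L2norm (vol G) (gradm P (fst (p NW))))\<^sup>2 + (L2norm (vol G) (gradm P (fst (p W))))\<^sup>2)
    \<le> (LINT x|vol G. matrix_term pk uk dt p u NW (p NW) x) + (LINT x|vol G. matrix_term pk uk dt p u W (p W) x)"
proof -
  note A = flow_integrable(1)[OF u uk, of pk dt p]
  note i1 = bounded_cells_integrable(1)[of phi0 "pcm pk"] bounded_cells_integrable(2)[of "pEm D pk"]
  have uU: "u \<in> U0 G" using u dispV_subset by blast
  note i2 = Pim_dvg_integrable[OF U0_diff[OF uU uk], of "pEm D p"]
  have i3: "integrable (vol G) (\<lambda>x. (norm (gradm P v x))\<^sup>2)" for v using gradm_L2[of v] by (simp add: L2_def)
  define L where "L x = - (Pim P phi0 x * \<bar>Pim P (pcm pk) x\<bar>) - invM D * (Pim P (pEm D pk) x)\<^sup>2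
      + biot D * (Pim P (pEm D p) x * dvg G (\<lambda>y. u y - uk y) x)
      + dt * lo * \<kappa> * ((norm (gradm P (fst (p NW)) x))\<^sup>2 + (norm (gradm P (fst (p W)) x))\<^sup>2)" for x
  have "(LINT x|vol G. L x) \<le> (LINT x|vol G. matrix_term pk uk dt p u NW (p NW) x + matrix_term pk uk dt p u W (p W) x)"
  proof (rule integral_mono_AE)
    show "integrable (vol G) L" unfolding L_def using i1 i2 i3 by simp
    show "AE x in vol G. L x \<le> matrix_term pk uk dt p u NW (p NW) x + matrix_term pk uk dt p u W (p W) x"
      using cell_vol phi0 kap(2)
    proof eventually_elim
      case (elim x)
      then obtain i where i: "\<And>v::real^'m. Pim P v x = v $ i" by blast
      define a b where "a = fst (p NW) $ i" and "b = fst (p W) $ i"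
      define s sk where "s = Snw D Mat (a - b)" and "sk = Snw D Mat (pcm pk $ i)"
      define e ek where "e = pEm D p $ i" and "ek = pEm D pk $ i"
      have sat: "satm D p NW $ i = s" "satm D p W $ i = 1 - s" "satm D pk NW $ i = sk" "satm D pk W $ i = 1 - sk"
        by (simp_all add: satm_def cmap_def s_def sk_def pcm_def a_def b_def)
      have e: "e = a * s + b * (1 - s)" unfolding e_def pEm_def by (simp add: sat a_def b_def)
      define g where "g \<alpha> = eta D \<alpha> Mat (Pim P (satm D p \<alpha>) x) * ((Km D x *v gradm P (fst (p \<alpha>)) x) \<bullet> gradm P (fst (p \<alpha>)) x)" for \<alpha>
      have g: "lo * \<kappa> * (norm (gradm P (fst (p \<alpha>)) x))\<^sup>2 \<le> g \<alpha>" for \<alpha>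
      proof -
        have "lo * (\<kappa> * (norm (gradm P (fst (p \<alpha>)) x))\<^sup>2) \<le> eta D \<alpha> Mat (Pim P (satm D p \<alpha>) x) * (gradm P (fst (p \<alpha>)) x \<bullet> (Km D x *v gradm P (fst (p \<alpha>)) x))"
          using lo kap(1) elim(3) Pim_sat_01[of p \<alpha> x] by (intro mult_mono) (auto intro: order_trans[of 0 lo])
        then show ?thesis by (simp add: g_def inner_commute mult.assoc)
      qed
      have 1: "- (phi0 $ i) * \<bar>pcm pk $ i\<bar> - invM D * ek\<^sup>2 + biot D * (e * dvg G (\<lambda>y. u y - uk y) x)
        \<le> (phi0 $ i * (s - sk) + s * (biot D * dvg G (\<lambda>y. u y - uk y) x + invM D * (e - ek))) * a
         + (phi0 $ i * ((1 - s) - (1 - sk)) + (1 - s) * (biot D * dvg G (\<lambda>y. u y - uk y) x + invM D * (e - ek))) * b"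
        by (rule matrix_cell_energy)
          (use elim(2) i invM_nonneg Snw_01 Snw_mono_prod e in \<open>simp_all add: s_def sk_def\<close>)
      have "matrix_term pk uk dt p u NW (p NW) x + matrix_term pk uk dt p u W (p W) x
         = (phi0 $ i * (s - sk) + s * (biot D * dvg G (\<lambda>y. u y - uk y) x + invM D * (e - ek))) * a
         + (phi0 $ i * ((1 - s) - (1 - sk)) + (1 - s) * (biot D * dvg G (\<lambda>y. u y - uk y) x + invM D * (e - ek))) * b
         + dt * (g NW + g W)"
        unfolding matrix_term_def g_def i sat a_def b_def e_def ek_def by (simp add: algebra_simps)
      moreover have "dt * (lo * \<kappa> * (norm (gradm P (fst (p NW)) x))\<^sup>2 + lo * \<kappa> * (norm (gradm P (fst (p W)) x))\<^sup>2) \<le> dt * (g NW + g W)"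
        using dt g by (intro mult_left_mono add_mono) auto
      ultimately show ?case using 1 unfolding L_def i e_def[symmetric] ek_def[symmetric] by (simp add: algebra_simps)
    qed
  qed (use A in simp)
  also have "\<dots> = (LINT x|vol G. matrix_term pk uk dt p u NW (p NW) x) + (LINT x|vol G. matrix_term pk uk dt p u W (p W) x)"
    using A by simp
  also have "(LINT x|vol G. L x) = - (LINT x|vol G. Pim P phi0 x * \<bar>Pim P (pcm pk) x\<bar>) - invM D * (LINT x|vol G. (Pim P (pEm D pk) x)\<^sup>2)
      + biot D * (LINT x|vol G. Pim P (pEm D p) x * dvg G (\<lambda>y. u y - uk y) x)
      + dt * lo * \<kappa> * ((L2norm (vol G) (gradm P (fst (p NW))))\<^sup>2 + (L2norm (vol G) (gradm P (fst (p W))))\<^sup>2)"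
    unfolding L_def L2norm_sq using i1 i2 i3 by simp
  finally show ?thesis .
qed

lemma jmpF_nonpos: "(\<And>\<sigma>. face_jump_n u \<sigma> \<le> 0) \<Longrightarrow> jmpF G Q u x \<le> 0"
  unfolding jmpF_eq pwc_def by (intro sum_nonpos) (simp add: indicator_def)

lemma apert_lower: "(\<And>\<sigma>. face_jump_n u \<sigma> \<le> 0) \<Longrightarrow> d0 D x \<le> apert G D Q u x"
  using jmpF_nonpos[of u x] by (simp add: apert_def)

lemma fracture_acc_energy:
  fixes p pk :: "phase \<Rightarrow> (real^'m) \<times> (real^'f)"
  assumes u: "u \<in> dispV Q" "\<And>\<sigma>. face_jump_n u \<sigma> \<le> 0" and uk: "uk \<in> U0 G" "\<And>\<sigma>. face_jump_n uk \<sigma> \<le> 0"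
  shows "- (LINT x|surf G. apert G D Q uk x * Pif P (\<chi> i. capU D Frac (pcf pk $ i)) x)
      - (LINT x|surf G. Pif P (pEf D p) x * jmpF G Q (\<lambda>y. u y - uk y) x)
    \<le> (LINT x|surf G. fracture_acc pk uk p u NW (p NW) x) + (LINT x|surf G. fracture_acc pk uk p u W (p W) x)"
proof -
  have uU: "u \<in> U0 G" using u dispV_subset by blast
  note A = flow_integrable(2)[OF u(1) uk(1), of pk p]
  note i1 = bounded_cells_integrable(4)[of uk "\<chi> i. capU D Frac (pcf pk $ i)"]
  note i2 = Pif_jmpF_integrable[of "pEf D p" "\<lambda>y. u y - uk y"]
  have "(LINT x|surf G. - (apert G D Q uk x * Pif P (\<chi> i. capU D Frac (pcf pk $ i)) x)
      - Pif P (pEf D p) x * jmpF G Q (\<lambda>y. u y - uk y) x)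
     \<le> (LINT x|surf G. fracture_acc pk uk p u NW (p NW) x + fracture_acc pk uk p u W (p W) x)"
  proof (rule integral_mono_AE)
    show "AE x in surf G. - (apert G D Q uk x * Pif P (\<chi> i. capU D Frac (pcf pk $ i)) x)
        - Pif P (pEf D p) x * jmpF G Q (\<lambda>y. u y - uk y) x
      \<le> fracture_acc pk uk p u NW (p NW) x + fracture_acc pk uk p u W (p W) x"
      using cell_surf AE_space
    proof eventually_elim
      case (elim x)
      then obtain i where i: "\<And>v::real^'f. Pif P v x = v $ i" by blast
      define a b where "a = snd (p NW) $ i" and "b = snd (p W) $ i"
      define s sk where "s = Snw D Frac (a - b)" and "sk = Snw D Frac (pcf pk $ i)"
      define U Uk where "U = capU D Frac (a - b)" and "Uk = capU D Frac (pcf pk $ i)"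
      define d dk where "d = apert G D Q u x" and "dk = apert G D Q uk x"
      have sat: "satf D p NW $ i = s" "satf D p W $ i = 1 - s" "satf D pk NW $ i = sk" "satf D pk W $ i = 1 - sk"
        by (simp_all add: satf_def cmap_def s_def sk_def pcf_def a_def b_def)
      have e: "pEf D p $ i = a * s + b * (1 - s) - U" unfolding pEf_def by (simp add: sat a_def b_def U_def pcf_def)
      have "0 < d0 D x" using elim(2) d0_props(2) by (simp add: space_surf)
      then have d: "0 \<le> d" "0 \<le> dk" unfolding d_def dk_def using apert_lower[of u x] apert_lower[of uk x] u(2) uk(2) by auto
      have dd: "d - dk = - jmpF G Q (\<lambda>y. u y - uk y) x"
        using jmpF_lincomb[OF uU uk(1), of 1 "-1" x] by (simp add: d_def dk_def apert_def)
      have "- dk * Uk + (d - dk) * (a * s + b * (1 - s) - U) \<le> (d * s - dk * sk) * a + (d * (1 - s) - dk * (1 - sk)) * b"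
        by (rule fracture_cell_energy) (use d capU_props in \<open>simp_all add: U_def Uk_def s_def sk_def\<close>)
      then show ?case unfolding fracture_acc_def i sat e dd d_def[symmetric] dk_def[symmetric] a_def[symmetric] b_def[symmetric]
        by (simp add: Uk_def[symmetric] mult.commute)
    qed
  qed (use A i1 i2 in simp_all)
  then show ?thesis using A i1 i2 by simp
qed

text \<open>
  The conductivity is at least $d_0^3/12$, which is the square of the weight in the flow norm up to the
  constant.
\<close>

lemma fracture_cond_energy:
  fixes p :: "phase \<Rightarrow> (real^'m) \<times> (real^'f)"
  assumes u: "u \<in> dispV Q" "\<And>\<sigma>. face_jump_n u \<sigma> \<le> 0" and dt: "0 < dt" and lo: "0 < lo" "\<And>\<alpha> rt s. s \<in> {0..1} \<Longrightarrow> lo \<le> eta D \<alpha> rt s"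
  shows "dt * lo / 12 * (L2norm (surf G) (\<lambda>x. (d0 D x powr (3/2)) *\<^sub>R gradf P (snd (p \<alpha>)) x))\<^sup>2
    \<le> (LINT x|surf G. fracture_cond dt p u \<alpha> (p \<alpha>) x)"
proof -
  have uU: "u \<in> U0 G" using u dispV_subset by blast
  note A = flow_integrable(3)[OF u(1) uU, of dt p \<alpha> "p \<alpha>"]
  have i: "integrable (surf G) (\<lambda>x. (norm ((d0 D x powr (3/2)) *\<^sub>R gradf P (snd (p \<alpha>)) x))\<^sup>2)"
    using gradf_L2 by (simp add: L2_def)
  have "(LINT x|surf G. dt * lo / 12 * (norm ((d0 D x powr (3/2)) *\<^sub>R gradf P (snd (p \<alpha>)) x))\<^sup>2) \<le> (LINT x|surf G. fracture_cond dt p u \<alpha> (p \<alpha>) x)"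
  proof (rule integral_mono_AE[OF _ A])
    show "AE x in surf G. dt * lo / 12 * (norm ((d0 D x powr (3/2)) *\<^sub>R gradf P (snd (p \<alpha>)) x))\<^sup>2 \<le> fracture_cond dt p u \<alpha> (p \<alpha>) x"
    proof (rule AE_I2)
      fix x assume "x \<in> space (surf G)"
      then have d: "0 < d0 D x" using d0_props(2) by (simp add: space_surf)
      have "(d0 D x powr (3/2))\<^sup>2 = d0 D x ^ 3"
        using d by (simp add: power2_eq_square powr_add[symmetric] powr_numeral)
      then have n: "(norm ((d0 D x powr (3/2)) *\<^sub>R gradf P (snd (p \<alpha>)) x))\<^sup>2 = d0 D x ^ 3 * (norm (gradf P (snd (p \<alpha>)) x))\<^sup>2"
        by (simp add: power_mult_distrib)
      have m: "d0 D x ^ 3 \<le> max (d0 D x) (apert G D Q u x) ^ 3" using d by (intro power_mono) auto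
      have "lo * (d0 D x ^ 3 / 12) \<le> eta D \<alpha> Frac (Pif P (satf D p \<alpha>) x) * (max (d0 D x) (apert G D Q u x) ^ 3 / 12)"
        using lo Pif_sat_01[of p \<alpha> x] m d by (intro mult_mono) (auto intro: order_trans[of 0 lo])
      then have "lo * (d0 D x ^ 3 / 12) * (norm (gradf P (snd (p \<alpha>)) x))\<^sup>2 \<le>
         eta D \<alpha> Frac (Pif P (satf D p \<alpha>) x) * (max (d0 D x) (apert G D Q u x) ^ 3 / 12) * (norm (gradf P (snd (p \<alpha>)) x))\<^sup>2"
        by (rule mult_right_mono) simp
      then have "dt * (lo * (d0 D x ^ 3 / 12) * (norm (gradf P (snd (p \<alpha>)) x))\<^sup>2) \<le>
         dt * (eta D \<alpha> Frac (Pif P (satf D p \<alpha>) x) * (max (d0 D x) (apert G D Q u x) ^ 3 / 12) * (norm (gradf P (snd (p \<alpha>)) x))\<^sup>2)"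
        using dt by (intro mult_left_mono) auto
      then show "dt * lo / 12 * (norm ((d0 D x powr (3/2)) *\<^sub>R gradf P (snd (p \<alpha>)) x))\<^sup>2 \<le> fracture_cond dt p u \<alpha> (p \<alpha>) x"
        unfolding n unfolding fracture_cond_def power2_norm_eq_inner by (simp add: mult_ac)
    qed
  qed (use i in simp)
  then show ?thesis unfolding L2norm_sq by simp
qed

lemma interface_term_energy:
  fixes p pk :: "phase \<Rightarrow> (real^'m) \<times> (real^'f)"
  assumes u: "u \<in> dispV Q" and dt: "0 < dt" and lo: "0 < lo" "\<And>\<alpha> rt s. s \<in> {0..1} \<Longrightarrow> lo \<le> eta D \<alpha> rt s"
    and c: "0 < c" "AE x in surf G. c \<le> Lamf D x"
  shows "dt * c * lo * ((L2norm (surf G) (djump P a (p NW)))\<^sup>2 + (L2norm (surf G) (djump P a (p W)))\<^sup>2)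
      - width D a * dporo D a * (LINT x|surf G. \<bar>Tr P a (pcm pk) x\<bar>)
    \<le> (LINT x|surf G. interface_term a pk dt p NW (p NW) x) + (LINT x|surf G. interface_term a pk dt p W (p W) x)"
proof -
  have uU: "u \<in> U0 G" using u dispV_subset by blast
  note A = flow_integrable(4)[OF u uU, of a pk dt p]
  note i1 = bounded_cells_integrable(3)[of a "pcm pk"]
  have i: "integrable (surf G) (\<lambda>x. (djump P a v x)\<^sup>2)" for v
    using djump_L2[of a v] by (simp add: L2_def)
  have "(LINT x|surf G. dt * c * lo * ((djump P a (p NW) x)\<^sup>2 + (djump P a (p W) x)\<^sup>2) - width D a * dporo D a * \<bar>Tr P a (pcm pk) x\<bar>)
     \<le> (LINT x|surf G. interface_term a pk dt p NW (p NW) x + interface_term a pk dt p W (p W) x)"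
  proof (rule integral_mono_AE)
    show "AE x in surf G. dt * c * lo * ((djump P a (p NW) x)\<^sup>2 + (djump P a (p W) x)\<^sup>2) - width D a * dporo D a * \<bar>Tr P a (pcm pk) x\<bar>
      \<le> interface_term a pk dt p NW (p NW) x + interface_term a pk dt p W (p W) x"
      using cell_trace[of a] c(2)
    proof eventually_elim
      case (elim x)
      then obtain i where i: "\<And>v::real^'m. Tr P a v x = v $ i" by blast
      define \<alpha>1 \<alpha>2 where "\<alpha>1 = fst (p NW) $ i" and "\<alpha>2 = fst (p W) $ i"
      define s sk where "s = Snw D (Dam a) (\<alpha>1 - \<alpha>2)" and "sk = Snw D (Dam a) (pcm pk $ i)"
      define w where "w = width D a * dporo D a"
      have w: "0 \<le> w" using damaged_props[of a] by (simp add: w_def)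
      have sat: "sata D a p NW $ i = s" "sata D a p W $ i = 1 - s" "sata D a pk NW $ i = sk" "sata D a pk W $ i = 1 - sk"
        by (simp_all add: sata_def cmap_def s_def sk_def pcm_def \<alpha>1_def \<alpha>2_def)
      have 1: "dt * (c * lo * (djump P a (p \<alpha>) x)\<^sup>2) \<le> dt * (Qflux D P p \<alpha> a x * djump P a (p \<alpha>) x)" for \<alpha>
        unfolding Qflux_def using dt c(1) elim(2) lo(1)
        by (intro mult_left_mono jump_energy lo(2) Tr_sat_01 Pif_sat_01) auto
      have "\<bar>pcm pk $ i * (s - sk)\<bar> \<le> \<bar>pcm pk $ i\<bar> * 1"
        unfolding abs_mult using Snw_01[of "Dam a" "\<alpha>1 - \<alpha>2"] Snw_01[of "Dam a" "pcm pk $ i"]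
        by (intro mult_left_mono) (auto simp: s_def sk_def)
      moreover have "0 \<le> ((\<alpha>1 - \<alpha>2) - pcm pk $ i) * (s - sk)" unfolding s_def sk_def by (rule Snw_mono_prod)
      ultimately have "- \<bar>pcm pk $ i\<bar> \<le> (\<alpha>1 - \<alpha>2) * (s - sk)" by (simp add: left_diff_distrib)
      then have 2: "w * - \<bar>pcm pk $ i\<bar> \<le> w * ((\<alpha>1 - \<alpha>2) * (s - sk))" using w by (rule mult_left_mono)
      have "interface_term a pk dt p NW (p NW) x + interface_term a pk dt p W (p W) x = dt * (Qflux D P p NW a x * djump P a (p NW) x)
         + dt * (Qflux D P p W a x * djump P a (p W) x) + w * ((\<alpha>1 - \<alpha>2) * (s - sk))"
        unfolding interface_term_def i sat w_def \<alpha>1_def \<alpha>2_def by (simp add: algebra_simps)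
      then show ?case using 1[of NW] 1[of W] 2 unfolding i w_def[symmetric] by (simp add: algebra_simps)
    qed
  qed (use A i i1 in simp_all)
  then show ?thesis unfolding L2norm_sq using A i i1 by simp
qed

text \<open>
  Let \<open>y\<close> represent the body force in the elastic form \<open>a\<close>. With $w = u - u_k$ and $q = y - u_k$ the
  difference is $a(w,w) - a(q,w)$, which is at least $-a(q,q)$.
\<close>

lemma mech_work_bound:
  assumes uk: "uk \<in> dispV Q"
  shows "\<exists>C. \<forall>u\<in>dispV Q. C \<le> elastic u (\<lambda>x. u x - uk x) - (LINT x|vol G. bodyf D x \<bullet> (u x - uk x))"
proof -
  have ukU: "uk \<in> U0 G" using uk dispV_subset by blast
  have "\<exists>C. (\<forall>w. continuous_on UNIV (\<lambda>z::real. C z w)) \<and> (\<forall>z. \<forall>v\<in>dispV Q. elastic (disp_comb (C z)) v = (LINT x|vol G. bodyf D x \<bullet> v x))"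
  proof (rule riesz_V)
    show "fun_linear (U0 G) (\<lambda>v. LINT x|vol G. bodyf D x \<bullet> v x)" by (rule mech_rhs_linear)
    show "(LINT x|vol G. bodyf D x \<bullet> z x) = 0" if z: "z \<in> U0 G" "elastic z z = 0" for z
    proof -
      have "(LINT x|vol G. bodyf D x \<bullet> z x) = (LINT x|vol G. 0)"
        by (rule integral_cong_AE) (use null_functionals(1)[OF z] mech_rhs_integrable[OF z(1)] in auto)
      then show ?thesis by simp
    qed
  qed simp
  then obtain K :: "real \<Rightarrow> _" where K: "\<And>v. v \<in> dispV Q \<Longrightarrow> elastic (disp_comb (K 0)) v = (LINT x|vol G. bodyf D x \<bullet> v x)" by blast
  define y where "y = disp_comb (K 0)"
  have yU: "y \<in> U0 G" unfolding y_def by (rule disp_comb_U0)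
  define q where "q = (\<lambda>x. y x - uk x)"
  have qU: "q \<in> U0 G" unfolding q_def by (rule U0_diff[OF yU ukU])
  have "- (elastic q q) \<le> elastic u (\<lambda>x. u x - uk x) - (LINT x|vol G. bodyf D x \<bullet> (u x - uk x))" if u: "u \<in> dispV Q" for u
  proof -
    have uU: "u \<in> U0 G" using u dispV_subset by blast
    define w where "w = (\<lambda>x. u x - uk x)"
    have wU: "w \<in> U0 G" unfolding w_def by (rule U0_diff[OF uU ukU])
    have "elastic u w - (LINT x|vol G. bodyf D x \<bullet> w x) = elastic u w - elastic y w"
      using K[OF V_diff[OF u uk]] by (simp add: y_def w_def)
    also have "\<dots> = elastic w w - elastic q w"
      using elastic_diff(1)[OF uU ukU wU] elastic_diff(1)[OF yU ukU wU] by (simp add: w_def[symmetric] q_def[symmetric])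
    finally have e: "elastic u w - (LINT x|vol G. bodyf D x \<bullet> w x) = elastic w w - elastic q w" .
    show ?thesis
      using e elastic_young[OF qU wU] elastic.a_pos[OF wU] elastic.a_pos[OF qU] unfolding w_def by linarith
  qed
  then show ?thesis by blast
qed

text \<open>
  A norm on a Euclidean space is convex, hence continuous, hence bounded below on the unit sphere.
\<close>

lemma flow_norm_lower: "\<exists>c>0. \<forall>v. c * norm v \<le> flow_norm G D P v"
proof (rule homogeneous_lower_bound)
  have N: "is_norm (flow_norm G D P)" by (rule flow_operators(7))
  have hom: "flow_norm G D P (r *\<^sub>R x) = \<bar>r\<bar> * flow_norm G D P x" for r x using N unfolding is_norm_def by blast
  then show "flow_norm G D P (r *\<^sub>R x) = \<bar>r\<bar> * flow_norm G D P x" for r x .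
  show "continuous_on UNIV (flow_norm G D P)"
  proof (rule convex_on_continuous)
    show "convex_on UNIV (flow_norm G D P)"
    proof (rule convex_onI)
      fix t :: real and x y assume t: "0 < t" "t < 1"
      have "flow_norm G D P ((1 - t) *\<^sub>R x + t *\<^sub>R y) \<le> flow_norm G D P ((1 - t) *\<^sub>R x) + flow_norm G D P (t *\<^sub>R y)"
        using N unfolding is_norm_def by blast
      also have "\<dots> = \<bar>1 - t\<bar> * flow_norm G D P x + \<bar>t\<bar> * flow_norm G D P y" unfolding hom ..
      finally show "flow_norm G D P ((1 - t) *\<^sub>R x + t *\<^sub>R y) \<le> (1 - t) * flow_norm G D P x + t * flow_norm G D P y"
        using t by simp
    qed simp
  qed simp
  show "0 < flow_norm G D P x" if "x \<noteq> 0" for x using N that unfolding is_norm_def by (metis less_le)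
qed

lemma flow_norm_sq: "(flow_norm G D P v)\<^sup>2 \<le> 4 * ((L2norm (vol G) (gradm P (fst v)))\<^sup>2
   + (L2norm (surf G) (\<lambda>x. (d0 D x powr (3/2)) *\<^sub>R gradf P (snd v) x))\<^sup>2
   + ((L2norm (surf G) (djump P Plus v))\<^sup>2 + (L2norm (surf G) (djump P Minus v))\<^sup>2))"
proof -
  have "(a + b + (c + d))\<^sup>2 \<le> 4 * (a\<^sup>2 + b\<^sup>2 + (c\<^sup>2 + d\<^sup>2))" for a b c d :: real
  proof -
    have "0 \<le> (a - b)\<^sup>2 + (a - c)\<^sup>2 + (a - d)\<^sup>2 + (b - c)\<^sup>2 + (b - d)\<^sup>2 + (c - d)\<^sup>2" by simp
    then show ?thesis by (simp add: power2_eq_square algebra_simps)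
  qed
  then show ?thesis unfolding flow_norm_def by simp
qed

lemma quadratic_bound:
  fixes x k C B :: real
  assumes "0 < k" "0 \<le> C" "0 \<le> B" "0 \<le> x" "k * x\<^sup>2 \<le> C + B * x"
  shows "x \<le> (C + B) / k + 1"
proof (cases "x \<le> 1")
  case True
  then show ?thesis using assms by (simp add: add_increasing)
next
  case False
  then have "C + B * x \<le> C * x + B * x" using assms mult_left_mono[of 1 x C] by simp
  then have "(k * x) * x \<le> (C + B) * x" using assms by (simp add: power2_eq_square algebra_simps)
  then have "k * x \<le> C + B" using False by (simp add: mult_le_cancel_right)
  then have "x \<le> (C + B) / k" using assms(1) by (simp add: field_simps)
  then show ?thesis by simp
qed

text \<open>
  The residual tested with the pressures is only required to be non-positive, because this is what the
  variational inequality on a ball of pressures provides. The work terms of the matrix and of the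
  fracture add up to \<open>Wk\<close>; by the mechanical equation tested with the increment of the
  displacement, \<open>Wk\<close> is the work of the elastic forces, minus the body force, plus that of the multipliers,
  hence bounded below. The remaining terms are the dissipation, of order $|p|^2$ as the flow norm is a
  norm, constants depending on the previous state, and the sources, of order $|p|$.
\<close>

lemma step_energy:
  fixes src :: "phase \<Rightarrow> (real^'m) \<times> (real^'f) \<Rightarrow> real" and pk :: "phase \<Rightarrow> (real^'m) \<times> (real^'f)"
  assumes uk: "uk \<in> dispV Q" "\<And>\<sigma>. face_jump_n uk \<sigma> \<le> 0" and dt: "0 < dt" and src: "\<And>\<alpha>. linear (src \<alpha>)"
  shows "\<exists>R\<ge>0. \<forall>p u lam. u \<in> dispV Q \<longrightarrow> (\<forall>\<sigma>. face_jump_n u \<sigma> \<le> 0) \<longrightarrow>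
     (\<forall>v\<in>dispV Q. elastic u v + traction lam v = mech_load (by_phase p) v) \<longrightarrow> 0 \<le> traction lam (\<lambda>x. u x - uk x) \<longrightarrow>
     flow_res pk uk dt src (by_phase p) u NW (fst p) + flow_res pk uk dt src (by_phase p) u W (snd p) \<le> 0 \<longrightarrow> norm p \<le> R"
proof -
  have ukU: "uk \<in> U0 G" using uk dispV_subset by blast
  obtain lo where lo: "0 < lo" "\<And>\<alpha> rt s. s \<in> {0..1} \<Longrightarrow> lo \<le> eta D \<alpha> rt s" using eta_lower_bound by blast
  obtain \<kappa> where kap: "0 < \<kappa>" "AE x in vol G. \<forall>\<xi>. \<kappa> * (norm \<xi>)\<^sup>2 \<le> \<xi> \<bullet> (Km D x *v \<xi>)" using Km_props(2) by blast
  obtain c where c: "0 < c" "AE x in surf G. c \<le> Lamf D x" using Lamf_props(2) by blast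
  obtain C5 where C5: "\<And>u. u \<in> dispV Q \<Longrightarrow> C5 \<le> elastic u (\<lambda>x. u x - uk x) - (LINT x|vol G. bodyf D x \<bullet> (u x - uk x))"
    using mech_work_bound[OF uk(1)] by blast
  obtain c0 where c0: "0 < c0" "\<And>v. c0 * norm v \<le> flow_norm G D P v" using flow_norm_lower by blast
  have "\<exists>B. \<forall>v. norm (src \<alpha> v) \<le> B * norm v" for \<alpha> using linear_bounded[OF src[of \<alpha>]] .
  then obtain Bs where Bs: "\<And>\<alpha> v. \<bar>src \<alpha> v\<bar> \<le> Bs \<alpha> * norm v" unfolding real_norm_def by metis
  define B where "B = \<bar>Bs NW\<bar> + \<bar>Bs W\<bar>"
  define Cv where "Cv = (LINT x|vol G. Pim P phi0 x * \<bar>Pim P (pcm pk) x\<bar>) + invM D * (LINT x|vol G. (Pim P (pEm D pk) x)\<^sup>2)"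
  define Cs where "Cs = (LINT x|surf G. apert G D Q uk x * Pif P (\<chi> i. capU D Frac (pcf pk $ i)) x)"
  define Cj where "Cj a = width D a * dporo D a * (LINT x|surf G. \<bar>Tr P a (pcm pk) x\<bar>)" for a
  define C where "C = \<bar>Cv + Cs + Cj Plus + Cj Minus - C5\<bar>"
  define m where "m = dt * lo * min \<kappa> (min (1 / 12) c)"
  have m: "0 < m" using dt lo(1) kap(1) c(1) by (simp add: m_def)
  have mle: "m \<le> dt * lo * \<kappa>" "m \<le> dt * lo / 12" "m \<le> dt * c * lo"
  proof -
    have "dt * lo * min \<kappa> (min (1 / 12) c) \<le> dt * lo * y" if "min \<kappa> (min (1 / 12) c) \<le> y" for y
      using that dt lo(1) by (intro mult_left_mono) auto
    from this[of \<kappa>] this[of "1 / 12"] this[of c]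
    show "m \<le> dt * lo * \<kappa>" "m \<le> dt * lo / 12" "m \<le> dt * c * lo" by (simp_all add: m_def mult_ac)
  qed
  define k where "k = m / 4 * c0\<^sup>2"
  have k: "0 < k" using m c0(1) by (simp add: k_def)
  define R where "R = (C + B) / k + 1"
  have "norm p \<le> R" if u: "u \<in> dispV Q" "\<And>\<sigma>. face_jump_n u \<sigma> \<le> 0" and mech: "\<And>v. v \<in> dispV Q \<Longrightarrow> elastic u v + traction lam v = mech_load (by_phase p) v"
    and diss: "0 \<le> traction lam (\<lambda>x. u x - uk x)"
    and r: "flow_res pk uk dt src (by_phase p) u NW (fst p) + flow_res pk uk dt src (by_phase p) u W (snd p) \<le> 0" for p :: "((real^'m) \<times> (real^'f)) \<times> ((real^'m) \<times> (real^'f))" and u lam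
  proof -
    define w where "w = (\<lambda>x. u x - uk x)"
    define pp where "pp = by_phase p"
    have pp: "pp NW = fst p" "pp W = snd p" by (simp_all add: pp_def)
    define n1 where "n1 v = (L2norm (vol G) (gradm P (fst v)))\<^sup>2" for v :: "(real^'m) \<times> (real^'f)"
    define n2 where "n2 v = (L2norm (surf G) (\<lambda>x. (d0 D x powr (3/2)) *\<^sub>R gradf P (snd v) x))\<^sup>2" for v :: "(real^'m) \<times> (real^'f)"
    define n3 where "n3 a v = (L2norm (surf G) (djump P a v))\<^sup>2" for a and v :: "(real^'m) \<times> (real^'f)"
    have n0: "0 \<le> n1 v" "0 \<le> n2 v" "0 \<le> n3 a v" for v a by (simp_all add: n1_def n2_def n3_def)
    define Wk where "Wk = biot D * (LINT x|vol G. Pim P (pEm D pp) x * dvg G w x) - (LINT x|surf G. Pif P (pEf D pp) x * jmpF G Q w x)"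
    have Wk: "C5 \<le> Wk"
    proof -
      have "elastic u w + traction lam w = (LINT x|vol G. bodyf D x \<bullet> w x) + Wk"
        using mech[OF V_diff[OF u(1) uk(1)]] by (simp add: mech_load_def w_def Wk_def pp_def)
      then show ?thesis using C5[OF u(1)] diss by (simp add: w_def)
    qed
    have sum_ge: "m * y \<le> z * y" if "m \<le> z" "0 \<le> y" for y z using that by (rule mult_right_mono)
    have E1: "- Cv + biot D * (LINT x|vol G. Pim P (pEm D pp) x * dvg G w x) + m * (n1 (fst p) + n1 (snd p))
      \<le> (LINT x|vol G. matrix_term pk uk dt pp u NW (fst p) x) + (LINT x|vol G. matrix_term pk uk dt pp u W (snd p) x)"
      using matrix_term_energy[OF u(1) ukU dt lo kap, of pk pp] sum_ge[OF mle(1), of "n1 (fst p) + n1 (snd p)"] n0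
      by (simp add: Cv_def w_def n1_def pp)
    have E2: "- Cs - (LINT x|surf G. Pif P (pEf D pp) x * jmpF G Q w x)
      \<le> (LINT x|surf G. fracture_acc pk uk pp u NW (fst p) x) + (LINT x|surf G. fracture_acc pk uk pp u W (snd p) x)"
      using fracture_acc_energy[OF u ukU uk(2), of pk pp] by (simp add: Cs_def w_def pp)
    have E3: "m * n2 (pp \<alpha>) \<le> (LINT x|surf G. fracture_cond dt pp u \<alpha> (pp \<alpha>) x)" for \<alpha>
      using fracture_cond_energy[OF u dt lo, of pp \<alpha>] sum_ge[OF mle(2), of "n2 (pp \<alpha>)"] n0 by (simp add: n2_def)
    have E4: "m * (n3 a (fst p) + n3 a (snd p)) - Cj a \<le> (LINT x|surf G. interface_term a pk dt pp NW (fst p) x) + (LINT x|surf G. interface_term a pk dt pp W (snd p) x)" for a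
      using interface_term_energy[OF u(1) dt lo c, of a pp pk] sum_ge[OF mle(3), of "n3 a (fst p) + n3 a (snd p)"] n0
      by (simp add: Cj_def n3_def pp)
    have S: "src NW (fst p) + src W (snd p) \<le> B * norm p"
    proof -
      have b: "src \<alpha> v \<le> \<bar>Bs \<alpha>\<bar> * norm p" if "norm v \<le> norm p" for \<alpha> v
      proof -
        have "src \<alpha> v \<le> Bs \<alpha> * norm v" using Bs[of \<alpha> v] by linarith
        also have "\<dots> \<le> \<bar>Bs \<alpha>\<bar> * norm p" using that by (intro mult_mono) auto
        finally show ?thesis .
      qed
      have "norm (fst p) \<le> norm p" "norm (snd p) \<le> norm p"
        by (cases p, simp add: norm_fst_le, cases p, simp add: norm_snd_le)
      then have "src NW (fst p) \<le> \<bar>Bs NW\<bar> * norm p" and "src W (snd p) \<le> \<bar>Bs W\<bar> * norm p"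
        by (auto intro: b)
      then show ?thesis by (simp add: B_def distrib_right)
    qed
    define n where "n v = n1 v + n2 v + (n3 Plus v + n3 Minus v)" for v
    have nk: "k * (norm v)\<^sup>2 \<le> m * n v" for v
    proof -
      have "(c0 * norm v)\<^sup>2 \<le> (flow_norm G D P v)\<^sup>2" using c0 by (intro power_mono) auto
      also have "\<dots> \<le> 4 * n v" using flow_norm_sq[of v] by (simp add: n_def n1_def n2_def n3_def)
      finally have "m / 4 * (c0 * norm v)\<^sup>2 \<le> m / 4 * (4 * n v)" using m by (intro mult_left_mono) auto
      then show ?thesis by (simp add: k_def power_mult_distrib mult.assoc)
    qed
    have "flow_res pk uk dt src pp u NW (fst p) + flow_res pk uk dt src pp u W (snd p) \<le> 0" using r by (simp add: pp_def)
    then have "m * (n (fst p) + n (snd p)) - Cv - Cs - Cj Plus - Cj Minus + Wk - B * norm p \<le> 0"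
      using E1 E2 E3[of NW] E3[of W] E4[of Plus] E4[of Minus] S unfolding flow_res_def n_def Wk_def pp
      by (simp add: algebra_simps)
    then have "k * (norm (fst p))\<^sup>2 + k * (norm (snd p))\<^sup>2 \<le> C + B * norm p"
      using nk[of "fst p"] nk[of "snd p"] Wk unfolding C_def by (simp add: algebra_simps)
    moreover have "(norm p)\<^sup>2 = (norm (fst p))\<^sup>2 + (norm (snd p))\<^sup>2" by (simp add: norm_prod_def)
    ultimately have "k * (norm p)\<^sup>2 \<le> C + B * norm p" by (simp add: algebra_simps)
    then show ?thesis unfolding R_def by (intro quadratic_bound) (auto simp: k C_def B_def)
  qed
  moreover have "0 \<le> R" using k by (simp add: R_def C_def B_def)
  ultimately show ?thesis by blast
qed

lemma contact_traction_nonneg: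
  assumes "uk \<in> U0 G" "\<And>\<sigma>. face_jump_n uk \<sigma> \<le> 0" "u \<in> U0 G" "contact uk u lam"
  shows "0 \<le> traction lam (\<lambda>x. u x - uk x)"
proof -
  have c: "0 \<le> mult_n lam \<sigma>" "mult_n lam \<sigma> * face_jump_n u \<sigma> = 0"
    "norm m \<le> fric D * mult_n lam \<sigma> \<Longrightarrow> (m - mult_t lam \<sigma>) \<bullet> (face_jump_t u \<sigma> - face_jump_t uk \<sigma>) \<le> 0" for \<sigma> m
    using assms(4) unfolding contact_def by blast+
  show ?thesis
    by (rule contact_dissipation[OF assms(1,2,3) c(1) _ c(3)]) (simp add: c(2))
qed

text \<open>
  On the pressure ball of radius $R + 1$, with \<open>R\<close> from the energy estimate, the variational
  inequality tested with 0 says that the residual tested with the pressures is non-positive. Hence $|p| \le R$,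
  the pressures are interior, and the residual vanishes.
\<close>

lemma step_exists:
  fixes src :: "phase \<Rightarrow> (real^'m) \<times> (real^'f) \<Rightarrow> real" and pk :: "phase \<Rightarrow> (real^'m) \<times> (real^'f)"
  assumes uk: "uk \<in> dispV Q" "\<And>\<sigma>. face_jump_n uk \<sigma> \<le> 0" and dt: "0 < dt" and src: "\<And>\<alpha>. linear (src \<alpha>)"
  obtains p u lam where "u \<in> dispV Q" "\<And>v. v \<in> dispV Q \<Longrightarrow> elastic u v + traction lam v = mech_load p v" "contact uk u lam"
    "\<And>\<alpha> \<phi>. flow_res pk uk dt src p u \<alpha> \<phi> = 0"
proof -
  have ukU: "uk \<in> U0 G" using uk dispV_subset by blast
  obtain R where R0: "0 \<le> R" and R: "\<forall>p u lam. u \<in> dispV Q \<longrightarrow> (\<forall>\<sigma>. face_jump_n u \<sigma> \<le> 0) \<longrightarrow>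
     (\<forall>v\<in>dispV Q. elastic u v + traction lam v = mech_load (by_phase p) v) \<longrightarrow> 0 \<le> traction lam (\<lambda>x. u x - uk x) \<longrightarrow>
     flow_res pk uk dt src (by_phase p) u NW (fst p) + flow_res pk uk dt src (by_phase p) u W (snd p) \<le> 0 \<longrightarrow> norm p \<le> R"
    using step_energy[where src = src and pk = pk, OF uk dt src] by (elim exE conjE)
  have R1: "0 \<le> R + 1" using R0 by simp
  have "\<exists>p u lam. u \<in> dispV Q \<and> (\<forall>q. norm q \<le> R + 1 \<longrightarrow> 0 \<le> flow_resvec pk uk dt src p u \<bullet> (q - p)) \<and>
     (norm p < R + 1 \<longrightarrow> flow_resvec pk uk dt src p u = 0) \<and>
     (\<forall>v\<in>dispV Q. elastic u v + traction lam v = mech_load (by_phase p) v) \<and> contact uk u lam"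
  proof (rule flow_contact_existence[OF uk R1, where \<rho> = "flow_resvec pk uk dt src"])
    show "continuous_on UNIV (\<lambda>z. flow_resvec pk uk dt src (fst z) (disp_comb (C z)))" if "\<And>w. continuous_on UNIV (\<lambda>z. C z w)"
      for C :: "(((real^'m) \<times> (real^'f)) \<times> ((real^'m) \<times> (real^'f))) \<times> ((real^'d)^'s) \<Rightarrow> (real^'d \<Rightarrow> real^'d) \<Rightarrow> real"
      by (rule flow_resvec_continuous[OF that ukU])
  qed blast
  then obtain p u lam where u: "u \<in> dispV Q" and VI: "\<forall>q. norm q \<le> R + 1 \<longrightarrow> 0 \<le> flow_resvec pk uk dt src p u \<bullet> (q - p)"
    and Z: "norm p < R + 1 \<longrightarrow> flow_resvec pk uk dt src p u = 0"
    and mech: "\<forall>v\<in>dispV Q. elastic u v + traction lam v = mech_load (by_phase p) v" and con: "contact uk u lam"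
    by (elim exE conjE)
  have uU: "u \<in> U0 G" using u dispV_subset by blast
  note inner = flow_resvec_inner[where src = src, OF u ukU src]
  have "flow_resvec pk uk dt src p u \<bullet> p \<le> 0" using VI[rule_format, of 0] R0 by simp
  then have "flow_res pk uk dt src (by_phase p) u NW (fst p) + flow_res pk uk dt src (by_phase p) u W (snd p) \<le> 0"
    unfolding inner .
  moreover have "\<forall>\<sigma>. face_jump_n u \<sigma> \<le> 0" using con by (simp add: contact_def)
  ultimately have "norm p \<le> R"
    using R[rule_format, of u lam p] u contact_traction_nonneg[OF ukU uk(2) uU con] mech by blast
  then have z: "flow_resvec pk uk dt src p u = 0" using Z by simp
  have "flow_res pk uk dt src (by_phase p) u \<alpha> \<phi> = 0" for \<alpha> \<phi>
  proof -
    have l0: "flow_res pk uk dt src (by_phase p) u \<beta> 0 = 0" for \<beta>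
      using linear_0[OF flow_res_linear[where src = src and \<alpha> = \<beta>, OF u ukU src]] .
    show ?thesis
      using inner[of pk dt p "(\<phi>, 0)"] inner[of pk dt p "(0, \<phi>)"] z l0 by (cases \<alpha>) simp_all
  qed
  then show ?thesis using that[OF u mech[rule_format] con] by blast
qed

end

section \<open>Piecewise constant functions of time\<close>

definition time_cell :: "(nat \<Rightarrow> real) \<Rightarrow> nat \<Rightarrow> real set" where "time_cell t k = {t (k - 1)<..t k}"

lemma grid_mono:
  assumes g: "time_grid T N t" and "i \<le> j" "j \<le> N" shows "t i \<le> t j"
  using assms(2,3)
proof (induction j rule: dec_induct)
  case (step n)
  then have "t n < t (Suc n)" using g by (simp add: time_grid_def)
  then show ?case using step by simp
qed simp

lemma grid_step: "time_grid T N t \<Longrightarrow> k \<in> {1..N} \<Longrightarrow> t (k - 1) < t k"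
  unfolding time_grid_def by (metis (no_types, lifting) One_nat_def Suc_pred atLeastAtMost_iff less_eq_Suc_le)

lemma tidx_time_cell:
  assumes g: "time_grid T N t" and k: "k \<in> {1..N}" and s: "s \<in> time_cell t k"
  shows "tidx t s = k"
  unfolding tidx_def
proof (rule Least_equality)
  show "s \<le> t k" using s by (simp add: time_cell_def)
  fix j assume j: "s \<le> t j"
  show "k \<le> j"
  proof (rule ccontr)
    assume "\<not> k \<le> j"
    then have "t j \<le> t (k - 1)" using k by (intro grid_mono[OF g]) auto
    then show False using s j by (simp add: time_cell_def)
  qed
qed

lemma time_cell_cover:
  assumes g: "time_grid T N t" and s: "s \<in> {0<..<T}"
  obtains k where "k \<in> {1..N}" "s \<in> time_cell t k" "tidx t s = k"
proof -
  define k where "k = (LEAST k. s \<le> t k)"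
  have sN: "s \<le> t N" and t0: "t 0 < s" using g s by (auto simp: time_grid_def)
  have sk: "s \<le> t k" unfolding k_def by (rule LeastI[of _ N]) (rule sN)
  have kN: "k \<le> N" unfolding k_def by (rule Least_le) (rule sN)
  have k0: "k \<noteq> 0" using sk t0 by (metis not_less)
  have "\<not> s \<le> t (k - 1)"
  proof
    assume "s \<le> t (k - 1)"
    then have "k \<le> k - 1" unfolding k_def by (rule Least_le)
    then show False using k0 by simp
  qed
  then have "s \<in> time_cell t k" using sk by (simp add: time_cell_def)
  moreover have "k \<in> {1..N}" using kN k0 by simp
  ultimately show ?thesis using that tidx_time_cell[OF g] by blast
qed

lemma sum_indicator_tidx:
  assumes g: "time_grid T N t" and s: "s \<in> {0<..<T}"
  shows "(\<Sum>k\<in>{1..N}. indicator (time_cell t k) s * (H k :: real)) = H (tidx t s)"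
proof -
  obtain k where k: "k \<in> {1..N}" "s \<in> time_cell t k" "tidx t s = k" using time_cell_cover[OF g s] .
  have "(\<Sum>j\<in>{1..N}. indicator (time_cell t j) s * H j) = (\<Sum>j\<in>{1..N}. if j = k then H k else 0)"
    by (rule sum.cong[OF refl]) (use tidx_time_cell[OF g] k in \<open>auto simp: indicator_def\<close>)
  then show ?thesis using k by simp
qed

lemma LINT_tidx_sum:
  assumes g: "time_grid T N t"
    and i: "\<And>k. k \<in> {1..N} \<Longrightarrow> integrable (lebesgue_on {0<..<T}) (\<lambda>s. indicator (time_cell t k) s * H k s)"
  shows "(LINT s|lebesgue_on {0<..<T}. H (tidx t s) s)
    = (\<Sum>k\<in>{1..N}. LINT s|lebesgue_on {0<..<T}. indicator (time_cell t k) s * (H k s :: real))"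
proof -
  have "(LINT s|lebesgue_on {0<..<T}. H (tidx t s) s) = (LINT s|lebesgue_on {0<..<T}. (\<Sum>k\<in>{1..N}. indicator (time_cell t k) s * H k s))"
  proof (rule Bochner_Integration.integral_cong[OF refl])
    fix s assume "s \<in> space (lebesgue_on {0<..<T})"
    then have "s \<in> {0<..<T}" by simp
    from sum_indicator_tidx[OF g this, of "\<lambda>k. H k s"]
    show "H (tidx t s) s = (\<Sum>k\<in>{1..N}. indicator (time_cell t k) s * H k s)" by simp
  qed
  also have "\<dots> = (\<Sum>k\<in>{1..N}. LINT s|lebesgue_on {0<..<T}. indicator (time_cell t k) s * H k s)"
    by (rule Bochner_Integration.integral_sum) (rule i)
  finally show ?thesis .
qed

lemma time_cell_measure:
  assumes g: "time_grid T N t" and k: "k \<in> {1..N}"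
  shows "integrable (lebesgue_on {0<..<T}) (\<lambda>s. indicator (time_cell t k) s * (c :: real))"
    and "(LINT s|lebesgue_on {0<..<T}. indicator (time_cell t k) s * c) = (t k - t (k - 1)) * c"
proof -
  have lt: "t (k - 1) < t k" by (rule grid_step[OF g k])
  have 0: "0 \<le> t (k - 1)" using grid_mono[OF g, of 0 "k - 1"] k g by (auto simp: time_grid_def)
  have T: "t k \<le> T" using grid_mono[OF g, of k N] k g by (auto simp: time_grid_def)
  have m: "time_cell t k \<inter> {0<..<T} \<in> lmeasurable" and me: "measure lebesgue (time_cell t k \<inter> {0<..<T}) = t k - t (k - 1)"
  proof -
    consider "time_cell t k \<inter> {0<..<T} = {t (k - 1)<..t k}" | "time_cell t k \<inter> {0<..<T} = {t (k - 1)<..<t k}"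
    proof (cases "t k < T")
      case True
      have "time_cell t k \<inter> {0<..<T} = {t (k - 1)<..t k}"
        unfolding time_cell_def using 0 True by (intro set_eqI) (auto simp del: One_nat_def)
      then show ?thesis by (rule that(1))
    next
      case False
      have "time_cell t k \<inter> {0<..<T} = {t (k - 1)<..<t k}"
        unfolding time_cell_def using 0 T False by (intro set_eqI) (auto simp del: One_nat_def)
      then show ?thesis by (rule that(2))
    qed
    then show "time_cell t k \<inter> {0<..<T} \<in> lmeasurable" "measure lebesgue (time_cell t k \<inter> {0<..<T}) = t k - t (k - 1)"
      using lt by (cases; simp add: fmeasurable_def)+
  qed
  have e: "indicator {0<..<T} s *\<^sub>R (indicator (time_cell t k) s * c) = indicator (time_cell t k \<inter> {0<..<T}) s * c" for s :: real
    by (auto simp: indicator_def)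
  have i: "integrable lebesgue (\<lambda>s. indicator (time_cell t k \<inter> {0<..<T}) s * c)"
    using m by (intro integrable_mult_left) (auto simp: fmeasurable_def)
  show "integrable (lebesgue_on {0<..<T}) (\<lambda>s. indicator (time_cell t k) s * c)"
    using i by (subst integrable_restrict_space) (simp, simp only: e)
  have "(LINT s|lebesgue_on {0<..<T}. indicator (time_cell t k) s * c) = (LINT s|lebesgue. indicator (time_cell t k \<inter> {0<..<T}) s * c)"
    by (subst integral_restrict_space) (simp, simp only: e)
  also have "\<dots> = (t k - t (k - 1)) * c" using m me by simp
  finally show "(LINT s|lebesgue_on {0<..<T}. indicator (time_cell t k) s * c) = (t k - t (k - 1)) * c" .
qed

lemma LINT_tidx_const:
  assumes g: "time_grid T N t"
  shows "(LINT s|lebesgue_on {0<..<T}. g (tidx t s)) = (\<Sum>k\<in>{1..N}. (t k - t (k - 1)) * (g k :: real))"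
proof -
  have "(LINT s|lebesgue_on {0<..<T}. g (tidx t s)) = (\<Sum>k\<in>{1..N}. LINT s|lebesgue_on {0<..<T}. indicator (time_cell t k) s * g k)"
    by (rule LINT_tidx_sum[OF g, of "\<lambda>k s. g k"]) (rule time_cell_measure(1)[OF g])
  also have "\<dots> = (\<Sum>k\<in>{1..N}. (t k - t (k - 1)) * g k)"
    by (rule sum.cong[OF refl time_cell_measure(2)[OF g]])
  finally show ?thesis .
qed

context poromechanics
begin

section \<open>Source terms\<close>

definition source_term :: "(nat \<Rightarrow> real) \<Rightarrow> nat \<Rightarrow> phase \<Rightarrow> (real^'m) \<times> (real^'f) \<Rightarrow> real" where
  "source_term t k \<alpha> \<phi> = (LINT s|lebesgue_on {0<..<T}. indicator (time_cell t k) s * (LINT x|vol G. hm D \<alpha> s x * Pim P (fst \<phi>) x))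
     + (LINT s|lebesgue_on {0<..<T}. indicator (time_cell t k) s * (LINT x|surf G. hf D \<alpha> s x * Pif P (snd \<phi>) x))"

lemma finite_measure_time: "finite_measure (lebesgue_on {0<..<T})"
  by (rule finite_measure_lebesgue_on_bounded) auto

lemma source_product:
  fixes h :: "real \<Rightarrow> real^'d \<Rightarrow> real" and A :: "'i::finite \<Rightarrow> (real^'d) set"
  assumes M: "finite_measure M" and A: "ae_partition M A"
    and h: "L2 (lebesgue_on {0<..<T} \<Otimes>\<^sub>M M) (\<lambda>(s, x). h s x)"
  shows "integrable (lebesgue_on {0<..<T}) (\<lambda>s. LINT x|M. h s x * pwc A v x)"
    and "AE s in lebesgue_on {0<..<T}. integrable M (\<lambda>x. h s x * pwc A (v :: real^'i) x)"
proof -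
  interpret M: finite_measure M by (rule M)
  interpret L: finite_measure "lebesgue_on {0<..<T}" by (rule finite_measure_time)
  interpret P: pair_sigma_finite "lebesgue_on {0<..<T}" M ..
  interpret F: finite_measure "lebesgue_on {0<..<T} \<Otimes>\<^sub>M M"
    by (rule finite_measure_pair_measure[OF M.finite_measure_axioms L.finite_measure_axioms])
  have [measurable]: "pwc A v \<in> borel_measurable M" by (rule pwc_measurable[OF A])
  have "norm (pwc A v x) \<le> norm v" for x
    using pwc_value[of A v x] A Finite_Cartesian_Product.norm_nth_le[of v] by (auto simp: ae_partition_def)
  then have "Linf (lebesgue_on {0<..<T} \<Otimes>\<^sub>M M) (\<lambda>z. pwc A v (snd z))"
    unfolding Linf_def by (intro conjI exI[of _ "norm v"] AE_I2) auto
  from F.L2_integrable[OF L2_bounded_scaleR[OF h this]]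
  have i: "integrable (lebesgue_on {0<..<T} \<Otimes>\<^sub>M M) (\<lambda>z. h (fst z) (snd z) * pwc A v (snd z))"
    by (simp add: split_beta' mult.commute)
  show "integrable (lebesgue_on {0<..<T}) (\<lambda>s. LINT x|M. h s x * pwc A v x)"
    using P.integrable_fst'[OF i] by simp
  show "AE s in lebesgue_on {0<..<T}. integrable M (\<lambda>x. h s x * pwc A v x)"
    using P.AE_integrable_fst'[OF i] by simp
qed

lemma time_cell_mult_integrable:
  assumes "integrable (lebesgue_on {0<..<T}) f"
  shows "integrable (lebesgue_on {0<..<T}) (\<lambda>s. indicator (time_cell t k) s * (f s :: real))"
proof -
  have "time_cell t k \<in> sets lebesgue" by (simp add: time_cell_def)
  then have "(indicator (time_cell t k) :: _ \<Rightarrow> real) \<in> borel_measurable (lebesgue_on {0<..<T})"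
    by (intro measurable_restrict_space1 borel_measurable_indicator)
  then have "(\<lambda>s. indicator (time_cell t k) s * f s) \<in> borel_measurable (lebesgue_on {0<..<T})"
    using borel_measurable_integrable[OF assms] by (rule borel_measurable_times)
  then show ?thesis
    by (rule Bochner_Integration.integrable_bound[OF assms]) (auto simp: indicator_def)
qed

lemma source_linear:
  fixes h :: "real \<Rightarrow> real^'d \<Rightarrow> real" and A :: "'i::finite \<Rightarrow> (real^'d) set"
  assumes M: "finite_measure M" and A: "ae_partition M A"
    and h: "L2 (lebesgue_on {0<..<T} \<Otimes>\<^sub>M M) (\<lambda>(s, x). h s x)"
  shows "linear (\<lambda>v :: real^'i. LINT s|lebesgue_on {0<..<T}. indicator (time_cell t k) s * (LINT x|M. h s x * pwc A v x))"
proof -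
  note P = source_product[OF M A h]
  define F where "F v = (LINT s|lebesgue_on {0<..<T}. indicator (time_cell t k) s * (LINT x|M. h s x * pwc A v x))" for v :: "real^'i"
  have comb: "F (a *\<^sub>R v + b *\<^sub>R w) = a * F v + b * F w" for a b v w
  proof -
    have "F (a *\<^sub>R v + b *\<^sub>R w) = (LINT s|lebesgue_on {0<..<T}. a *\<^sub>R (indicator (time_cell t k) s * (LINT x|M. h s x * pwc A v x))
        + b *\<^sub>R (indicator (time_cell t k) s * (LINT x|M. h s x * pwc A w x)))"
      unfolding F_def
    proof (rule integral_cong_AE)
      show "AE s in lebesgue_on {0<..<T}. indicator (time_cell t k) s * (LINT x|M. h s x * pwc A (a *\<^sub>R v + b *\<^sub>R w) x)
        = a *\<^sub>R (indicator (time_cell t k) s * (LINT x|M. h s x * pwc A v x)) + b *\<^sub>R (indicator (time_cell t k) s * (LINT x|M. h s x * pwc A w x))"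
        using P(2)[of v] P(2)[of w]
      proof eventually_elim
        case (elim s)
        have "(LINT x|M. h s x * pwc A (a *\<^sub>R v + b *\<^sub>R w) x) = (LINT x|M. a *\<^sub>R (h s x * pwc A v x) + b *\<^sub>R (h s x * pwc A w x))"
          by (simp add: pwc_linear algebra_simps)
        also have "\<dots> = a *\<^sub>R (LINT x|M. h s x * pwc A v x) + b *\<^sub>R (LINT x|M. h s x * pwc A w x)"
          by (rule integral_lincomb[OF elim])
        finally show ?case by (simp add: algebra_simps)
      qed
    qed (use borel_measurable_integrable[OF time_cell_mult_integrable[OF P(1)]] in \<open>auto intro!: borel_measurable_add borel_measurable_scaleR\<close>)
    also have "\<dots> = a * F v + b * F w"
      unfolding F_def using integral_lincomb[OF time_cell_mult_integrable[OF P(1)] time_cell_mult_integrable[OF P(1)], of a t k v b t k w] by simp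
    finally show ?thesis .
  qed
  have "linear F"
  proof (rule linearI)
    show "F (v + w) = F v + F w" for v w using comb[of 1 v 1 w] by simp
    show "F (r *\<^sub>R v) = r *\<^sub>R F v" for r v using comb[of r v 0 v] by simp
  qed
  then show ?thesis by (simp add: F_def[abs_def])
qed

lemma source_data:
  "L2 (lebesgue_on {0<..<T} \<Otimes>\<^sub>M vol G) (\<lambda>(s, x). hm D \<alpha> s x)"
  "L2 (lebesgue_on {0<..<T} \<Otimes>\<^sub>M surf G) (\<lambda>(s, x). hf D \<alpha> s x)"
proof -
  have *: "\<forall>\<alpha>. L2 (lebesgue_on {0<..<T} \<Otimes>\<^sub>M vol G) (\<lambda>(s, x). hm D \<alpha> s x) \<and>
          L2 (lebesgue_on {0<..<T} \<Otimes>\<^sub>M surf G) (\<lambda>(s, x). hf D \<alpha> s x)"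
    using model unfolding model_data_def by (elim conjE)
  show "L2 (lebesgue_on {0<..<T} \<Otimes>\<^sub>M vol G) (\<lambda>(s, x). hm D \<alpha> s x)"
    "L2 (lebesgue_on {0<..<T} \<Otimes>\<^sub>M surf G) (\<lambda>(s, x). hf D \<alpha> s x)" using spec[OF *, of \<alpha>] by blast+
qed

lemma source_term_linear: "linear (source_term t k \<alpha>)"
proof -
  have 1: "linear (\<lambda>\<phi> :: (real^'m) \<times> (real^'f). LINT s|lebesgue_on {0<..<T}. indicator (time_cell t k) s * (LINT x|vol G. hm D \<alpha> s x * Pim P (fst \<phi>) x))"
    using linear_compose[OF linear_fst source_linear[OF vol.finite_measure_axioms flow_cells(1) source_data(1)[of \<alpha>], of t k]]
    by (simp add: Pim_def comp_def)
  have 2: "linear (\<lambda>\<phi> :: (real^'m) \<times> (real^'f). LINT s|lebesgue_on {0<..<T}. indicator (time_cell t k) s * (LINT x|surf G. hf D \<alpha> s x * Pif P (snd \<phi>) x))"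
    using linear_compose[OF linear_snd source_linear[OF surf.finite_measure_axioms flow_cells(2) source_data(2)[of \<alpha>], of t k]]
    by (simp add: Pif_def comp_def)
  show ?thesis using linear_compose_add[OF 1 2] by (simp add: source_term_def[abs_def])
qed

section \<open>The time-discrete flow equations\<close>

text \<open>
  Apart from the sources, all integrands are constant in time on each interval of the grid, and the length of
  the interval cancels the divisor of the discrete time derivative.
\<close>

lemma flow_eq_of_steps:
  fixes p :: "phase \<Rightarrow> nat \<Rightarrow> (real^'m) \<times> (real^'f)"
  assumes g: "time_grid T N t" and u: "\<And>k. k \<le> N \<Longrightarrow> u k \<in> dispV Q" "\<And>k \<sigma>. k \<le> N \<Longrightarrow> face_jump_n (u k) \<sigma> \<le> 0"
    and r: "\<And>k \<phi>. k \<in> {1..N} \<Longrightarrow>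
      flow_res (\<lambda>\<beta>. p \<beta> (k - 1)) (u (k - 1)) (t k - t (k - 1)) (source_term t k) (\<lambda>\<beta>. p \<beta> k) (u k) \<alpha> \<phi> = 0"
  shows "flow_eq G D P Q T t p u \<alpha> \<phi>"
proof -
  define pk where "pk k = (\<lambda>\<beta>. p \<beta> k)" for k
  define dt where "dt k = t k - t (k - 1)" for k
  have dt: "0 < dt k" if "k \<in> {1..N}" for k using grid_step[OF g that] by (simp add: dt_def)
  have uU: "u k \<in> U0 G" if "k \<le> N" for k using u(1)[OF that] dispV_subset by blast
  define A where "A k = (LINT x|vol G. matrix_term (pk (k - 1)) (u (k - 1)) (dt k) (pk k) (u k) \<alpha> (\<phi> k) x)" for k
  define B1 where "B1 k = (LINT x|surf G. fracture_acc (pk (k - 1)) (u (k - 1)) (pk k) (u k) \<alpha> (\<phi> k) x)" for k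
  define B2 where "B2 k = (LINT x|surf G. fracture_cond (dt k) (pk k) (u k) \<alpha> (\<phi> k) x)" for k
  define B3 where "B3 a k = (LINT x|surf G. interface_term a (pk (k - 1)) (dt k) (pk k) \<alpha> (\<phi> k) x)" for a k
  have T: "(LINT s|lebesgue_on {0<..<T}. I s) = (\<Sum>k\<in>{1..N}. X k)"
    if "\<And>s k. k \<in> {1..N} \<Longrightarrow> tidx t s = k \<Longrightarrow> I s = (1 / dt k) * X k" for I :: "real \<Rightarrow> real" and X
  proof -
    have "(LINT s|lebesgue_on {0<..<T}. I s) = (LINT s|lebesgue_on {0<..<T}. (1 / dt (tidx t s)) * X (tidx t s))"
    proof (rule Bochner_Integration.integral_cong[OF refl])
      fix s assume "s \<in> space (lebesgue_on {0<..<T})"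
      then have "s \<in> {0<..<T}" by simp
      then obtain k where "k \<in> {1..N}" "tidx t s = k" using time_cell_cover[OF g] by metis
      then show "I s = 1 / dt (tidx t s) * X (tidx t s)" using that by simp
    qed
    also have "\<dots> = (\<Sum>k\<in>{1..N}. dt k * ((1 / dt k) * X k))"
      using LINT_tidx_const[OF g, of "\<lambda>k. (1 / dt k) * X k"] by (simp add: dt_def)
    also have "\<dots> = (\<Sum>k\<in>{1..N}. X k)" by (rule sum.cong[OF refl]) (use dt in force)
    finally show ?thesis .
  qed
  have dtime: "dtime t w s = (1 / dt k) *\<^sub>R (w k - w (k - 1))" if "tidx t s = k" for w :: "nat \<Rightarrow> real" and s k
    using that by (simp add: dtime_def dt_def Let_def)
  have at: "at_time t w s = w k" if "tidx t s = k" for w :: "nat \<Rightarrow> real" and s k using that by (simp add: at_time_def)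
  have V: "(LINT s|lebesgue_on {0<..<T}. LINT x|vol G.
        (Pim P (intphi P (phibar D)) x * dtime t (\<lambda>k. Pim P (satm D (pk k) \<alpha>) x) s
         + at_time t (\<lambda>k. Pim P (satm D (pk k) \<alpha>) x) s * dtime t (\<lambda>k. phiD G D P p u k x) s)
          * at_time t (\<lambda>k. Pim P (fst (\<phi> k)) x) s
        + at_time t (\<lambda>k. eta D \<alpha> Mat (Pim P (satm D (pk k) \<alpha>) x) *
            ((Km D x *v gradm P (fst (p \<alpha> k)) x) \<bullet> gradm P (fst (\<phi> k)) x)) s) = (\<Sum>k\<in>{1..N}. A k)" (is "(LINT s|_. LINT x|_. ?V s x) = _")
  proof (rule T)
    fix s k assume k: "k \<in> {1..N}" and s: "tidx t s = k"
    have kN: "k \<le> N" "k - 1 \<le> N" using k by auto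
    note U = uU[OF kN(1)] uU[OF kN(2)] uU[of 0, simplified]
    define c where "c = 1 / dt k"
    have c: "c * dt k = 1" using dt[OF k] by (simp add: c_def)
    \<comment> \<open>The porosity refers to the initial displacement, the step to the previous one; since the divergence
      is linear almost everywhere only, the discrepancy \<open>E\<close> is a null function.\<close>
    define E where "E x = dvg G (\<lambda>y. u k y - u 0 y) x - dvg G (\<lambda>y. u (k - 1) y - u 0 y) x - dvg G (\<lambda>y. u k y - u (k - 1) y) x" for x
    have E0: "AE x in vol G. E x = 0"
      using dvg_diff[OF U(1) U(3)] dvg_diff[OF U(2) U(3)] dvg_diff[OF U(1) U(2)] by eventually_elim (simp add: E_def)
    have [measurable]: "E \<in> borel_measurable (vol G)"
      using L2_dvg[OF U0_diff[OF U(1) U(3)]] L2_dvg[OF U0_diff[OF U(2) U(3)]] L2_dvg[OF U0_diff[OF U(1) U(2)]]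
      unfolding E_def by (auto simp: L2_def)
    have [measurable]: "Pim P v \<in> borel_measurable (vol G)" for v :: "real^'m" using Pim_Linf[of v] by (simp add: Linf_def)
    define R where "R x = c * (Pim P (satm D (pk k) \<alpha>) x * (biot D * E x) * Pim P (fst (\<phi> k)) x)" for x
    note i = flow_integrable(1)[OF u(1)[OF kN(1)] U(2), of "pk (k - 1)" "dt k" "pk k" \<alpha> "\<phi> k"]
    have "(LINT x|vol G. c * matrix_term (pk (k - 1)) (u (k - 1)) (dt k) (pk k) (u k) \<alpha> (\<phi> k) x + R x)
        = (LINT x|vol G. c * matrix_term (pk (k - 1)) (u (k - 1)) (dt k) (pk k) (u k) \<alpha> (\<phi> k) x)"
    proof (rule integral_cong_AE)
      have "R \<in> borel_measurable (vol G)" unfolding R_def by measurable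
      then show "(\<lambda>x. c * matrix_term (pk (k - 1)) (u (k - 1)) (dt k) (pk k) (u k) \<alpha> (\<phi> k) x + R x) \<in> borel_measurable (vol G)"
        using borel_measurable_integrable[OF i] by measurable
      show "AE x in vol G. c * matrix_term (pk (k - 1)) (u (k - 1)) (dt k) (pk k) (u k) \<alpha> (\<phi> k) x + R x
         = c * matrix_term (pk (k - 1)) (u (k - 1)) (dt k) (pk k) (u k) \<alpha> (\<phi> k) x"
        using E0 by eventually_elim (simp add: R_def)
    qed (use borel_measurable_integrable[OF i] in measurable)
    moreover have "?V s x
       = c * matrix_term (pk (k - 1)) (u (k - 1)) (dt k) (pk k) (u k) \<alpha> (\<phi> k) x + R x" for x
    proof -
      have pd: "Pim P (v - w) x = Pim P v x - Pim P w x" for v w :: "real^'m"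
        using pwc_linear[of "cellm P" 1 v "-1" w x] by (simp add: Pim_def)
      have ph: "phiD G D P p u k x - phiD G D P p u (k - 1) x = biot D * dvg G (\<lambda>y. u k y - u (k - 1) y) x
          + invM D * (Pim P (pEm D (pk k)) x - Pim P (pEm D (pk (k - 1))) x) + biot D * E x"
        unfolding phiD_def E_def pk_def pd by (simp add: algebra_simps)
      have cond: "y = c * (dt k * y)" for y using c by (simp add: mult.assoc[symmetric])
      show ?thesis
        unfolding dtime[OF s] at[OF s] ph c_def[symmetric] R_def matrix_term_def
        using cond[of "eta D \<alpha> Mat (Pim P (satm D (pk k) \<alpha>) x) * ((Km D x *v gradm P (fst (pk k \<alpha>)) x) \<bullet> gradm P (fst (\<phi> k)) x)"]
        by (simp add: pk_def algebra_simps)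
    qed
    ultimately show "(LINT x|vol G. ?V s x) = 1 / dt k * A k"
      using i by (simp add: A_def c_def)
  qed
  have S1: "(LINT s|lebesgue_on {0<..<T}. LINT x|surf G.
          dtime t (\<lambda>k. apert G D Q (u k) x * Pif P (satf D (pk k) \<alpha>) x) s
            * at_time t (\<lambda>k. Pif P (snd (\<phi> k)) x) s) = (\<Sum>k\<in>{1..N}. B1 k)" (is "(LINT s|_. LINT x|_. ?S1 s x) = _")
  proof (rule T)
    fix s k assume k: "k \<in> {1..N}" and s: "tidx t s = k"
    have "?S1 s x
       = (1 / dt k) * fracture_acc (pk (k - 1)) (u (k - 1)) (pk k) (u k) \<alpha> (\<phi> k) x" for x
      unfolding dtime[OF s] at[OF s] fracture_acc_def by simp
    then show "(LINT x|surf G. ?S1 s x) = 1 / dt k * B1 k"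
      unfolding B1_def by (simp only: integral_mult_right_zero)
  qed
  have S2: "(LINT s|lebesgue_on {0<..<T}. LINT x|surf G.
          at_time t (\<lambda>k. eta D \<alpha> Frac (Pif P (satf D (pk k) \<alpha>) x) * (apert G D Q (u k) x ^ 3 / 12)
            * (gradf P (snd (p \<alpha> k)) x \<bullet> gradf P (snd (\<phi> k)) x)) s) = (\<Sum>k\<in>{1..N}. B2 k)" (is "(LINT s|_. LINT x|_. ?S2 s x) = _")
  proof (rule T)
    fix s k assume k: "k \<in> {1..N}" and s: "tidx t s = k"
    \<comment> \<open>By non-penetration the aperture is at least its contact value.\<close>
    have "max (d0 D x) (apert G D Q (u k) x) = apert G D Q (u k) x" for x
      using apert_lower[OF u(2)] k by simp
    then have "?S2 s x = (1 / dt k) * fracture_cond (dt k) (pk k) (u k) \<alpha> (\<phi> k) x" for x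
      unfolding at[OF s] fracture_cond_def using dt[OF k] by (simp add: pk_def)
    then show "(LINT x|surf G. ?S2 s x) = 1 / dt k * B2 k"
      unfolding B2_def by (simp only: integral_mult_right_zero)
  qed
  have S3: "(LINT s|lebesgue_on {0<..<T}. LINT x|surf G.
          at_time t (\<lambda>k. Qflux D P (pk k) \<alpha> a x * djump P a (\<phi> k) x) s
          + width D a * dporo D a * dtime t (\<lambda>k. Tr P a (sata D a (pk k) \<alpha>) x) s
              * at_time t (\<lambda>k. Tr P a (fst (\<phi> k)) x) s) = (\<Sum>k\<in>{1..N}. B3 a k)" (is "(LINT s|_. LINT x|_. ?S3 s x) = _") for a
  proof (rule T)
    fix s k assume k: "k \<in> {1..N}" and s: "tidx t s = k"
    have "?S3 s x = (1 / dt k) * interface_term a (pk (k - 1)) (dt k) (pk k) \<alpha> (\<phi> k) x" for x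
      unfolding at[OF s] dtime[OF s] interface_term_def using dt[OF k] by (simp add: distrib_left)
    then show "(LINT x|surf G. ?S3 s x) = 1 / dt k * B3 a k"
      unfolding B3_def by (simp only: integral_mult_right_zero)
  qed
  have R1: "(LINT s|lebesgue_on {0<..<T}. LINT x|vol G. hm D \<alpha> s x * at_time t (\<lambda>k. Pim P (fst (\<phi> k)) x) s)
     = (\<Sum>k\<in>{1..N}. LINT s|lebesgue_on {0<..<T}. indicator (time_cell t k) s * (LINT x|vol G. hm D \<alpha> s x * Pim P (fst (\<phi> k)) x))"
    unfolding at_time_def
    by (rule LINT_tidx_sum[OF g, of "\<lambda>k s. LINT x|vol G. hm D \<alpha> s x * Pim P (fst (\<phi> k)) x"])
      (unfold Pim_def, intro time_cell_mult_integrable source_product(1) vol.finite_measure_axioms flow_cells source_data)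
  have R2: "(LINT s|lebesgue_on {0<..<T}. LINT x|surf G. hf D \<alpha> s x * at_time t (\<lambda>k. Pif P (snd (\<phi> k)) x) s)
     = (\<Sum>k\<in>{1..N}. LINT s|lebesgue_on {0<..<T}. indicator (time_cell t k) s * (LINT x|surf G. hf D \<alpha> s x * Pif P (snd (\<phi> k)) x))"
    unfolding at_time_def
    by (rule LINT_tidx_sum[OF g, of "\<lambda>k s. LINT x|surf G. hf D \<alpha> s x * Pif P (snd (\<phi> k)) x"])
      (unfold Pif_def, intro time_cell_mult_integrable source_product(1) surf.finite_measure_axioms flow_cells source_data)
  have "A k + B1 k + B2 k + (\<Sum>a\<in>{Plus, Minus}. B3 a k) = source_term t k \<alpha> (\<phi> k)" if "k \<in> {1..N}" for k
    using r[OF that, of "\<phi> k"] unfolding flow_res_def A_def B1_def B2_def B3_def pk_def dt_def by simp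
  then have "(\<Sum>k\<in>{1..N}. A k + B1 k + B2 k + (\<Sum>a\<in>{Plus, Minus}. B3 a k)) = (\<Sum>k\<in>{1..N}. source_term t k \<alpha> (\<phi> k))"
    by (rule sum.cong[OF refl])
  then have "(\<Sum>k\<in>{1..N}. A k) + (\<Sum>k\<in>{1..N}. B1 k) + (\<Sum>k\<in>{1..N}. B2 k) + (\<Sum>a\<in>{Plus, Minus}. \<Sum>k\<in>{1..N}. B3 a k) = (\<Sum>k\<in>{1..N}. source_term t k \<alpha> (\<phi> k))"
    by (simp add: sum.distrib)
  then show ?thesis
    unfolding flow_eq_def Let_def
    unfolding V[unfolded pk_def] S1[unfolded pk_def] S2[unfolded pk_def] S3[unfolded pk_def] R1 R2
    by (simp add: source_term_def sum.distrib)
qed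

section \<open>Contact conditions as variational inequalities\<close>

lemma mul_n_mult_n: "mul_n G Q lam $ \<sigma> = mult_n lam \<sigma>" by (simp add: mul_n_def mult_n_def)
lemma mul_t_mult_t: "mul_t G Q lam $ \<sigma> = mult_t lam \<sigma>" by (simp add: mul_t_def mult_t_def mul_n_mult_n)

lemma pwc_diff: "pwc A v x - pwc A w x = pwc A (v - w) x"
  using pwc_linear[of A 1 v "-1" w x] by simp

lemma contact_cone: "contact uk u lam \<Longrightarrow> lam \<in> dual_cone G D Q (mul_n G Q lam)"
  by (simp add: contact_def dual_cone_def mul_n_mult_n mul_t_mult_t)

lemma contact_normal_ineq:
  assumes u: "u \<in> U0 G" and c: "contact uk u lam" and m: "\<mu> \<in> dual_cone G D Q (mul_n G Q lam)"
  shows "(LINT x|surf G. (pwc (face Q) (mul_n G Q \<mu>) x - pwc (face Q) (mul_n G Q lam) x) * jmp_n G u x) \<le> 0"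
  unfolding pwc_diff jmp_n_LINT[OF u]
proof (rule sum_nonpos, rule mult_nonneg_nonpos)
  fix \<sigma>
  have "0 \<le> mult_n \<mu> \<sigma>" using m by (simp add: dual_cone_def mul_n_mult_n)
  moreover have "face_jump_n u \<sigma> \<le> 0" "mult_n lam \<sigma> * face_jump_n u \<sigma> = 0" using c unfolding contact_def by blast+
  ultimately show "(mul_n G Q \<mu> - mul_n G Q lam) $ \<sigma> * face_jump_n u \<sigma> \<le> 0"
    using mult_nonneg_nonpos[of "mult_n \<mu> \<sigma>" "face_jump_n u \<sigma>"]
    unfolding vector_minus_component mul_n_mult_n left_diff_distrib by linarith
qed simp

lemma contact_tangential_ineq:
  assumes u: "u \<in> U0 G" and uk: "uk \<in> U0 G" and c: "contact uk u lam" and m: "\<mu> \<in> dual_cone G D Q (mul_n G Q lam)"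
  shows "(LINT x|surf G. (pwc (face Q) (mul_t G Q \<mu>) x - pwc (face Q) (mul_t G Q lam) x) \<bullet> (jmp_t G u x - jmp_t G uk x)) \<le> 0"
proof -
  have "(LINT x|surf G. pwc (face Q) (mul_t G Q \<mu> - mul_t G Q lam) x \<bullet> (jmp_t G u x - jmp_t G uk x))
     = (\<Sum>\<sigma>\<in>UNIV. area \<sigma> * ((mul_t G Q \<mu> - mul_t G Q lam) $ \<sigma> \<bullet> (face_jump_t u \<sigma> - face_jump_t uk \<sigma>)))"
    unfolding inner_diff_right
    by (subst Bochner_Integration.integral_diff) (simp_all add: jmp_t_LINT u uk sum_subtractf right_diff_distrib)
  also have "\<dots> \<le> 0"
  proof (intro sum_nonpos mult_nonneg_nonpos)
    fix \<sigma>
    have "norm (mult_t \<mu> \<sigma>) \<le> fric D * mult_n lam \<sigma>" using m by (simp add: dual_cone_def mul_n_mult_n mul_t_mult_t)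
    then show "(mul_t G Q \<mu> - mul_t G Q lam) $ \<sigma> \<bullet> (face_jump_t u \<sigma> - face_jump_t uk \<sigma>) \<le> 0"
      using c unfolding contact_def by (simp add: mul_t_mult_t)
  qed simp
  finally show ?thesis unfolding pwc_diff .
qed


section \<open>Existence of solutions\<close>

lemma face_jump_zero: "face_jump_n (\<lambda>x. 0) \<sigma> = 0" "face_jump_t (\<lambda>x. 0) \<sigma> = 0"
  using fun_linear_0[OF face_jump_n_linear U0_fun_space] fun_linear_0[OF face_jump_t_linear U0_fun_space] .

text \<open>
  The contact problem with previous displacement 0, where the residual $p - x_0$ prescribes the initial pressures
  $x_0$: its variational inequality on the ball of radius $|x_0|$, tested with $x_0$ itself, forces
  $p = x_0$.
\<close>

lemma initial_state_exists:
  obtains u lam where "u \<in> dispV Q" "\<And>\<sigma>. face_jump_n u \<sigma> \<le> 0"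
    "initial_state G D P Q (\<lambda>\<alpha>. (intm P (pbarm D \<alpha>), intf P (pbarf D \<alpha>))) u lam"
proof -
  define p0 where "p0 = (\<lambda>\<alpha>. (intm P (pbarm D \<alpha>), intf P (pbarf D \<alpha>)))"
  define x0 where "x0 = (p0 NW, p0 W)"
  have x0: "by_phase x0 = p0" unfolding x0_def by (rule by_phase_pair)
  have zV: "(\<lambda>x. 0) \<in> dispV Q" by (rule fun_spaceD(1)[OF dispV_fun_space])
  have "\<exists>u lam. u \<in> dispV Q \<and> (\<forall>v\<in>dispV Q. elastic u v + traction lam v = mech_load p0 v) \<and> contact (\<lambda>x. 0) u lam"
  proof (rule flow_contact_existence[where uk = "\<lambda>x. 0" and ?R1.0 = "norm x0" and \<rho> = "\<lambda>p u. p - x0"])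
    show "continuous_on UNIV (\<lambda>z. fst z - x0)" for C :: "(((real^'m) \<times> (real^'f)) \<times> ((real^'m) \<times> (real^'f))) \<times> ((real^'d)^'s) \<Rightarrow> (real^'d \<Rightarrow> real^'d) \<Rightarrow> real"
      by (intro continuous_intros)
    fix p u lam
    assume u: "u \<in> dispV Q" and VI: "\<And>q. norm q \<le> norm x0 \<Longrightarrow> 0 \<le> (p - x0) \<bullet> (q - p)"
      and m: "\<And>v. v \<in> dispV Q \<Longrightarrow> elastic u v + traction lam v = mech_load (by_phase p) v" and c: "contact (\<lambda>x. 0) u lam"
    have "0 \<le> (p - x0) \<bullet> (x0 - p)" by (rule VI) simp
    also have "(p - x0) \<bullet> (x0 - p) = - ((p - x0) \<bullet> (p - x0))" by (metis inner_minus_right minus_diff_eq)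
    finally have "(p - x0) \<bullet> (p - x0) = 0" using inner_ge_zero[of "p - x0"] by linarith
    then have "p - x0 = 0" by (rule inner_eq_zero_iff[THEN iffD1])
    then have "p = x0" by (rule eq_iff_diff_eq_0[THEN iffD2])
    then show "\<exists>u lam. u \<in> dispV Q \<and> (\<forall>v\<in>dispV Q. elastic u v + traction lam v = mech_load p0 v) \<and> contact (\<lambda>x. 0) u lam"
      using u m c x0 by blast
  qed (use zV face_jump_zero in auto)
  then obtain u lam where u: "u \<in> dispV Q" and m: "\<And>v. v \<in> dispV Q \<Longrightarrow> elastic u v + traction lam v = mech_load p0 v"
    and c: "contact (\<lambda>x. 0) u lam" by blast
  have uU: "u \<in> U0 G" using u dispV_subset by blast
  have t: "(LINT x|surf G. (pwc (face Q) (mul_t G Q \<mu>) x - pwc (face Q) (mul_t G Q lam) x) \<bullet> jmp_t G u x) \<le> 0"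
    if \<mu>: "\<mu> \<in> dual_cone G D Q (mul_n G Q lam)" for \<mu>
    unfolding pwc_diff jmp_t_LINT(1)[OF uU]
  proof (intro sum_nonpos mult_nonneg_nonpos)
    fix \<sigma>
    have "norm (mult_t \<mu> \<sigma>) \<le> fric D * mult_n lam \<sigma>" using \<mu> by (simp add: dual_cone_def mul_n_mult_n mul_t_mult_t)
    then show "(mul_t G Q \<mu> - mul_t G Q lam) $ \<sigma> \<bullet> face_jump_t u \<sigma> \<le> 0"
      using c unfolding contact_def by (simp add: mul_t_mult_t face_jump_zero)
  qed simp
  have "initial_state G D P Q p0 u lam"
    unfolding initial_state_def
  proof (intro conjI allI ballI)
    show "p0 \<alpha> = (intm P (pbarm D \<alpha>), intf P (pbarf D \<alpha>))" for \<alpha> by (simp add: p0_def)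
    show "lam \<in> dual_cone G D Q (mul_n G Q lam)" by (rule contact_cone[OF c])
    show "mech_lhs G D P Q p0 u lam v = mech_rhs G D v" if "v \<in> dispV Q" for v
      using m[OF that] that dispV_subset by (intro mech_lhs_eq uU) auto
    fix \<mu> assume \<mu>: "\<mu> \<in> dual_cone G D Q (mul_n G Q lam)"
    show "(LINT x|surf G. (pwc (face Q) (mul_n G Q \<mu>) x - pwc (face Q) (mul_n G Q lam) x) * jmp_n G u x)
        + (LINT x|surf G. (pwc (face Q) (mul_t G Q \<mu>) x - pwc (face Q) (mul_t G Q lam) x) \<bullet> jmp_t G u x) \<le> 0"
      using contact_normal_ineq[OF uU c \<mu>] t[OF \<mu>] by linarith
  qed (rule u)
  moreover have "\<And>\<sigma>. face_jump_n u \<sigma> \<le> 0" using c by (simp add: contact_def)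
  ultimately show ?thesis using that u unfolding p0_def by blast
qed

lemma LINT_nonpos:
  assumes "\<And>x. x \<in> space M \<Longrightarrow> f x \<le> (0::real)" shows "(LINT x|M. f x) \<le> 0"
proof -
  have "0 \<le> (LINT x|M. - f x)" by (rule integral_nonneg_AE) (use assms in auto)
  then show ?thesis by simp
qed

lemma scheme_solution_of_steps:
  fixes p :: "phase \<Rightarrow> nat \<Rightarrow> (real^'m) \<times> (real^'f)"
  assumes g: "time_grid T N t" and u: "\<And>k. u k \<in> dispV Q" "\<And>k \<sigma>. face_jump_n (u k) \<sigma> \<le> 0"
    and init: "initial_state G D P Q (\<lambda>\<alpha>. p \<alpha> 0) (u 0) (lam 0)"
    and m: "\<And>k v. k \<in> {1..N} \<Longrightarrow> v \<in> dispV Q \<Longrightarrow> elastic (u k) v + traction (lam k) v = mech_load (\<lambda>\<alpha>. p \<alpha> k) v"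
    and c: "\<And>k. k \<in> {1..N} \<Longrightarrow> contact (u (k - 1)) (u k) (lam k)"
    and r: "\<And>k \<alpha> \<phi>. k \<in> {1..N} \<Longrightarrow>
      flow_res (\<lambda>\<beta>. p \<beta> (k - 1)) (u (k - 1)) (t k - t (k - 1)) (source_term t k) (\<lambda>\<beta>. p \<beta> k) (u k) \<alpha> \<phi> = 0"
  shows "scheme_solution G D P Q T N t p u lam"
proof -
  have uU: "u k \<in> U0 G" for k using u(1)[of k] dispV_subset by blast
  have cover: "\<exists>k. k \<in> {1..N} \<and> tidx t s = k" if "s \<in> space (lebesgue_on {0<..<T})" for s
    using time_cell_cover[OF g, of s] that by auto
  show ?thesis
    unfolding scheme_solution_def
  proof (intro conjI allI impI)
    fix k assume k: "k \<le> N"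
    show "u k \<in> dispV Q" by (rule u)
    show "lam k \<in> dual_cone G D Q (mul_n G Q (lam k))"
    proof (cases "k = 0")
      case True
      then show ?thesis using init unfolding initial_state_def by simp
    next
      case False
      then show ?thesis using contact_cone[OF c] k by simp
    qed
  next
    show "initial_state G D P Q (\<lambda>\<alpha>. p \<alpha> 0) (u 0) (lam 0)" by (rule init)
    show "flow_eq G D P Q T t p u \<alpha> \<phi>" for \<alpha> \<phi> by (rule flow_eq_of_steps[OF g u r])
  next
    fix v assume v: "\<forall>k\<le>N. v k \<in> dispV Q"
    show "(LINT s|lebesgue_on {0<..<T}. at_time t (\<lambda>k. mech_lhs G D P Q (\<lambda>\<alpha>. p \<alpha> k) (u k) (lam k) (v k)) s)
        = (LINT s|lebesgue_on {0<..<T}. at_time t (\<lambda>k. mech_rhs G D (v k)) s)"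
    proof (rule Bochner_Integration.integral_cong[OF refl])
      fix s assume "s \<in> space (lebesgue_on {0<..<T})"
      then obtain k where k: "k \<in> {1..N}" "tidx t s = k" using cover by blast
      then have vk: "v k \<in> dispV Q" using v by simp
      have "mech_lhs G D P Q (\<lambda>\<alpha>. p \<alpha> k) (u k) (lam k) (v k) = mech_rhs G D (v k)"
        by (rule mech_lhs_eq[OF uU _ m[OF k(1) vk]]) (use vk dispV_subset in blast)
      then show "at_time t (\<lambda>k. mech_lhs G D P Q (\<lambda>\<alpha>. p \<alpha> k) (u k) (lam k) (v k)) s = at_time t (\<lambda>k. mech_rhs G D (v k)) s"
        by (simp add: at_time_def k(2))
    qed
  next
    fix \<mu> assume \<mu>: "\<forall>k\<in>{1..N}. \<mu> k \<in> dual_cone G D Q (mul_n G Q (lam k))"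
    have "(LINT s|lebesgue_on {0<..<T}. LINT x|surf G.
           at_time t (\<lambda>k. (pwc (face Q) (mul_n G Q (\<mu> k)) x - pwc (face Q) (mul_n G Q (lam k)) x) * jmp_n G (u k) x) s) \<le> 0"
    proof (rule LINT_nonpos)
      fix s assume "s \<in> space (lebesgue_on {0<..<T})"
      then obtain k where k: "k \<in> {1..N}" "tidx t s = k" using cover by blast
      show "(LINT x|surf G. at_time t (\<lambda>k. (pwc (face Q) (mul_n G Q (\<mu> k)) x - pwc (face Q) (mul_n G Q (lam k)) x) * jmp_n G (u k) x) s) \<le> 0"
        unfolding at_time_def k(2) by (rule contact_normal_ineq[OF uU c[OF k(1)]]) (use \<mu> k(1) in blast)
    qed
    moreover have "(LINT s|lebesgue_on {0<..<T}. LINT x|surf G.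
           at_time t (\<lambda>k. pwc (face Q) (mul_t G Q (\<mu> k)) x - pwc (face Q) (mul_t G Q (lam k)) x) s
             \<bullet> dtime t (\<lambda>k. jmp_t G (u k) x) s) \<le> 0"
    proof (rule LINT_nonpos)
      fix s assume "s \<in> space (lebesgue_on {0<..<T})"
      then obtain k where k: "k \<in> {1..N}" "tidx t s = k" using cover by blast
      have dt: "0 < t k - t (k - 1)" using grid_step[OF g k(1)] by simp
      have "(LINT x|surf G. (pwc (face Q) (mul_t G Q (\<mu> k)) x - pwc (face Q) (mul_t G Q (lam k)) x)
             \<bullet> ((1 / (t k - t (k - 1))) *\<^sub>R (jmp_t G (u k) x - jmp_t G (u (k - 1)) x)))
        = (1 / (t k - t (k - 1))) * (LINT x|surf G. (pwc (face Q) (mul_t G Q (\<mu> k)) x - pwc (face Q) (mul_t G Q (lam k)) x)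
             \<bullet> (jmp_t G (u k) x - jmp_t G (u (k - 1)) x))"
        by (simp only: inner_scaleR_right integral_mult_right_zero)
      also have "\<dots> \<le> 0"
        using contact_tangential_ineq[OF uU uU c[OF k(1)], of "\<mu> k"] \<mu> k(1) dt by (intro mult_nonneg_nonpos) auto
      finally show "(LINT x|surf G. at_time t (\<lambda>k. pwc (face Q) (mul_t G Q (\<mu> k)) x - pwc (face Q) (mul_t G Q (lam k)) x) s
             \<bullet> dtime t (\<lambda>k. jmp_t G (u k) x) s) \<le> 0"
        by (simp add: at_time_def dtime_def Let_def k(2))
    qed
    ultimately show "(LINT s|lebesgue_on {0<..<T}. LINT x|surf G.
           at_time t (\<lambda>k. (pwc (face Q) (mul_n G Q (\<mu> k)) x - pwc (face Q) (mul_n G Q (lam k)) x) * jmp_n G (u k) x) s)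
        + (LINT s|lebesgue_on {0<..<T}. LINT x|surf G.
           at_time t (\<lambda>k. pwc (face Q) (mul_t G Q (\<mu> k)) x - pwc (face Q) (mul_t G Q (lam k)) x) s
             \<bullet> dtime t (\<lambda>k. jmp_t G (u k) x) s) \<le> 0" by linarith
  qed
qed

text \<open>
  The states are chosen recursively. Non-penetration is carried along as an invariant, because a time step
  starts from a non-penetrating displacement; after the last step the state is repeated.
\<close>

lemma scheme_solution_exists:
  assumes g: "time_grid T N t"
  shows "\<exists>p u lam. scheme_solution G D P Q T N t p u lam"
proof -
  define p0 where "p0 = (\<lambda>\<alpha>. (intm P (pbarm D \<alpha>), intf P (pbarf D \<alpha>)))"
  obtain u0 lam0 where 0: "u0 \<in> dispV Q" "\<And>\<sigma>. face_jump_n u0 \<sigma> \<le> 0" "initial_state G D P Q p0 u0 lam0"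
    using initial_state_exists unfolding p0_def by blast
  define Inv where "Inv n st \<longleftrightarrow> fst (snd st) \<in> dispV Q \<and> (\<forall>\<sigma>. face_jump_n (fst (snd st)) \<sigma> \<le> 0) \<and> (n = 0 \<longrightarrow> st = (p0, u0, lam0))"
    for n :: nat and st :: "(phase \<Rightarrow> (real^'m) \<times> (real^'f)) \<times> (real^'d \<Rightarrow> real^'d) \<times> ((real^'d)^'s)"
  define Stp where "Stp n st st' \<longleftrightarrow> (n < N \<longrightarrow>
      (\<forall>v\<in>dispV Q. elastic (fst (snd st')) v + traction (snd (snd st')) v = mech_load (fst st') v) \<and>
      contact (fst (snd st)) (fst (snd st')) (snd (snd st')) \<and>
      (\<forall>\<alpha> \<phi>. flow_res (fst st) (fst (snd st)) (t (Suc n) - t n) (source_term t (Suc n)) (fst st') (fst (snd st')) \<alpha> \<phi> = 0))"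
    for n and st st' :: "(phase \<Rightarrow> (real^'m) \<times> (real^'f)) \<times> (real^'d \<Rightarrow> real^'d) \<times> ((real^'d)^'s)"
  have "\<exists>f. \<forall>n. Inv n (f n) \<and> Stp n (f n) (f (Suc n))"
  proof (rule dependent_nat_choice)
    show "\<exists>st. Inv 0 st" using 0 by (intro exI[of _ "(p0, u0, lam0)"]) (simp add: Inv_def)
    fix st n assume I: "Inv n st"
    show "\<exists>st'. Inv (Suc n) st' \<and> Stp n st st'"
    proof (cases "n < N")
      case False
      then show ?thesis using I by (intro exI[of _ st]) (simp add: Inv_def Stp_def)
    next
      case True
      then have dt: "0 < t (Suc n) - t n" using g by (simp add: time_grid_def)
      have uk: "fst (snd st) \<in> dispV Q" "\<And>\<sigma>. face_jump_n (fst (snd st)) \<sigma> \<le> 0" using I by (auto simp: Inv_def)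
      obtain p u lam where s: "u \<in> dispV Q" "\<And>v. v \<in> dispV Q \<Longrightarrow> elastic u v + traction lam v = mech_load p v" "contact (fst (snd st)) u lam"
        "\<And>\<alpha> \<phi>. flow_res (fst st) (fst (snd st)) (t (Suc n) - t n) (source_term t (Suc n)) p u \<alpha> \<phi> = 0"
        by (rule step_exists[where src = "source_term t (Suc n)" and pk = "fst st", OF uk dt source_term_linear]) (rule that; blast)
      have "\<forall>\<sigma>. face_jump_n u \<sigma> \<le> 0" using s(3) by (simp add: contact_def)
      then show ?thesis using s by (intro exI[of _ "(p, u, lam)"]) (simp add: Inv_def Stp_def)
    qed
  qed
  then obtain f where I: "\<And>n. Inv n (f n)" and S: "\<And>n. Stp n (f n) (f (Suc n))" by blast
  have f0: "f 0 = (p0, u0, lam0)" using I[of 0] by (simp add: Inv_def)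
  have "scheme_solution G D P Q T N t (\<lambda>\<alpha> k. fst (f k) \<alpha>) (\<lambda>k. fst (snd (f k))) (\<lambda>k. snd (snd (f k)))"
  proof (rule scheme_solution_of_steps[OF g])
    show "fst (snd (f k)) \<in> dispV Q" "face_jump_n (fst (snd (f k))) \<sigma> \<le> 0" for k \<sigma> using I[of k] by (auto simp: Inv_def)
    show "initial_state G D P Q (\<lambda>\<alpha>. fst (f 0) \<alpha>) (fst (snd (f 0))) (snd (snd (f 0)))" using 0(3) by (simp add: f0)
    fix k assume k: "k \<in> {1..N}"
    then obtain n where n: "k = Suc n" "n < N" by (cases k) auto
    note st = S[of n, unfolded Stp_def, rule_format, OF n(2)]
    show "elastic (fst (snd (f k))) v + traction (snd (snd (f k))) v = mech_load (\<lambda>\<alpha>. fst (f k) \<alpha>) v" if "v \<in> dispV Q" for v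
      using st that n(1) by simp
    show "contact (fst (snd (f (k - 1)))) (fst (snd (f k))) (snd (snd (f k)))" using st n(1) by simp
    show "flow_res (\<lambda>\<beta>. fst (f (k - 1)) \<beta>) (fst (snd (f (k - 1)))) (t k - t (k - 1)) (source_term t k) (\<lambda>\<beta>. fst (f k) \<beta>) (fst (snd (f k))) \<alpha> \<phi> = 0" for \<alpha> \<phi>
      unfolding n(1) diff_Suc_1 using st[THEN conjunct2, THEN conjunct2, rule_format, of \<alpha> \<phi>] .
  qed
  then show ?thesis by blast
qed

end

theorem theorem4p4:
  fixes G :: "('d::finite) geometry"
    and D :: "'d model"
    and P :: "('d, 'e::finite, 'm::finite, 'f::finite) flow_disc"
    and Q :: "('d, 's::finite) mech_disc"
    and T cstar cinfsup \<phi>min :: real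
    and N :: nat
    and t :: "nat \<Rightarrow> real"
  assumes "CARD('d) \<in> {2, 3}" and "CARD('d) = CARD('e) + 1"
    and "fractured_domain G"
    and "korn_inequality G"
    and "0 < T" and "model_data G T D"
    and "flow_discretization G D P"
    and "0 < cstar" and "coercive G D P cstar"
    and "mech_discretization G Q"
    and "0 < cinfsup" and "inf_sup_condition G Q cinfsup"
    and "time_grid T N t"
    and "0 \<le> \<phi>min" and "AE x in vol G. \<phi>min \<le> Pim P (intphi P (phibar D)) x"
  shows "\<exists>p u lam. scheme_solution G D P Q T N t p u lam"
proof -
  have "AE x in vol G. 0 \<le> Pim P (intphi P (phibar D)) x"
    using assms(15) by eventually_elim (use assms(14) in linarith)
  then interpret poromechanics G D P Q T cinfsup
    using assms by unfold_locales
  show ?thesis by (rule scheme_solution_exists[OF assms(13)])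
qed

end
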